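(* Let $M$ be a closed connected oriented three-manifold with a volume form $\mathrm{dvol}_M$, let $v=(v_1,v_2,v_3)$ be a positive divergence-free frame on $(M,\mathrm{dvol}_M)$, and let $X$ be a closed hyperkähler manifold with complex structures $J_1,J_2,J_3$. Assume that $v$ is regular and that $X$ is flat. Then there is a constant $c$ such that every contractible smooth map $f:M\to X$ satisfies $$\int_M|df|^2\,\mathrm{dvol}_M\le c\int_M|D_vf|^2\,\mathrm{dvol}_M.$$
   Context: A positive divergence-free frame on $(M,\mathrm{dvol}_M)$ is a triple $v=(v_1,v_2,v_3)$ of smooth vector fields on $M$ such that $\mathcal{L}_{v_i}\mathrm{dvol}_M=0$ for $i=1,2,3$ and $\mathrm{dvol}_M(v_1,v_2,v_3)>0$ everywhere on $M$. The hyperkähler manifold $X$ has symplectic forms $\omega_1,\omega_2,\omega_3$, complex structures $J_1,J_2,J_3$ satisfying the quaternion relations (with $J_1J_2=J_3$), and hyperkähler metric $\langle\cdot,\cdot\rangle=\omega_i(\cdot,J_i\cdot)$; "flat" means that this metric is flat. For a smooth map $f:M\to X$ define $$D_vf:=J_1\partial_{v_1}f+J_2\partial_{v_2}f+J_3\partial_{v_3}f,$$ a section of $f^*TX$, where $\partial_{v_i}f:=df(v_i)$, and define $|df|^2:=\sum_{i=1}^3|\partial_{v_i}f|^2$. A map $f:M\to X$ is called contractible if it is homotopic to a constant map. The frame $v$ is called regular if every smooth solution $f:M\to\mathbb{H}$ of $D_vf=0$ is constant, where the target is the quaternions $\mathbb{H}$ and $J_1,J_2,J_3$ are left multiplication by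 $\mathbf{i},\mathbf{j},\mathbf{k}$. *)

theory Defs
  imports "HOL-Analysis.Analysis"
begin

section \<open>Smooth maps between open subsets of Euclidean spaces\<close>

abbreviation dir_deriv ::
  "('a::real_normed_vector \<Rightarrow> 'b::real_normed_vector) \<Rightarrow> 'a \<Rightarrow> 'a \<Rightarrow> 'b" where
  "dir_deriv f x u \<equiv> frechet_derivative f (at x) u"

text \<open>Only used for open \<open>S\<close>, where \<open>C_on k S f\<close> says that \<open>f\<close> is of class C^k on \<open>S\<close>.\<close>

fun C_on :: "nat \<Rightarrow> 'a::euclidean_space set \<Rightarrow> ('a \<Rightarrow> 'b::real_normed_vector) \<Rightarrow> bool" where
  "C_on 0 S f \<longleftrightarrow> continuous_on S f"
| "C_on (Suc k) S f \<longleftrightarrow>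
     (\<forall>x\<in>S. f differentiable (at x)) \<and> (\<forall>u. C_on k S (\<lambda>x. dir_deriv f x u))"

definition smooth_on :: "'a::euclidean_space set \<Rightarrow> ('a \<Rightarrow> 'b::real_normed_vector) \<Rightarrow> bool" where
  "smooth_on S f \<longleftrightarrow> (\<forall>k. C_on k S f)"

section \<open>Smooth manifolds\<close>

text \<open>A chart is a pair of its domain and its coordinate map; the values of the coordinate map
  outside the domain are irrelevant. Points of the manifold are the points of the underlying
  topological space. The atlas need not be maximal. The model space is a fixed Euclidean space,
  so all manifolds here are without boundary.\<close>

type_synonym ('a, 'e) chart = "'a set \<times> ('a \<Rightarrow> 'e)"

record ('a, 'e) manifold =
  mtop :: "'a topology"
  charts :: "('a, 'e) chart set"

abbreviation points :: "('a, 'e) manifold \<Rightarrow> 'a set" where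
  "points M \<equiv> topspace (mtop M)"

abbreviation cimage :: "('a, 'e) chart \<Rightarrow> 'e set" where
  "cimage c \<equiv> snd c ` fst c"

abbreviation cinv :: "('a, 'e) chart \<Rightarrow> 'e \<Rightarrow> 'a" where
  "cinv c \<equiv> inv_into (fst c) (snd c)"

definition smooth_manifold :: "('a, 'e::euclidean_space) manifold \<Rightarrow> bool" where
  "smooth_manifold M \<longleftrightarrow>
     Hausdorff_space (mtop M) \<and> second_countable (mtop M) \<and>
     (\<Union>c\<in>charts M. fst c) = points M \<and>
     (\<forall>c\<in>charts M. openin (mtop M) (fst c) \<and> open (cimage c) \<and>
        homeomorphic_map (subtopology (mtop M) (fst c)) (top_of_set (cimage c)) (snd c)) \<and>
     (\<forall>c\<in>charts M. \<forall>d\<in>charts M. smooth_on (snd c ` (fst c \<inter> fst d)) (snd d \<circ> cinv c))"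

definition closed_manifold :: "('a, 'e::euclidean_space) manifold \<Rightarrow> bool" where
  "closed_manifold M \<longleftrightarrow> smooth_manifold M \<and> compact_space (mtop M)"

text \<open>The derivative at the point \<open>p\<close> of the change of coordinates from \<open>c\<close> to \<open>d\<close>.\<close>

definition dtrans ::
  "('a, 'e::euclidean_space) chart \<Rightarrow> ('a, 'e) chart \<Rightarrow> 'a \<Rightarrow> 'e \<Rightarrow> 'e" where
  "dtrans c d p u = dir_deriv (snd d \<circ> cinv c) (snd c p) u"

text \<open>An orientation is given by an atlas with orientation preserving changes of coordinates.\<close>

definition oriented :: "('a, real^'n) manifold \<Rightarrow> bool" where
  "oriented M \<longleftrightarrow>
     (\<forall>c\<in>charts M. \<forall>d\<in>charts M. \<forall>p\<in>fst c \<inter> fst d. 0 < det (matrix (dtrans c d p)))"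

definition smooth_map ::
  "('a, 'e::euclidean_space) manifold \<Rightarrow> ('b, 'h::euclidean_space) manifold \<Rightarrow> ('a \<Rightarrow> 'b) \<Rightarrow> bool"
  where
  "smooth_map M N f \<longleftrightarrow>
     continuous_map (mtop M) (mtop N) f \<and>
     (\<forall>c\<in>charts M. \<forall>d\<in>charts N.
        smooth_on (snd c ` {p \<in> fst c. f p \<in> fst d}) (snd d \<circ> f \<circ> cinv c))"

definition constant_map ::
  "('a, 'e) manifold \<Rightarrow> ('b, 'h) manifold \<Rightarrow> ('a \<Rightarrow> 'b) \<Rightarrow> bool" where
  "constant_map M N f \<longleftrightarrow> (\<exists>q\<in>points N. \<forall>p\<in>points M. f p = q)"

definition contractible_map ::
  "('a, 'e) manifold \<Rightarrow> ('b, 'h) manifold \<Rightarrow> ('a \<Rightarrow> 'b) \<Rightarrow> bool" where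
  "contractible_map M N f \<longleftrightarrow>
     (\<exists>q\<in>points N. homotopic_with (\<lambda>_. True) (mtop M) (mtop N) f (\<lambda>_. q))"

definition chart_at :: "('a, 'e) manifold \<Rightarrow> 'a \<Rightarrow> ('a, 'e) chart" where
  "chart_at M p = (SOME c. c \<in> charts M \<and> p \<in> fst c)"

section \<open>Tensor fields\<close>

text \<open>A tensor field is the family of its component functions in the charts of the atlas, subject
  to the transformation law under changes of coordinates: \<open>V c p\<close> is the coordinate expression in
  the chart \<open>c\<close> of the value at \<open>p\<close>. It is meaningful only for \<open>p \<in> fst c\<close>.\<close>

type_synonym ('a, 'e) vector_field = "('a, 'e) chart \<Rightarrow> 'a \<Rightarrow> 'e"
type_synonym ('a, 'e) endo_field = "('a, 'e) chart \<Rightarrow> 'a \<Rightarrow> 'e \<Rightarrow> 'e"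
type_synonym ('a, 'e) form2 = "('a, 'e) chart \<Rightarrow> 'a \<Rightarrow> 'e \<Rightarrow> 'e \<Rightarrow> real"
type_synonym ('a, 'e) form3 = "('a, 'e) chart \<Rightarrow> 'a \<Rightarrow> 'e \<Rightarrow> 'e \<Rightarrow> 'e \<Rightarrow> real"

definition smooth_vector_field ::
  "('a, 'e::euclidean_space) manifold \<Rightarrow> ('a, 'e) vector_field \<Rightarrow> bool" where
  "smooth_vector_field M V \<longleftrightarrow>
     (\<forall>c\<in>charts M. smooth_on (cimage c) (\<lambda>x. V c (cinv c x))) \<and>
     (\<forall>c\<in>charts M. \<forall>d\<in>charts M. \<forall>p\<in>fst c \<inter> fst d. V d p = dtrans c d p (V c p))"

definition smooth_endo_field ::
  "('a, 'e::euclidean_space) manifold \<Rightarrow> ('a, 'e) endo_field \<Rightarrow> bool" where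
  "smooth_endo_field M J \<longleftrightarrow>
     (\<forall>c\<in>charts M. \<forall>p\<in>fst c. linear (J c p)) \<and>
     (\<forall>c\<in>charts M. \<forall>u. smooth_on (cimage c) (\<lambda>x. J c (cinv c x) u)) \<and>
     (\<forall>c\<in>charts M. \<forall>d\<in>charts M. \<forall>p\<in>fst c \<inter> fst d. \<forall>u.
        J d p (dtrans c d p u) = dtrans c d p (J c p u))"

definition smooth_bilinear_field ::
  "('a, 'e::euclidean_space) manifold \<Rightarrow> ('a, 'e) form2 \<Rightarrow> bool" where
  "smooth_bilinear_field M B \<longleftrightarrow>
     (\<forall>c\<in>charts M. \<forall>p\<in>fst c. bilinear (B c p)) \<and>
     (\<forall>c\<in>charts M. \<forall>u w. smooth_on (cimage c) (\<lambda>x. B c (cinv c x) u w)) \<and>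
     (\<forall>c\<in>charts M. \<forall>d\<in>charts M. \<forall>p\<in>fst c \<inter> fst d. \<forall>u w.
        B d p (dtrans c d p u) (dtrans c d p w) = B c p u w)"

definition smooth_3form ::
  "('a, 'e::euclidean_space) manifold \<Rightarrow> ('a, 'e) form3 \<Rightarrow> bool" where
  "smooth_3form M A \<longleftrightarrow>
     (\<forall>c\<in>charts M. \<forall>p\<in>fst c.
        (\<forall>u w. linear (\<lambda>z. A c p z u w) \<and> linear (\<lambda>z. A c p u z w) \<and> linear (\<lambda>z. A c p u w z)) \<and>
        (\<forall>u w. A c p u u w = 0 \<and> A c p u w u = 0 \<and> A c p w u u = 0)) \<and>
     (\<forall>c\<in>charts M. \<forall>u w z. smooth_on (cimage c) (\<lambda>x. A c (cinv c x) u w z)) \<and>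
     (\<forall>c\<in>charts M. \<forall>d\<in>charts M. \<forall>p\<in>fst c \<inter> fst d. \<forall>u w z.
        A d p (dtrans c d p u) (dtrans c d p w) (dtrans c d p z) = A c p u w z)"

section \<open>Volume forms and divergence-free frames on oriented three-manifolds\<close>

definition volume_form :: "('a, real^3) manifold \<Rightarrow> ('a, real^3) form3 \<Rightarrow> bool" where
  "volume_form M dvol \<longleftrightarrow>
     smooth_3form M dvol \<and>
     (\<forall>c\<in>charts M. \<forall>p\<in>fst c. 0 < dvol c p (axis 1 1) (axis 2 1) (axis 3 1))"

text \<open>The Lie derivative of a 3-form, evaluated on the coordinate vectors \<open>a\<close>, \<open>b\<close>, \<open>d\<close>, in the
  coordinates of the chart \<open>c\<close>.\<close>

definition lie_deriv ::
  "('a, 'e::euclidean_space) vector_field \<Rightarrow> ('a, 'e) form3 \<Rightarrow> ('a, 'e) form3" where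
  "lie_deriv V A c p a b d =
     (let DV = dir_deriv (\<lambda>x. V c (cinv c x)) (snd c p) in
      dir_deriv (\<lambda>x. A c (cinv c x) a b d) (snd c p) (V c p)
      + A c p (DV a) b d + A c p a (DV b) d + A c p a b (DV d))"

text \<open>Triples are indexed by the three-element type \<open>3\<close> with elements \<open>1\<close>, \<open>2\<close>, \<open>3\<close>.\<close>

definition positive_divergence_free_frame ::
  "('a, real^3) manifold \<Rightarrow> ('a, real^3) form3 \<Rightarrow> (3 \<Rightarrow> ('a, real^3) vector_field) \<Rightarrow> bool" where
  "positive_divergence_free_frame M dvol v \<longleftrightarrow>
     (\<forall>i. smooth_vector_field M (v i)) \<and>
     (\<forall>i. \<forall>c\<in>charts M. \<forall>p\<in>fst c. \<forall>a b d. lie_deriv (v i) dvol c p a b d = 0) \<and>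
     (\<forall>c\<in>charts M. \<forall>p\<in>fst c. 0 < dvol c p (v 1 c p) (v 2 c p) (v 3 c p))"

section \<open>Integration over closed oriented three-manifolds\<close>

definition partition_of_unity ::
  "('a, 'e::euclidean_space) manifold \<Rightarrow> ('a, 'e) chart set \<Rightarrow> (('a, 'e) chart \<Rightarrow> 'a \<Rightarrow> real) \<Rightarrow> bool"
  where
  "partition_of_unity M K \<rho> \<longleftrightarrow>
     finite K \<and> K \<subseteq> charts M \<and>
     (\<forall>k\<in>K. \<forall>c\<in>charts M. smooth_on (cimage c) (\<rho> k \<circ> cinv c)) \<and>
     (\<forall>k\<in>K. \<forall>p\<in>points M. 0 \<le> \<rho> k p) \<and>
     (\<forall>k\<in>K. mtop M closure_of {p \<in> points M. \<rho> k p \<noteq> 0} \<subseteq> fst k) \<and>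
     (\<forall>p\<in>points M. (\<Sum>k\<in>K. \<rho> k p) = 1)"

text \<open>Finite partitions of unity exist on closed manifolds, and by the change of variables formula
  the integral does not depend on the chosen one (on an oriented atlas).\<close>

definition volume_integral ::
  "('a, real^3) manifold \<Rightarrow> ('a, real^3) form3 \<Rightarrow> ('a \<Rightarrow> real) \<Rightarrow> real" where
  "volume_integral M dvol h =
     (let (K, \<rho>) = (SOME (K, \<rho>). partition_of_unity M K \<rho>) in
      \<Sum>c\<in>K. set_lebesgue_integral lborel (cimage c)
        (\<lambda>x. let p = cinv c x in
             \<rho> c p * h p * dvol c p (axis 1 1) (axis 2 1) (axis 3 1)))"

section \<open>Hyperkaehler manifolds\<close>

definition closed_2form :: "('a, 'e::euclidean_space) manifold \<Rightarrow> ('a, 'e) form2 \<Rightarrow> bool" where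
  "closed_2form M w \<longleftrightarrow>
     (\<forall>c\<in>charts M. \<forall>x\<in>cimage c. \<forall>a b d.
        dir_deriv (\<lambda>y. w c (cinv c y) b d) x a
        - dir_deriv (\<lambda>y. w c (cinv c y) a d) x b
        + dir_deriv (\<lambda>y. w c (cinv c y) a b) x d = 0)"

definition symplectic_form :: "('a, 'e::euclidean_space) manifold \<Rightarrow> ('a, 'e) form2 \<Rightarrow> bool" where
  "symplectic_form M w \<longleftrightarrow>
     smooth_bilinear_field M w \<and>
     (\<forall>c\<in>charts M. \<forall>p\<in>fst c. \<forall>u. w c p u u = 0) \<and>
     (\<forall>c\<in>charts M. \<forall>p\<in>fst c. \<forall>u. (\<forall>z. w c p u z = 0) \<longrightarrow> u = 0) \<and>
     closed_2form M w"

text \<open>An almost complex structure is integrable if there are local coordinates \<open>\<psi>\<close> around every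
  point in which it has constant coefficients, i.e. if there are local holomorphic coordinates.\<close>

definition complex_structure :: "('a, 'e::euclidean_space) manifold \<Rightarrow> ('a, 'e) endo_field \<Rightarrow> bool"
  where
  "complex_structure M J \<longleftrightarrow>
     smooth_endo_field M J \<and>
     (\<forall>c\<in>charts M. \<forall>p\<in>fst c. \<forall>u. J c p (J c p u) = - u) \<and>
     (\<forall>c\<in>charts M. \<forall>p\<in>fst c. \<exists>S \<psi> (J0 :: 'e \<Rightarrow> 'e).
        open S \<and> snd c p \<in> S \<and> S \<subseteq> cimage c \<and>
        smooth_on S \<psi> \<and> inj_on \<psi> S \<and> open (\<psi> ` S) \<and> smooth_on (\<psi> ` S) (inv_into S \<psi>) \<and>
        (\<forall>x\<in>S. \<forall>u. dir_deriv \<psi> x (J c (cinv c x) u) = J0 (dir_deriv \<psi> x u)))"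

definition riemannian_metric :: "('a, 'e::euclidean_space) manifold \<Rightarrow> ('a, 'e) form2 \<Rightarrow> bool" where
  "riemannian_metric M g \<longleftrightarrow>
     smooth_bilinear_field M g \<and>
     (\<forall>c\<in>charts M. \<forall>p\<in>fst c. \<forall>u w. g c p u w = g c p w u) \<and>
     (\<forall>c\<in>charts M. \<forall>p\<in>fst c. \<forall>u. u \<noteq> 0 \<longrightarrow> 0 < g c p u u)"

definition compat_metric :: "('a, 'e) form2 \<Rightarrow> ('a, 'e) endo_field \<Rightarrow> ('a, 'e) form2" where
  "compat_metric w J c p u z = w c p u (J c p z)"

definition hyperkaehler ::
  "('a, 'e::euclidean_space) manifold \<Rightarrow> (3 \<Rightarrow> ('a, 'e) form2) \<Rightarrow> (3 \<Rightarrow> ('a, 'e) endo_field) \<Rightarrow>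
   ('a, 'e) form2 \<Rightarrow> bool" where
  "hyperkaehler X \<omega> J g \<longleftrightarrow>
     smooth_manifold X \<and>
     (\<forall>i. symplectic_form X (\<omega> i)) \<and>
     (\<forall>i. complex_structure X (J i)) \<and>
     (\<forall>c\<in>charts X. \<forall>p\<in>fst c. \<forall>u.
        J 1 c p (J 2 c p u) = J 3 c p u \<and> J 2 c p (J 1 c p u) = - J 3 c p u) \<and>
     riemannian_metric X g \<and>
     (\<forall>i. \<forall>c\<in>charts X. \<forall>p\<in>fst c. \<forall>u z. g c p u z = compat_metric (\<omega> i) (J i) c p u z)"

text \<open>The Christoffel symbols of \<open>g\<close> as a bilinear map: the covariant derivative of the constant
  coordinate vector field \<open>b\<close> in the direction \<open>a\<close>, determined by the Koszul formula.\<close>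

definition christoffel ::
  "('a, 'e::euclidean_space) form2 \<Rightarrow> ('a, 'e) chart \<Rightarrow> 'e \<Rightarrow> 'e \<Rightarrow> 'e \<Rightarrow> 'e" where
  "christoffel g c x a b =
     (THE z. \<forall>w. 2 * g c (cinv c x) z w =
        dir_deriv (\<lambda>y. g c (cinv c y) b w) x a
        + dir_deriv (\<lambda>y. g c (cinv c y) a w) x b
        - dir_deriv (\<lambda>y. g c (cinv c y) a b) x w)"

definition curvature ::
  "('a, 'e::euclidean_space) form2 \<Rightarrow> ('a, 'e) chart \<Rightarrow> 'e \<Rightarrow> 'e \<Rightarrow> 'e \<Rightarrow> 'e \<Rightarrow> 'e" where
  "curvature g c x a b w =
     dir_deriv (\<lambda>y. christoffel g c y b w) x a
     - dir_deriv (\<lambda>y. christoffel g c y a w) x b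
     + christoffel g c x a (christoffel g c x b w)
     - christoffel g c x b (christoffel g c x a w)"

definition flat_metric :: "('a, 'e::euclidean_space) manifold \<Rightarrow> ('a, 'e) form2 \<Rightarrow> bool" where
  "flat_metric X g \<longleftrightarrow>
     (\<forall>c\<in>charts X. \<forall>x\<in>cimage c. \<forall>a b w. curvature g c x a b w = 0)"

section \<open>The Dirac operator of a frame and the energy\<close>

text \<open>A section along \<open>f\<close> of the tangent bundle of the target is represented by its components:
  in a chart \<open>d\<close> of the target, at each point \<open>p\<close> with \<open>f p \<in> fst d\<close>. By the transformation law
  the choice of the chart of \<open>M\<close> at \<open>p\<close> in \<open>partial\<close>, and of the chart of the target in
  \<open>norm_sq_along\<close>, is immaterial.\<close>

definition partial ::
  "('a, 'e::euclidean_space) manifold \<Rightarrow> ('a, 'e) vector_field \<Rightarrow> ('a \<Rightarrow> 'b) \<Rightarrow>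
   ('b, 'h::euclidean_space) chart \<Rightarrow> 'a \<Rightarrow> 'h" where
  "partial M V f d p =
     (let c = chart_at M p in dir_deriv (snd d \<circ> f \<circ> cinv c) (snd c p) (V c p))"

definition dirac ::
  "('a, 'e::euclidean_space) manifold \<Rightarrow> (3 \<Rightarrow> ('a, 'e) vector_field) \<Rightarrow>
   (3 \<Rightarrow> ('b, 'h::euclidean_space) endo_field) \<Rightarrow> ('a \<Rightarrow> 'b) \<Rightarrow> ('b, 'h) chart \<Rightarrow> 'a \<Rightarrow> 'h" where
  "dirac M v J f d p = (\<Sum>i\<in>UNIV. J i d (f p) (partial M (v i) f d p))"

definition norm_sq_along ::
  "('b, 'h::euclidean_space) manifold \<Rightarrow> ('b, 'h) form2 \<Rightarrow> ('a \<Rightarrow> 'b) \<Rightarrow>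
   (('b, 'h) chart \<Rightarrow> 'a \<Rightarrow> 'h) \<Rightarrow> 'a \<Rightarrow> real" where
  "norm_sq_along X g f s p = (let d = chart_at X (f p) in g d (f p) (s d p) (s d p))"

definition energy_density ::
  "('a, 'e::euclidean_space) manifold \<Rightarrow> (3 \<Rightarrow> ('a, 'e) vector_field) \<Rightarrow>
   ('b, 'h::euclidean_space) manifold \<Rightarrow> ('b, 'h) form2 \<Rightarrow> ('a \<Rightarrow> 'b) \<Rightarrow> 'a \<Rightarrow> real" where
  "energy_density M v X g f p = (\<Sum>i\<in>UNIV. norm_sq_along X g f (partial M (v i) f) p)"

section \<open>The quaternions and regular frames\<close>

text \<open>The vector \<open>(x$1, x$2, x$3, x$4)\<close> stands for the quaternion with real part \<open>x$1\<close> and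
  imaginary parts \<open>x$2\<close>, \<open>x$3\<close>, \<open>x$4\<close>.\<close>

definition qmult :: "real^4 \<Rightarrow> real^4 \<Rightarrow> real^4" where
  "qmult x y = vector
     [x$1 * y$1 - x$2 * y$2 - x$3 * y$3 - x$4 * y$4,
      x$1 * y$2 + x$2 * y$1 + x$3 * y$4 - x$4 * y$3,
      x$1 * y$3 - x$2 * y$4 + x$3 * y$1 + x$4 * y$2,
      x$1 * y$4 + x$2 * y$3 - x$3 * y$2 + x$4 * y$1]"

definition quaternion_unit :: "3 \<Rightarrow> real^4" where
  "quaternion_unit i = (if i = 1 then axis 2 1 else if i = 2 then axis 3 1 else axis 4 1)"

definition quaternion_space :: "(real^4, real^4) manifold" where
  "quaternion_space = \<lparr>mtop = euclidean, charts = {(UNIV, \<lambda>x. x)}\<rparr>"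

definition quaternion_J :: "3 \<Rightarrow> (real^4, real^4) endo_field" where
  "quaternion_J i d q u = qmult (quaternion_unit i) u"

definition regular_frame ::
  "('a, real^3) manifold \<Rightarrow> (3 \<Rightarrow> ('a, real^3) vector_field) \<Rightarrow> bool" where
  "regular_frame M v \<longleftrightarrow>
     (\<forall>f. smooth_map M quaternion_space f \<and>
          (\<forall>d\<in>charts quaternion_space. \<forall>p\<in>points M. dirac M v quaternion_J f d p = 0) \<longrightarrow>
          constant_map M quaternion_space f)"

end

(* Near every point, a flat hyperkaehler metric has coordinates in which the metric and the
complex structures are constant, and two such coordinate systems differ by an affine isometry.
Continuing a germ of flat coordinates along the paths H(s,p) of a contraction H of f gives a map F
from M to a Euclidean space that is locally f in flat coordinates, and the functions
(g(b,F), g(J1 b,F), g(J2 b,F), g(J3 b,F)), b in an orthogonal basis, reduce the claim to maps from M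
to the quaternions. There it is a Poincare inequality for an elliptic operator: counterexamples of
mean zero and norm one would, by Garding's inequality and Rellich's theorem, subconverge in L^2 to a
weak solution, which is smooth by the method of difference quotients, hence constant by regularity
of the frame, hence zero: a contradiction. *)
theory Submission
  imports Defs "HOL-Library.Diagonal_Subsequence"
begin

text \<open>The constant must not depend on \<open>f\<close>. Hence the inequality is proved once
  for quaternion-valued functions, and constant linear maps that intertwine the complex structures
  with left multiplication turn both sides for \<open>f\<close> into the same weighted sum of both
  sides for such functions. This needs complex structures that are constant in flat coordinates,
  which is why closedness of the forms and integrability are used to make each of them parallel. The
  analysis stays within smooth functions of compact support: a weak solution is represented by
  functions \<open>f n\<close> bounded in L^2 with \<open>D (f n)\<close> tending to 0 in L^2. The
  obstacle is that nothing bounds the derivatives of \<open>D (f n)\<close>. Its difference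
  quotients of order k and step h cost a factor h^-k, so h is fixed before n becomes large.
  Mollification then turns bounds on quotients into bounds on derivatives that do not depend on the
  mollification scale. Continuation along the paths of the contraction takes the place of a lift to
  the universal cover: uniqueness along a path makes F well defined, and continuing all nearby paths
  with one family of germs makes it smooth.\<close>

notation scaleR (infixr "*R" 75)

abbreviation "DD f x u \<equiv> frechet_derivative f (at x) u"

section \<open>Calculus of smooth maps\<close>

lemma deriv_cong_open:
 assumes "open S" "x : S" "!!y. y : S ==> f y = g y"
 shows "frechet_derivative f (at x) = frechet_derivative g (at x)"
proof -
 have "(f has_derivative D) (at x) \<longleftrightarrow> (g has_derivative D) (at x)" for D
  using assms by (metis has_derivative_transform_within_open)
 then show ?thesis by (simp add: frechet_derivative_def)
qed

lemma differentiable_cong_open: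
 assumes "open S" "x : S" "!!y. y : S ==> f y = g y"
 shows "f differentiable (at x) \<longleftrightarrow> g differentiable (at x)"
 unfolding differentiable_def using assms by (metis has_derivative_transform_within_open)

lemma dir_deriv_eq: "(f has_derivative f') (at x) ==> DD f x u = f' u"
 using frechet_derivative_at by metis

lemma C_on_continuous: "C_on k S f ==> continuous_on S f"
proof (cases k)
 case (Suc m)
 assume "C_on k S f"
 then have "ALL x:S. f differentiable (at x)" using Suc by simp
 then show ?thesis
  using differentiable_imp_continuous_within continuous_at_imp_continuous_on by blast
qed simp

lemma C_on_SucD: "C_on (Suc k) S f ==> C_on k S f"
proof (induction k arbitrary: f)
 case 0 then show ?case using C_on_continuous[OF 0] by simp
next
 case (Suc k) then show ?case by (metis C_on.simps(2))
qed

lemma C_on_subset: "C_on k S f ==> T <= S ==> C_on k T f"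
 by (induction k arbitrary: f) (auto intro: continuous_on_subset)

lemma C_on_cong:
 assumes S: "open S"
 shows "C_on k S f ==> (!!x. x : S ==> f x = g x) ==> C_on k S g"
proof (induction k arbitrary: f g)
 case 0 then show ?case by (simp cong: continuous_on_cong)
next
 case (Suc k)
 have e: "f y = g y" if "y : S" for y using Suc.prems(2) that by blast
 have 1: "frechet_derivative f (at x) = frechet_derivative g (at x)" if "x : S" for x
  by (rule deriv_cong_open[OF S that]) (rule e)
 have 2: "g differentiable at x" if "x : S" for x
  using differentiable_cong_open[OF S that, of f g] e Suc.prems(1) that by auto
 have 3: "C_on k S (%x. DD g x u)" for u
 proof (rule Suc.IH)
  show "C_on k S (%x. DD f x u)" using Suc.prems(1) by simp
 qed (simp add: 1)
 show ?case using 2 3 by simp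
qed

lemma C_on_local:
 "(!!x. x : S ==> EX T. open T & x : T & C_on k T f) ==> C_on k S f"
proof (induction k arbitrary: f)
 case 0
 have "continuous (at x within S) f" if "x : S" for x
 proof -
  obtain T where "open T" "x : T" "continuous_on T f" using 0[OF \<open>x : S\<close>] by auto
  then have "continuous (at x) f" by (simp add: continuous_on_eq_continuous_at)
  then show ?thesis by (simp add: continuous_at_imp_continuous_within)
 qed
 then show ?case by (simp add: continuous_on_eq_continuous_within)
next
 case (Suc k)
 have "C_on k S (%x. DD f x u)" for u
 proof (rule Suc.IH)
  fix x assume "x : S"
  then obtain T where "open T" "x : T" "C_on (Suc k) T f" using Suc.prems by blast
  then show "EX T. open T & x : T & C_on k T (%x. DD f x u)" by auto
 qed
 moreover have "f differentiable at x" if "x : S" for x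
  using Suc.prems[OF that] by auto
 ultimately show ?case by simp
qed

lemma C_on_SucI:
 assumes "open S" "!!x. x : S ==> (f has_derivative f' x) (at x)" "!!u. C_on k S (%x. f' x u)"
 shows "C_on (Suc k) S f"
proof -
 have "C_on k S (%x. DD f x u)" for u
 proof (rule C_on_cong[OF assms(1) assms(3)])
  show "f' x u = DD f x u" if "x : S" for x
   using dir_deriv_eq[OF assms(2)[OF that]] by simp
 qed
 then show ?thesis using assms(2) by (auto intro: differentiableI)
qed

lemma C_on_has_derivative:
 "C_on (Suc k) S f ==> x : S ==> (f has_derivative DD f x) (at x)"
 using frechet_derivative_works by auto

lemma C_on_const: "C_on k S (%x. c)"
proof (induction k arbitrary: c)
 case (Suc k)
 have "DD (%x::'a. c) x u = 0" for x u by simp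
 then show ?case using Suc by simp
qed simp

lemma C_on_bounded_linear:
 assumes "bounded_linear L" "open S"
 shows "C_on k S f ==> C_on k S (%x. L (f x))"
proof (induction k arbitrary: f)
 case 0 then show ?case by (simp add: bounded_linear.continuous_on[OF assms(1)])
next
 case (Suc k)
 show ?case
 proof (rule C_on_SucI[OF assms(2)])
  show "((%x. L (f x)) has_derivative (%u. L (DD f x u))) (at x)" if "x : S" for x
   using bounded_linear.has_derivative[OF assms(1) C_on_has_derivative[OF Suc.prems that]] .
  show "C_on k S (%x. L (DD f x u))" for u using Suc by simp
 qed
qed

lemma C_on_add:
 assumes "open S"
 shows "C_on k S f ==> C_on k S g ==> C_on k S (%x. f x + g x)"
proof (induction k arbitrary: f g)
 case 0 then show ?case by (simp add: continuous_on_add)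
next
 case (Suc k)
 show ?case
 proof (rule C_on_SucI[OF assms])
  show "((%x. f x + g x) has_derivative (%u. DD f x u + DD g x u)) (at x)" if "x : S" for x
   using has_derivative_add[OF C_on_has_derivative[OF Suc.prems(1) that] C_on_has_derivative[OF Suc.prems(2) that]] .
  show "C_on k S (%x. DD f x u + DD g x u)" for u using Suc by simp
 qed
qed

lemma C_on_sum:
 assumes "open S"
 shows "(!!i. i : I ==> C_on k S (f i)) ==> C_on k S (%x. SUM i:I. f i x)"
 by (induction I rule: infinite_finite_induct) (auto intro!: C_on_add[OF assms] C_on_const)

lemma C_on_bilinear:
 assumes B: "bounded_bilinear B" and "open S"
 shows "C_on k S f ==> C_on k S g ==> C_on k S (%x. B (f x) (g x))"
proof (induction k arbitrary: f g)
 case 0 then show ?case by (simp add: bounded_bilinear.continuous_on[OF B])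
next
 case (Suc k)
 show ?case
 proof (rule C_on_SucI[OF assms(2)])
  show "((%x. B (f x) (g x)) has_derivative
    (%u. B (f x) (DD g x u) + B (DD f x u) (g x))) (at x)" if "x : S" for x
   using bounded_bilinear.FDERIV[OF B C_on_has_derivative[OF Suc.prems(1) that] C_on_has_derivative[OF Suc.prems(2) that]] .
  show "C_on k S (%x. B (f x) (DD g x u) + B (DD f x u) (g x))" for u
  proof (rule C_on_add[OF assms(2)])
   show "C_on k S (%x. B (f x) (DD g x u))"
    using Suc.prems by (intro Suc.IH) (auto intro: C_on_SucD)
   show "C_on k S (%x. B (DD f x u) (g x))"
    using Suc.prems by (intro Suc.IH) (auto intro: C_on_SucD)
  qed
 qed
qed

text \<open>\<open>C_on\<close> differentiates only in fixed directions. A direction that varies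
  with the point, as in the chain rule, is reduced by this expansion to finitely many fixed
  ones.\<close>

lemma basis_expand:
 "linear L ==> L (u::'a::euclidean_space) = (SUM b:Basis. (u \<bullet> b) *R L b)"
 by (subst euclidean_representation[symmetric, of u])
   (simp add: linear_sum linear_scale o_def del: euclidean_representation)

lemma C_on_compose:
 fixes g :: "'a::euclidean_space => 'b::euclidean_space" and f :: "'b => 'c::real_normed_vector"
 assumes S: "open S" and T: "open T" and gS: "g ` S <= T"
 shows "C_on k T f ==> C_on k S g ==> C_on k S (%x. f (g x))"
proof (induction k arbitrary: f)
 case 0 then show ?case using gS by (simp add: continuous_on_compose2)
next
 case (Suc k)
 show ?case
 proof (rule C_on_SucI[OF S])
  fix x assume x: "x : S"
  have f: "(f has_derivative DD f (g x)) (at (g x))"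
   by (rule C_on_has_derivative[OF Suc.prems(1)]) (use x gS in blast)
  have "((%x. f (g x)) has_derivative (%u. DD f (g x) (DD g x u))) (at x)"
   by (rule diff_chain_at[OF C_on_has_derivative[OF Suc.prems(2) x] f, unfolded o_def])
  then show "((%x. f (g x)) has_derivative
    (%u. SUM b:Basis. (DD g x u \<bullet> b) *R DD f (g x) b)) (at x)"
   by (subst (asm) basis_expand[OF has_derivative_linear[OF f]])
 next
  fix u
  show "C_on k S (%x. SUM b:Basis. (DD g x u \<bullet> b) *R DD f (g x) b)"
  proof (rule C_on_sum[OF S], rule C_on_bilinear[OF bounded_bilinear_scaleR S])
   fix b :: 'b
   show "C_on k S (%x. DD g x u \<bullet> b)"
    using Suc.prems(2) by (intro C_on_bounded_linear[OF bounded_linear_inner_left S]) simp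
   show "C_on k S (%x. DD f (g x) b)"
    using Suc.prems C_on_SucD by (intro Suc.IH) auto
  qed
 qed
qed

section \<open>Smooth functions and the rules for their derivatives\<close>

lemma smooth_on_subset: "smooth_on S f ==> T <= S ==> smooth_on T f"
 unfolding smooth_on_def by (meson C_on_subset)
lemma smooth_on_cong: "open S ==> smooth_on S f ==> (!!x. x : S ==> f x = g x) ==> smooth_on S g"
 unfolding smooth_on_def by (intro allI, rule C_on_cong[of S _ f]) auto
lemma smooth_on_local:
 assumes "!!x. x : S ==> EX T. open T & x : T & smooth_on T f"
 shows "smooth_on S f"
 unfolding smooth_on_def
proof (intro allI C_on_local)
 fix k x assume "x : S"
 then obtain T where "open T" "x : T" "smooth_on T f" using assms by blast
 then show "EX T. open T & x : T & C_on k T f" unfolding smooth_on_def by blast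
qed
lemma smooth_on_const: "smooth_on S (%x. c)"
 unfolding smooth_on_def by (intro allI C_on_const)
lemma smooth_on_bounded_linear:
 "bounded_linear L ==> open S ==> smooth_on S f ==> smooth_on S (%x. L (f x))"
 unfolding smooth_on_def by (intro allI, rule C_on_bounded_linear[of L S _ f]) auto
lemma smooth_on_add: "open S ==> smooth_on S f ==> smooth_on S g ==> smooth_on S (%x. f x + g x)"
 unfolding smooth_on_def by (intro allI, rule C_on_add[of S _ f g]) auto
lemma smooth_on_sum:
 "open S ==> (!!i. i : I ==> smooth_on S (f i)) ==> smooth_on S (%x. SUM i:I. f i x)"
 unfolding smooth_on_def by (intro allI, rule C_on_sum[of S I _ f]) auto
lemma smooth_on_bilinear:
 "bounded_bilinear B ==> open S ==> smooth_on S f ==> smooth_on S g ==> smooth_on S (%x. B (f x) (g x))"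
 unfolding smooth_on_def by (intro allI, rule C_on_bilinear[of B S _ f g]) auto
lemmas smooth_on_scaleR = smooth_on_bilinear[OF bounded_bilinear_scaleR]
lemmas smooth_on_mult = smooth_on_bilinear[OF bounded_bilinear_mult]
lemmas smooth_on_inner = smooth_on_bilinear[OF bounded_bilinear_inner]
lemmas smooth_on_scale = smooth_on_bounded_linear[OF bounded_linear_scaleR_right]

lemma smooth_on_minus: "open S ==> smooth_on S f ==> smooth_on S (%x. - f x)"
 by (rule smooth_on_bounded_linear[OF bounded_linear_minus[OF bounded_linear_ident]])
lemma smooth_on_diff: "open S ==> smooth_on S f ==> smooth_on S g ==> smooth_on S (%x. f x - g x)"
 using smooth_on_add[of S f "%x. - g x"] smooth_on_minus[of S g] by simp
lemma smooth_on_compose: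
 "open S ==> open T ==> g ` S <= T ==> smooth_on T f ==> smooth_on S g ==> smooth_on S (%x. f (g x))"
 unfolding smooth_on_def by (intro allI, rule C_on_compose[of S T g _ f]) auto

lemma smooth_on_deriv: "smooth_on S f ==> smooth_on S (%x. DD f x u)"
 unfolding smooth_on_def by (metis C_on.simps(2))
lemma smooth_has_deriv: "smooth_on S f ==> x : S ==> (f has_derivative DD f x) (at x)"
 unfolding smooth_on_def by (erule allE[of _ "Suc 0"]) (rule C_on_has_derivative)
lemma smooth_on_continuous: "smooth_on S f ==> continuous_on S f"
 unfolding smooth_on_def by (meson C_on_continuous)
lemma linear_DD: "smooth_on S f ==> x : S ==> linear (DD f x)"
 using has_derivative_linear[OF smooth_has_deriv] .

lemma smooth_on_if_deriv:
 assumes "open S" "!!x. x : S ==> (f has_derivative f' x) (at x)" "!!u. smooth_on S (%x. f' x u)"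
 shows "smooth_on S f"
 unfolding smooth_on_def
proof
 fix k show "C_on k S f"
  by (rule C_on_SucD[OF C_on_SucI[OF assms(1,2)]]) (use assms(3) in "auto simp: smooth_on_def")
qed

lemma smooth_on_linear: assumes "bounded_linear L" shows "smooth_on UNIV L"
 by (rule smooth_on_if_deriv[where f'="%x. L"])
   (auto intro: bounded_linear_imp_has_derivative[OF assms] smooth_on_const)
lemma smooth_on_ident: "smooth_on S (%x. x)"
 using smooth_on_subset[OF smooth_on_linear[OF bounded_linear_ident]] by simp

lemma smooth_on_componentwise:
 assumes "open S" "!!b. b : Basis ==> smooth_on S (%x. f x \<bullet> b)"
 shows "smooth_on S f"
proof -
 have "smooth_on S (%x. SUM b:Basis. (f x \<bullet> b) *R b)"
  by (intro smooth_on_sum smooth_on_scaleR assms smooth_on_const)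
 then show ?thesis by (simp add: euclidean_representation)
qed

lemma C_on_inverse: "C_on k (- {0::real}) inverse"
proof (induction k)
 case 0 show ?case by (auto intro!: continuous_intros)
next
 case (Suc k)
 show ?case
 proof (rule C_on_SucI[where f'="%x u. inverse x * inverse x * - u"])
  fix x :: real assume "x : - {0}"
  then show "(inverse has_derivative (%u. inverse x * inverse x * (-u))) (at x)"
   by (auto intro!: derivative_eq_intros)
 next
  show "C_on k (- {0}) (%x. inverse x * inverse x * - u)" for u :: real
   by (intro C_on_bilinear[OF bounded_bilinear_mult] Suc.IH C_on_const) auto
 qed auto
qed

lemma smooth_on_inverse:
 assumes "open S" "smooth_on S f" "!!x. x : S ==> f x ~= (0::real)"
 shows "smooth_on S (%x. inverse (f x))"
 using smooth_on_compose[of S "-{0}" f inverse] assms C_on_inverse unfolding smooth_on_def by force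

lemma dir_deriv_add:
 "smooth_on S f ==> smooth_on S g ==> x : S ==>
  DD (%x. f x + g x) x u = DD f x u + DD g x u"
 by (rule dir_deriv_eq[OF has_derivative_add[OF smooth_has_deriv smooth_has_deriv]])
lemma dir_deriv_diff:
 "smooth_on S f ==> smooth_on S g ==> x : S ==>
  DD (%x. f x - g x) x u = DD f x u - DD g x u"
 by (rule dir_deriv_eq[OF has_derivative_diff[OF smooth_has_deriv smooth_has_deriv]])
lemma dir_deriv_linear:
 "bounded_linear L ==> smooth_on S f ==> x : S ==> DD (%x. L (f x)) x u = L (DD f x u)"
 by (rule dir_deriv_eq[OF bounded_linear.has_derivative[OF _ smooth_has_deriv]])
lemma dir_deriv_bilinear:
 "bounded_bilinear B ==> smooth_on S f ==> smooth_on S g ==> x : S ==>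
  DD (%x. B (f x) (g x)) x u = B (f x) (DD g x u) + B (DD f x u) (g x)"
 by (rule dir_deriv_eq[OF bounded_bilinear.FDERIV[OF _ smooth_has_deriv smooth_has_deriv]])
lemma dir_deriv_sum:
 assumes "!!i. i : I ==> smooth_on S (f i)" "x : S"
 shows "DD (%x. SUM i:I. f i x) x u = (SUM i:I. DD (f i) x u)"
 by (rule dir_deriv_eq, rule has_derivative_sum, rule smooth_has_deriv[OF assms])
lemma dir_deriv_compose:
 assumes "smooth_on T f" "smooth_on S g" "x : S" "g x : T"
 shows "DD (%x. f (g x)) x u = DD f (g x) (DD g x u)"
 by (rule dir_deriv_eq[OF diff_chain_at[OF smooth_has_deriv[OF assms(2,3)]
    smooth_has_deriv[OF assms(1,4)], unfolded o_def]])

lemma dir_deriv_translate: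
 assumes "smooth_on UNIV f"
 shows "DD (%x. f (x + c)) x u = DD f (x + c) u"
proof -
 have "((%x. x + c) has_derivative (%u. u)) (at x)" by (auto intro!: derivative_eq_intros)
 from dir_deriv_eq[OF diff_chain_at[OF this smooth_has_deriv[OF assms UNIV_I], unfolded o_def]]
 show ?thesis .
qed

lemma smooth_on_translate: "smooth_on UNIV f ==> smooth_on UNIV (%x. f (x + c))"
 by (rule smooth_on_compose[where T=UNIV]) (simp_all add: smooth_on_add smooth_on_ident smooth_on_const)

lemma norm_deriv_basis_bound:
 assumes "linear L" "!!b. b : Basis ==> norm (L b) <= C"
 shows "norm (L (u::'a::euclidean_space)) <= (real DIM('a) * C) * norm u"
proof -
 have "norm (L u) <= (SUM b:Basis. norm ((u \<bullet> b) *R L b))"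
  by (subst basis_expand[OF assms(1)]) (rule norm_sum)
 also have "... <= (SUM b:(Basis::'a set). norm u * C)"
  using assms(2) by (intro sum_mono) (auto intro!: mult_mono Basis_le_norm)
 finally show ?thesis by (simp add: algebra_simps)
qed

text \<open>Both mixed derivatives are the limit of the second difference quotient, which is symmetric.\<close>

lemma second_difference_bound:
 fixes f :: "'a::euclidean_space => 'b::real_normed_vector"
 assumes f: "smooth_on (ball x r) f" and h: "0 < h" "h * (norm a + norm b) < r"
  and L: "!!y. dist x y <= h * (norm a + norm b) ==> norm (DD (%y. DD f y b) y a - L) <= e"
 shows "norm (f (x + h *R a + h *R b) - f (x + h *R a) - f (x + h *R b) + f x - (h * h) *R L) <= h * h * e"
proof -
 have dist: "dist x (x + s *R a + t *R b) <= h * (norm a + norm b)"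
  if "0 <= s" "s <= h" "0 <= t" "t <= h" for s t
 proof -
  have "norm (s *R a + t *R b) <= s * norm a + t * norm b"
   using norm_triangle_ineq[of "s *R a" "t *R b"] that by simp
  also have "... <= h * norm a + h * norm b" using that by (intro add_mono mult_right_mono) auto
  finally have "norm (s *R a + t *R b) <= h * norm a + h * norm b" .
  moreover have "x - (x + s *R a + t *R b) = - (s *R a + t *R b)" by simp
  ultimately show ?thesis unfolding dist_norm by (simp only: norm_minus_cancel distrib_left)
 qed
 have inb: "x + s *R a + t *R b : ball x r" if "0 <= s" "s <= h" "0 <= t" "t <= h" for s t
  unfolding mem_ball using dist[OF that] h(2) by linarith
 \<comment> \<open>The mean value inequality is used twice: here along \<open>a\<close>, for the
   derivative of \<open>f\<close> in the direction \<open>b\<close>, and below along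
   \<open>b\<close>, for the differences of \<open>f\<close> itself.\<close>
 have inner: "norm (DD f (x + h *R a + t *R b) b - DD f (x + t *R b) b - h *R L) <= h * e"
  if t: "0 <= t" "t <= h" for t
 proof -
  have "norm ((DD f (x + h *R a + t *R b) b - h *R L) - (DD f (x + 0 *R a + t *R b) b - 0 *R L)) <= e * norm (h - 0)"
  proof (rule differentiable_bound[where S="{0..h}" and f'="%s d. d *R (DD (%y. DD f y b) (x + s *R a + t *R b) a - L)"])
   fix s assume s: "s : {0..h}"
   have g: "((%s. x + s *R a + t *R b) has_derivative (%d. d *R a)) (at s within {0..h})"
    by (auto intro!: derivative_eq_intros)
   have y: "x + s *R a + t *R b : ball x r" using inb s t by auto
   have k: "((%y. DD f y b) has_derivative DD (%y. DD f y b) (x + s *R a + t *R b)) (at (x + s *R a + t *R b))"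
    using smooth_has_deriv[OF smooth_on_deriv[OF f] y] .
   from has_derivative_in_compose[OF g has_derivative_at_withinI[OF k]]
   show "((%s. DD f (x + s *R a + t *R b) b - s *R L) has_derivative
     (%d. d *R (DD (%y. DD f y b) (x + s *R a + t *R b) a - L))) (at s within {0..h})"
    by (auto intro!: derivative_eq_intros simp: linear_scale[OF has_derivative_linear[OF k]] scaleR_diff_right)
   show "onorm (%d. d *R (DD (%y. DD f y b) (x + s *R a + t *R b) a - L)) <= e"
    using L[OF dist[of s t]] s t
    by (intro onorm_le) (simp add: mult.commute[of e] mult_left_mono)
  qed (use h in auto)
  then show ?thesis using h by (simp add: algebra_simps)
 qed
 have "norm ((f (x + h *R a + h *R b) - f (x + h *R b) - h *R h *R L) - (f (x + h *R a + 0 *R b) - f (x + 0 *R b) - 0 *R h *R L)) <= (h * e) * norm (h - 0)"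
 proof (rule differentiable_bound[where S="{0..h}" and f'="%t d. d *R (DD f (x + h *R a + t *R b) b - DD f (x + t *R b) b - h *R L)"])
  fix t assume t: "t : {0..h}"
  have D: "((%t. f (x + s *R a + t *R b)) has_derivative (%d. d *R DD f (x + s *R a + t *R b) b)) (at t within {0..h})"
   if "0 <= s" "s <= h" for s
  proof -
   have g: "((%t. x + s *R a + t *R b) has_derivative (%d. d *R b)) (at t within {0..h})"
    by (auto intro!: derivative_eq_intros)
   have k: "(f has_derivative DD f (x + s *R a + t *R b)) (at (x + s *R a + t *R b))"
    using smooth_has_deriv[OF f inb[of s t]] t that by auto
   show ?thesis
    using has_derivative_in_compose[OF g has_derivative_at_withinI[OF k]]
    by (simp add: linear_scale[OF has_derivative_linear[OF k]])
  qed
  from D[of h] D[of 0] h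
  show "((%t. f (x + h *R a + t *R b) - f (x + t *R b) - t *R h *R L) has_derivative
    (%d. d *R (DD f (x + h *R a + t *R b) b - DD f (x + t *R b) b - h *R L))) (at t within {0..h})"
   by (auto intro!: derivative_eq_intros simp: scaleR_diff_right)
  show "onorm (%d. d *R (DD f (x + h *R a + t *R b) b - DD f (x + t *R b) b - h *R L)) <= h * e"
   using inner[of t] t by (intro onorm_le) (simp add: mult.commute[of "h * e"] mult_left_mono del: mult.assoc)
 qed (use h in auto)
 then show ?thesis using h by (simp add: algebra_simps)
qed

lemma dir_deriv_commute:
 fixes f :: "'a::euclidean_space => 'b::real_normed_vector"
 assumes S: "open S" and f: "smooth_on S f" and x: "x : S"
 shows "DD (%y. DD f y b) x a = DD (%y. DD f y a) x b" (is "?A = ?B")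
proof (rule ccontr)
 assume ne: "?A ~= ?B"
 \<comment> \<open>The second difference is the same for both orders, so the two error bounds give
   \<open>norm (?A - ?B) <= 2 * e\<close>, half of the left side.\<close>
 define e where "e = norm (?A - ?B) / 4"
 have e: "e > 0" using ne by (simp add: e_def)
 obtain r where r: "r > 0" "ball x r <= S" using S x openE by blast
 have c: "continuous_on S (%x. DD (%y. DD f y b) x a)" for a b
  by (intro smooth_on_continuous smooth_on_deriv f)
 have "EX d>0. ALL y. dist x y < d --> norm (DD (%y. DD f y b) y a - DD (%y. DD f y b) x a) <= e" for a b
 proof -
  have "isCont (%x. DD (%y. DD f y b) x a) x"
   using c[of b a] S x by (simp add: continuous_on_eq_continuous_at)
  then obtain d where "d > 0" "!!y. dist y x < d ==>
    dist (DD (%y. DD f y b) y a) (DD (%y. DD f y b) x a) < e"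
   unfolding continuous_at_eps_delta using e by blast
  then show ?thesis by (intro exI[of _ d]) (auto simp: dist_commute dist_norm less_imp_le)
 qed
 from this[of b a] this[of a b] obtain d1 d2 where d: "d1 > 0" "d2 > 0"
  "!!y. dist x y < d1 ==> norm (DD (%y. DD f y b) y a - ?A) <= e"
  "!!y. dist x y < d2 ==> norm (DD (%y. DD f y a) y b - ?B) <= e" by (elim exE conjE) simp
 define m where "m = norm a + norm b + 1"
 have m: "m > 0" unfolding m_def by (simp add: add_nonneg_pos)
 define h where "h = min r (min d1 d2) / (2 * m)"
 have h0: "h > 0" using r d m by (simp add: h_def)
 have "h * (norm a + norm b) < h * (2 * m)"
  using h0 m by (intro mult_strict_left_mono) (auto simp: m_def add_nonneg_pos intro: add_nonneg_pos)
 also have "h * (2 * m) = min r (min d1 d2)" using m by (simp add: h_def)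
 finally have hl: "h * (norm a + norm b) < r" "h * (norm a + norm b) < d1" "h * (norm a + norm b) < d2" by auto
 have fb: "smooth_on (ball x r) f" using f r smooth_on_subset by blast
 have 1: "norm (f (x + h *R a + h *R b) - f (x + h *R a) - f (x + h *R b) + f x - (h * h) *R ?A) <= h * h * e"
  using hl d(3) by (intro second_difference_bound[OF fb h0]) auto
 have 2: "norm (f (x + h *R b + h *R a) - f (x + h *R b) - f (x + h *R a) + f x - (h * h) *R ?B) <= h * h * e"
  using hl d(4) by (intro second_difference_bound[OF fb h0]) (auto simp: add.commute)
 have "norm ((h * h) *R (?A - ?B)) <= h * h * e + h * h * e"
  using norm_triangle_ineq4[of "f (x + h *R b + h *R a) - f (x + h *R b) - f (x + h *R a) + f x - (h * h) *R ?B"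
    "f (x + h *R a + h *R b) - f (x + h *R a) - f (x + h *R b) + f x - (h * h) *R ?A"] 1 2
  by (simp add: algebra_simps)
 then have "(h * h) * norm (?A - ?B) <= (h * h) * (2 * e)"
  unfolding norm_scaleR by (simp add: algebra_simps)
 then have "norm (?A - ?B) <= 2 * e" using h0 by (simp only: mult_le_cancel_left_pos mult_pos_pos)
 then show False using e by (simp add: e_def)
qed

section \<open>Bump functions\<close>

text \<open>Derivatives of \<open>exp (- inverse x)\<close> bring in powers of
  \<open>inverse x\<close>. With these included, the derivative of a member of the family is a
  linear combination of members.\<close>

definition flat_fun :: "nat => real => real" where
 "flat_fun k x = (if x > 0 then inverse x ^ k * exp (- inverse x) else 0)"

text \<open>With \<open>t = inverse x\<close> this is
  \<open>exp t >= (1 + t / (k + 2)) ^ (k + 2)\<close>. Quadratic decay settles the one delicate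
  point of the next lemma, the derivative at the origin.\<close>

lemma flat_fun_bound: "\<bar>flat_fun k x\<bar> <= real (k + 2) ^ (k + 2) * x^2"
proof (cases "x > 0")
 case True
 define t where "t = inverse x"
 have t: "t > 0" "x = inverse t" using True by (simp_all add: t_def)
 have "(t / real (k + 2)) ^ (k + 2) <= (1 + t / real (k + 2)) ^ (k + 2)"
  using t by (intro power_mono) auto
 also have "... <= exp t"
  using t by (intro exp_ge_one_plus_x_over_n_power_n) auto
 finally have "t ^ (k + 2) / real (k + 2) ^ (k + 2) <= exp t"
  by (simp only: power_divide)
 then have "t ^ (k + 2) <= real (k + 2) ^ (k + 2) * exp t"
  by (subst (asm) pos_divide_le_eq) (simp_all add: mult.commute)
 then have "t ^ k * exp (- t) <= real (k + 2) ^ (k + 2) * (inverse t)^2"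
  using t by (simp add: exp_minus field_simps power_add power2_eq_square)
 then show ?thesis using True t by (simp add: flat_fun_def)
qed (simp add: flat_fun_def)

lemma flat_fun_has_derivative:
 "(flat_fun k has_derivative (%u. u * (flat_fun (k + 2) x - real k * flat_fun (k + 1) x))) (at x)"
proof -
 consider "x > 0" | "x < 0" | "x = 0" by linarith
 then show ?thesis
 proof cases
  case 1
  have "((%x. inverse x ^ k * exp (- inverse x)) has_derivative
    (%u. u * (flat_fun (k + 2) x - real k * flat_fun (k + 1) x))) (at x)"
   using 1 by (auto intro!: derivative_eq_intros simp: flat_fun_def fun_eq_iff)
     (cases k; simp add: algebra_simps)
  then show ?thesis
   by (rule has_derivative_transform_within_open[where s="{0<..}"]) (use 1 in "auto simp: flat_fun_def")
 next
  case 2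
  have "((%x. 0) has_derivative (%u. u * (flat_fun (k + 2) x - real k * flat_fun (k + 1) x))) (at x)"
   using 2 by (simp add: flat_fun_def)
  then show ?thesis
   by (rule has_derivative_transform_within_open[where s="{..<0}"]) (use 2 in "auto simp: flat_fun_def")
 next
  case 3
  define C where "C = real (k + 2) ^ (k + 2)"
  have C: "\<bar>flat_fun k x\<bar> <= C * x^2" for x using flat_fun_bound[of k x] by (simp add: C_def)
  have "((%h. norm (flat_fun k (0 + h) - flat_fun k 0 - 0) / norm h) \<longlongrightarrow> 0) (at 0)"
  proof (rule tendsto_sandwich[where f="%_. 0" and h="%h. C * \<bar>h\<bar>"])
   have "norm (flat_fun k (0 + h) - flat_fun k 0 - 0) / norm h <= C * \<bar>h\<bar>" for h
    using C[of h] by (cases "h = 0") (auto simp: flat_fun_def divide_simps power2_eq_square abs_mult[symmetric] mult.assoc)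
   then show "\<forall>\<^sub>F h in at 0. norm (flat_fun k (0 + h) - flat_fun k 0 - 0) / norm h <= C * \<bar>h\<bar>" by simp
   show "((%h. C * \<bar>h\<bar>) \<longlongrightarrow> 0) (at 0)" by (auto intro!: tendsto_eq_intros)
  qed auto
  then show ?thesis using 3 unfolding has_derivative_at by (simp add: flat_fun_def)
 qed
qed

lemma smooth_on_flat_fun: "smooth_on UNIV (flat_fun k)"
 unfolding smooth_on_def
proof
 fix m show "C_on m UNIV (flat_fun k)"
 proof (induction m arbitrary: k)
  case 0
  show ?case using flat_fun_has_derivative[THEN has_derivative_continuous]
   by (simp add: continuous_at_imp_continuous_on)
 next
  case (Suc m)
  show ?case
  proof (rule C_on_SucI[OF open_UNIV flat_fun_has_derivative])
   fix u :: real
   have "C_on m UNIV (%x. u * (flat_fun (k + 2) x + (- real k) * flat_fun (k + 1) x))"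
    by (intro C_on_bounded_linear[OF bounded_linear_mult_right] C_on_add[OF open_UNIV] Suc.IH open_UNIV)
   then show "C_on m UNIV (%x. u * (flat_fun (k + 2) x - real k * flat_fun (k + 1) x))" by simp
  qed
 qed
qed

definition smooth_step :: "real => real" where
 "smooth_step t = flat_fun 0 t * inverse (flat_fun 0 t + flat_fun 0 (1 - t))"

lemma flat_fun0_pos: "t > 0 ==> flat_fun 0 t > 0" "t <= 0 ==> flat_fun 0 t = 0" "flat_fun 0 t >= 0"
 by (auto simp: flat_fun_def)

lemma flat_fun0_mono: "s <= t ==> flat_fun 0 s <= flat_fun 0 t"
 by (auto simp: flat_fun_def)

lemma smooth_step_denom: "flat_fun 0 t + flat_fun 0 (1 - t) > 0"
 using flat_fun0_pos[of t] flat_fun0_pos[of "1-t"] by (cases "t > 0") (auto intro: add_pos_nonneg add_nonneg_pos)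

lemma smooth_on_smooth_step: "smooth_on UNIV smooth_step"
proof -
 have 1: "smooth_on UNIV (%t. flat_fun 0 (1 - t))"
  by (rule smooth_on_compose[OF open_UNIV open_UNIV subset_UNIV smooth_on_flat_fun])
    (intro smooth_on_diff open_UNIV smooth_on_const smooth_on_ident)
 have "smooth_on UNIV (%t. flat_fun 0 t * inverse (flat_fun 0 t + flat_fun 0 (1 - t)))"
  by (intro smooth_on_mult open_UNIV smooth_on_flat_fun smooth_on_inverse smooth_on_add 1)
    (use smooth_step_denom in "auto simp: less_le")
 then show ?thesis by (simp add: smooth_step_def[abs_def])
qed

lemma smooth_step_0: "t <= 0 ==> smooth_step t = 0"
 by (simp add: smooth_step_def flat_fun0_pos)
lemma smooth_step_1: "t >= 1 ==> smooth_step t = 1"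
 using flat_fun0_pos(1)[of t] by (simp add: smooth_step_def flat_fun0_pos(2))
lemma smooth_step_ge_0: "0 <= smooth_step t"
 using smooth_step_denom[of t] flat_fun0_pos(3)[of t] by (simp add: smooth_step_def)
lemma smooth_step_le_1: "smooth_step t <= 1"
 using smooth_step_denom[of t] flat_fun0_pos(3)[of "1-t"] by (simp add: smooth_step_def field_simps)

text \<open>It gives the sign of the derivative of \<open>smooth_step\<close>, which later serves as
  the radial profile of the mollifying kernel.\<close>

lemma smooth_step_mono: "s <= t ==> smooth_step s <= smooth_step t"
proof -
 assume st: "s <= t"
 have "flat_fun 0 s * flat_fun 0 (1 - t) <= flat_fun 0 t * flat_fun 0 (1 - s)"
  using st by (intro mult_mono flat_fun0_mono) (auto simp: flat_fun0_pos)
 then show ?thesis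
  using smooth_step_denom[of t] smooth_step_denom[of s] by (simp add: smooth_step_def field_simps)
qed

section \<open>Smooth functions with compact support\<close>

text \<open>Vanishing off a compact subset of \<open>S\<close> replaces the closed support. Thus
  \<open>S\<close> may be open, such as the image of a chart, or compact, when a constant has to
  serve all functions supported there.\<close>

definition ccs :: "'a::euclidean_space set => ('a => 'b::real_normed_vector) => bool" where
 "ccs S u \<longleftrightarrow> smooth_on UNIV u & (EX K. compact K & K <= S & (ALL x. x ~: K --> u x = 0))"

lemma ccs_smooth: "ccs S u ==> smooth_on UNIV u" by (simp add: ccs_def)
lemma ccs_smooth_on: "ccs S u ==> smooth_on T u"
 using smooth_on_subset[OF ccs_smooth subset_UNIV] .
lemma ccs_mono: "ccs S u ==> S <= T ==> ccs T u" unfolding ccs_def by (meson order_trans)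

text \<open>\<open>T\<close> and the complement of \<open>K\<close> form an open cover, so a
  function that is known to be smooth only near its support is smooth everywhere.\<close>

lemma ccsI:
 assumes "compact K" "K <= S" "!!x. x ~: K ==> u x = 0" "open T" "K <= T" "smooth_on T u"
 shows "ccs S u"
proof -
 have "smooth_on UNIV u"
 proof (rule smooth_on_local)
  fix x :: 'a
  show "EX W. open W & x : W & smooth_on W u"
  proof (cases "x : T")
   case False
   have "smooth_on (- K) u"
    by (rule smooth_on_cong[OF _ smooth_on_const[of _ 0]]) (use assms in "auto simp: compact_imp_closed")
   then show ?thesis using False assms by (intro exI[of _ "-K"]) (auto simp: compact_imp_closed)
  qed (use assms in blast)
 qed
 then show ?thesis unfolding ccs_def using assms by blast
qed

lemma ccs_compact_iff: "compact K ==> ccs K u \<longleftrightarrow> smooth_on UNIV u & (ALL x. x ~: K --> u x = 0)"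
 unfolding ccs_def by blast

lemma ccs_scaleR_smooth:
 assumes "ccs S th" "open T" "S <= T" "smooth_on T f"
 shows "ccs S (%x. th x *R f x)"
proof -
 obtain K where K: "compact K" "K <= S" "ALL x. x ~: K --> th x = 0" using assms(1) unfolding ccs_def by blast
 show ?thesis
  by (rule ccsI[OF K(1,2) _ assms(2)]) (use K assms in "auto intro!: smooth_on_scaleR ccs_smooth_on[OF assms(1)]")
qed

lemma ccs_mult_smooth:
 assumes "ccs S th" "open T" "S <= T" "smooth_on T f"
 shows "ccs S (%x. th x * (f x :: real))"
 using ccs_scaleR_smooth[OF assms(1-3), of f] assms(4) by simp

lemma ccs_add:
 assumes "ccs S u" "ccs S v" shows "ccs S (%x. u x + v x)"
proof -
 obtain K where K: "compact K" "K <= S" "ALL x. x ~: K --> u x = 0" using assms(1) unfolding ccs_def by blast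
 obtain L where L: "compact L" "L <= S" "ALL x. x ~: L --> v x = 0" using assms(2) unfolding ccs_def by blast
 show ?thesis unfolding ccs_def
  using K L by (intro conjI smooth_on_add ccs_smooth[OF assms(1)] ccs_smooth[OF assms(2)] open_UNIV exI[of _ "K Un L"]) auto
qed

lemma ccs_bounded_linear:
 assumes "bounded_linear L" "ccs S u" shows "ccs S (%x. L (u x))"
proof -
 obtain K where K: "compact K" "K <= S" "ALL x. x ~: K --> u x = 0" using assms(2) unfolding ccs_def by blast
 show ?thesis unfolding ccs_def
  using K linear_0[OF bounded_linear.linear[OF assms(1)]]
  by (intro conjI smooth_on_bounded_linear[OF assms(1)] ccs_smooth[OF assms(2)] open_UNIV exI[of _ K]) auto
qed

lemma ccs_minus: "ccs S u ==> ccs S (%x. - u x)"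
 by (rule ccs_bounded_linear[OF bounded_linear_minus[OF bounded_linear_ident]])
lemma ccs_diff: "ccs S u ==> ccs S v ==> ccs S (%x. u x - v x)"
 using ccs_add[of S u "%x. - v x"] ccs_minus[of S v] by simp
lemma ccs_scale: "ccs S u ==> ccs S (%x. c *R u x)"
 by (rule ccs_bounded_linear[OF bounded_linear_scaleR_right])
lemma ccs_zero: "ccs S (%x. 0)"
 unfolding ccs_def by (intro conjI smooth_on_const exI[of _ "{}"]) auto
lemma ccs_sum: "(!!i. i : I ==> ccs S (u i)) ==> ccs S (%x. SUM i:I. u i x)"
 by (induction I rule: infinite_finite_induct) (auto simp: ccs_zero ccs_add)

lemma dir_deriv_eq_0:
 assumes "closed K" "!!x. x ~: K ==> u x = 0" "x ~: K"
 shows "DD u x b = 0"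
proof -
 have "frechet_derivative u (at x) = frechet_derivative (%x. 0) (at x)"
  by (rule deriv_cong_open[of "-K"]) (use assms in auto)
 then show ?thesis by simp
qed

lemma ccs_deriv: assumes "ccs S u" shows "ccs S (%x. DD u x b)"
proof -
 obtain K where K: "compact K" "K <= S" "ALL x. x ~: K --> u x = 0" using assms unfolding ccs_def by blast
 then have "DD u x b = 0" if "x ~: K" for x
  using dir_deriv_eq_0[of K u x b] that compact_imp_closed by blast
 then show ?thesis unfolding ccs_def using K smooth_on_deriv[OF ccs_smooth[OF assms]] by blast
qed

lemma ex_bump:
 fixes a :: "'a::euclidean_space"
 assumes "r > 0"
 shows "EX ph. ccs (ball a r) ph & (ALL x. 0 <= ph x & ph x <= (1::real)) & (ALL x:ball a (r/2). ph x = 1)"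
proof -
 \<comment> \<open>A function of the distance to \<open>a\<close> that is at least 1 up to distance
   \<open>r / 2\<close> and negative from distance \<open>3 * r / 4\<close> on, so
   \<open>smooth_step\<close> turns it into the bump.\<close>
 define f where "f x = 2 - (4 / r^2) * ((x - a) \<bullet> (x - a))" for x
 have sm: "smooth_on UNIV f" unfolding f_def
  by (intro smooth_on_diff smooth_on_mult smooth_on_inner smooth_on_const smooth_on_ident open_UNIV)
 have s2: "smooth_on UNIV (%x. smooth_step (f x))"
  by (rule smooth_on_compose[OF open_UNIV open_UNIV subset_UNIV smooth_on_smooth_step sm])
 have f: "f x = 2 - 4 * (dist a x / r)^2" for x
  by (simp add: f_def dist_norm power2_norm_eq_inner[symmetric] power_divide norm_minus_commute)
 have out: "smooth_step (f x) = 0" if "x ~: cball a (3 * r / 4)" for x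
 proof -
  have "dist a x / r > 3/4" using that assms by (simp add: field_simps)
  then have "(dist a x / r)^2 >= (3/4)^2" by (intro power_mono) auto
  moreover have "(3/4::real)^2 = 9/16" by (simp add: power2_eq_square)
  ultimately show ?thesis by (intro smooth_step_0) (unfold f, linarith)
 qed
 have inn: "smooth_step (f x) = 1" if "x : ball a (r/2)" for x
 proof -
  have "dist a x / r <= 1/2" using that assms by (simp add: field_simps)
  then have "(dist a x / r)^2 <= (1/2)^2" using assms by (intro power_mono) auto
  moreover have "(1/2::real)^2 = 1/4" by (simp add: power2_eq_square)
  ultimately show ?thesis by (intro smooth_step_1) (unfold f, linarith)
 qed
 have "ccs (ball a r) (%x. smooth_step (f x))"
  unfolding ccs_def using assms by (intro conjI s2 exI[of _ "cball a (3 * r / 4)"]) (auto simp: out)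
 then show ?thesis using inn smooth_step_ge_0 smooth_step_le_1 by blast
qed

text \<open>Finitely many bumps add up to at least 1 near \<open>K\<close>, and
  \<open>smooth_step\<close> truncates the sum to exactly 1 there without enlarging its support. The
  value 1 holds on an open \<open>U\<close>, so that multiplying by \<open>th\<close> changes no
  derivative on \<open>U\<close>.\<close>

lemma ex_cutoff:
 fixes K :: "'a::euclidean_space set"
 assumes K: "compact K" and S: "open S" "K <= S"
 shows "EX th U. ccs S th & (ALL x. 0 <= th x & th x <= (1::real)) & open U & K <= U & (ALL x:U. th x = 1)"
proof -
 have "EX ph r. r > 0 & ccs S ph & (ALL x. 0 <= ph x) & (ALL x:ball a r. ph x = (1::real))" if a: "a : K" for a
 proof -
  obtain r where r: "r > 0" "ball a r <= S" using a S openE by blast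
  obtain ph where "ccs (ball a r) ph" "ALL x. 0 <= ph x & ph x <= (1::real)" "ALL x:ball a (r/2). ph x = 1"
   using ex_bump[OF r(1)] by blast
  then show ?thesis using r ccs_mono by (intro exI[of _ ph] exI[of _ "r/2"]) auto
 qed
 then obtain ph r where f: "!!a. a : K ==> r a > 0 & ccs S (ph a) & (ALL x. 0 <= ph a x) & (ALL x:ball a (r a). ph a x = (1::real))"
  by metis
 have "K <= (UN a:K. ball a (r a))" using f by (auto intro!: bexI)
 then obtain F where F: "F <= K" "finite F" "K <= (UN a:F. ball a (r a))"
  using compactE_image[OF K, of K "%a. ball a (r a)"] by blast
 define Ph where "Ph x = (SUM a:F. ph a x)" for x
 have cc: "ccs S Ph" unfolding Ph_def using f F by (intro ccs_sum) blast
 then obtain L where L: "compact L" "L <= S" "ALL x. x ~: L --> Ph x = 0" unfolding ccs_def by blast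
 define U where "U = (UN a:F. ball a (r a))"
 have "Ph x >= 1" if x: "x : U" for x
 proof -
  obtain a where a: "a : F" "x : ball a (r a)" using x U_def by blast
  then have "ph a x = 1" using f F by blast
  moreover have "ph a x <= Ph x" unfolding Ph_def using a F f by (intro member_le_sum) auto
  ultimately show ?thesis by simp
 qed
 then have one: "smooth_step (Ph x) = 1" if "x : U" for x using that smooth_step_1 by blast
 have "smooth_on UNIV (%x. smooth_step (Ph x))"
  by (rule smooth_on_compose[OF open_UNIV open_UNIV subset_UNIV smooth_on_smooth_step ccs_smooth[OF cc]])
 then have "ccs S (%x. smooth_step (Ph x))" unfolding ccs_def using L smooth_step_0 by (metis order_refl)
 then show ?thesis using F(3) one smooth_step_ge_0 smooth_step_le_1
  by (intro exI[of _ "%x. smooth_step (Ph x)"] exI[of _ U]) (auto simp: U_def)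
qed

lemma ccs_bounded: assumes "ccs S u" shows "EX C>=0. ALL x. norm (u x) <= C"
proof -
 obtain K where K: "compact K" "ALL x. x ~: K --> u x = 0" using assms unfolding ccs_def by blast
 have "compact (u ` K)"
  by (intro compact_continuous_image K(1) smooth_on_continuous ccs_smooth_on[OF assms])
 then obtain C where "ALL y:u ` K. norm y <= C" using compact_imp_bounded bounded_iff by blast
 then have "ALL x. norm (u x) <= max C 0"
  using K(2) by (metis image_eqI max.coboundedI1 max.cobounded2 norm_zero)
 then show ?thesis by (intro exI[of _ "max C 0"]) auto
qed

lemma deriv_bound_lipschitz:
 fixes u :: "'a::euclidean_space => 'b::real_normed_vector"
 assumes "smooth_on UNIV u" "!!x b. b : Basis ==> norm (DD u x b) <= C"
 shows "norm (u y - u x) <= (real DIM('a) * C) * norm (y - x)"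
proof (rule differentiable_bound[OF convex_UNIV])
 show "(u has_derivative DD u x) (at x)" for x
  using smooth_has_deriv[OF assms(1) UNIV_I] .
 show "onorm (DD u x) <= real DIM('a) * C" for x
  by (rule onorm_le, rule norm_deriv_basis_bound[OF linear_DD[OF assms(1) UNIV_I] assms(2)])
qed auto

lemma ccs_deriv_bounded: assumes "ccs S u" shows "EX C>=0. ALL x v. norm (DD u x v) <= C * norm v"
proof -
 have "ALL b. EX C>=0. ALL x. norm (DD u x b) <= C" using ccs_bounded[OF ccs_deriv[OF assms]] by blast
 then obtain C where C: "!!b. C b >= 0" "!!b x. norm (DD u x b) <= C b" by metis
 have "norm (DD u x b) <= (SUM b:Basis. C b)" if "b : Basis" for x b
  using order_trans[OF C(2) member_le_sum[OF that, of C]] C(1) by simp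
 then have "norm (DD u x v) <= (real DIM('a) * (SUM b:Basis. C b)) * norm v" for x v
  by (intro norm_deriv_basis_bound linear_DD[OF ccs_smooth[OF assms] UNIV_I])
 then show ?thesis using C(1) by (intro exI[of _ "real DIM('a) * (SUM b:Basis. C b)"]) (auto intro!: mult_nonneg_nonneg sum_nonneg)
qed

text \<open>The error is uniform in \<open>x\<close>. Below this allows differentiation under an
  integral sign with an explicit quadratic remainder, in place of dominated convergence.\<close>

lemma ccs_taylor:
 fixes u :: "'a::euclidean_space => 'b::real_normed_vector"
 assumes "ccs S u"
 shows "EX C>=0. ALL x v. norm (u (x + v) - u x - DD u x v) <= C * (norm v)^2"
proof -
 have "ALL b. EX C>=0. ALL x v. norm (DD (%x. DD u x b) x v) <= C * norm v"
  using ccs_deriv_bounded[OF ccs_deriv[OF assms]] by blast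
 then obtain C where C: "!!b. C b >= 0" "!!b x v. norm (DD (%x. DD u x b) x v) <= C b * norm v" by metis
 have lip: "norm (DD u y b - DD u x b) <= C b * norm (y - x)" for x y b
 proof (rule differentiable_bound[OF convex_UNIV])
  show "((%x. DD u x b) has_derivative DD (%x. DD u x b) x) (at x)" for x
   using smooth_has_deriv[OF smooth_on_deriv[OF ccs_smooth[OF assms]] UNIV_I] .
  show "onorm (DD (%x. DD u x b) x) <= C b" for x
   by (rule onorm_le) (rule C(2))
 qed auto
 define D where "D = real DIM('a) * (SUM b:Basis. C b)"
 have D: "D >= 0" using C(1) by (auto simp: D_def intro!: mult_nonneg_nonneg sum_nonneg)
 have der: "(u has_derivative DD u x) (at x)" for x
  using smooth_has_deriv[OF ccs_smooth[OF assms] UNIV_I] .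
 have b: "norm (DD u y v - DD u x v) <= (D * norm (y - x)) * norm v" for x y v
 proof -
  have "norm (DD u y v - DD u x v) <= (real DIM('a) * ((SUM b:Basis. C b) * norm (y - x))) * norm v"
  proof (rule norm_deriv_basis_bound)
   show "linear (%v. DD u y v - DD u x v)"
    by (intro linear_compose_sub has_derivative_linear[OF der])
   fix b :: 'a assume "b : Basis"
   then have "C b <= (SUM b:Basis. C b)" using C(1) by (intro member_le_sum) auto
   then show "norm (DD u y b - DD u x b) <= (SUM b:Basis. C b) * norm (y - x)"
    using lip[of y b x] mult_right_mono[of "C b" "SUM b:Basis. C b" "norm (y - x)"] by auto
  qed
  then show ?thesis by (simp add: D_def mult.assoc)
 qed
 have "norm (u (x + v) - u x - DD u x v) <= D * (norm v)^2" for x v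
 proof -
  have lin: "linear (DD u x)" by (rule has_derivative_linear[OF der])
  have "norm ((u (x + v) - DD u x (x + v)) - (u x - DD u x x)) <= (D * norm v) * norm (x + v - x)"
  proof (rule differentiable_bound[where S="cball x (norm v)" and f'="%y w. DD u y w - DD u x w"])
   fix y assume "y : cball x (norm v)"
   then have y: "norm (y - x) <= norm v" by (simp add: dist_norm norm_minus_commute)
   show "((%a. u a - DD u x a) has_derivative (%w. DD u y w - DD u x w)) (at y within cball x (norm v))"
    by (intro has_derivative_diff has_derivative_at_withinI[OF der] linear_imp_has_derivative lin)
   show "onorm (%w. DD u y w - DD u x w) <= D * norm v"
   proof (rule onorm_le)
    fix w
    show "norm (DD u y w - DD u x w) <= D * norm v * norm w"
     using b[of y w x] mult_right_mono[OF mult_left_mono[OF y D], of "norm w"] by simp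
   qed
  qed (auto simp: dist_norm)
  then show ?thesis by (simp add: linear_add[OF lin] power2_eq_square algebra_simps)
 qed
 then show ?thesis using D by blast
qed

section \<open>Integrals of continuous functions with compact support\<close>

text \<open>The class in which all L^2 computations take place. Integrability is automatic, and the
  class is stable under translations and therefore under difference quotients.\<close>

definition cc0 :: "('a::euclidean_space => 'b::real_normed_vector) => bool" where
 "cc0 u \<longleftrightarrow> continuous_on UNIV u & (EX R. ALL x. norm x > R --> u x = 0)"

definition ip :: "('a::euclidean_space => 'b::euclidean_space) => ('a => 'b) => real" where
 "ip u v = (LINT x|lborel. u x \<bullet> v x)"

definition nrm :: "('a::euclidean_space => 'b::euclidean_space) => real" where
 "nrm u = sqrt (ip u u)"

lemma ccs_cc0: assumes "ccs S u" shows "cc0 u"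
proof -
 obtain K where K: "compact K" "ALL x. x ~: K --> u x = 0" using assms unfolding ccs_def by blast
 obtain R where "ALL x:K. norm x <= R" using compact_imp_bounded[OF K(1)] bounded_iff by blast
 then show ?thesis unfolding cc0_def using K smooth_on_continuous[OF ccs_smooth[OF assms]] by (metis not_less)
qed

lemma cc0_continuous: "cc0 u ==> continuous_on UNIV u" by (simp add: cc0_def)

lemma cc0_zero: "cc0 (%x. 0)" by (simp add: cc0_def)

lemma cc0_comp2:
 assumes "cc0 u" "cc0 v" "continuous_on UNIV (%p. F (fst p) (snd p))" "F 0 0 = 0"
 shows "cc0 (%x. F (u x) (v x))"
proof -
 obtain R R' where "ALL x. norm x > R --> u x = 0" "ALL x. norm x > R' --> v x = 0"
  using assms unfolding cc0_def by blast
 then have "ALL x. norm x > max R R' --> F (u x) (v x) = 0" using assms(4) by auto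
 moreover have "continuous_on UNIV (%x. F (fst (u x, v x)) (snd (u x, v x)))"
  by (rule continuous_on_compose2[OF assms(3)])
    (auto intro!: continuous_on_Pair cc0_continuous[OF assms(1)] cc0_continuous[OF assms(2)])
 ultimately show ?thesis unfolding cc0_def by (intro conjI exI[of _ "max R R'"]) simp_all
qed

lemma cc0_add: "cc0 u ==> cc0 v ==> cc0 (%x. u x + v x)"
 by (rule cc0_comp2) (auto intro!: continuous_intros)
lemma cc0_diff: "cc0 u ==> cc0 v ==> cc0 (%x. u x - v x)"
 by (rule cc0_comp2) (auto intro!: continuous_intros)
lemma cc0_inner: "cc0 u ==> cc0 v ==> cc0 (%x. u x \<bullet> v x)"
 by (rule cc0_comp2) (auto intro!: continuous_intros)
lemma cc0_norm: "cc0 u ==> cc0 (%x. norm (u x))"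
 by (rule cc0_comp2[of u u "%a b. norm a"]) (auto intro!: continuous_intros)
lemma cc0_scale: "cc0 u ==> cc0 (%x. c *R u x)"
 by (rule cc0_comp2[of u u "%a b. c *R a"]) (auto intro!: continuous_intros)
lemma cc0_minus: "cc0 u ==> cc0 (%x. - u x)"
 using cc0_scale[of u "-1"] by simp
lemma cc0_sum: "(!!i. i : I ==> cc0 (u i)) ==> cc0 (%x. SUM i:I. u i x)"
 by (induction I rule: infinite_finite_induct) (auto simp: cc0_zero cc0_add)
lemma cc0_bounded_linear: "bounded_linear L ==> cc0 u ==> cc0 (%x. L (u x))"
 by (rule cc0_comp2[of u u "%a b. L a"])
   (simp_all add: linear_0 bounded_linear.linear bounded_linear.continuous_on[OF _ continuous_on_fst[OF continuous_on_id]])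
lemma cc0_scaleR: "cc0 th ==> continuous_on UNIV f ==> cc0 (%x. th x *R f x)"
 unfolding cc0_def by (auto intro!: continuous_intros)
lemma cc0_mult: "cc0 th ==> continuous_on UNIV f ==> cc0 (%x. th x * (f x::real))"
 unfolding cc0_def by (auto intro!: continuous_intros)
lemma cc0_translate: assumes "cc0 u" shows "cc0 (%x. u (x + c))"
proof -
 obtain R where "ALL x. norm x > R --> u x = 0" using assms unfolding cc0_def by blast
 then have "ALL x. norm x > R + norm c --> u (x + c) = 0"
  using norm_diff_ineq[of _ c] by (smt (verit))
 moreover have "continuous_on UNIV (%x. u (x + c))"
  by (rule continuous_on_compose2[OF cc0_continuous[OF assms]]) (auto intro!: continuous_intros)
 ultimately show ?thesis unfolding cc0_def by blast
qed

lemma cc0_measurable: "cc0 u ==> u : borel_measurable borel"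
 by (intro borel_measurable_continuous_onI cc0_continuous)

lemma cc0_integrable:
 fixes u :: "'a::euclidean_space => 'b::{banach, second_countable_topology}"
 assumes "cc0 u" shows "integrable lborel u"
proof -
 obtain R where R: "ALL x. norm x > R --> u x = 0" using assms unfolding cc0_def by blast
 have "integrable lborel (%x. indicator (cball 0 R) x *R u x)"
  by (rule borel_integrable_compact)
    (auto intro: continuous_on_subset[OF cc0_continuous[OF assms]])
 moreover have "(%x. indicator (cball 0 R) x *R u x) = u"
  using R by (auto simp: indicator_def fun_eq_iff)
 ultimately show ?thesis by simp
qed

lemma ip_integrable: "cc0 u ==> cc0 v ==> integrable lborel (%x. u x \<bullet> v x)"
 by (intro cc0_integrable cc0_inner)

lemma ip_commute: "ip u v = ip v u" by (simp add: ip_def inner_commute)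
lemma ip_add_left: "cc0 u ==> cc0 v ==> cc0 w ==> ip (%x. u x + v x) w = ip u w + ip v w"
 by (simp add: ip_def inner_add_left ip_integrable)
lemma ip_scale_left: "ip (%x. c *R u x) w = c * ip u w"
 by (simp add: ip_def)
lemma ip_diff_left: "cc0 u ==> cc0 v ==> cc0 w ==> ip (%x. u x - v x) w = ip u w - ip v w"
 by (simp add: ip_def inner_diff_left ip_integrable)
lemma ip_ge_0: "ip u u >= 0" by (simp add: ip_def)
lemma nrm_sq: "(nrm u)^2 = ip u u" by (simp add: nrm_def ip_ge_0)
lemma nrm_ge_0: "nrm u >= 0" by (simp add: nrm_def ip_ge_0)

lemma nrm_diff_sq:
 assumes "cc0 u" "cc0 v"
 shows "ip (%x. u x - t *R v x) (%x. u x - t *R v x) = ip u u - 2 * t * ip u v + t^2 * ip v v"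
proof -
 have a: "ip (%x. u x - t *R v x) w = ip u w - t * ip v w" if "cc0 w" for w
  using ip_diff_left[OF assms(1) cc0_scale[OF assms(2)] that] by (simp add: ip_scale_left)
 have b: "ip w (%x. u x - t *R v x) = ip w u - t * ip w v" if "cc0 w" for w
  using a[OF that] by (simp add: ip_commute[of w])
 have c: "cc0 (%x. u x - t *R v x)" by (intro cc0_diff cc0_scale assms)
 show ?thesis
  unfolding a[OF c] b[OF assms(1)] b[OF assms(2)] by (simp add: power2_eq_square algebra_simps ip_commute[of v u])
qed

lemma ip_Cauchy_Schwarz:
 assumes "cc0 u" "cc0 v" shows "\<bar>ip u v\<bar> <= nrm u * nrm v"
proof -
 have q: "ip u u - 2 * t * ip u v + t^2 * ip v v >= 0" for t
  using ip_ge_0[of "%x. u x - t *R v x"] nrm_diff_sq[OF assms] by simp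
 have "(ip u v)^2 <= ip u u * ip v v"
 proof (cases "ip v v = 0")
  case True
  have "ip u v = 0"
  proof (rule ccontr)
   assume "ip u v ~= 0"
   \<comment> \<open>When \<open>ip v v\<close> vanishes, the quadratic is affine in
     \<open>t\<close>, and this \<open>t\<close> gives it the value -1.\<close>
   then show False using q[of "(ip u u + 1) / (2 * ip u v)"] True by simp
  qed
  then show ?thesis using True by simp
 next
  case False
  then have "ip v v > 0" using ip_ge_0[of v] by simp
  then show ?thesis using q[of "ip u v / ip v v"] by (simp add: field_simps power2_eq_square)
 qed
 also have "... = (nrm u * nrm v)^2" by (simp add: power_mult_distrib nrm_sq)
 finally show ?thesis
  by (intro power2_le_imp_le[of "\<bar>ip u v\<bar>"]) (simp_all add: nrm_ge_0)
qed

lemma nrm_add: assumes "cc0 u" "cc0 v" shows "nrm (%x. u x + v x) <= nrm u + nrm v"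
proof -
 have "(nrm (%x. u x + v x))^2 = ip u u + 2 * ip u v + ip v v"
  using nrm_diff_sq[OF assms, of "-1"] by (simp add: nrm_sq)
 also have "... <= (nrm u + nrm v)^2"
  using ip_Cauchy_Schwarz[OF assms] by (simp add: power2_sum nrm_sq)
 finally show ?thesis by (rule power2_le_imp_le) (simp add: nrm_ge_0)
qed

lemma nrm_scale: "nrm (%x. c *R u x) = \<bar>c\<bar> * nrm u"
 by (simp add: nrm_def ip_def real_sqrt_mult power2_eq_square[symmetric] mult.assoc[symmetric])

lemma nrm_minus: "nrm (%x. - u x) = nrm u"
 by (simp add: nrm_def ip_def)

lemma nrm_diff: "cc0 u ==> cc0 v ==> nrm (%x. u x - v x) <= nrm u + nrm v"
 using nrm_add[of u "%x. - v x"] cc0_minus[of v] by (simp add: nrm_minus)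

lemma nrm_zero: "nrm (%x. 0) = 0" by (simp add: nrm_def ip_def)

lemma nrm_sum: "(!!i. i : I ==> cc0 (u i)) ==> nrm (%x. SUM i:I. u i x) <= (SUM i:I. nrm (u i))"
proof (induction I rule: infinite_finite_induct)
 case (insert i I)
 have "nrm (%x. u i x + (SUM i:I. u i x)) <= nrm (u i) + nrm (%x. SUM i:I. u i x)"
  using insert by (intro nrm_add cc0_sum) auto
 then show ?case using insert by fastforce
qed (auto simp: nrm_zero)

lemma nrm_mono:
 assumes "cc0 u" "cc0 v" "!!x. norm (u x) <= C * norm (v x)" "C >= 0"
 shows "nrm u <= C * nrm v"
proof -
 have "ip u u <= (LINT x|lborel. C^2 * (v x \<bullet> v x))" unfolding ip_def
 proof (rule integral_mono)
  show "u x \<bullet> u x <= C^2 * (v x \<bullet> v x)" for x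
   using power_mono[OF assms(3)[of x] norm_ge_zero, of 2]
   by (simp add: power_mult_distrib power2_norm_eq_inner)
 qed (intro ip_integrable assms integrable_mult_right)+
 also have "... = (C * nrm v)^2" by (simp add: power_mult_distrib nrm_sq ip_def)
 finally show ?thesis unfolding nrm_sq[symmetric]
  by (rule power2_le_imp_le) (simp add: nrm_ge_0 assms(4))
qed

lemma nrm_mono1: "cc0 u ==> cc0 v ==> (!!x. norm (u x) <= norm (v x)) ==> nrm u <= nrm v"
 using nrm_mono[of u v 1] by simp

lemma nrm_le_sup:
 fixes u :: "'a::euclidean_space => 'b::euclidean_space"
 assumes "cc0 u" "!!x. norm (u x) <= C" "!!x. norm x > R ==> u x = 0"
 shows "nrm u <= C * sqrt (measure lborel (cball (0::'a) R))"
  (is "_ <= C * sqrt (measure lborel ?B)")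
proof -
 have C: "C >= 0" using order_trans[OF norm_ge_zero assms(2)] .
 have i: "integrable lborel (%x. C^2 * indicator ?B x)"
  using emeasure_lborel_cball_finite by (intro integrable_mult_right integrable_real_indicator) auto
 have "ip u u <= (LINT x|lborel. C^2 * indicator ?B x)" unfolding ip_def
 proof (rule integral_mono[OF ip_integrable[OF assms(1,1)] i])
  fix x show "u x \<bullet> u x <= C^2 * indicator ?B x"
   using power_mono[OF assms(2)[of x] norm_ge_zero, of 2] assms(3)[of x]
   by (auto simp: indicator_def power2_norm_eq_inner)
 qed
 also have "... = (C * sqrt (measure lborel ?B))^2" by (simp add: power_mult_distrib)
 finally show ?thesis unfolding nrm_sq[symmetric]
  by (rule power2_le_imp_le) (simp add: C)
qed

text \<open>By continuity the set where \<open>u\<close> is nonzero is open, and a nonempty open set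
  is not negligible.\<close>

lemma nrm_eq_0: assumes "cc0 u" "nrm u = 0" shows "u x = 0"
proof -
 have "(LINT x|lborel. u x \<bullet> u x) = 0" using assms(2) by (simp add: nrm_def ip_def)
 then have ae: "AE x in lborel. u x \<bullet> u x = 0"
  using integral_nonneg_eq_0_iff_AE[OF ip_integrable[OF assms(1,1)]] by simp
 have "{x. u x ~= 0} = {}"
 proof (rule ccontr)
  assume ne: "{x. u x ~= 0} ~= {}"
  have op: "open {x. u x ~= 0}"
   using open_Collect_neq[OF cc0_continuous[OF assms(1)] continuous_on_const] .
  have "{x. u x ~= 0} : null_sets lborel"
   using ae op by (intro AE_iff_null_sets[THEN iffD2]) auto
  then have "negligible {x. u x ~= 0}" using negligible_iff_null_sets null_sets_completionI by blast
  then show False using open_not_negligible[OF op ne] by blast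
 qed
 then show ?thesis by blast
qed

lemma integral_affine:
 fixes f :: "'a::euclidean_space => 'b::{banach, second_countable_topology}"
 assumes "c ~= 0" "f : borel_measurable borel"
 shows "(LINT x|lborel. f x) = \<bar>c\<bar> ^ DIM('a) *R (LINT x|lborel. f (t + c *R x))"
proof -
 have "(LINT x|lborel. f x) = (\<integral>x. f x \<partial>(density (distr lborel borel (%x. t + c *R x)) (%_. \<bar>c\<bar> ^ DIM('a))))"
  using lborel_affine[OF assms(1), of t] by simp
 also have "... = (\<integral>x. \<bar>c\<bar> ^ DIM('a) *R f x \<partial>(distr lborel borel (%x. t + c *R x)))"
  using assms(2) by (subst integral_density) auto
 also have "... = (LINT x|lborel. \<bar>c\<bar> ^ DIM('a) *R f (t + c *R x))"
  using assms(2) by (subst integral_distr) auto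
 finally show ?thesis by simp
qed

lemma integral_translate:
 fixes f :: "'a::euclidean_space => 'b::{banach, second_countable_topology}"
 shows "f : borel_measurable borel ==> (LINT x|lborel. f (x + t)) = (LINT x|lborel. f x)"
 using integral_affine[of 1 f t] by (simp add: add.commute)

lemma nrm_translate: assumes "cc0 u" shows "nrm (%x. u (x + t)) = nrm u"
 unfolding nrm_def ip_def
 using integral_translate[OF cc0_measurable[OF cc0_inner[OF assms assms]], of t] by simp

text \<open>Translation invariance makes the integral of \<open>u (x + t *R b) - u x\<close> zero.
  By Taylor's formula it equals \<open>t\<close> times the integral of the derivative up to an error
  of order \<open>t^2\<close>; divide by \<open>t\<close> and let it tend to 0.\<close>

lemma integral_deriv_eq_0:
 fixes u :: "'a::euclidean_space => 'b::euclidean_space"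
 assumes "ccs S u" shows "(LINT x|lborel. DD u x b) = 0"
proof -
 obtain C where C: "C >= 0" "!!x v. norm (u (x + v) - u x - DD u x v) <= C * (norm v)^2"
  using ccs_taylor[OF assms] by blast
 obtain K where K: "compact K" "ALL x. x ~: K --> u x = 0" using assms unfolding ccs_def by blast
 obtain R where R: "ALL x:K. norm x <= R" using compact_imp_bounded[OF K(1)] bounded_iff by blast
 have u0: "u x = 0" "DD u x w = 0" if "norm x > R" for x w
  using K R that dir_deriv_eq_0[of K u x w] compact_imp_closed[OF K(1)] by force+
 define V where "V = measure lborel (cball (0::'a) (R + norm b))"
 have V: "V >= 0" by (simp add: V_def)
 have lin: "linear (DD u x)" for x by (rule linear_DD[OF ccs_smooth[OF assms] UNIV_I])
 have iu: "integrable lborel u" by (intro cc0_integrable ccs_cc0[OF assms])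
 have it: "integrable lborel (%x. u (x + v))" for v by (intro cc0_integrable cc0_translate ccs_cc0[OF assms])
 have idd: "integrable lborel (%x. DD u x v)" for v
  by (intro cc0_integrable ccs_cc0[OF ccs_deriv[OF assms]])
 define I where "I = (LINT x|lborel. DD u x b)"
 have "norm I <= C * (norm b)^2 * V * t" if t: "0 < t" "t <= 1" for t
 proof -
  let ?r = "%x. u (x + t *R b) - u x - DD u x (t *R b)"
  have "(LINT x|lborel. ?r x) = - (t *R I)"
   using iu it idd integral_translate[OF cc0_measurable[OF ccs_cc0[OF assms]], of "t *R b"]
   by (simp add: linear_scale[OF lin] I_def)
  then have "t * norm I = norm (LINT x|lborel. ?r x)" using t by simp
  also have "... <= (LINT x|lborel. C * (t * norm b)^2 * indicator (cball (0::'a) (R + norm b)) x)"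
  proof (rule order_trans[OF integral_norm_bound integral_mono])
   have "integrable lborel ?r" using iu it idd by auto
   then show "integrable lborel (%x. norm (?r x))" by (rule integrable_norm)
   show "integrable lborel (%x. C * (t * norm b)^2 * indicator (cball (0::'a) (R + norm b)) x)"
    using emeasure_lborel_cball_finite by (intro integrable_mult_right integrable_real_indicator) auto
   fix x :: 'a
   show "norm (?r x) <= C * (t * norm b)^2 * indicator (cball (0::'a) (R + norm b)) x"
   proof (cases "norm x <= R + norm b")
    case True then show ?thesis using C(2)[of x "t *R b"] t by simp
   next
    case False
    have "norm (t *R b) <= norm b" using t by (simp add: mult_left_le_one_le)
    then have "norm (x + t *R b) > R" "norm x > R"
     using False norm_triangle_ineq2[of x "- (t *R b)"] norm_ge_zero[of b] by (simp_all del: norm_ge_zero)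
    then show ?thesis using False by (simp add: u0)
   qed
  qed
  also have "... = C * (t * norm b)^2 * V" by (simp add: V_def)
  finally have "t * norm I <= t * (C * (norm b)^2 * V * t)" by (simp add: power2_eq_square algebra_simps)
  then show ?thesis using t by simp
 qed
 then have "\<forall>\<^sub>F t in at_right 0. norm I <= C * (norm b)^2 * V * t"
  unfolding eventually_at_right_field by (intro exI[of _ 1]) auto
 moreover have "((%t. C * (norm b)^2 * V * t) \<longlongrightarrow> 0) (at_right 0)" by (auto intro!: tendsto_eq_intros)
 ultimately have "norm I <= 0"
  by (intro tendsto_lowerbound[where F="at_right (0::real)"]) auto
 then show ?thesis by (simp add: I_def)
qed

lemma ip_by_parts:
 assumes "ccs S u" "ccs T v"
 shows "ip (%x. DD u x b) v = - ip u (%x. DD v x b)"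
proof -
 have cc: "ccs S (%x. u x \<bullet> v x)"
 proof -
  obtain K where K: "compact K" "K <= S" "ALL x. x ~: K --> u x = 0" using assms(1) unfolding ccs_def by blast
  show ?thesis by (rule ccsI[OF K(1,2) _ open_UNIV subset_UNIV])
   (use K in "auto intro!: smooth_on_inner ccs_smooth[OF assms(1)] ccs_smooth[OF assms(2)]")
 qed
 have "DD (%x. u x \<bullet> v x) x b = u x \<bullet> DD v x b + DD u x b \<bullet> v x" for x
  by (rule dir_deriv_bilinear[OF bounded_bilinear_inner ccs_smooth[OF assms(1)] ccs_smooth[OF assms(2)] UNIV_I])
 then have "0 = (LINT x|lborel. u x \<bullet> DD v x b + DD u x b \<bullet> v x)"
  using integral_deriv_eq_0[OF cc, of b] by simp
 also have "... = ip u (%x. DD v x b) + ip (%x. DD u x b) v"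
  unfolding ip_def by (intro Bochner_Integration.integral_add ip_integrable ccs_cc0[OF assms(1)] ccs_cc0[OF assms(2)]
   ccs_cc0[OF ccs_deriv[OF assms(1)]] ccs_cc0[OF ccs_deriv[OF assms(2)]])
 finally show ?thesis by simp
qed

text \<open>A translation is a composition of many small ones, to each of which Taylor's formula applies.\<close>

lemma nrm_shift_le:
 fixes u :: "'a::euclidean_space => 'b::euclidean_space"
 assumes "ccs S u" shows "nrm (%x. u (x + v) - u x) <= nrm (%x. DD u x v)"
proof -
 obtain C where C: "C >= 0" "!!x v. norm (u (x + v) - u x - DD u x v) <= C * (norm v)^2"
  using ccs_taylor[OF assms] by blast
 obtain K where K: "compact K" "ALL x. x ~: K --> u x = 0" using assms unfolding ccs_def by blast
 obtain R where R: "ALL x:K. norm x <= R" using compact_imp_bounded[OF K(1)] bounded_iff by blast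
 have u0: "u x = 0" "DD u x w = 0" if "norm x > R" for x w
  using K R that dir_deriv_eq_0[of K u x w] compact_imp_closed[OF K(1)] by force+
 have cu: "cc0 u" "cc0 (%x. DD u x w)" for w using ccs_cc0[OF assms] ccs_cc0[OF ccs_deriv[OF assms]] by auto
 have lin: "linear (DD u x)" for x by (rule linear_DD[OF ccs_smooth[OF assms] UNIV_I])
 define V where "V = sqrt (measure lborel (cball (0::'a) (R + norm v)))"
 have tel: "nrm (%x. u (x + real n *R w) - u x) <= real n * nrm (%x. u (x + w) - u x)" for n w
 proof (induction n)
  case (Suc n)
  have e: "u (x + real (Suc n) *R w) - u x = (u ((x + real n *R w) + w) - u (x + real n *R w)) + (u (x + real n *R w) - u x)" for x
   by (simp add: algebra_simps)
  have "nrm (%x. u (x + real (Suc n) *R w) - u x)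
    <= nrm (%x. u ((x + real n *R w) + w) - u (x + real n *R w)) + nrm (%x. u (x + real n *R w) - u x)"
   unfolding e using cc0_translate[OF cc0_diff[OF cc0_translate[OF cu(1)] cu(1)], of w "real n *R w"]
   by (intro nrm_add cc0_diff cc0_translate cu)
  also have "nrm (%x. u ((x + real n *R w) + w) - u (x + real n *R w)) = nrm (%x. u (x + w) - u x)"
   by (rule nrm_translate[OF cc0_diff[OF cc0_translate[OF cu(1)] cu(1)]])
  finally show ?case using Suc by (simp add: algebra_simps)
 qed (simp add: nrm_zero)
 \<comment> \<open>Each of the \<open>N = n + 1\<close> steps has a Taylor error of order
   \<open>1 / N^2\<close>, so the total error is of order \<open>1 / N\<close>.\<close>
 have main: "nrm (%x. u (x + v) - u x) <= nrm (%x. DD u x v) + C * (norm v)^2 * V * inverse (real (Suc n))" for n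
 proof -
  define N where "N = real (Suc n)"
  have N: "N >= 1" by (simp add: N_def)
  define w where "w = (1 / N) *R v"
  have w: "v = N *R w" using N by (simp add: w_def)
  have nw: "norm w = norm v / N" "norm w <= norm v" using N mult_left_mono[of 1 N "norm v"] by (simp_all add: w_def divide_simps)
  let ?r = "%x. u (x + w) - u x - DD u x w"
  have r: "nrm ?r <= C * (norm w)^2 * V" unfolding V_def
  proof (rule nrm_le_sup)
   show "cc0 ?r" by (intro cc0_diff cc0_translate cu)
   show "norm (?r x) <= C * (norm w)^2" for x by (rule C(2))
   fix x :: 'a assume x: "norm x > R + norm v"
   then have "norm (x + w) > R" "norm x > R"
    using nw norm_triangle_ineq2[of x "- w"] norm_ge_zero[of v] by (simp_all del: norm_ge_zero)
   then show "?r x = 0" by (simp add: u0)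
  qed
  have "nrm (%x. u (x + w) - u x) = nrm (%x. ?r x + DD u x w)" by simp
  also have "... <= nrm ?r + nrm (%x. DD u x w)" by (intro nrm_add cc0_diff cc0_translate cu)
  also have "nrm (%x. DD u x w) = nrm (%x. DD u x v) / N"
   using N by (simp add: w_def linear_scale[OF lin] nrm_scale)
  finally have "nrm (%x. u (x + w) - u x) <= C * (norm v / N)^2 * V + nrm (%x. DD u x v) / N"
   using r nw by simp
  then have "N * nrm (%x. u (x + w) - u x) <= N * (C * (norm v / N)^2 * V + nrm (%x. DD u x v) / N)"
   using N by (intro mult_left_mono) auto
  also have "... = nrm (%x. DD u x v) + C * (norm v)^2 * V * inverse N"
   using N by (simp add: field_simps power2_eq_square)
  finally show ?thesis using tel[of "Suc n" w] w unfolding N_def by simp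
 qed
 have "(%n. nrm (%x. DD u x v) + C * (norm v)^2 * V * inverse (real (Suc n))) \<longlonglongrightarrow> nrm (%x. DD u x v) + C * (norm v)^2 * V * 0"
  by (intro tendsto_intros LIMSEQ_inverse_real_of_nat)
 then show ?thesis using main by (intro LIMSEQ_le_const) auto
qed

section \<open>Mollifiers\<close>

text \<open>Minkowski's inequality for a kernel. Writing the modulus of \<open>k\<close> as a
  product of two square roots, Cauchy-Schwarz in \<open>z\<close> gives one factor \<open>N\<close>
  and leaves the integral of the modulus of \<open>k z\<close> times the square of
  \<open>F x z\<close>. Fubini then moves the integral over \<open>x\<close> inside, where
  \<open>A\<close> bounds it.\<close>

lemma minkowski_kernel:
 fixes F :: "'a::euclidean_space => 'a => 'b::euclidean_space" and k :: "'a => real"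
 assumes k: "cc0 k" and F: "continuous_on UNIV (%p. F (fst p) (snd p))"
  and supp: "!!x z. k z ~= 0 ==> norm x > R ==> F x z = 0"
  and A: "!!z. k z ~= 0 ==> nrm (%x. F x z) <= A" "0 <= A"
  and G: "cc0 (%x. LINT z|lborel. k z *R F x z)"
 shows "nrm (%x. LINT z|lborel. k z *R F x z) <= (LINT z|lborel. \<bar>k z\<bar>) * A"
proof -
 define N where "N = (LINT z|lborel. \<bar>k z\<bar>)"
 have N0: "N >= 0" by (simp add: N_def)
 define H where "H x z = \<bar>k z\<bar> * (norm (F x z))^2" for x z
 obtain P where P: "ALL z. norm z > P --> k z = 0" using k unfolding cc0_def by blast
 have ck: "continuous_on UNIV k" by (rule cc0_continuous[OF k])
 have cF1: "continuous_on UNIV (%z. F x z)" for x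
  using continuous_on_compose2[OF F continuous_on_Pair[OF continuous_on_const[of UNIV x] continuous_on_id]] by simp
 have cF2: "continuous_on UNIV (%x. F x z)" for z
  using continuous_on_compose2[OF F continuous_on_Pair[OF continuous_on_id continuous_on_const[of UNIV z]]] by simp
 have kz: "cc0 (%z. \<bar>k z\<bar>)" using cc0_norm[OF k] by simp
 have ccF: "cc0 (%x. F x z)" if "k z ~= 0" for z
  unfolding cc0_def using cF2 supp[OF that] by blast
 have Hp: "cc0 (%p::'a \<times> 'a. H (fst p) (snd p))"
 proof -
  have "continuous_on UNIV (%p::'a \<times> 'a. H (fst p) (snd p))" unfolding H_def
   by (intro continuous_intros F continuous_on_compose2[OF ck]) auto
  moreover have "H (fst p) (snd p) = 0" if "norm p > R + P" for p :: "'a \<times> 'a"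
  proof -
   have "norm (fst p) > R | norm (snd p) > P"
    using that norm_Pair_le[of "fst p" "snd p"] by (cases p) auto
   then show ?thesis unfolding H_def using supp[of "snd p" "fst p"] P by (cases "k (snd p) = 0") auto
  qed
  ultimately show ?thesis unfolding cc0_def by blast
 qed
 have intH: "integrable (lborel \<Otimes>\<^sub>M lborel) (case_prod H)"
  using cc0_integrable[OF Hp] by (simp add: lborel_prod case_prod_beta')
 have pt: "(LINT z|lborel. k z *R F x z) \<bullet> (LINT z|lborel. k z *R F x z) <= N * (LINT z|lborel. H x z)" for x
 proof -
  define a where "a z = sqrt \<bar>k z\<bar>" for z
  define b where "b z = a z * norm (F x z)" for z
  have a: "cc0 a" unfolding cc0_def a_def using P by (intro conjI continuous_intros ck exI[of _ P]) auto
  have b: "cc0 b" unfolding b_def by (intro cc0_mult[OF a] continuous_intros cF1)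
  have "norm (LINT z|lborel. k z *R F x z) <= (LINT z|lborel. norm (k z *R F x z))" by (rule integral_norm_bound)
  also have "norm (k z *R F x z) = a z \<bullet> b z" for z
   by (simp only: norm_scaleR inner_real_def b_def a_def mult.assoc[symmetric] real_sqrt_mult_self abs_abs)
  then have "(LINT z|lborel. norm (k z *R F x z)) = ip a b" by (simp only: ip_def)
  also have "... <= nrm a * nrm b" using ip_Cauchy_Schwarz[OF a b] by simp
  finally have "(norm (LINT z|lborel. k z *R F x z))^2 <= (nrm a * nrm b)^2" by (intro power_mono) auto
  also have "(nrm a)^2 = N" unfolding nrm_sq by (simp add: ip_def a_def N_def)
  then have "(nrm a * nrm b)^2 = N * (nrm b)^2" by (simp add: power_mult_distrib)
  also have "(nrm b)^2 = (LINT z|lborel. H x z)"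
   unfolding nrm_sq ip_def
   by (simp only: inner_real_def power2_eq_square[symmetric] b_def a_def H_def power_mult_distrib real_sqrt_pow2 abs_ge_zero)
  finally show ?thesis by (simp add: power2_norm_eq_inner)
 qed
 have "(nrm (%x. LINT z|lborel. k z *R F x z))^2 <= (LINT x|lborel. N * (LINT z|lborel. H x z))"
  unfolding nrm_sq ip_def
  by (intro integral_mono ip_integrable G pt integrable_mult_right lborel_pair.integrable_fst[OF intH])
 also have "... = N * (LINT z|lborel. (LINT x|lborel. H x z))"
  using lborel_pair.Fubini_integral[OF intH] by simp
 also have "... <= N * (LINT z|lborel. \<bar>k z\<bar> * A^2)"
 proof (intro mult_left_mono N0 integral_mono)
  show "integrable lborel (%z. LINT x|lborel. H x z)" by (rule lborel_pair.integrable_snd[OF intH])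
  show "integrable lborel (%z. \<bar>k z\<bar> * A^2)" by (intro integrable_mult_left cc0_integrable kz)
  fix z
  show "(LINT x|lborel. H x z) <= \<bar>k z\<bar> * A^2"
  proof (cases "k z = 0")
   case False
   have "(LINT x|lborel. H x z) = \<bar>k z\<bar> * (nrm (%x. F x z))^2"
    unfolding nrm_sq ip_def H_def by (simp add: power2_norm_eq_inner)
   also have "... <= \<bar>k z\<bar> * A^2" using A(1)[OF False] nrm_ge_0 by (intro mult_left_mono power_mono) auto
   finally show ?thesis .
  qed (simp add: H_def)
 qed
 also have "... = (N * A)^2" by (simp add: N_def power2_eq_square)
 finally show ?thesis unfolding N_def[symmetric] by (rule power2_le_imp_le) (simp add: N0 A(2))
qed

text \<open>The scale sits in the argument of \<open>u\<close>, not in the kernel. So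
  \<open>s = 0\<close> is allowed and returns \<open>u\<close> when \<open>k\<close> has integral 1,
  and one can differentiate with respect to the scale.\<close>

definition mollify :: "('a::euclidean_space => real) => real => ('a => 'b::euclidean_space) => 'a => 'b" where
 "mollify k s u x = (LINT z|lborel. k z *R u (x - s *R z))"

lemma has_derivative_quadratic:
 fixes f :: "'a::euclidean_space => 'b::real_normed_vector"
 assumes "linear D" "!!v. norm (f (x + v) - f x - D v) <= C * (norm v)^2"
 shows "(f has_derivative D) (at x)"
proof -
 have "((%h. norm (f (x + h) - f x - D h) / norm h) \<longlongrightarrow> 0) (at 0)"
 proof (rule tendsto_sandwich[where f="%_. 0" and h="%h. C * norm h"])
  have "norm (f (x + h) - f x - D h) / norm h <= C * norm h" for h
   using assms(2)[of h] by (cases "h = 0") (auto simp: divide_simps power2_eq_square mult.assoc)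
  then show "\<forall>\<^sub>F h in at 0. norm (f (x + h) - f x - D h) / norm h <= C * norm h" by simp
  show "((%h. C * norm h) \<longlongrightarrow> 0) (at 0)" by (auto intro!: tendsto_eq_intros)
 qed auto
 then show ?thesis unfolding has_derivative_at using assms(1) linear_conv_bounded_linear by blast
qed

lemma mollify_integrable:
 fixes u :: "'a::euclidean_space => 'b::euclidean_space"
 assumes "cc0 k" "continuous_on UNIV u"
 shows "integrable lborel (%z. k z *R u (x - s *R z))"
 by (intro cc0_integrable cc0_scaleR assms continuous_on_compose2[OF assms(2)]) (auto intro!: continuous_intros)

lemma mollify_has_derivative:
 assumes k: "cc0 k" and u: "ccs S u"
 shows "(mollify k s u has_derivative (%v. mollify k s (%y. DD u y v) x)) (at x)"
proof -
 obtain C where C: "C >= 0" "!!x v. norm (u (x + v) - u x - DD u x v) <= C * (norm v)^2"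
  using ccs_taylor[OF u] by blast
 have lin: "linear (DD u x)" for x by (rule linear_DD[OF ccs_smooth[OF u] UNIV_I])
 have cu: "continuous_on UNIV u" "continuous_on UNIV (%y. DD u y v)" for v
  using smooth_on_continuous[OF ccs_smooth[OF u]] smooth_on_continuous[OF ccs_smooth[OF ccs_deriv[OF u]]] by auto
 note i = mollify_integrable[OF k cu(1)] mollify_integrable[OF k cu(2)]
 show ?thesis
 proof (rule has_derivative_quadratic)
  show "linear (%v. mollify k s (%y. DD u y v) x)"
  proof (rule linearI)
   fix v w show "mollify k s (%y. DD u y (v + w)) x = mollify k s (%y. DD u y v) x + mollify k s (%y. DD u y w) x"
    unfolding mollify_def linear_add[OF lin] scaleR_add_right by (intro Bochner_Integration.integral_add i)
   fix c :: real show "mollify k s (%y. DD u y (c *R v)) x = c *R mollify k s (%y. DD u y v) x"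
    unfolding mollify_def linear_scale[OF lin] scaleR_left_commute[of _ c] by (rule integral_scaleR_right)
  qed
  fix v
  have e: "mollify k s u (x + v) - mollify k s u x - mollify k s (%y. DD u y v) x
    = (LINT z|lborel. k z *R (u ((x - s *R z) + v) - u (x - s *R z) - DD u (x - s *R z) v))"
   unfolding mollify_def using i[of x s] i(1)[of "x+v" s]
   by (simp add: scaleR_diff_right algebra_simps)
  also have "norm ... <= (LINT z|lborel. \<bar>k z\<bar> * (C * (norm v)^2))"
  proof (rule order_trans[OF integral_norm_bound integral_mono])
   have "integrable lborel (%z. k z *R (u ((x - s *R z) + v) - u (x - s *R z) - DD u (x - s *R z) v))"
    using i[of x s] i(1)[of "x+v" s] by (simp add: scaleR_diff_right algebra_simps)
   then show "integrable lborel (%z. norm (k z *R (u ((x - s *R z) + v) - u (x - s *R z) - DD u (x - s *R z) v)))"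
    by (rule integrable_norm)
   show "integrable lborel (%z. \<bar>k z\<bar> * (C * (norm v)^2))"
    using cc0_norm[OF k] by (intro integrable_mult_left cc0_integrable) simp
   fix z show "norm (k z *R (u ((x - s *R z) + v) - u (x - s *R z) - DD u (x - s *R z) v)) <= \<bar>k z\<bar> * (C * (norm v)^2)"
    using C(2) by (simp add: mult_left_mono)
  qed
  finally show "norm (mollify k s u (x + v) - mollify k s u x - mollify k s (%y. DD u y v) x) <= ((LINT z|lborel. \<bar>k z\<bar>) * C) * (norm v)^2"
   by (simp add: mult.assoc)
 qed
qed

lemma mollify_deriv:
 "cc0 k ==> ccs S u ==> DD (mollify k s u) x v = mollify k s (%y. DD u y v) x"
 by (rule dir_deriv_eq[OF mollify_has_derivative])

lemma mollify_C_on: "cc0 k ==> ccs S u ==> C_on n UNIV (mollify k s u)"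
proof (induction n arbitrary: u)
 case 0
 have "continuous_on UNIV (mollify k s u)"
  using mollify_has_derivative[OF 0, THEN has_derivative_continuous] by (simp add: continuous_at_imp_continuous_on)
 then show ?case by simp
next
 case (Suc n)
 show ?case
  by (rule C_on_SucI[OF open_UNIV mollify_has_derivative[OF Suc.prems]]) (rule Suc.IH[OF Suc.prems(1) ccs_deriv[OF Suc.prems(2)]])
qed

lemma mollify_support:
 assumes "!!z. norm z > P ==> k z = 0" "!!x. norm x > R ==> u x = 0" "norm x > R + \<bar>s\<bar> * P"
 shows "mollify k s u x = 0"
proof -
 have "k z *R u (x - s *R z) = 0" for z
 proof (cases "norm z > P")
  case False
  then have "norm (s *R z) <= \<bar>s\<bar> * P" by (simp add: mult_left_mono)
  then have "norm (x - s *R z) > R" using assms(3) norm_triangle_ineq2[of x "s *R z"] by linarith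
  then show ?thesis using assms(2) by simp
 qed (simp add: assms(1))
 then show ?thesis unfolding mollify_def by (simp only: integral_zero)
qed

lemma mollify_ccs: assumes k: "cc0 k" and u: "ccs S u" shows "ccs UNIV (mollify k s u)"
proof -
 obtain P where P: "ALL z. norm z > P --> k z = 0" using k unfolding cc0_def by blast
 obtain R where R: "ALL z. norm z > R --> u z = 0" using ccs_cc0[OF u] unfolding cc0_def by blast
 have "mollify k s u x = 0" if "x ~: cball 0 (R + \<bar>s\<bar> * P)" for x
  by (rule mollify_support[where P=P and R=R]) (use P R that in auto)
 then show ?thesis unfolding ccs_def smooth_on_def using mollify_C_on[OF assms] by (intro conjI exI[of _ "cball 0 (R + \<bar>s\<bar> * P)"]) auto
qed

lemma mollify_diff: "cc0 k ==> continuous_on UNIV u ==> continuous_on UNIV v ==>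
  mollify k s (%x. u x - v x) x = mollify k s u x - mollify k s v x"
 by (simp add: mollify_def scaleR_diff_right mollify_integrable)
lemma mollify_scale: "mollify k s (%x. c *R u x) x = c *R mollify k s u x"
 unfolding mollify_def scaleR_left_commute[of _ c] by (rule integral_scaleR_right)

text \<open>The derivative of \<open>k z *R u (x - s *R z)\<close> in \<open>z\<close> has integral
  zero. A derivative of \<open>u\<close> is thereby traded for one of the kernel, at the price of a
  factor \<open>inverse s\<close>.\<close>

lemma mollify_by_parts:
 assumes k: "ccs S k" and u: "ccs T u"
 shows "s *R mollify k s (%y. DD u y b) x = mollify (%z. DD k z b) s u x"
proof -
 define g where "g z = x - s *R z" for z
 have g: "smooth_on UNIV g" unfolding g_def by (intro smooth_on_diff smooth_on_scale smooth_on_ident smooth_on_const open_UNIV)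
 have dg: "DD g z b = - (s *R b)" for z
  unfolding g_def by (rule dir_deriv_eq) (auto intro!: derivative_eq_intros)
 have lin: "linear (DD u x)" for x by (rule linear_DD[OF ccs_smooth[OF u] UNIV_I])
 have ug: "smooth_on UNIV (%z. u (g z))"
  by (rule smooth_on_compose[OF open_UNIV open_UNIV subset_UNIV ccs_smooth[OF u] g])
 have cc: "ccs S (%z. k z *R u (g z))"
  by (rule ccs_scaleR_smooth[OF k open_UNIV subset_UNIV ug])
 have dug: "DD (%z. u (g z)) z b = - (s *R DD u (g z) b)" for z
  using dir_deriv_compose[OF ccs_smooth[OF u] g UNIV_I UNIV_I, of z b] by (simp add: dg linear_neg[OF lin] linear_scale[OF lin])
 have "DD (%z. k z *R u (g z)) z b = DD k z b *R u (g z) - s *R (k z *R DD u (g z) b)" for z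
  using dir_deriv_bilinear[OF bounded_bilinear_scaleR ccs_smooth[OF k] ug UNIV_I, of z b] by (simp add: dug scaleR_left_commute)
 then have "0 = (LINT z|lborel. DD k z b *R u (g z) - s *R (k z *R DD u (g z) b))"
  using integral_deriv_eq_0[OF cc, of b] by simp
 also have "... = mollify (%z. DD k z b) s u x - s *R mollify k s (%y. DD u y b) x"
  unfolding mollify_def g_def
  using mollify_integrable[OF ccs_cc0[OF ccs_deriv[OF k]] smooth_on_continuous[OF ccs_smooth[OF u]]]
   mollify_integrable[OF ccs_cc0[OF k] smooth_on_continuous[OF ccs_smooth[OF ccs_deriv[OF u]]]]
  by (subst Bochner_Integration.integral_diff) (simp_all del: scaleR_scaleR)
 finally show ?thesis by simp
qed

lemma mollify_nrm_le:
 fixes u :: "'a::euclidean_space => 'b::euclidean_space"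
 assumes k: "cc0 k" and u: "ccs S u"
 shows "nrm (mollify k s u) <= (LINT z|lborel. \<bar>k z\<bar>) * nrm u"
proof -
 obtain P where P: "ALL z. norm z > P --> k z = 0" using k unfolding cc0_def by blast
 obtain R where R: "ALL z. norm z > R --> u z = 0" using ccs_cc0[OF u] unfolding cc0_def by blast
 have c: "cc0 (%x. LINT z|lborel. k z *R u (x - s *R z))"
  using ccs_cc0[OF mollify_ccs[OF assms]] unfolding mollify_def .
 have "nrm (%x. LINT z|lborel. k z *R u (x - s *R z)) <= (LINT z|lborel. \<bar>k z\<bar>) * nrm u"
 proof (rule minkowski_kernel[OF k _ _ _ nrm_ge_0 c, where R="R + \<bar>s\<bar> * P"])
  show "continuous_on UNIV (%p. u (fst p - s *R snd p))"
   by (rule continuous_on_compose2[OF cc0_continuous[OF ccs_cc0[OF u]]]) (auto intro!: continuous_intros)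
  fix x z :: 'a
  assume z: "k z ~= 0"
  show "nrm (%x. u (x - s *R z)) <= nrm u"
   using nrm_translate[OF ccs_cc0[OF u], of "- (s *R z)"] by simp
  assume x: "R + \<bar>s\<bar> * P < norm x"
  have "norm z <= P" using z P not_less by blast
  then have "norm (s *R z) <= \<bar>s\<bar> * P" by (simp add: mult_left_mono)
  then have "norm (x - s *R z) > R" using x norm_triangle_ineq2[of x "s *R z"] by linarith
  then show "u (x - s *R z) = 0" using R by blast
 qed
 then show ?thesis unfolding mollify_def .
qed

text \<open>Cauchy-Schwarz in \<open>z\<close>, where the substitution \<open>y = x - s *R z\<close>
  produces \<open>s ^ DIM('a)\<close>. The L^2 norm thus gives a pointwise bound, with a constant
  that blows up as \<open>s\<close> tends to 0.\<close>

lemma mollify_sup_le: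
 fixes u :: "'a::euclidean_space => 'b::euclidean_space"
 assumes k: "cc0 k" and u: "ccs S u" and s: "s > 0"
 shows "norm (mollify k s u x) <= nrm k * nrm u / sqrt (s ^ DIM('a))"
proof -
 obtain R where R: "ALL z. norm z > R --> u z = 0" using ccs_cc0[OF u] unfolding cc0_def by blast
 define v where "v z = norm (u (x - s *R z))" for z
 have "v z = 0" if "norm z > (R + norm x) / s" for z
 proof -
  have "norm (s *R z) > R + norm x" using that s by (simp add: field_simps)
  then have "norm (x - s *R z) > R" using norm_triangle_ineq2[of "s *R z" x] by (simp add: norm_minus_commute)
  then show ?thesis using R by (simp add: v_def)
 qed
 moreover have "continuous_on UNIV v" unfolding v_def
  by (intro continuous_on_norm continuous_on_compose2[OF cc0_continuous[OF ccs_cc0[OF u]]]) (auto intro!: continuous_intros)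
 ultimately have v: "cc0 v" unfolding cc0_def by blast
 have m: "(%y. u y \<bullet> u y) : borel_measurable borel" by (intro cc0_measurable cc0_inner ccs_cc0[OF u])
 have "ip u u = s ^ DIM('a) * ip v v"
  unfolding ip_def using integral_affine[OF _ m, of "-s" x] s by (simp add: v_def power2_norm_eq_inner[symmetric] power2_eq_square)
 then have nv: "nrm v = nrm u / sqrt (s ^ DIM('a))"
  using s by (simp add: nrm_def real_sqrt_mult)
 have "norm (mollify k s u x) <= (LINT z|lborel. norm (k z *R u (x - s *R z)))"
  unfolding mollify_def by (rule integral_norm_bound)
 also have "... = ip (%z. \<bar>k z\<bar>) v" by (simp add: ip_def v_def)
 also have "... <= nrm (%z. \<bar>k z\<bar>) * nrm v"
  using ip_Cauchy_Schwarz[of "%z. \<bar>k z\<bar>" v] cc0_norm[OF k] v by simp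
 also have "nrm (%z. \<bar>k z\<bar>) = nrm k" by (simp add: nrm_def ip_def)
 finally show ?thesis by (simp add: nv)
qed

definition gnrm :: "('a::euclidean_space => 'b::euclidean_space) => real" where
 "gnrm u = (SUM b:Basis. nrm (%x. DD u x b))"

lemma gnrm_ge_0: "gnrm u >= 0" by (simp add: gnrm_def sum_nonneg nrm_ge_0)

lemma nrm_dir_deriv_le:
 assumes "ccs S u" shows "nrm (%x. DD u x v) <= norm v * gnrm u"
proof -
 have cc: "cc0 (%x. DD u x w)" for w by (rule ccs_cc0[OF ccs_deriv[OF assms]])
 have "(%x. DD u x v) = (%x. SUM b:Basis. (v \<bullet> b) *R DD u x b)"
  using basis_expand[OF linear_DD[OF ccs_smooth[OF assms] UNIV_I]] by blast
 then have "nrm (%x. DD u x v) <= (SUM b:Basis. nrm (%x. (v \<bullet> b) *R DD u x b))"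
  using nrm_sum[of Basis "%b x. (v \<bullet> b) *R DD u x b"] cc0_scale[OF cc] by simp
 also have "... <= (SUM b:Basis. norm v * nrm (%x. DD u x b))"
  unfolding nrm_scale by (intro sum_mono mult_right_mono Basis_le_norm nrm_ge_0)
 finally show ?thesis by (simp add: gnrm_def sum_distrib_left)
qed

text \<open>As \<open>k\<close> has integral 1, the difference is an average of
  \<open>u (x - s *R z) - u x\<close>, and \<open>nrm_shift_le\<close> bounds each of these by the
  gradient. The error is linear in the scale and depends on first derivatives only.\<close>

lemma mollify_close:
 fixes u :: "'a::euclidean_space => 'b::euclidean_space"
 assumes k: "cc0 k" and u: "ccs S u" and one: "(LINT z|lborel. k z) = 1"
  and P: "!!z. norm z > P ==> k z = 0" "P >= 0"
 shows "nrm (%x. mollify k s u x - u x) <= (LINT z|lborel. \<bar>k z\<bar>) * (\<bar>s\<bar> * P * gnrm u)"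
proof -
 obtain R where R: "ALL z. norm z > R --> u z = 0" using ccs_cc0[OF u] unfolding cc0_def by blast
 have e: "mollify k s u x - u x = (LINT z|lborel. k z *R (u (x - s *R z) - u x))" for x
 proof -
  have "(LINT z|lborel. k z *R u x) = u x"
   using cc0_integrable[OF k] one by simp
  moreover have "integrable lborel (%z. k z *R u x)" using cc0_integrable[OF k] by simp
  ultimately show ?thesis unfolding mollify_def
   using mollify_integrable[OF k cc0_continuous[OF ccs_cc0[OF u]], of x s] by (simp add: scaleR_diff_right)
 qed
 have c: "cc0 (%x. LINT z|lborel. k z *R (u (x - s *R z) - u x))"
  using cc0_diff[OF ccs_cc0[OF mollify_ccs[OF k u]] ccs_cc0[OF u], of s] unfolding e .
 show ?thesis unfolding e
 proof (rule minkowski_kernel[OF k _ _ _ _ c, where R="R + \<bar>s\<bar> * P"])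
  show "continuous_on UNIV (%p. u (fst p - s *R snd p) - u (fst p))"
   by (intro continuous_on_diff continuous_on_compose2[OF cc0_continuous[OF ccs_cc0[OF u]]]) (auto intro!: continuous_intros)
  show "0 <= \<bar>s\<bar> * P * gnrm u" using P(2) gnrm_ge_0 by (intro mult_nonneg_nonneg) auto
  fix x z :: 'a
  assume z: "k z ~= 0"
  then have nz: "norm z <= P" using P(1) not_less by blast
  then have sz: "norm (s *R z) <= \<bar>s\<bar> * P" by (simp add: mult_left_mono)
  have "nrm (%x. u (x + - (s *R z)) - u x) <= norm (- (s *R z)) * gnrm u"
   by (rule order_trans[OF nrm_shift_le[OF u] nrm_dir_deriv_le[OF u]])
  also have "... <= \<bar>s\<bar> * P * gnrm u" using sz gnrm_ge_0 by (intro mult_right_mono) auto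
  finally show "nrm (%x. u (x - s *R z) - u x) <= \<bar>s\<bar> * P * gnrm u" by simp
  assume x: "R + \<bar>s\<bar> * P < norm x"
  have "norm (x - s *R z) > R" using x sz norm_triangle_ineq2[of x "s *R z"] by linarith
  moreover have "norm x > R" using x P(2) by (smt (verit) abs_ge_zero mult_nonneg_nonneg)
  ultimately show "u (x - s *R z) - u x = 0" using R by simp
 qed
qed

text \<open>The kernel is the derivative of a radial bump, so that its first moments are exact.\<close>

lemma ex_kernel:
 "EX k K :: 'a::euclidean_space => real. ccs (cball 0 1) k & ccs (cball 0 1) K & (LINT z|lborel. k z) = 1 &
   (ALL z b. (z \<bullet> b) * k z = DD K z b)"
proof -
 define q where "q z = 1 - z \<bullet> z" for z :: 'a
 define si where "si t = DD smooth_step t 1" for t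
 define k0 where "k0 z = si (q z)" for z
 define K0 where "K0 z = smooth_step (q z)" for z
 have q: "smooth_on UNIV q" unfolding q_def
  by (intro smooth_on_diff smooth_on_inner smooth_on_const smooth_on_ident open_UNIV)
 have sk: "smooth_on UNIV k0" unfolding k0_def si_def
  by (rule smooth_on_compose[OF open_UNIV open_UNIV subset_UNIV smooth_on_deriv[OF smooth_on_smooth_step] q])
 have sK: "smooth_on UNIV K0" unfolding K0_def
  by (rule smooth_on_compose[OF open_UNIV open_UNIV subset_UNIV smooth_on_smooth_step q])
 have out: "q z < 0" if "z ~: cball 0 1" for z
 proof -
  have "norm z > 1" using that by simp
  then have "(norm z)^2 > 1" by (simp add: one_less_power)
  then show ?thesis by (simp add: q_def power2_norm_eq_inner)
 qed
 have si0: "si t = 0" if "t < 0" for t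
 proof -
  have "frechet_derivative smooth_step (at t) = frechet_derivative (%_. 0) (at t)"
   by (rule deriv_cong_open[of "{..<0}"]) (use that in "auto simp: smooth_step_0")
  then show ?thesis by (simp add: si_def)
 qed
 have ck: "ccs (cball 0 1) k0" unfolding ccs_compact_iff[OF compact_cball] using sk out si0 by (auto simp: k0_def)
 have cK: "ccs (cball 0 1) K0" unfolding ccs_compact_iff[OF compact_cball] 
  using sK smooth_step_0[OF less_imp_le[OF out]] by (simp add: K0_def)
 have der: "(smooth_step has_real_derivative si t) (at t)" for t
 proof -
  have h: "(smooth_step has_derivative DD smooth_step t) (at t)"
   by (rule smooth_has_deriv[OF smooth_on_smooth_step UNIV_I])
  have "DD smooth_step t h = si t * h" for h
   using linear_scale[OF has_derivative_linear[OF h], of h 1] by (simp add: si_def mult.commute)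
  then have "DD smooth_step t = (*) (si t)" by (rule ext)
  then show ?thesis using h unfolding has_field_derivative_def by simp
 qed
 \<comment> \<open>The factor -2 comes from the gradient of \<open>q\<close> and is undone by the
   factor in front of \<open>K0\<close> at the end.\<close>
 have dK: "DD K0 z b = - 2 * (z \<bullet> b) * k0 z" for z b
 proof -
  have "(q has_derivative (%b. - 2 * (z \<bullet> b))) (at z)"
   unfolding q_def by (auto intro!: derivative_eq_intros simp: inner_commute)
  from has_derivative_compose[OF this, of smooth_step "%h. si (q z) * h"] der[of "q z"]
  have "(K0 has_derivative (%b. si (q z) * (- 2 * (z \<bullet> b)))) (at z)"
   unfolding has_field_derivative_def K0_def by simp
  then show ?thesis by (simp add: dir_deriv_eq k0_def)
 qed
 have sinn: "si t >= 0" for t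
 proof (rule tendsto_lowerbound)
  show "((%y. (smooth_step y - smooth_step t) / (y - t)) \<longlongrightarrow> si t) (at t)"
   using der[of t] by (simp add: has_field_derivative_iff)
  have "0 <= (smooth_step y - smooth_step t) / (y - t)" for y
   using smooth_step_mono[of y t] smooth_step_mono[of t y]
   by (cases "y <= t") (auto intro: divide_nonneg_nonneg divide_nonpos_nonpos)
  then show "\<forall>\<^sub>F y in at t. 0 <= (smooth_step y - smooth_step t) / (y - t)" by simp
 qed simp
 \<comment> \<open>A point where the profile equals 1 shows that \<open>k0\<close> is not
   identically zero, so that its integral \<open>c\<close> can be divided by.\<close>
 obtain t where t: "0 < t" "t < 1" "si t = 1"
 proof -
  have "EX t. 0 < t & t < 1 & smooth_step 1 - smooth_step 0 = (1 - 0) * si t"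
   by (rule MVT2) (use der in auto)
  then show ?thesis using that by (auto simp: smooth_step_0 smooth_step_1)
 qed
 obtain e :: 'a where e: "e : Basis" using nonempty_Basis by blast
 have k0e: "k0 (sqrt (1 - t) *R e) = 1" using t e by (simp add: k0_def q_def)
 define c where "c = (LINT z|lborel. k0 z)"
 have c: "c ~= 0"
 proof
  assume "c = 0"
  define s where "s z = sqrt (k0 z)" for z
  have "continuous_on UNIV s" unfolding s_def by (intro continuous_intros smooth_on_continuous sk)
  moreover have "ALL z. norm z > 1 --> s z = 0" using out si0 by (auto simp: s_def k0_def)
  ultimately have "cc0 s" unfolding cc0_def by blast
  moreover have "nrm s = 0" using \<open>c = 0\<close> sinn by (simp add: nrm_def ip_def s_def c_def k0_def)
  ultimately have "s (sqrt (1 - t) *R e) = 0" by (rule nrm_eq_0)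
  then show False using k0e by (simp add: s_def)
 qed
 show ?thesis
 proof (intro exI conjI allI)
  show "ccs (cball 0 1) (%z. inverse c *R k0 z)" by (rule ccs_scale[OF ck])
  show "ccs (cball 0 1) (%z. (- inverse (2 * c)) *R K0 z)" by (rule ccs_scale[OF cK])
  show "(LINT z|lborel. inverse c *R k0 z) = 1" using c by (simp add: c_def)
  fix z b :: 'a
  show "(z \<bullet> b) * (inverse c *R k0 z) = DD (%z. (- inverse (2 * c)) *R K0 z) z b"
   using dir_deriv_linear[OF bounded_linear_scaleR_right ccs_smooth[OF cK] UNIV_I, of "- inverse (2 * c)" z b] c
   by (simp add: dK field_simps)
 qed
qed

section \<open>A Sobolev inequality\<close>

text \<open>Differentiating in \<open>s\<close> produces the first moments of \<open>k\<close>. By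
  \<open>m\<close> these are derivatives of \<open>K\<close>, and an integration by parts turns them
  into \<open>s\<close> times a mollified Laplacian. The factor \<open>s\<close> gained here is what
  carries the Sobolev inequality up to dimension three.\<close>

lemma mollify_scale_derivative:
 fixes u :: "'a::euclidean_space => 'b::euclidean_space"
 assumes k: "ccs (cball 0 1) k" and K: "ccs (cball 0 1) K" and m: "!!z b. (z \<bullet> b) * k z = DD K z b"
  and u: "ccs S u"
 shows "((%s. mollify k s u x) has_derivative
   (%de. de *R - (s *R (SUM b:Basis. mollify K s (%y. DD (%y. DD u y b) y b) x)))) (at s)"
proof -
 obtain C where C: "C >= 0" "!!x v. norm (u (x + v) - u x - DD u x v) <= C * (norm v)^2"
  using ccs_taylor[OF u] by blast
 have lin: "linear (DD u x)" for x by (rule linear_DD[OF ccs_smooth[OF u] UNIV_I])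
 have cu: "continuous_on UNIV u" "continuous_on UNIV (%y. DD u y v)" for v
  using smooth_on_continuous[OF ccs_smooth[OF u]] smooth_on_continuous[OF ccs_smooth[OF ccs_deriv[OF u]]] by auto
 have k0: "k z = 0" if "norm z > 1" for z using k that unfolding ccs_compact_iff[OF compact_cball] by simp
 have expand: "k z *R DD u y (- z) = - (SUM b:Basis. DD K z b *R DD u y b)" for y z
  unfolding linear_neg[OF lin] basis_expand[OF lin, of y z]
  by (simp add: scaleR_sum_right m[symmetric] mult.commute)
 have iK: "integrable lborel (%z. DD K z b *R DD u (x - s *R z) b)" for b
  by (rule mollify_integrable[OF ccs_cc0[OF ccs_deriv[OF K]] cu(2)])
 have ik: "integrable lborel (%z. k z *R u (x - s *R z))" for s
  by (rule mollify_integrable[OF ccs_cc0[OF k] cu(1)])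
 define D where "D = (LINT z|lborel. k z *R DD u (x - s *R z) (- z))"
 have iD: "integrable lborel (%z. k z *R DD u (x - s *R z) (- z))"
  unfolding expand by (intro Bochner_Integration.integrable_minus Bochner_Integration.integrable_sum iK)
 have "D = - (SUM b:Basis. mollify (%z. DD K z b) s (%y. DD u y b) x)"
  unfolding D_def expand mollify_def using iK by (simp add: Bochner_Integration.integral_sum)
 also have "... = - (s *R (SUM b:Basis. mollify K s (%y. DD (%y. DD u y b) y b) x))"
  unfolding mollify_by_parts[OF K ccs_deriv[OF u], symmetric] by (simp add: scaleR_sum_right)
 finally have D: "D = - (s *R (SUM b:Basis. mollify K s (%y. DD (%y. DD u y b) y b) x))" .
 have "((%s. mollify k s u x) has_derivative (%de. de *R D)) (at s)"
 proof (rule has_derivative_quadratic)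
  show "linear (%de. de *R D)" by (rule linearI) (simp_all add: scaleR_left_distrib)
  fix de
  let ?f = "%z. k z *R (u ((x - s *R z) + de *R (- z)) - u (x - s *R z) - DD u (x - s *R z) (de *R (- z)))"
  have f: "?f = (%z. k z *R u (x - (s + de) *R z) - k z *R u (x - s *R z) - de *R (k z *R DD u (x - s *R z) (- z)))"
   unfolding linear_scale[OF lin] by (simp add: algebra_simps)
  have if': "integrable lborel ?f" unfolding f using ik iD by (simp del: scaleR_scaleR)
  have "mollify k (s + de) u x - mollify k s u x - de *R D = (LINT z|lborel. ?f z)"
   unfolding f mollify_def D_def using ik iD by (simp del: scaleR_scaleR)
  also have "norm ... <= (LINT z|lborel. \<bar>k z\<bar> * (C * de^2))"
  proof (rule order_trans[OF integral_norm_bound integral_mono])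
   show "integrable lborel (%z. norm (?f z))" by (rule integrable_norm[OF if'])
   show "integrable lborel (%z. \<bar>k z\<bar> * (C * de^2))"
    using cc0_norm[OF ccs_cc0[OF k]] by (intro integrable_mult_left cc0_integrable) simp
   fix z :: 'a
   show "norm (?f z) <= \<bar>k z\<bar> * (C * de^2)"
   proof (cases "norm z > 1")
    case False
    have "norm (?f z) <= \<bar>k z\<bar> * (C * (norm (de *R (- z)))^2)"
     unfolding norm_scaleR by (intro mult_left_mono order_trans[OF C(2)]) (simp_all add: C(1))
    also have "... <= \<bar>k z\<bar> * (C * de^2)"
    proof (intro mult_left_mono C(1))
     have "norm (de *R (- z)) <= \<bar>de\<bar>" using False by (simp add: mult_left_le)
     then show "(norm (de *R (- z)))^2 <= de^2" using power_mono[of "norm (de *R (- z))" "\<bar>de\<bar>" 2] by simp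
    qed simp
    finally show ?thesis .
   qed (simp add: k0)
  qed
  finally show "norm (mollify k (s + de) u x - mollify k s u x - de *R D) <= ((LINT z|lborel. \<bar>k z\<bar>) * C) * (norm de)^2"
   by (simp add: mult.assoc)
 qed
 then show ?thesis unfolding D .
qed

text \<open>\<open>u x\<close> is the mollification at scale 0, and at scale 1 the L^2 norm bounds
  the mollification pointwise. In between, the derivative with respect to the scale s has size s
  times s^(-n/2) in dimension n, which is integrable at 0 for n at most 3. The substitution s =
  \<open>ta^2\<close> makes the derivative bounded, so that the mean value inequality
  suffices.\<close>

lemma sobolev:
 assumes dim: "DIM('a::euclidean_space) <= 3"
 shows "EX C>=0. ALL (u :: 'a => 'b::euclidean_space) S x. ccs S u -->
  norm (u x) <= C * (nrm u + (SUM b:Basis. nrm (%y. DD (%y. DD u y b) y b)))"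
proof -
 obtain k K :: "'a => real" where k: "ccs (cball 0 1) k" and K: "ccs (cball 0 1) K" and one: "(LINT z|lborel. k z) = 1"
  and m: "!!z b. (z \<bullet> b) * k z = DD K z b" using ex_kernel by blast
 define C where "C = max (nrm k) (2 * nrm K)"
 have "norm (u x) <= C * (nrm u + (SUM b:Basis. nrm (%y. DD (%y. DD u y b) y b)))"
  if u: "ccs S u" for S x and u :: "'a => 'b"
 proof -
  define w where "w b = (%y. DD (%y. DD u y b) y b)" for b
  have w: "ccs S (w b)" for b unfolding w_def by (intro ccs_deriv u)
  define L where "L s = - (s *R (SUM b:Basis. mollify K s (w b) x))" for s
  have d: "((%s. mollify k s u x) has_derivative (%de. de *R L s)) (at s)" for s
   unfolding L_def w_def by (rule mollify_scale_derivative[OF k K m u])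
  have "norm (mollify k (1^2) u x - mollify k (0^2) u x) <= (2 * nrm K * (SUM b:Basis. nrm (w b))) * norm (1 - (0::real))"
  proof (rule differentiable_bound[where S="{0..1}" and f'="%ta de. de *R ((2 * ta) *R L (ta^2))"])
   fix ta :: real assume t: "ta : {0..1}"
   have g: "((%ta. ta^2) has_derivative (%de. 2 * ta * de)) (at ta)"
    by (auto intro!: derivative_eq_intros)
   show "((%ta. mollify k (ta^2) u x) has_derivative (%de. de *R ((2 * ta) *R L (ta^2)))) (at ta within {0..1})"
   proof (rule has_derivative_at_withinI)
    have "(%de. (2 * ta * de) *R L (ta^2)) = (%de. de *R ((2 * ta) *R L (ta^2)))"
     by (simp add: fun_eq_iff mult.commute)
    then show "((%ta. mollify k (ta^2) u x) has_derivative (%de. de *R ((2 * ta) *R L (ta^2)))) (at ta)"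
     using has_derivative_compose[OF g d] by argo
   qed
   show "onorm (%de. de *R ((2 * ta) *R L (ta^2))) <= 2 * nrm K * (SUM b:Basis. nrm (w b))"
   proof (rule onorm_le)
    fix de :: real
    have "norm ((2 * ta) *R L (ta^2)) <= 2 * nrm K * (SUM b:Basis. nrm (w b))"
    proof (cases "ta = 0")
     case False
     then have t0: "ta > 0" "ta <= 1" using t by auto
     have "norm (SUM b:Basis. mollify K (ta^2) (w b) x) <= (SUM b:Basis. nrm K * nrm (w b) / sqrt ((ta^2) ^ DIM('a)))"
      using t0 by (intro sum_norm_le mollify_sup_le[OF ccs_cc0[OF K] w]) auto
     also have "sqrt ((ta^2) ^ DIM('a)) = ta ^ DIM('a)"
      using t0 by (simp add: real_sqrt_power)
     also have "(SUM b:Basis. nrm K * nrm (w b) / ta ^ DIM('a)) <= (SUM b:Basis. nrm K * nrm (w b) / ta ^ 3)"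
      using t0 dim by (intro sum_mono divide_left_mono mult_nonneg_nonneg nrm_ge_0 power_decreasing) auto
     also have "... = nrm K * (SUM b:Basis. nrm (w b)) / ta ^ 3"
      by (simp add: sum_distrib_left sum_divide_distrib)
     finally have s: "norm (SUM b:Basis. mollify K (ta^2) (w b) x) <= nrm K * (SUM b:Basis. nrm (w b)) / ta ^ 3" .
     have "norm ((2 * ta) *R L (ta^2)) = (2 * ta ^ 3) * norm (SUM b:Basis. mollify K (ta^2) (w b) x)"
      using t0 by (simp add: L_def power2_eq_square power3_eq_cube)
     also have "... <= (2 * ta ^ 3) * (nrm K * (SUM b:Basis. nrm (w b)) / ta ^ 3)"
      using t0 s by (intro mult_left_mono) auto
     finally show ?thesis using t0 by simp
    qed (auto intro!: mult_nonneg_nonneg nrm_ge_0 sum_nonneg)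
    then show "norm (de *R ((2 * ta) *R L (ta^2))) <= 2 * nrm K * (SUM b:Basis. nrm (w b)) * norm de"
     using mult_right_mono[of _ _ "\<bar>de\<bar>"] by (subst norm_scaleR, subst mult.commute) simp
   qed
  qed auto
  moreover have "mollify k 0 u x = u x"
   unfolding mollify_def using one cc0_integrable[OF ccs_cc0[OF k]] by simp
  moreover have "norm (mollify k 1 u x) <= nrm k * nrm u"
   using mollify_sup_le[OF ccs_cc0[OF k] u, of 1 x] by simp
  ultimately have "norm (u x) <= nrm k * nrm u + 2 * nrm K * (SUM b:Basis. nrm (w b))"
   using norm_triangle_ineq2[of "u x" "mollify k 1 u x"] by (simp add: norm_minus_commute)
  also have "... <= C * nrm u + C * (SUM b:Basis. nrm (w b))"
   unfolding C_def by (intro add_mono mult_right_mono sum_nonneg nrm_ge_0) auto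
  finally show ?thesis by (simp add: w_def distrib_left)
 qed
 then show ?thesis using nrm_ge_0[of k] by (intro exI[of _ C]) (auto simp: C_def)
qed

section \<open>Limits of smooth functions\<close>

primrec pd :: "'a list => ('a::euclidean_space => 'b::real_normed_vector) => 'a => 'b" where
 "pd [] u = u"
| "pd (b # be) u = (%x. DD (pd be u) x b)"

lemma pd_ccs: "ccs S u ==> ccs S (pd be u)"
 by (induction be) (simp_all add: ccs_deriv)

lemma pd_diff: assumes "ccs S u" "ccs T v" shows "pd be (%x. u x - v x) = (%x. pd be u x - pd be v x)"
proof (induction be)
 case (Cons b be)
 show ?case
  using dir_deriv_diff[OF ccs_smooth[OF pd_ccs[OF assms(1)]] ccs_smooth[OF pd_ccs[OF assms(2)]] UNIV_I] by (simp add: Cons)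
qed simp

text \<open>One integration by parts. It serves to pass from L^2 convergence of functions to that of
  all their derivatives, once these are known to be bounded.\<close>

lemma nrm_interpolate:
 assumes "ccs S w"
 shows "(nrm (%x. DD w x b))^2 <= nrm w * nrm (%x. DD (%x. DD w x b) x b)"
proof -
 have "(nrm (%x. DD w x b))^2 = - ip w (%x. DD (%x. DD w x b) x b)"
  unfolding nrm_sq by (rule ip_by_parts[OF assms ccs_deriv[OF assms]])
 also have "... <= nrm w * nrm (%x. DD (%x. DD w x b) x b)"
  using ip_Cauchy_Schwarz[OF ccs_cc0[OF assms] ccs_cc0[OF ccs_deriv[OF ccs_deriv[OF assms]]], of b b] by linarith
 finally show ?thesis .
qed

lemma nrm_pd_Cauchy:
 fixes g :: "nat => 'a::euclidean_space => 'b::euclidean_space"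
 assumes g: "!!m. ccs S (g m)"
  and cau: "!!e. e > 0 ==> EX M. ALL m>=M. ALL n>=M. nrm (%x. g m x - g n x) < e"
  and bd: "!!be. set be <= Basis ==> EX C N. ALL m>=N. nrm (pd be (g m)) <= C"
 shows "set be <= Basis ==> e > 0 ==> EX M. ALL m>=M. ALL n>=M. nrm (pd be (%x. g m x - g n x)) < e"
proof (induction be arbitrary: e)
 case Nil then show ?case using cau by simp
next
 case (Cons b be)
 obtain C N where C: "!!m. m >= N ==> nrm (pd (b # b # be) (g m)) <= C" using bd[of "b # b # be"] Cons.prems by auto
 have C0: "C >= 0" using order_trans[OF nrm_ge_0 C] by blast
 define de where "de = e^2 / (2 * C + 1)"
 have de: "de > 0" using Cons.prems C0 by (auto simp: de_def)
 obtain M where M: "!!m n. m >= M ==> n >= M ==> nrm (pd be (%x. g m x - g n x)) < de"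
  using Cons.IH[OF _ de] Cons.prems by auto
 have "nrm (pd (b # be) (%x. g m x - g n x)) < e" if mn: "m >= max M N" "n >= max M N" for m n
 proof -
  let ?w = "%x. g m x - g n x"
  have w: "ccs S ?w" by (intro ccs_diff g)
  have "nrm (pd (b # b # be) ?w) <= nrm (pd (b # b # be) (g m)) + nrm (pd (b # b # be) (g n))"
   unfolding pd_diff[OF g g] by (intro nrm_diff ccs_cc0[OF pd_ccs[OF g]])
  also have "... <= 2 * C" using C[of m] C[of n] mn by auto
  finally have 1: "nrm (pd (b # b # be) ?w) <= 2 * C" .
  have "(nrm (pd (b # be) ?w))^2 <= nrm (pd be ?w) * nrm (pd (b # b # be) ?w)"
   using nrm_interpolate[OF pd_ccs[OF w]] by simp
  also have "... <= de * (2 * C)" using M[of m n] mn 1 de by (intro mult_mono nrm_ge_0) auto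
  also have "... < de * (2 * C + 1)" using de by simp
  also have "... = e^2" using C0 by (simp add: de_def)
  finally show ?thesis by (rule power2_less_imp_less) (use Cons.prems(2) in simp)
 qed
 then show ?case by (intro exI[of _ "max M N"] allI impI)
qed

text \<open>Interpolation makes every derivative Cauchy in L^2, and the Sobolev inequality makes it
  uniformly Cauchy, so the limit can be differentiated term by term. The bound on a derivative is
  asked for only from some index on, which may depend on the derivative: this is what a diagonal
  choice can provide.\<close>

lemma smooth_limit:
 fixes g :: "nat => 'a::euclidean_space => 'b::euclidean_space"
 assumes dim: "DIM('a) <= 3" and g: "!!m. ccs (cball 0 R) (g m)"
  and cau: "!!e. e > 0 ==> EX M. ALL m>=M. ALL n>=M. nrm (%x. g m x - g n x) < e"
  and bd: "!!be. set be <= Basis ==> EX C N. ALL m>=N. nrm (pd be (g m)) <= C"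
 shows "EX G. ccs (cball 0 R) G & (%m. nrm (%x. g m x - G x)) \<longlonglongrightarrow> 0"
proof -
 obtain C where C: "C >= 0" and sob: "!!(u :: 'a => 'b) S x. ccs S u ==>
  norm (u x) <= C * (nrm u + (SUM b:Basis. nrm (%y. DD (%y. DD u y b) y b)))"
  using sobolev[OF dim, where 'b='b] by (elim exE conjE) blast
 have nC: "EX M. ALL m>=M. ALL n>=M. nrm (pd be (%x. g m x - g n x)) < e" if "set be <= Basis" "e > 0" for be e
  by (rule nrm_pd_Cauchy[where S="cball 0 R" and g=g]) (rule g that | erule cau bd)+
 have uc: "EX M. ALL m>=M. ALL n>=M. ALL x. norm (pd be (g m) x - pd be (g n) x) < e" if b: "set be <= Basis" and e: "e > 0" for be e
 proof -
  define de where "de = e / ((C + 1) * (1 + real DIM('a)))"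
  have de: "de > 0" using e C by (simp add: de_def)
  obtain M where M: "!!m n. m >= M ==> n >= M ==> nrm (pd be (%x. g m x - g n x)) < de"
   using nC[OF b de] by blast
  have "EX M. ALL m>=M. ALL n>=M. nrm (pd (c # c # be) (%x. g m x - g n x)) < de" if "c : Basis" for c
   using nC[OF _ de, of "c # c # be"] b that by simp
  then obtain N where N: "!!c m n. c : Basis ==> m >= N c ==> n >= N c ==> nrm (pd (c # c # be) (%x. g m x - g n x)) < de"
   by metis
  define L where "L = Max (insert M (N ` Basis))"
  have L: "L >= M" "!!c. c : Basis ==> L >= N c" unfolding L_def by (rule Max_ge; simp)+
  have "norm (pd be (g m) x - pd be (g n) x) < e" if mn: "m >= L" "n >= L" for m n x
  proof -
   let ?w = "%x. g m x - g n x"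
   have w: "ccs (cball 0 R) ?w" by (intro ccs_diff g)
   have "norm (pd be ?w x) <= C * (nrm (pd be ?w) + (SUM c:Basis. nrm (pd (c # c # be) ?w)))"
    using sob[OF pd_ccs[OF w]] by simp
   also have "... <= C * (de + (SUM c:(Basis::'a set). de))"
    using L mn by (intro mult_left_mono add_mono sum_mono less_imp_le[OF M] less_imp_le[OF N] C order_trans[OF L(2) mn(1)] order_trans[OF L(2) mn(2)]) auto
   also have "... < (C + 1) * (de * (1 + real DIM('a)))"
    using de C by (simp add: algebra_simps add_pos_nonneg)
   also have "... = e" using C by (simp add: de_def)
   finally show ?thesis by (simp add: pd_diff[OF g g])
  qed
  then show ?thesis by (intro exI[of _ L] allI impI)
 qed
 have conv: "convergent (%m. pd be (g m) x)" if "set be <= Basis" for be x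
 proof (rule Cauchy_convergent, rule CauchyI)
  fix e :: real assume "e > 0"
  then show "EX M. ALL m>=M. ALL n>=M. norm (pd be (g m) x - pd be (g n) x) < e" using uc[OF that] by fast
 qed
 define G where "G be x = lim (%m. pd be (g m) x)" for be x
 have lim: "(%m. pd be (g m) x) \<longlonglongrightarrow> G be x" if "set be <= Basis" for be x
  unfolding G_def using conv[OF that] convergent_LIMSEQ_iff by blast
 have unif: "EX M. ALL m>=M. ALL x. norm (pd be (g m) x - G be x) <= e" if b: "set be <= Basis" and e: "e > 0" for be e
 proof -
  obtain M where M: "!!m n x. m >= M ==> n >= M ==> norm (pd be (g m) x - pd be (g n) x) < e" using uc[OF b e] by blast
  have "norm (pd be (g m) x - G be x) <= e" if "m >= M" for m x
  proof (rule LIMSEQ_le_const2)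
   show "(%n. norm (pd be (g m) x - pd be (g n) x)) \<longlonglongrightarrow> norm (pd be (g m) x - G be x)"
    by (intro tendsto_intros lim b)
   show "EX N. ALL n>=N. norm (pd be (g m) x - pd be (g n) x) <= e"
    by (intro exI[of _ M] allI impI less_imp_le[OF M[OF that]])
  qed
  then show ?thesis by (intro exI[of _ M] allI impI)
 qed
 have der: "(G be has_derivative (%h. SUM c:Basis. (h \<bullet> c) *R G (c # be) x)) (at x)" if b: "set be <= Basis" for be x
 proof -
  have "EX h. ALL x:UNIV. (%m. pd be (g m) x) \<longlonglongrightarrow> h x & (h has_derivative (%h. SUM c:Basis. (h \<bullet> c) *R G (c # be) x)) (at x within UNIV)"
  proof (rule has_derivative_sequence[OF convex_UNIV _ _ UNIV_I lim[OF b]])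
   show "(pd be (g m) has_derivative DD (pd be (g m)) x) (at x within UNIV)" for m x
    using smooth_has_deriv[OF ccs_smooth[OF pd_ccs[OF g]] UNIV_I] by simp
   fix e :: real assume e: "e > 0"
   define de where "de = e / real DIM('a)"
   have de: "de > 0" using e by (simp add: de_def)
   have "EX M. ALL m>=M. ALL x. norm (pd (c # be) (g m) x - G (c # be) x) <= de" if "c : Basis" for c
    using unif[of "c # be" de] de b that by simp
   then obtain N where N: "!!c m x. c : Basis ==> m >= N c ==> norm (pd (c # be) (g m) x - G (c # be) x) <= de"
    by metis
   define L where "L = Max (N ` Basis)"
   have L: "!!c. c : Basis ==> L >= N c" by (auto simp: L_def)
   have "norm (DD (pd be (g m)) x h - (SUM c:Basis. (h \<bullet> c) *R G (c # be) x)) <= e * norm h" if "m >= L" for m x h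
   proof -
    have "DD (pd be (g m)) x h - (SUM c:Basis. (h \<bullet> c) *R G (c # be) x)
     = (SUM c:Basis. (h \<bullet> c) *R (pd (c # be) (g m) x - G (c # be) x))"
     using basis_expand[OF linear_DD[OF ccs_smooth[OF pd_ccs[OF g]] UNIV_I], of be m x h]
     by (simp add: sum_subtractf scaleR_diff_right)
    also have "norm ... <= (SUM c:(Basis::'a set). norm h * de)"
    proof (rule sum_norm_le)
     fix c :: 'a assume c: "c : Basis"
     show "norm ((h \<bullet> c) *R (pd (c # be) (g m) x - G (c # be) x)) <= norm h * de"
      unfolding norm_scaleR using L[OF c] \<open>m >= L\<close> by (intro mult_mono Basis_le_norm N c) auto
    qed
    also have "... = e * norm h" by (simp add: de_def)
    finally show ?thesis .
   qed
   then show "\<forall>\<^sub>F m in sequentially. ALL x:UNIV. ALL h. norm (DD (pd be (g m)) x h - (SUM c:Basis. (h \<bullet> c) *R G (c # be) x)) <= e * norm h"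
    unfolding eventually_sequentially by (intro exI[of _ L] allI impI ballI)
  qed
  then obtain h where h: "!!x. (%m. pd be (g m) x) \<longlonglongrightarrow> h x" "!!x. (h has_derivative (%h. SUM c:Basis. (h \<bullet> c) *R G (c # be) x)) (at x)"
   by auto
  have "h = G be" using LIMSEQ_unique[OF h(1) lim[OF b]] by blast
  then show ?thesis using h(2) by simp
 qed
 have sm: "C_on k UNIV (G be)" if "set be <= Basis" for k be
  using that
 proof (induction k arbitrary: be)
  case 0
  show ?case using der[OF 0, THEN has_derivative_continuous] by (simp add: continuous_at_imp_continuous_on)
 next
  case (Suc k)
  have "C_on k UNIV (%x. SUM c:Basis. (u \<bullet> c) *R G (c # be) x)" for u
  proof (rule C_on_sum[OF open_UNIV])
   fix c :: 'a assume "c : Basis"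
   then have "C_on k UNIV (G (c # be))" using Suc.prems by (intro Suc.IH) simp
   then show "C_on k UNIV (%x. (u \<bullet> c) *R G (c # be) x)"
    by (rule C_on_bounded_linear[OF bounded_linear_scaleR_right open_UNIV])
  qed
  then show ?case by (rule C_on_SucI[OF open_UNIV der[OF Suc.prems]])
 qed
 have sup0: "g m x = 0" if "norm x > R" for m x
  using g[of m] that unfolding ccs_compact_iff[OF compact_cball] by simp
 have out: "G [] x = 0" if "norm x > R" for x
  using lim[of "[]" x] LIMSEQ_unique[OF _ tendsto_const] by (simp add: sup0[OF that])
 have cG: "ccs (cball 0 R) (G [])"
  unfolding ccs_compact_iff[OF compact_cball] smooth_on_def using sm[of "[]"] out by simp
 have "(%m. nrm (%x. g m x - G [] x)) \<longlonglongrightarrow> 0"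
 proof (rule LIMSEQ_I)
  fix e :: real assume e: "e > 0"
  define V where "V = sqrt (measure lborel (cball (0::'a) R))"
  have V: "V >= 0" by (simp add: V_def)
  obtain M where M: "!!m x. m >= M ==> norm (pd [] (g m) x - G [] x) <= e / (V + 1)"
   using unif[of "[]" "e / (V + 1)"] e V by auto
  have "norm (nrm (%x. g m x - G [] x) - 0) < e" if "m >= M" for m
  proof -
   have "nrm (%x. g m x - G [] x) <= e / (V + 1) * V" unfolding V_def
    by (rule nrm_le_sup[OF cc0_diff[OF ccs_cc0[OF g] ccs_cc0[OF cG]]])
      (use M[OF that] sup0 out in "auto simp: V_def")
   also have "... < e" using e V by (simp add: field_simps)
   finally show ?thesis using nrm_ge_0[of "%x. g m x - G [] x"] by simp
  qed
  then show "EX M. ALL m>=M. norm (nrm (%x. g m x - G [] x) - 0) < e" by (intro exI[of _ M] allI impI)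
 qed
 then show ?thesis using cG by blast
qed

section \<open>The Garding inequality\<close>

locale quaternionic =
 fixes J :: "3 => 'q::euclidean_space => 'q"
 assumes linear_J: "linear (J i)"
  and inner_J: "J i x \<bullet> J i y = x \<bullet> y"
  and J_J: "J i (J i x) = - x"
  and J_anticommute: "i ~= j ==> J i (J j x) = - J j (J i x)"
begin

lemma J_skew: "J i x \<bullet> y = - (x \<bullet> J i y)"
 using inner_J[of i x "J i y"] by (simp add: J_J)

lemma bounded_linear_J: "bounded_linear (J i)"
 using linear_J linear_conv_bounded_linear by blast

text \<open>The product of two anticommuting skew maps is skew. This makes the cross terms in
  Garding's inequality of lower order.\<close>

lemma JJ_skew: "i ~= j ==> J i (J j x) \<bullet> y = - (x \<bullet> J i (J j y))"
 using J_anticommute[of i j y] by (simp add: J_skew)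

lemma smooth_J: "open T ==> smooth_on T u ==> smooth_on T (%x. J i (u x))"
 by (rule smooth_on_bounded_linear[OF bounded_linear_J])

lemma ccs_J: "ccs T u ==> ccs T (%x. J i (u x))"
 by (rule ccs_bounded_linear[OF bounded_linear_J])

lemma nrm_J: "nrm (%x. J i (u x)) = nrm u"
 by (simp add: nrm_def ip_def inner_J)

end

lemma ip_mult_left: "ip (%x. p x *R u x) v = ip u (%x. p x *R v x)"
 by (simp add: ip_def)

text \<open>Integration by parts along \<open>a\<close> and along \<open>b\<close> gives two
  formulas for the same quantity. Since \<open>K\<close> is skew and second derivatives commute,
  they contain the second-order term with opposite signs. In their sum only terms with a derivative
  of \<open>p\<close> survive.\<close>

lemma garding_term:
 fixes p :: "'a::euclidean_space => real" and K :: "'q::euclidean_space => 'q"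
 assumes p: "ccs S p" and K: "bounded_linear K" "!!x y. K x \<bullet> y = - (x \<bullet> K y)"
 shows "EX C>=0. ALL u T. ccs T u --> \<bar>ip (%x. p x *R DD u x a) (%x. K (DD u x b))\<bar>
  <= C * nrm u * (nrm (%x. DD u x a) + nrm (%x. DD u x b))"
proof -
 obtain C1 where C1: "C1 >= 0" "!!x. norm (DD p x a) <= C1" using ccs_bounded[OF ccs_deriv[OF p]] by blast
 obtain C2 where C2: "C2 >= 0" "!!x. norm (DD p x b) <= C2" using ccs_bounded[OF ccs_deriv[OF p]] by blast
 obtain CK where CK: "CK >= 0" "!!x. norm (K x) <= CK * norm x"
  using bounded_linear.nonneg_bounded[OF K(1)] by (metis mult.commute)
 define C where "C = (C1 + C2) * CK"
 have C: "C >= 0" using C1 C2 CK by (simp add: C_def)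
 have "\<bar>ip (%x. p x *R DD u x a) (%x. K (DD u x b))\<bar>
  <= C * nrm u * (nrm (%x. DD u x a) + nrm (%x. DD u x b))" if u: "ccs T u" for u T
 proof -
  define A where "A = (%x. DD u x a)"
  define B where "B = (%x. DD u x b)"
  define W where "W = (%x. K (DD A x b))"
  have su: "smooth_on UNIV u" and cA: "ccs T A" and cB: "ccs T B"
   unfolding A_def B_def by (intro ccs_smooth[OF u] ccs_deriv u)+
  have sA: "smooth_on UNIV A" and sB: "smooth_on UNIV B" by (intro ccs_smooth[OF cA] ccs_smooth[OF cB])+
  have cW: "ccs T W" unfolding W_def by (intro ccs_bounded_linear[OF K(1)] ccs_deriv cA)
  have cKA: "ccs T (%x. K (A x))" and cKB: "ccs T (%x. K (B x))"
   by (intro ccs_bounded_linear[OF K(1)] cA cB)+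
  have W': "DD (%x. K (B x)) x a = W x" for x
  proof -
   have "DD (%x. K (B x)) x a = K (DD B x a)"
    by (rule dir_deriv_linear[OF K(1) sB UNIV_I])
   then show ?thesis using dir_deriv_commute[OF open_UNIV su UNIV_I, of b x a] by (simp add: W_def A_def B_def)
  qed
  have W'': "DD (%x. K (A x)) x b = W x" for x
   unfolding W_def by (rule dir_deriv_linear[OF K(1) sA UNIV_I])
  have pu: "ccs S (%x. p x *R u x)" by (rule ccs_scaleR_smooth[OF p open_UNIV subset_UNIV su])
  have pKA: "ccs S (%x. p x *R K (A x))" by (rule ccs_scaleR_smooth[OF p open_UNIV subset_UNIV ccs_smooth[OF cKA]])
  have pc: "cc0 (%x. p x *R v x)" "cc0 (%x. DD p x c *R v x)" if "cc0 v" for v :: "'a => 'q" and c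
   by (intro cc0_scaleR cc0_continuous[OF that] ccs_cc0[OF p] ccs_cc0[OF ccs_deriv[OF p]])+
  note cc = ccs_cc0[OF u] ccs_cc0[OF cA] ccs_cc0[OF cB] ccs_cc0[OF cKA] ccs_cc0[OF cKB] ccs_cc0[OF cW]
  have dpu: "DD (%x. p x *R u x) x a = p x *R A x + DD p x a *R u x" for x
   unfolding A_def by (rule dir_deriv_bilinear[OF bounded_bilinear_scaleR ccs_smooth[OF p] su UNIV_I])
  have dpKA: "DD (%x. p x *R K (A x)) x b = p x *R W x + DD p x b *R K (A x)" for x
   using dir_deriv_bilinear[OF bounded_bilinear_scaleR ccs_smooth[OF p] ccs_smooth[OF cKA] UNIV_I, of x b] W'' by simp
  have K0: "(%x. K (p x *R v x)) = (%x. p x *R K (v x))" for v by (simp add: linear_scale[OF bounded_linear.linear[OF K(1)]])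
  have Kip: "ip f (%x. K (v x)) = - ip (%x. K (f x)) v" for f v by (simp add: ip_def K(2))
  have 1: "ip (%x. p x *R A x) (%x. K (B x)) = - ip (%x. p x *R u x) W - ip (%x. DD p x a *R u x) (%x. K (B x))"
  proof -
   have "ip (%x. p x *R A x + DD p x a *R u x) (%x. K (B x)) = - ip (%x. p x *R u x) W"
    using ip_by_parts[OF pu cKB, of a] by (simp add: dpu W')
   then show ?thesis using ip_add_left[OF pc(1)[OF cc(2)] pc(2)[OF cc(1)] cc(5)] by simp
  qed
  have 2: "ip (%x. p x *R A x) (%x. K (B x)) = ip (%x. p x *R W x) u + ip (%x. DD p x b *R K (A x)) u"
  proof -
   have "ip (%x. p x *R A x) (%x. K (B x)) = - ip (%x. p x *R K (A x)) B"
    unfolding Kip K0 ..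
   also have "... = ip (%x. p x *R W x + DD p x b *R K (A x)) u"
    using ip_by_parts[OF pKA u, of b] by (simp add: dpKA B_def)
   finally show ?thesis using ip_add_left[OF pc(1)[OF cc(6)] pc(2)[OF cc(4)] cc(1)] by simp
  qed
  have 3: "ip (%x. p x *R W x) u = ip (%x. p x *R u x) W" by (simp add: ip_mult_left[of p u] ip_commute)
  have KA: "nrm (%x. K (v x)) <= CK * nrm v" if "cc0 v" for v :: "'a => 'q"
   by (rule nrm_mono[OF cc0_bounded_linear[OF K(1) that] that CK(2) CK(1)])
  have 4: "\<bar>ip (%x. DD p x a *R u x) (%x. K (B x))\<bar> <= C1 * nrm u * (CK * nrm B)"
  proof -
   have "nrm (%x. DD p x a *R u x) <= C1 * nrm u"
    by (rule nrm_mono[OF pc(2)[OF cc(1)] cc(1) _ C1(1)]) (use C1 in "auto intro: mult_right_mono")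
   then show ?thesis
    by (intro order_trans[OF ip_Cauchy_Schwarz[OF pc(2)[OF cc(1)] cc(5), of a]] mult_mono KA[OF cc(3)]
      mult_nonneg_nonneg nrm_ge_0 C1(1))
  qed
  have 5: "\<bar>ip (%x. DD p x b *R K (A x)) u\<bar> <= C2 * (CK * nrm A) * nrm u"
  proof -
   have "nrm (%x. DD p x b *R K (A x)) <= C2 * nrm (%x. K (A x))"
    by (rule nrm_mono[OF pc(2)[OF cc(4)] cc(4) _ C2(1)]) (use C2 in "auto intro: mult_right_mono")
   also have "... <= C2 * (CK * nrm A)" by (intro mult_left_mono KA cc C2)
   finally show ?thesis
    by (intro order_trans[OF ip_Cauchy_Schwarz[OF pc(2)[OF cc(4)] cc(1), of b]] mult_right_mono nrm_ge_0)
  qed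
  have "2 * \<bar>ip (%x. p x *R A x) (%x. K (B x))\<bar> <= C1 * nrm u * (CK * nrm B) + C2 * (CK * nrm A) * nrm u"
   using 1 2 3 4 5 by linarith
  also have "... <= (C1 + C2) * nrm u * (CK * nrm B) + (C1 + C2) * (CK * nrm A) * nrm u"
   using C1 C2 CK by (intro add_mono mult_right_mono mult_nonneg_nonneg nrm_ge_0) auto
  also have "... = C * nrm u * (nrm A + nrm B)" by (simp add: C_def algebra_simps)
  finally have "\<bar>ip (%x. p x *R A x) (%x. K (B x))\<bar> <= C * nrm u * (nrm A + nrm B)"
   by linarith
  then show ?thesis by (simp add: A_def B_def)
 qed
 then show ?thesis using C by blast
qed

locale local_frame = quaternionic J for J :: "3 => 'q::euclidean_space => 'q" +
 fixes S :: "(real^3) set" and V :: "3 => real^3 => real^3"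
 assumes open_S: "open S" and smooth_V: "smooth_on S (V i)"
  and frame: "x : S ==> det (\<chi> i j. V j x $ i) ~= 0"
begin

definition dv :: "3 => (real^3 => 'b::real_normed_vector) => real^3 => 'b" where
 "dv i u x = DD u x (V i x)"

definition D :: "(real^3 => 'q) => real^3 => 'q" where
 "D u x = (SUM i:UNIV. J i (dv i u x))"

text \<open>By Cramer's rule the coefficients are quotients of determinants, hence continuous, hence
  bounded on the compact set.\<close>

lemma frame_coefficients:
 assumes L: "compact L" "L <= S"
 shows "EX B>=0. ALL x:L. ALL b:Basis. EX be. b = (SUM j:UNIV. be j *R V j x) & (ALL j. \<bar>be j\<bar> <= B)"
proof -
 define A where "A x = (\<chi> i j. V j x $ i)" for x
 define be where "be b k x = det (\<chi> i j. if j = k then b $ i else A x $ i $ j) / det (A x)" for b k x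
 have cV: "continuous_on L (%x. V j x $ i)" for i j
  using continuous_on_subset[OF smooth_on_continuous[OF smooth_V] L(2)] by (intro continuous_intros)
 have nz: "det (A x) ~= 0" if "x : L" for x using frame L that by (auto simp: A_def)
 have c1: "continuous_on L (%x. det (A x))"
  unfolding det_def A_def by (simp, intro continuous_intros cV)
 have c2: "continuous_on L (%x. det (\<chi> i j. if j = k then b $ i else A x $ i $ j))" for b k
 proof -
  have "continuous_on L (%x. if j = k then b $ i else A x $ i $ j)" for i j
   by (cases "j = k") (simp_all add: A_def cV)
  then show ?thesis unfolding det_def by (simp, intro continuous_intros)
 qed
 have "continuous_on L (be b k)" for b k
  unfolding be_def by (intro continuous_on_divide c1 c2) (use nz in auto)
 then have "bounded (be b k ` L)" for b k by (intro compact_imp_bounded compact_continuous_image L(1))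
 then have "ALL b k. EX C. ALL x:L. \<bar>be b k x\<bar> <= C" unfolding bounded_iff by simp
 then obtain C where C: "!!b k x. x : L ==> \<bar>be b k x\<bar> <= C b k" by metis
 define B where "B = (SUM b:Basis. SUM k:UNIV. \<bar>C b k\<bar>)"
 have CB: "\<bar>C b k\<bar> <= B" if "b : Basis" for b k
 proof -
  have "\<bar>C b k\<bar> <= (SUM k:UNIV. \<bar>C b k\<bar>)" by (rule member_le_sum) auto
  also have "... <= B" unfolding B_def by (rule member_le_sum) (use that in "auto intro: sum_nonneg")
  finally show ?thesis .
 qed
 have "EX ga. b = (SUM j:UNIV. ga j *R V j x) & (ALL j. \<bar>ga j\<bar> <= B)" if x: "x : L" and b: "b : Basis" for x b
 proof (intro exI[of _ "%j. be b j x"] conjI allI)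
  have "A x *v (\<chi> k. be b k x) = b" using cramer[OF nz[OF x], of "\<chi> k. be b k x" b] by (simp add: be_def)
  then have "ALL i. (SUM j:UNIV. A x $ i $ j * be b j x) = b $ i" by (simp add: vec_eq_iff matrix_vector_mult_def)
  then show "b = (SUM j:UNIV. be b j x *R V j x)"
   by (simp add: vec_eq_iff A_def mult.commute)
  show "\<bar>be b j x\<bar> <= B" for j using C[OF x, of b j] CB[OF b, of j] by linarith
 qed
 moreover have "B >= 0" unfolding B_def by (intro sum_nonneg) auto
 ultimately show ?thesis by (intro exI[of _ B]) blast
qed

text \<open>On functions supported in a given compact set, cutting off the coefficients changes nothing,
 and it makes them smooth and bounded on the whole space.\<close>

lemma ex_coefficients:
 assumes L: "compact L" "L <= S"
 obtains a where "!!i b. ccs S (a i b)"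
  "!!i u x. ccs L (u :: real^3 => 'b::real_normed_vector) ==>
   dv i u x = (SUM b:Basis. a i b x *R DD u x b)"
proof -
 obtain th U where th: "ccs S th" "open U" "L <= U" "ALL x:U. th x = (1::real)"
  using ex_cutoff[OF L(1) open_S L(2)] by blast
 define a where "a i b x = th x * (V i x \<bullet> b)" for i b x
 have "ccs S (a i b)" for i b unfolding a_def
  by (rule ccs_mult_smooth[OF th(1) open_S order_refl]) (intro smooth_on_inner open_S smooth_V smooth_on_const)
 moreover have "dv i u x = (SUM b:Basis. a i b x *R DD u x b)" if u: "ccs L u" for u :: "real^3 => 'b" and i x
 proof (cases "x : L")
  case True
  then have "th x = 1" using th by blast
  then show ?thesis unfolding dv_def a_def
   using basis_expand[OF linear_DD[OF ccs_smooth[OF u] UNIV_I], of x "V i x"] by simp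
 next
  case False
  have "DD u x w = 0" for w
   by (rule dir_deriv_eq_0[OF compact_imp_closed[OF L(1)] _ False]) (use u ccs_compact_iff[OF L(1)] in blast)
  then show ?thesis by (simp add: dv_def)
 qed
 ultimately show ?thesis by (rule that)
qed

lemma dv_ccs:
 assumes "ccs T u" "T <= S" shows "ccs T (dv i u)"
proof -
 obtain K where K: "compact K" "K <= T" "ALL x. x ~: K --> u x = 0" using assms(1) unfolding ccs_def by blast
 have u: "ccs K u" using assms(1) K unfolding ccs_def by blast
 obtain a where a: "!!i b. ccs S (a i b)" "!!i u x. ccs K (u :: real^3 => 'a) ==> dv i u x = (SUM b:Basis. a i b x *R DD u x b)"
  by (rule ex_coefficients[OF K(1) order_trans[OF K(2) assms(2)], where 'b='a]) (rule that)
 have "smooth_on UNIV (%x. SUM b:Basis. a i b x *R DD u x b)"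
  by (intro smooth_on_sum smooth_on_scaleR open_UNIV ccs_smooth[OF a(1)] ccs_smooth[OF ccs_deriv[OF u]])
 then have s: "smooth_on UNIV (dv i u)" unfolding a(2)[OF u, symmetric] .
 have "dv i u x = 0" if "x ~: K" for x unfolding dv_def
  by (rule dir_deriv_eq_0[OF compact_imp_closed[OF K(1)] _ that]) (use K in blast)
 then show ?thesis unfolding ccs_def using s K by blast
qed

lemma D_ccs: "ccs T u ==> T <= S ==> ccs T (D u)"
 unfolding D_def[abs_def] by (intro ccs_sum ccs_J dv_ccs)

lemma gnrm_le_dv:
 assumes L: "compact L" "L <= S"
 shows "EX B>=0. ALL u :: real^3 => 'b::euclidean_space. ccs L u --> gnrm u <= B * (SUM j:UNIV. nrm (dv j u))"
proof -
 obtain B where B: "B >= 0" "!!x b. x : L ==> b : Basis ==> EX be. b = (SUM j:UNIV. be j *R V j x) & (ALL j. \<bar>be j\<bar> <= B)"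
  using frame_coefficients[OF L] by blast
 have "gnrm u <= (real DIM(real^3) * B) * (SUM j:UNIV. nrm (dv j u))" if u: "ccs L u" for u :: "real^3 => 'b"
 proof -
  have cd: "cc0 (%x. norm (dv j u x))" for j by (intro cc0_norm ccs_cc0[OF dv_ccs[OF u L(2)]])
  have pt: "norm (DD u x b) <= B * norm (SUM j:UNIV. norm (dv j u x))" if b: "b : Basis" for x b
  proof (cases "x : L")
   case True
   obtain be where be: "b = (SUM j:UNIV. be j *R V j x)" "!!j. \<bar>be j\<bar> <= B" using B(2)[OF True b] by blast
   have lin: "linear (DD u x)" by (rule linear_DD[OF ccs_smooth[OF u] UNIV_I])
   have "DD u x b = (SUM j:UNIV. be j *R dv j u x)"
    by (subst be(1)) (simp add: dv_def linear_sum[OF lin] linear_scale[OF lin])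
   also have "norm ... <= (SUM j:UNIV. B * norm (dv j u x))"
    by (intro sum_norm_le) (simp add: be(2) mult_right_mono)
   also have "... = B * norm (SUM j:UNIV. norm (dv j u x))" by (simp add: sum_distrib_left sum_nonneg)
   finally show ?thesis .
  next
   case False
   have "DD u x b = 0"
    by (rule dir_deriv_eq_0[OF compact_imp_closed[OF L(1)] _ False]) (use u ccs_compact_iff[OF L(1)] in blast)
   then show ?thesis using B(1) by simp
  qed
  have "nrm (%x. DD u x b) <= B * (SUM j:UNIV. nrm (dv j u))" if b: "b : Basis" for b
  proof -
   have "nrm (%x. DD u x b) <= B * nrm (%x. SUM j:UNIV. norm (dv j u x))"
    by (intro nrm_mono pt b B(1) cc0_sum cd ccs_cc0[OF ccs_deriv[OF u]])
   also have "nrm (%x. SUM j:UNIV. norm (dv j u x)) <= (SUM j:UNIV. nrm (%x. norm (dv j u x)))"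
    by (intro nrm_sum cd)
   also have "(SUM j:UNIV. nrm (%x. norm (dv j u x))) = (SUM j:UNIV. nrm (dv j u))"
    by (simp add: nrm_def ip_def power2_norm_eq_inner[symmetric] power2_eq_square)
   finally show ?thesis using B(1) by (simp add: mult_left_mono)
  qed
  then have "gnrm u <= (SUM b:(Basis::(real^3) set). B * (SUM j:UNIV. nrm (dv j u)))"
   unfolding gnrm_def by (intro sum_mono)
  then show ?thesis by simp
 qed
 then show ?thesis using B(1) by (intro exI[of _ "real DIM(real^3) * B"]) auto
qed

text \<open>In the square of \<open>nrm (D u)\<close> the diagonal terms are the squares of
  \<open>nrm (dv j u)\<close>, because each \<open>J j\<close> is orthogonal. The cross terms look
  quadratic in the gradient, but \<open>garding_term\<close> bounds them by
  \<open>nrm u * gnrm u\<close>. The resulting inequality is quadratic in \<open>gnrm u\<close> and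
  is solved at the end.\<close>

lemma garding:
 assumes L: "compact L" "L <= S"
 shows "EX C>=0. ALL u. ccs L u --> gnrm u <= C * (nrm (D u) + nrm u)"
proof -
 obtain a where a: "!!i b. ccs S (a i b)" "!!i u x. ccs L (u :: real^3 => 'q) ==> dv i u x = (SUM b:Basis. a i b x *R DD u x b)"
  by (rule ex_coefficients[OF L, where 'b='q]) (rule that)
 obtain B where B: "B >= 0" "!!u :: real^3 => 'q. ccs L u ==> gnrm u <= B * (SUM j:UNIV. nrm (dv j u))"
  using gnrm_le_dv[OF L, where 'b='q] by (elim exE conjE) blast
 define P where "P j k b c C \<longleftrightarrow> C >= 0 & (ALL u T. ccs T u --> \<bar>ip (%x. (a j b x * a k c x) *R DD u x b) (%x. J j (J k (DD u x c)))\<bar>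
  <= C * nrm u * (nrm (%x. DD u x b) + nrm (%x. DD u x c)))" for j k b c C
 \<comment> \<open>A constant is guaranteed only for \<open>j ~= k\<close>, where the product of
   \<open>J j\<close> and \<open>J k\<close> is skew. The sums below omit the diagonal.\<close>
 define C where "C j k b c = (SOME C. P j k b c C)" for j k b c
 have PC: "P j k b c (C j k b c)" if "j ~= k" for j k b c
 proof -
  have "EX C. P j k b c C" unfolding P_def
   by (rule garding_term[OF ccs_mult_smooth[OF a(1) open_UNIV subset_UNIV ccs_smooth[OF a(1)]]
     bounded_linear_compose[OF bounded_linear_J bounded_linear_J] JJ_skew[OF that]])
  then show ?thesis unfolding C_def by (rule someI_ex)
 qed
 have C1: "C j k b c >= 0" if "j ~= k" for j k b c
  by (rule PC[OF that, unfolded P_def, THEN conjunct1])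
 have C2: "\<bar>ip (%x. (a j b x * a k c x) *R DD u x b) (%x. J j (J k (DD u x c)))\<bar>
  <= C j k b c * nrm u * (nrm (%x. DD u x b) + nrm (%x. DD u x c))" if "j ~= k" "ccs T u" for j k b c u T
  by (rule PC[OF that(1), unfolded P_def, THEN conjunct2, rule_format, OF that(2)])
 define E where "E = (SUM j:UNIV. SUM k:UNIV - {j}. SUM b:Basis. SUM c:Basis. C j k b c * 2)"
 have E: "E >= 0" unfolding E_def by (intro sum_nonneg mult_nonneg_nonneg C1) auto
 \<comment> \<open>The 3 is the number of frame fields, from the square of a sum against the sum of
   squares.\<close>
 define H where "H = B^2 * 3"
 have main: "gnrm u <= (sqrt H + H * E + 0) * (nrm (D u) + nrm u)" if u: "ccs L u" for u
 proof -
  let ?d = "%b x. DD u x b"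
  have cd: "cc0 (dv j u)" for j by (rule ccs_cc0[OF dv_ccs[OF u L(2)]])
  have cdd: "cc0 (?d b)" for b by (rule ccs_cc0[OF ccs_deriv[OF u]])
  have cJd: "cc0 (%x. J i (dv j u x))" for i j by (intro cc0_bounded_linear[OF bounded_linear_J] cd)
  have g: "nrm (?d b) <= gnrm u" if "b : Basis" for b
   unfolding gnrm_def using that by (intro member_le_sum nrm_ge_0) auto
  have cross: "\<bar>ip (%x. J j (dv j u x)) (%x. J k (dv k u x))\<bar> <= (SUM b:Basis. SUM c:Basis. C j k b c * 2) * (nrm u * gnrm u)"
   if jk: "j ~= k" for j k
  proof -
   have "ip (%x. J j (dv j u x)) (%x. J k (dv k u x)) = - (LINT x|lborel. dv j u x \<bullet> J j (J k (dv k u x)))"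
    by (simp add: ip_def J_skew)
   also have "(%x. dv j u x \<bullet> J j (J k (dv k u x)))
     = (%x. SUM b:Basis. SUM c:Basis. ((a j b x * a k c x) *R ?d b x) \<bullet> J j (J k (?d c x)))"
    unfolding a(2)[OF u]
    by (rule ext, subst sum.swap)
      (simp add: linear_sum[OF linear_J] linear_scale[OF linear_J] inner_sum_left inner_sum_right sum_distrib_left mult_ac)
   also have "(LINT x|lborel. (SUM b:Basis. SUM c:Basis. ((a j b x * a k c x) *R ?d b x) \<bullet> J j (J k (?d c x))))
     = (SUM b:Basis. SUM c:Basis. ip (%x. (a j b x * a k c x) *R ?d b x) (%x. J j (J k (?d c x))))"
   proof -
    have "integrable lborel (%x. ((a j b x * a k c x) *R ?d b x) \<bullet> J j (J k (?d c x)))" for b c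
     by (intro ip_integrable cc0_bounded_linear[OF bounded_linear_J] cdd cc0_scaleR cc0_mult
       ccs_cc0[OF a(1)] cc0_continuous[OF ccs_cc0[OF a(1)]] cc0_continuous[OF cdd])
    then show ?thesis unfolding ip_def by (simp add: Bochner_Integration.integral_sum)
   qed
   finally have "\<bar>ip (%x. J j (dv j u x)) (%x. J k (dv k u x))\<bar>
     = \<bar>SUM b:Basis. SUM c:Basis. ip (%x. (a j b x * a k c x) *R ?d b x) (%x. J j (J k (?d c x)))\<bar>" by simp
   also have "... <= (SUM b:Basis. SUM c:Basis. \<bar>ip (%x. (a j b x * a k c x) *R ?d b x) (%x. J j (J k (?d c x)))\<bar>)"
    by (intro order_trans[OF sum_abs] sum_mono sum_abs)
   also have "... <= (SUM b:Basis. SUM c:Basis. C j k b c * nrm u * (nrm (?d b) + nrm (?d c)))"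
    by (intro sum_mono C2[OF jk u])
   also have "... <= (SUM b:Basis. SUM c:Basis. C j k b c * nrm u * (gnrm u + gnrm u))"
    by (intro sum_mono mult_left_mono add_mono g mult_nonneg_nonneg C1[OF jk] nrm_ge_0)
   also have "... = (SUM b:Basis. SUM c:Basis. C j k b c * 2) * (nrm u * gnrm u)"
    by (simp add: sum_distrib_left mult_ac)
   finally show ?thesis .
  qed
  have sq: "(SUM j:UNIV. (nrm (dv j u))^2) <= (nrm (D u))^2 + E * (nrm u * gnrm u)"
  proof -
   have "(nrm (D u))^2 = (LINT x|lborel. (SUM j:UNIV. SUM k:UNIV. J j (dv j u x) \<bullet> J k (dv k u x)))"
    unfolding nrm_sq ip_def D_def by (subst inner_sum_left, subst inner_sum_right) (rule refl)
   also have "... = (SUM j:UNIV. SUM k:UNIV. ip (%x. J j (dv j u x)) (%x. J k (dv k u x)))"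
    unfolding ip_def using ip_integrable[OF cJd cJd] by (simp add: Bochner_Integration.integral_sum)
   also have "... = (SUM j:UNIV. (nrm (dv j u))^2 + (SUM k:UNIV - {j}. ip (%x. J j (dv j u x)) (%x. J k (dv k u x))))"
   proof (rule sum.cong[OF refl])
    fix j :: 3
    have "ip (%x. J j (dv j u x)) (%x. J j (dv j u x)) = (nrm (dv j u))^2" by (simp add: nrm_sq ip_def inner_J)
    then show "(SUM k:UNIV. ip (%x. J j (dv j u x)) (%x. J k (dv k u x))) = (nrm (dv j u))^2 + (SUM k:UNIV - {j}. ip (%x. J j (dv j u x)) (%x. J k (dv k u x)))"
     by (subst sum.remove[of UNIV j]) simp_all
   qed
   also have "... >= (SUM j:UNIV. (nrm (dv j u))^2 - (SUM k:UNIV - {j}. (SUM b:Basis. SUM c:Basis. C j k b c * 2) * (nrm u * gnrm u)))"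
   proof (intro sum_mono)
    fix j :: 3
    have "\<bar>SUM k:UNIV - {j}. ip (%x. J j (dv j u x)) (%x. J k (dv k u x))\<bar>
     <= (SUM k:UNIV - {j}. (SUM b:Basis. SUM c:Basis. C j k b c * 2) * (nrm u * gnrm u))"
     by (intro order_trans[OF sum_abs] sum_mono cross) auto
    then show "(nrm (dv j u))^2 - (SUM k:UNIV - {j}. (SUM b:Basis. SUM c:Basis. C j k b c * 2) * (nrm u * gnrm u))
     <= (nrm (dv j u))^2 + (SUM k:UNIV - {j}. ip (%x. J j (dv j u x)) (%x. J k (dv k u x)))" by linarith
   qed
   finally show ?thesis by (simp add: E_def sum_subtractf sum_distrib_right)
  qed
  define s where "s = gnrm u"
  define A where "A = sqrt H * nrm (D u)"
  define N where "N = H * E * nrm u"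
  have H: "H >= 0" by (simp add: H_def)
  have AN: "A >= 0" "N >= 0" "s >= 0" using H E by (simp_all add: A_def N_def s_def nrm_ge_0 gnrm_ge_0)
  have "s <= B * (SUM j:UNIV. nrm (dv j u))" unfolding s_def by (rule B(2)[OF u])
  then have "s^2 <= (B * (SUM j:UNIV. nrm (dv j u)))^2" using AN by (intro power_mono) auto
  also have "... <= B^2 * (3 * (SUM j:UNIV. (nrm (dv j u))^2))"
   using sum_squared_le_sum_of_squares[of "%j. nrm (dv j u)" "UNIV :: 3 set"] unfolding power_mult_distrib
   by (intro mult_left_mono) (auto simp: mult.commute)
  also have "... <= H * ((nrm (D u))^2 + E * (nrm u * gnrm u))"
   using mult_left_mono[OF sq H] by (simp add: H_def mult.assoc)
  also have "... = A^2 + N * s" using H by (simp add: A_def N_def s_def power_mult_distrib algebra_simps)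
  finally have ss: "s^2 <= A^2 + N * s" .
  have "s <= A + N"
  proof (rule ccontr)
   assume "~ s <= A + N"
   then have lt: "A + N < s" by simp
   then have "s > 0" "A < s" using AN by auto
   have "A * A + N * s <= A * s + N * s" using AN \<open>A < s\<close> by (intro add_mono mult_left_mono) auto
   also have "... = (A + N) * s" by (simp add: algebra_simps)
   also have "... < s * s" using lt \<open>s > 0\<close> by simp
   finally show False using ss by (simp add: power2_eq_square)
  qed
  also have "A + N <= (sqrt H + H * E) * nrm (D u) + (sqrt H + H * E) * nrm u"
   unfolding A_def N_def using H E by (intro add_mono mult_right_mono nrm_ge_0) auto
  finally show ?thesis by (simp add: s_def distrib_left)
 qed
 have "sqrt H + H * E >= 0" using E by (simp add: H_def)
 then show ?thesis using main by (intro exI[of _ "sqrt H + H * E + 0"]) auto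
qed

end

section \<open>Difference quotients\<close>

definition dq :: "real => 'a => ('a::euclidean_space => 'b::real_normed_vector) => 'a => 'b" where
 "dq h b u x = inverse h *R (u (x + h *R b) - u x)"

primrec dql :: "real => 'a list => ('a::euclidean_space => 'b::real_normed_vector) => 'a => 'b" where
 "dql h [] u = u"
| "dql h (b # be) u = dq h b (dql h be u)"

lemma dq_commute: "dq h b (dq h c u) = dq h c (dq h b u)"
 by (simp add: dq_def fun_eq_iff scaleR_diff_right algebra_simps)

lemma dql_dq: "dql h be (dq h b u) = dq h b (dql h be u)"
 by (induction be) (simp_all add: dq_commute)

lemma dq_translate: "dq h b (%x. u (x + c)) = (%x. dq h b u (x + c))"
 by (simp add: dq_def fun_eq_iff algebra_simps)

lemma dql_translate: "dql h be (%x. u (x + c)) = (%x. dql h be u (x + c))"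
 by (induction be) (simp_all add: dq_translate)

lemma dq_add: "dq h b (%x. u x + v x) = (%x. dq h b u x + dq h b v x)"
 by (simp add: dq_def fun_eq_iff scaleR_diff_right scaleR_add_right)
lemma dql_add: "dql h be (%x. u x + v x) = (%x. dql h be u x + dql h be v x)"
 by (induction be) (simp_all add: dq_add)
lemma dq_diff: "dq h b (%x. u x - v x) = (%x. dq h b u x - dq h b v x)"
 by (simp add: dq_def fun_eq_iff scaleR_diff_right)

lemma dq_linear: "linear L ==> dq h b (%x. L (u x)) = (%x. L (dq h b u x))"
 by (simp add: dq_def fun_eq_iff linear_scale linear_diff)
lemma dql_linear: "linear L ==> dql h be (%x. L (u x)) = (%x. L (dql h be u x))"
 by (induction be) (simp_all add: dq_linear)
lemma dql_zero: "dql h be (%x. 0) = (%x. 0)"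
 by (induction be) (simp_all add: dq_def)
lemma dql_sum: "dql h be (%x. SUM i:I. u i x) = (%x. SUM i:I. dql h be (u i) x)"
 by (induction I rule: infinite_finite_induct) (simp_all add: dql_zero dql_add)

lemma dq_scaleR:
 "dq h b (%x. a x *R u x) = (%x. a x *R dq h b u x + dq h b a x *R u (x + h *R b))"
 by (simp add: dq_def fun_eq_iff algebra_simps)

lemma cc0_scaleR_right: "cc0 v ==> continuous_on UNIV a ==> cc0 (%x. a x *R v x)"
 unfolding cc0_def by (auto intro!: continuous_intros)

lemma continuous_dq: assumes "continuous_on UNIV u" shows "continuous_on UNIV (dq h b u)"
proof -
 have "continuous_on UNIV (%x. u (x + h *R b))"
  by (rule continuous_on_compose2[OF assms]) (auto intro!: continuous_intros)
 then show ?thesis unfolding dq_def[abs_def] by (intro continuous_intros assms)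
qed

lemma cc0_dq: "cc0 u ==> cc0 (dq h b u)"
 unfolding dq_def[abs_def] by (intro cc0_scale cc0_diff cc0_translate)
lemma cc0_dql: "cc0 u ==> cc0 (dql h be u)"
 by (induction be) (simp_all add: cc0_dq)

lemma smooth_dq: "smooth_on UNIV u ==> smooth_on UNIV (dq h b u)"
 unfolding dq_def[abs_def] by (intro smooth_on_scale smooth_on_diff smooth_on_translate open_UNIV)
lemma smooth_dql: "smooth_on UNIV u ==> smooth_on UNIV (dql h be u)"
 by (induction be) (simp_all add: smooth_dq)

text \<open>Each quotient enlarges the support by at most \<open>h\<close>, as basis vectors have
  length 1. The distance function measures this because it is Lipschitz with constant 1.\<close>

lemma dql_support:
 assumes "!!x. infdist x K > 0 ==> u x = 0" "set be <= Basis" "h > 0"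
 shows "infdist x K > h * real (length be) ==> dql h be u x = 0"
 using assms(2)
proof (induction be arbitrary: x)
 case (Cons b be)
 have "infdist x K <= infdist (x + h *R b) K + dist x (x + h *R b)" by (rule infdist_triangle)
 moreover have "dist x (x + h *R b) = h" using Cons.prems assms(3) by (simp add: dist_norm)
 ultimately have "infdist (x + h *R b) K > h * real (length be)" "infdist x K > h * real (length be)"
  using Cons.prems(1) assms(3) by (simp_all add: algebra_simps)
 then show ?case using Cons.IH Cons.prems(2) by (simp add: dq_def)
qed (use assms in simp)

lemma ccs_dq: assumes "ccs UNIV u" shows "ccs UNIV (dq h b u)"
proof -
 obtain R where R: "ALL x. norm x > R --> dq h b u x = 0" using cc0_dq[OF ccs_cc0[OF assms]] unfolding cc0_def by blast
 show ?thesis unfolding ccs_def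
  by (intro conjI smooth_dq ccs_smooth[OF assms] exI[of _ "cball 0 R"]) (use R in auto)
qed
lemma ccs_dql: "ccs UNIV u ==> ccs UNIV (dql h be u)"
 by (induction be) (simp_all add: ccs_dq)

lemma dir_deriv_dq:
 assumes "smooth_on UNIV u" shows "DD (dq h b u) x c = dq h b (%x. DD u x c) x"
proof -
 have "DD (dq h b u) x c = inverse h *R DD (%x. u (x + h *R b) - u x) x c"
  unfolding dq_def[abs_def]
  by (rule dir_deriv_linear[OF bounded_linear_scaleR_right _ UNIV_I])
    (intro smooth_on_diff smooth_on_translate assms open_UNIV)
 also have "DD (%x. u (x + h *R b) - u x) x c = DD u (x + h *R b) c - DD u x c"
  using dir_deriv_diff[OF smooth_on_translate[OF assms] assms UNIV_I] dir_deriv_translate[OF assms] by simp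
 finally show ?thesis by (simp add: dq_def[abs_def])
qed

lemma dir_deriv_dql:
 "smooth_on UNIV u ==> DD (dql h be u) x c = dql h be (%x. DD u x c) x"
proof (induction be arbitrary: x)
 case (Cons b be)
 have "(%x. DD (dql h be u) x c) = dql h be (%x. DD u x c)" using Cons by blast
 then show ?case using dir_deriv_dq[OF smooth_dql[OF Cons.prems]] by simp
qed simp

lemma nrm_dq_le_deriv:
 assumes "ccs S u" "h > 0" shows "nrm (dq h b u) <= nrm (%x. DD u x b)"
proof -
 have lin: "linear (DD u x)" for x by (rule linear_DD[OF ccs_smooth[OF assms(1)] UNIV_I])
 have "nrm (dq h b u) = inverse h * nrm (%x. u (x + h *R b) - u x)"
  unfolding dq_def[abs_def] nrm_scale using assms by simp
 also have "... <= inverse h * nrm (%x. DD u x (h *R b))"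
  using assms by (intro mult_left_mono nrm_shift_le[OF assms(1)]) auto
 also have "... = nrm (%x. DD u x b)"
  unfolding linear_scale[OF lin] nrm_scale using assms by simp
 finally show ?thesis .
qed

lemma nrm_dq_le:
 assumes "cc0 u" "h > 0" shows "nrm (dq h b u) <= (2 / h) * nrm u"
proof -
 have "nrm (dq h b u) = inverse h * nrm (%x. u (x + h *R b) - u x)"
  unfolding dq_def[abs_def] nrm_scale using assms by simp
 also have "nrm (%x. u (x + h *R b) - u x) <= 2 * nrm u"
  using nrm_diff[OF cc0_translate[OF assms(1)] assms(1)] nrm_translate[OF assms(1)] by simp
 finally show ?thesis using assms by (simp add: field_simps)
qed

text \<open>A bound that is useless for small \<open>h\<close>. It will be applied only to cut-offs
  of \<open>D (f n)\<close>, whose norm can be made as small as desired after \<open>h\<close> has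
  been fixed.\<close>

lemma nrm_dql_le:
 assumes "cc0 u" "h > 0" shows "nrm (dql h be u) <= (2 / h) ^ length be * nrm u"
proof (induction be)
 case (Cons b be)
 have "nrm (dql h (b # be) u) <= (2 / h) * nrm (dql h be u)"
  using nrm_dq_le[OF cc0_dql[OF assms(1)] assms(2)] by simp
 also have "... <= (2 / h) * ((2 / h) ^ length be * nrm u)"
  using Cons assms by (intro mult_left_mono) auto
 finally show ?case by simp
qed simp

lemma norm_dq_le:
 fixes u :: "'a::euclidean_space => 'b::real_normed_vector"
 assumes "smooth_on UNIV u" "h > 0" "!!x. norm (DD u x b) <= B"
 shows "norm (dq h b u x) <= B"
proof -
 have "norm (u (x + h *R b) - u (x + 0 *R b)) <= B * norm (h - 0)"
 proof (rule differentiable_bound[where S=UNIV and f'="%t d. d *R DD u (x + t *R b) b"])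
  fix t :: real
  have g: "((%t. x + t *R b) has_derivative (%d. d *R b)) (at t)" by (auto intro!: derivative_eq_intros)
  have k: "(u has_derivative DD u (x + t *R b)) (at (x + t *R b))"
   by (rule smooth_has_deriv[OF assms(1) UNIV_I])
  show "((%t. u (x + t *R b)) has_derivative (%d. d *R DD u (x + t *R b) b)) (at t)"
   using has_derivative_compose[OF g k] by (simp add: linear_scale[OF has_derivative_linear[OF k]])
  show "onorm (%d. d *R DD u (x + t *R b) b) <= B"
   by (rule onorm_le) (use assms(3) in "simp add: mult.commute[of B] mult_left_mono")
 qed auto
 then have "norm (u (x + h *R b) - u x) <= B * h" using assms(2) by simp
 moreover have "norm (dq h b u x) = norm (u (x + h *R b) - u x) / h"
  using assms(2) by (simp add: dq_def divide_inverse mult.commute)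
 ultimately show ?thesis using assms(2) by (simp add: pos_divide_le_eq)
qed

lemma dql_bounded:
 fixes a :: "'a::euclidean_space => 'b::real_normed_vector"
 shows "ccs S a ==> EX B. ALL h>0. ALL x. norm (dql h be a x) <= B"
proof (induction be arbitrary: a)
 case Nil then show ?case using ccs_bounded[OF Nil] by auto
next
 case (Cons b be)
 obtain B where B: "ALL h>0. ALL x. norm (dql h be (%x. DD a x b) x) <= B"
  using Cons.IH[OF ccs_deriv[OF Cons.prems]] by blast
 have "norm (dql h (b # be) a x) <= B" if "h > 0" for h x
  using norm_dq_le[OF smooth_dql[OF ccs_smooth[OF Cons.prems]] that] B that
  by (simp add: dir_deriv_dql[OF ccs_smooth[OF Cons.prems]])
 then show ?case by (intro exI[of _ B] allI impI)
qed

section \<open>Products and commutators under difference quotients\<close>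

text \<open>Multi-indices of order at most \<open>k\<close>, kept as words. There are finitely many,
  so constants that depend on the word can be added up.\<close>

definition words :: "nat => 'a::euclidean_space list set" where
 "words k = {be. set be <= Basis & length be <= k}"

lemma finite_words: "finite (words k)"
 unfolding words_def by (rule finite_lists_length_le) simp

lemma words_mono: "be : words k ==> k <= l ==> be : words l" by (auto simp: words_def)
lemma words_Cons: "b # be : words (Suc k) \<longleftrightarrow> b : Basis & be : words k" by (auto simp: words_def)
lemma words_Nil: "[] : words k" by (simp add: words_def)

lemma dql_bounded_words:
 fixes a :: "'a::euclidean_space => 'b::real_normed_vector"
 assumes "ccs S a" shows "EX B>=0. ALL be:words k. ALL h>0. ALL x. norm (dql h be a x) <= B"
proof -
 have "ALL be. EX B. ALL h>0. ALL x. norm (dql h be a x) <= B" using dql_bounded[OF assms] by blast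
 from choice[OF this] obtain B where "ALL be. ALL h>0. ALL x. norm (dql h be a x) <= B be" ..
 then have B: "h > 0 ==> norm (dql h be a x) <= B be" for be h x by simp
 have "norm (dql h be a x) <= (SUM be:words k. \<bar>B be\<bar>)" if "h > 0" "be : words k" for h x be
 proof -
  have "\<bar>B be\<bar> <= (SUM be:words k. \<bar>B be\<bar>)" by (rule member_le_sum[OF that(2)]) (simp_all add: finite_words)
  then show ?thesis using B[OF that(1), of be x] by linarith
 qed
 then show ?thesis by (intro exI[of _ "SUM be:words k. \<bar>B be\<bar>"]) (simp add: sum_nonneg)
qed

text \<open>The discrete Leibniz rule doubles the number of terms with each quotient. It also
  translates \<open>u\<close>, which does not change its norm.\<close>

lemma dql_mult_le:
 assumes "h > 0" "B >= 0"
 shows "cc0 u ==> continuous_on UNIV a ==> (!!ga x. ga : words k ==> \<bar>dql h ga a x\<bar> <= B) ==>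
  (!!ga. ga : words k ==> nrm (dql h ga u) <= C) ==> be : words k ==>
  nrm (dql h be (%x. a x *R u x)) <= 2 ^ k * B * C"
proof (induction k arbitrary: a u be)
 case 0
 then have b: "be = []" by (simp add: words_def)
 have "nrm (%x. a x *R u x) <= B * nrm u"
 proof (rule nrm_mono[OF cc0_scaleR_right[OF 0(1,2)] 0(1) _ assms(2)])
  show "norm (a x *R u x) <= B * norm (u x)" for x
   using 0(3)[OF words_Nil, of x] by (simp add: mult_right_mono)
 qed
 also have "... <= B * C" using 0(4)[OF words_Nil] assms by (intro mult_left_mono) auto
 finally show ?case by (simp add: b)
next
 case (Suc k)
 have C: "C >= 0" using order_trans[OF nrm_ge_0 Suc.prems(4)[OF words_Nil]] .
 note cu = Suc.prems(1) and ca = Suc.prems(2)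
 have cda: "continuous_on UNIV (dq h b a)" for b by (rule continuous_dq[OF ca])
 note au = cc0_scaleR_right
 show ?case
 proof (cases be)
  case Nil
  have "nrm (dql h [] (%x. a x *R u x)) <= 2 ^ k * B * C"
   by (rule Suc.IH[OF cu ca _ _ words_Nil]; intro Suc.prems(3,4); erule words_mono; simp)
  also have "... <= 2 ^ Suc k * B * C" using assms C by (intro mult_right_mono) auto
  finally show ?thesis using Nil by simp
 next
  case (Cons b ga)
  have b: "b : Basis" "ga : words k" using Suc.prems(5) Cons by (auto simp: words_Cons)
  have 1: "nrm (dql h ga (%x. a x *R dq h b u x)) <= 2 ^ k * B * C"
  proof (rule Suc.IH[OF cc0_dq[OF cu] ca _ _ b(2)])
   show "\<bar>dql h de a x\<bar> <= B" if "de : words k" for de x by (intro Suc.prems(3) words_mono[OF that]) simp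
   show "nrm (dql h de (dq h b u)) <= C" if "de : words k" for de
    using Suc.prems(4)[of "b # de"] that b by (simp add: words_Cons dql_dq)
  qed
  have 2: "nrm (dql h ga (%x. dq h b a x *R u (x + h *R b))) <= 2 ^ k * B * C"
  proof (rule Suc.IH[OF cc0_translate[OF cu] cda _ _ b(2)])
   show "\<bar>dql h de (dq h b a) x\<bar> <= B" if "de : words k" for de x
    using Suc.prems(3)[of "b # de"] that b by (simp add: words_Cons dql_dq)
   show "nrm (dql h de (%x. u (x + h *R b))) <= C" if "de : words k" for de
    unfolding dql_translate nrm_translate[OF cc0_dql[OF cu]] by (intro Suc.prems(4) words_mono[OF that]) simp
  qed
  have "dql h be (%x. a x *R u x)
    = (%x. dql h ga (%x. a x *R dq h b u x) x + dql h ga (%x. dq h b a x *R u (x + h *R b)) x)"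
   by (simp add: Cons dql_dq[symmetric] dq_scaleR dql_add)
  then have "nrm (dql h be (%x. a x *R u x))
    = nrm (%x. dql h ga (%x. a x *R dq h b u x) x + dql h ga (%x. dq h b a x *R u (x + h *R b)) x)"
   by (rule arg_cong)
  also have "... <= nrm (dql h ga (%x. a x *R dq h b u x)) + nrm (dql h ga (%x. dq h b a x *R u (x + h *R b)))"
   by (intro nrm_add cc0_dql au cc0_dq cu ca cc0_translate cda)
  finally have "nrm (dql h be (%x. a x *R u x)) <= 2 ^ k * B * C + 2 ^ k * B * C" using 1 2 by linarith
  then show ?thesis by (simp add: algebra_simps)
 qed
qed

text \<open>The term in which all quotients fall on \<open>u\<close> cancels in the commutator.
  Therefore only words shorter than \<open>k\<close> have to be controlled for \<open>u\<close>, and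
  this is what lets the regularity induction close.\<close>

lemma dql_commutator_le:
 assumes "h > 0" "B >= 0"
 shows "cc0 u ==> continuous_on UNIV a ==> (!!ga x. ga : words k ==> \<bar>dql h ga a x\<bar> <= B) ==>
  (!!ga. length ga < k ==> set ga <= Basis ==> nrm (dql h ga u) <= C) ==> C >= 0 ==> be : words k ==>
  nrm (%x. dql h be (%x. a x *R u x) x - a x *R dql h be u x) <= real k * 2 ^ k * B * C"
proof (induction k arbitrary: a u be)
 case 0
 then show ?case by (simp add: words_def nrm_zero)
next
 case (Suc k)
 note cu = Suc.prems(1) and ca = Suc.prems(2) and C = Suc.prems(5)
 have cda: "continuous_on UNIV (dq h b a)" for b by (rule continuous_dq[OF ca])
 note au = cc0_scaleR_right
 show ?case
 proof (cases be)
  case Nil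
  then show ?thesis using assms C by (simp add: nrm_zero)
 next
  case (Cons b ga)
  have b: "b : Basis" "ga : words k" using Suc.prems(6) Cons by (auto simp: words_Cons)
  let ?X = "%x. dql h ga (%x. a x *R dq h b u x) x - a x *R dql h ga (dq h b u) x"
  let ?Y = "dql h ga (%x. dq h b a x *R u (x + h *R b))"
  have 1: "nrm ?X <= real k * 2 ^ k * B * C"
  proof (rule Suc.IH[OF cc0_dq[OF cu] ca _ _ C b(2)])
   show "\<bar>dql h de a x\<bar> <= B" if "de : words k" for de x by (intro Suc.prems(3) words_mono[OF that]) simp
   show "nrm (dql h de (dq h b u)) <= C" if "length de < k" "set de <= Basis" for de
    using Suc.prems(4)[of "b # de"] that b by (simp add: dql_dq)
  qed
  have 2: "nrm ?Y <= 2 ^ k * B * C"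
  proof (rule dql_mult_le[OF assms cc0_translate[OF cu] cda _ _ b(2)])
   show "\<bar>dql h de (dq h b a) x\<bar> <= B" if "de : words k" for de x
    using Suc.prems(3)[of "b # de"] that b by (simp add: words_Cons dql_dq)
   show "nrm (dql h de (%x. u (x + h *R b))) <= C" if "de : words k" for de
    unfolding dql_translate nrm_translate[OF cc0_dql[OF cu]] using Suc.prems(4)[of de] that by (simp add: words_def)
  qed
  have cX: "cc0 ?X" by (intro cc0_diff cc0_dql au cc0_dq cu ca)
  have cY: "cc0 ?Y" by (intro cc0_dql au cc0_translate cu cda)
  have "(%x. dql h be (%x. a x *R u x) x - a x *R dql h be u x) = (%x. ?X x + ?Y x)"
   by (simp add: Cons dql_dq[symmetric] dq_scaleR dql_add fun_eq_iff)
  then have "nrm (%x. dql h be (%x. a x *R u x) x - a x *R dql h be u x) <= real k * 2 ^ k * B * C + 2 ^ k * B * C"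
   using nrm_add[OF cX cY] 1 2 by simp
  also have "... = (real (Suc k) * 2 ^ k) * (B * C)" by (simp add: algebra_simps)
  also have "... <= (real (Suc k) * 2 ^ Suc k) * (B * C)"
   using assms C by (intro mult_right_mono mult_left_mono) auto
  finally show ?thesis by (simp add: mult.assoc)
 qed
qed

section \<open>Interior regularity by difference quotients\<close>

context local_frame
begin

lemma D_cutoff:
 assumes "x : S" "ccs S th" "smooth_on S f"
 shows "D (%x. th x *R f x) x = th x *R D f x + (SUM i:UNIV. J i (dv i th x *R f x))"
proof -
 have "dv i (%x. th x *R f x) x = th x *R dv i f x + dv i th x *R f x" for i
  unfolding dv_def by (rule dir_deriv_bilinear[OF bounded_bilinear_scaleR ccs_smooth_on[OF assms(2)] assms(3,1)])
 then show ?thesis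
  by (simp add: D_def linear_add[OF linear_J] linear_scale[OF linear_J] sum.distrib scaleR_sum_right)
qed

end

text \<open>The empty set is a case of its own: \<open>infdist\<close> to it is 0 by convention, so
  its thickening would be the whole space.\<close>

lemma thickening:
 fixes K S :: "'a::euclidean_space set"
 assumes "compact K" "open S" "K <= S"
 obtains d where "d > 0" "compact {x. infdist x K <= d}" "{x. infdist x K <= d} <= S" | "K = {}"
proof (cases "K = {}")
 case False
 obtain e where e: "e > 0" "(UN x:K. ball x e) <= S" using compact_subset_open_imp_ball_epsilon_subset[OF assms] by blast
 define d where "d = e / 2"
 have sub: "{x. infdist x K <= d} <= S"
 proof
  fix x assume "x : {x. infdist x K <= d}"
  then have "infdist x K <= d" by simp
  obtain y where y: "y : K" "infdist x K = dist x y"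
   using infdist_attains_inf[OF compact_imp_closed[OF assms(1)] False] by blast
  then have "x : ball y e" using \<open>infdist x K <= d\<close> e by (simp add: d_def dist_commute)
  then show "x : S" using y e by blast
 qed
 have "closed {x. infdist x K <= d}"
  by (intro closed_Collect_le continuous_on_infdist continuous_on_id continuous_on_const)
 moreover have "bounded {x. infdist x K <= d}"
 proof -
  obtain R where R: "!!y. y : K ==> norm y <= R" using compact_imp_bounded[OF assms(1)] bounded_iff by blast
  have "norm x <= R + d" if "infdist x K <= d" for x
  proof -
   obtain y where y: "y : K" "infdist x K = dist x y"
    using infdist_attains_inf[OF compact_imp_closed[OF assms(1)] False] by blast
   show ?thesis using R[OF y(1)] that norm_triangle_ineq2[of x y] by (simp add: y(2) dist_norm)
  qed
  then show ?thesis unfolding bounded_iff by blast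
 qed
 ultimately have "compact {x. infdist x K <= d}" using compact_eq_bounded_closed by blast
 moreover have "d > 0" using e by (simp add: d_def)
 ultimately show ?thesis using sub that(1) by blast
qed (rule that(2))

lemma nrm_partial_le_gnrm: "b : Basis ==> nrm (%x. DD u x b) <= gnrm u"
 unfolding gnrm_def by (intro member_le_sum nrm_ge_0) auto

text \<open>A local stand-in for a weak solution: a sequence that is locally bounded in L^2 and
  whose images under \<open>D\<close> tend to 0 locally in L^2. The functions themselves are smooth,
  but with no bounds on their derivatives.\<close>

locale approximate_solutions = local_frame J S V
 for J :: "3 => 'q::euclidean_space => 'q" and S V +
 fixes f :: "nat => real^3 => 'q"
 assumes smooth_f: "smooth_on S (f n)"
  and bounded_f: "ccs S th ==> EX C. ALL n. nrm (%x. th x *R f n x) <= C"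
  and D_f: "ccs S th ==> (%n. nrm (%x. th x *R D (f n) x)) \<longlonglongrightarrow> 0"
begin

definition w :: "(real^3 => real) => nat => real^3 => 'q" where
 "w th n x = th x *R f n x"

lemma w_ccs: "ccs T th ==> T <= S ==> ccs T (w th n)"
 unfolding w_def[abs_def] by (rule ccs_scaleR_smooth[OF _ open_S _ smooth_f])

lemma smooth_D_f: "smooth_on S (D (f n))"
proof -
 have "smooth_on S (%x. DD (f n) x (V i x))" for i
 proof (rule smooth_on_cong[OF open_S])
  show "smooth_on S (%x. SUM b:Basis. (V i x \<bullet> b) *R DD (f n) x b)"
   by (intro smooth_on_sum smooth_on_scaleR smooth_on_inner open_S smooth_V smooth_on_const smooth_on_deriv smooth_f)
  show "(SUM b:Basis. (V i x \<bullet> b) *R DD (f n) x b) = DD (f n) x (V i x)" if "x : S" for x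
   using basis_expand[OF linear_DD[OF smooth_f that], of n "V i x"] by simp
 qed
 then show ?thesis unfolding D_def[abs_def] dv_def by (intro smooth_on_sum smooth_J open_S)
qed

lemma D_w: assumes "ccs S th" shows "D (w th n) x = th x *R D (f n) x + (SUM i:UNIV. J i (w (dv i th) n x))"
proof (cases "x : S")
 case True
 then show ?thesis using D_cutoff[OF True assms smooth_f] by (simp add: w_def[abs_def])
next
 case False
 have z: "g x = 0" if "ccs S g" for g :: "real^3 => 'c::real_normed_vector" using that False unfolding ccs_def by blast
 show ?thesis using z[OF D_ccs[OF w_ccs[OF assms order_refl] order_refl]] z[OF assms] z[OF dv_ccs[OF assms order_refl]]
  by (simp add: w_def linear_0[OF linear_J])
qed

lemma D_w_bounded: assumes "ccs S th" shows "EX C. ALL n. nrm (D (w th n)) <= C"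
proof -
 have "EX C. ALL n. nrm (w (dv i th) n) <= C" for i
  unfolding w_def using bounded_f[OF dv_ccs[OF assms order_refl]] by blast
 then have "ALL i. EX C. ALL n. nrm (w (dv i th) n) <= C" by blast
 from choice[OF this] obtain C where "ALL i. ALL n. nrm (w (dv i th) n) <= C i" ..
 then have C: "nrm (w (dv i th) n) <= C i" for i n by blast
 have "Bseq (%n. nrm (%x. th x *R D (f n) x))" using D_f[OF assms] by (intro convergent_imp_Bseq convergentI)
 then obtain B where B: "!!n. nrm (%x. th x *R D (f n) x) <= B" unfolding Bseq_def by (auto simp: abs_le_iff)
 have "nrm (D (w th n)) <= B + (SUM i:UNIV. C i)" for n
 proof -
  have c1: "cc0 (%x. th x *R D (f n) x)"
   by (rule ccs_cc0[OF ccs_scaleR_smooth[OF assms open_S order_refl smooth_D_f]])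
  have c2: "cc0 (%x. J i (w (dv i th) n x))" for i
   by (intro cc0_bounded_linear[OF bounded_linear_J] ccs_cc0[OF w_ccs[OF dv_ccs[OF assms order_refl] order_refl]])
  have "nrm (D (w th n)) = nrm (%x. th x *R D (f n) x + (SUM i:UNIV. J i (w (dv i th) n x)))"
   using D_w[OF assms] by (intro arg_cong[of _ _ nrm] ext)
  also have "... <= nrm (%x. th x *R D (f n) x) + nrm (%x. SUM i:UNIV. J i (w (dv i th) n x))"
   by (intro nrm_add c1 cc0_sum c2)
  also have "nrm (%x. SUM i:UNIV. J i (w (dv i th) n x)) <= (SUM i:UNIV. nrm (%x. J i (w (dv i th) n x)))"
   by (intro nrm_sum c2)
  also have "... <= (SUM i:UNIV. C i)" unfolding nrm_J by (intro sum_mono C)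
  finally show ?thesis using B[of n] by linarith
 qed
 then show ?thesis by blast
qed

text \<open>A Caccioppoli inequality: Garding's inequality for the cut-off functions, whose images
  under \<open>D\<close> are bounded because the commutator of \<open>D\<close> with the cut-off has
  order zero.\<close>

lemma gnrm_w_bounded: assumes "ccs S th" shows "EX C>=0. ALL n. nrm (w th n) <= C & gnrm (w th n) <= C"
proof -
 obtain K where K: "compact K" "K <= S" "ALL x. x ~: K --> th x = 0" using assms unfolding ccs_def by blast
 have cK: "ccs K th" using assms K unfolding ccs_def by blast
 obtain G where G: "G >= 0" "!!u. ccs K u ==> gnrm u <= G * (nrm (D u) + nrm u)"
  using garding[OF K(1,2)] by (elim exE conjE) blast
 obtain A where A: "!!n. nrm (D (w th n)) <= A" using D_w_bounded[OF assms] by blast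
 obtain B where B: "!!n. nrm (w th n) <= B" unfolding w_def using bounded_f[OF assms] by blast
 have "gnrm (w th n) <= G * (A + B)" for n
  by (rule order_trans[OF G(2)[OF w_ccs[OF cK K(2)]]]) (intro mult_left_mono add_mono A B G)
 then show ?thesis using B order_trans[OF nrm_ge_0 B]
  by (intro exI[of _ "max B (G * (A + B))"]) (auto simp: max.coboundedI1 max.coboundedI2)
qed

section \<open>Bounds on all difference quotients\<close>

text \<open>The order of the choices is the point: \<open>C\<close> is to be independent of
  \<open>h\<close>, whereas the index from which the bound holds may depend on \<open>h\<close>,
  since the quotients of \<open>D (f n)\<close> cost powers of \<open>1 / h\<close>.\<close>

definition reg :: "nat => (real^3 => real) => real => real => bool" where
 "reg k th C h \<longleftrightarrow> (EX N. ALL n>=N. ALL ga:words k. nrm (dql h ga (w th n)) <= C & gnrm (dql h ga (w th n)) <= C)"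

text \<open>Garding's inequality is applied to a quotient of order \<open>k + 1\<close> of the
  cut-off solution. Its image under \<open>D\<close> is the quotient of \<open>D (w th n)\<close>
  minus commutators with the coefficients \<open>a\<close>. The commutators contain quotients of the
  gradient of order at most \<open>k\<close>, which the induction hypothesis bounds.\<close>

lemma reg_step:
 assumes IH: "!!th. ccs S th ==> EX C h0. h0 > 0 & (ALL h. 0 < h & h < h0 --> reg k th C h)"
  and th: "ccs S th"
 shows "EX C h0. h0 > 0 & (ALL h. 0 < h & h < h0 --> reg (Suc k) th C h)"
proof -
 obtain K where K: "compact K" "K <= S" "ALL x. x ~: K --> th x = 0" using th unfolding ccs_def by blast
 obtain d L where d: "d > 0" and L: "compact L" "L <= S" and Ld: "!!x. x ~: L ==> infdist x K > d | K = {}"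
 proof (rule thickening[OF K(1) open_S K(2)])
  fix d assume "d > 0" "compact {x. infdist x K <= d}" "{x. infdist x K <= d} <= S"
  then show thesis by (intro that[of d "{x. infdist x K <= d}"]) auto
 next
  assume "K = {}" then show thesis by (intro that[of 1 "{}"]) auto
 qed
 have wK: "w th n x = 0" if "x ~: K" for n x using K that by (simp add: w_def)
 have wu: "ccs UNIV (w th n)" for n by (rule ccs_mono[OF w_ccs[OF th order_refl]]) simp
 obtain a where a: "!!i b. ccs S (a i b)" "!!i u x. ccs L (u :: real^3 => 'q) ==> dv i u x = (SUM b:Basis. a i b x *R DD u x b)"
  by (rule ex_coefficients[OF L, where 'b='q]) (rule that)
 obtain G where G: "G >= 0" "!!u. ccs L u ==> gnrm u <= G * (nrm (D u) + nrm u)"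
  using garding[OF L] by (elim exE conjE) blast
 have "ALL p. EX B>=0. ALL ga:words (Suc k). ALL h>0. ALL x. norm (dql h ga (a (fst p) (snd p)) x) <= B"
  using dql_bounded_words[OF a(1)] by blast
 from choice[OF this] obtain B where B': "ALL p. B p >= 0 & (ALL ga:words (Suc k). ALL h>0. ALL x. norm (dql h ga (a (fst p) (snd p)) x) <= B p)" ..
 have B: "B (i, b) >= 0" "ga : words (Suc k) ==> h > 0 ==> \<bar>dql h ga (a i b) x\<bar> <= B (i, b)" for i b ga h x
  using B'[rule_format, of "(i, b)"] by auto
 obtain C1 h1 where h1: "h1 > 0" "!!h. 0 < h ==> h < h1 ==> reg k th C1 h" using IH[OF th] by blast
 \<comment> \<open>\<open>D\<close> also differentiates the cut-off, which brings in the functions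
   \<open>dv i th\<close>. This is why the induction runs over all cut-off functions at
   once.\<close>
 have "ALL i. EX p. snd p > 0 & (ALL h. 0 < h & h < snd p --> reg k (dv i th) (fst p) h)"
  using IH[OF dv_ccs[OF th order_refl]] by (metis fst_conv snd_conv)
 from choice[OF this] obtain p where p: "ALL i. snd (p i) > 0 & (ALL h. 0 < h & h < snd (p i) --> reg k (dv i th) (fst (p i)) h)" ..
 define C2 where "C2 i = fst (p i)" for i
 \<comment> \<open>The support of a quotient of order \<open>k + 1\<close> grows by at most
   \<open>h * (k + 1)\<close>; the bound \<open>d / (k + 2)\<close> keeps it inside
   \<open>L\<close>.\<close>
 define h0 where "h0 = min (min h1 (d / (real k + 2))) (Min (range (%i. snd (p i))))"
 define C' where "C' = \<bar>C1\<bar>"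
 define E where "E = (SUM i:(UNIV :: 3 set). SUM b:Basis. real (Suc k) * 2 ^ Suc k * B (i, b) * C') + (1 + (SUM i:(UNIV :: 3 set). C2 i))"
 define C where "C = max C' (G * (E + C'))"
 have h0: "h0 > 0" unfolding h0_def using h1 d p by (simp add: Min_gr_iff)
 have "reg (Suc k) th C h" if h: "0 < h" "h < h0" for h
 proof -
  have hh: "h < h1" "h * (real k + 2) < d" "h < snd (p i)" for i
   using h unfolding h0_def by (auto simp: field_simps)
  obtain N1 where N1: "!!n ga. n >= N1 ==> ga : words k ==> nrm (dql h ga (w th n)) <= C1 & gnrm (dql h ga (w th n)) <= C1"
   using h1(2)[OF h(1) hh(1)] unfolding reg_def by blast
  have "ALL i. EX N. ALL n>=N. ALL ga:words k. nrm (dql h ga (w (dv i th) n)) <= C2 i & gnrm (dql h ga (w (dv i th) n)) <= C2 i"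
   using p h(1) hh(3) unfolding reg_def C2_def by blast
  from choice[OF this] obtain N2 where N2: "ALL i. ALL n>=N2 i. ALL ga:words k. nrm (dql h ga (w (dv i th) n)) <= C2 i & gnrm (dql h ga (w (dv i th) n)) <= C2 i" ..
  \<comment> \<open>With \<open>h\<close> fixed, large \<open>n\<close> makes \<open>D (f n)\<close>
    small enough to pay for the factor \<open>(2 / h) ^ Suc k\<close> that its quotients cost. They
    then contribute the summand 1 in \<open>E\<close>.\<close>
  have "(h / 2) ^ Suc k > 0" using h by simp
  from LIMSEQ_D[OF D_f[OF th] this] obtain N3
   where N3': "ALL n>=N3. norm (nrm (%x. th x *R D (f n) x) - 0) < (h / 2) ^ Suc k" ..
  have N3: "nrm (%x. th x *R D (f n) x) < (h / 2) ^ Suc k" if "n >= N3" for n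
   using N3'[rule_format, OF that] nrm_ge_0[of "%x. th x *R D (f n) x"] by (simp only: diff_zero real_norm_def abs_of_nonneg)
  define N where "N = max (max N1 N3) (Max (range N2))"
  have N: "N >= N1" "N >= N3" "N >= N2 i" for i unfolding N_def by (auto simp: le_max_iff_disj)
  have "nrm (dql h ga (w th n)) <= C & gnrm (dql h ga (w th n)) <= C" if n: "n >= N" and ga: "ga : words (Suc k)" for n ga
  proof (cases "ga : words k")
   case True
   have "C1 <= C" by (simp add: C_def C'_def)
   then show ?thesis using N1[of n ga] True n N by (meson order_trans)
  next
   case False
   then obtain b0 be where b: "ga = b0 # be" using words_Nil by (cases ga) auto
   then have b0: "b0 : Basis" "be : words k" using ga by (auto simp: words_Cons)
   have len: "length ga = Suc k" using False ga by (auto simp: words_def)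
   have n1: "n >= N1" "n >= N3" "n >= N2 i" for i using n N order_trans by blast+
   let ?w = "w th n"
   let ?u = "dql h ga ?w"
   have sw: "smooth_on UNIV ?w" by (rule ccs_smooth[OF wu])
   have u0: "?u x = 0" if "x ~: L" for x
   proof (cases "K = {}")
    case True then have "?w = (%x. 0)" using wK by blast
    then show ?thesis by (simp add: dql_zero)
   next
    case False
    then have "infdist x K > d" using Ld[OF that] by blast
    moreover have "h * real (length ga) <= h * (real k + 2)" using h len by (intro mult_left_mono) auto
    ultimately have 1: "infdist x K > h * real (length ga)" using hh(2) by linarith
    show ?thesis
    proof (rule dql_support[OF _ _ h(1) 1])
     show "?w y = 0" if "infdist y K > 0" for y using wK[of y] that by (cases "y : K") auto
    qed (use ga in "auto simp: words_def")
   qed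
   have uL: "ccs L ?u" unfolding ccs_compact_iff[OF L(1)] using smooth_dql[OF sw] u0 by blast
   have wL: "ccs L ?w"
   proof -
    have "?w x = 0" if "x ~: L" for x
     using wK[of x n] Ld[OF that] d by (cases "x : K") auto
    then show ?thesis unfolding ccs_compact_iff[OF L(1)] using sw by blast
   qed
   have C10: "0 <= C1" using N1[OF n1(1) b0(2)] nrm_ge_0 order_trans by blast
   have nu: "nrm ?u <= C1"
   proof -
    have "nrm ?u <= nrm (%x. DD (dql h be ?w) x b0)"
     unfolding b dql.simps by (rule nrm_dq_le_deriv[OF ccs_dql[OF wu] h(1)])
    also have "... <= gnrm (dql h be ?w)" by (rule nrm_partial_le_gnrm[OF b0(1)])
    finally show ?thesis using N1[OF n1(1) b0(2)] by linarith
   qed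
   have cw: "cc0 (%x. J i (DD ?w x b))" for i b
    by (intro cc0_bounded_linear[OF bounded_linear_J] ccs_cc0[OF ccs_deriv[OF wu]])
   define X where "X i b = (%x. dql h ga (%x. a i b x *R J i (DD ?w x b)) x - a i b x *R dql h ga (%x. J i (DD ?w x b)) x)" for i b
   have ca: "continuous_on UNIV (a i b)" for i b by (rule cc0_continuous[OF ccs_cc0[OF a(1)]])
   have cX: "cc0 (X i b)" for i b unfolding X_def by (intro cc0_diff cc0_dql cc0_scaleR_right cw ca)
   have X: "nrm (X i b) <= real (Suc k) * 2 ^ Suc k * B (i, b) * C'" if "b : Basis" for i b
    unfolding X_def
   proof (rule dql_commutator_le[OF h(1) B(1) cw ca B(2)[OF _ h(1)] _ _ ga])
    fix de :: "(real^3) list" assume de: "length de < Suc k" "set de <= Basis"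
    have "nrm (dql h de (%x. J i (DD ?w x b))) = nrm (dql h de (%x. DD ?w x b))"
     unfolding dql_linear[OF linear_J] nrm_J ..
    also have "... = nrm (%x. DD (dql h de ?w) x b)" unfolding dir_deriv_dql[OF sw] ..
    also have "... <= gnrm (dql h de ?w)" by (rule nrm_partial_le_gnrm[OF that])
    also have "... <= C'" using N1[OF n1(1), of de] de by (auto simp: words_def C'_def)
    finally show "nrm (dql h de (%x. J i (DD ?w x b))) <= C'" .
   qed (simp_all add: C'_def)
   have Du: "D ?u x = dql h ga (D ?w) x - (SUM i:UNIV. SUM b:Basis. X i b x)" for x
   proof -
    have Dv: "D v = (%x. SUM i:UNIV. SUM b:Basis. a i b x *R J i (DD v x b))" if "ccs L v" for v
     unfolding D_def a(2)[OF that] by (simp add: linear_sum[OF linear_J] linear_scale[OF linear_J])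
    have "J i (DD ?u x b) = dql h ga (%x. J i (DD ?w x b)) x" for i b x
     unfolding dql_linear[OF linear_J] dir_deriv_dql[OF sw] ..
    then show ?thesis
     unfolding Dv[OF uL] Dv[OF wL] dql_sum X_def by (simp add: sum_subtractf)
   qed
   have DDw: "D ?w = (%x. th x *R D (f n) x + (SUM i:UNIV. J i (w (dv i th) n x)))" using D_w[OF th] by blast
   have c1: "cc0 (%x. th x *R D (f n) x)"
    by (rule ccs_cc0[OF ccs_scaleR_smooth[OF th open_S order_refl smooth_D_f]])
   have wi: "ccs UNIV (w (dv i th) n)" for i by (rule ccs_mono[OF w_ccs[OF dv_ccs[OF th order_refl] order_refl]]) simp
   have c2: "cc0 (%x. J i (w (dv i th) n x))" for i
    by (intro cc0_bounded_linear[OF bounded_linear_J] ccs_cc0[OF wi])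
   have 1: "nrm (dql h ga (%x. th x *R D (f n) x)) <= 1"
   proof -
    have "nrm (dql h ga (%x. th x *R D (f n) x)) <= (2 / h) ^ Suc k * nrm (%x. th x *R D (f n) x)"
     using nrm_dql_le[OF c1 h(1), of ga] unfolding len .
    also have "... <= (2 / h) ^ Suc k * (h / 2) ^ Suc k"
     using N3[OF n1(2)] h by (intro mult_left_mono less_imp_le) auto
    also have "... = 1" using h by (simp only: power_mult_distrib[symmetric]) simp
    finally show ?thesis .
   qed
   have 2: "nrm (dql h ga (%x. J i (w (dv i th) n x))) <= C2 i" for i
   proof -
    have "nrm (dql h ga (%x. J i (w (dv i th) n x))) = nrm (dql h ga (w (dv i th) n))"
     unfolding dql_linear[OF linear_J] nrm_J ..
    also have "... <= nrm (%x. DD (dql h be (w (dv i th) n)) x b0)"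
     unfolding b dql.simps by (rule nrm_dq_le_deriv[OF ccs_dql[OF wi] h(1)])
    also have "... <= gnrm (dql h be (w (dv i th) n))" by (rule nrm_partial_le_gnrm[OF b0(1)])
    also have "... <= C2 i" using N2 n1(3) b0(2) by blast
    finally show ?thesis .
   qed
   have "nrm (D ?u) = nrm (%x. dql h ga (D ?w) x - (SUM i:UNIV. SUM b:Basis. X i b x))"
    using Du by (intro arg_cong[of _ _ nrm] ext)
   also have "... <= nrm (dql h ga (D ?w)) + nrm (%x. SUM i:UNIV. SUM b:Basis. X i b x)"
    by (intro nrm_diff cc0_sum cX cc0_dql ccs_cc0[OF D_ccs[OF wL L(2)]])
   also have "nrm (%x. SUM i:UNIV. SUM b:Basis. X i b x) <= (SUM i:UNIV. nrm (%x. SUM b:Basis. X i b x))"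
    by (intro nrm_sum cc0_sum cX)
   also have "... <= (SUM i:UNIV. SUM b:Basis. real (Suc k) * 2 ^ Suc k * B (i, b) * C')"
    by (intro sum_mono order_trans[OF nrm_sum[OF cX]] X)
   also have "nrm (dql h ga (D ?w)) = nrm (%x. dql h ga (%x. th x *R D (f n) x) x + (SUM i:UNIV. dql h ga (%x. J i (w (dv i th) n x)) x))"
    unfolding DDw dql_add dql_sum ..
   also have "... <= nrm (dql h ga (%x. th x *R D (f n) x)) + nrm (%x. SUM i:UNIV. dql h ga (%x. J i (w (dv i th) n x)) x)"
    by (intro nrm_add cc0_sum cc0_dql c1 c2)
   also have "... <= 1 + (SUM i:UNIV. C2 i)"
    by (intro add_mono 1 order_trans[OF nrm_sum[OF cc0_dql[OF c2]]] sum_mono 2)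
   finally have "nrm (D ?u) <= E" by (simp add: E_def add.commute)
   then have "G * (nrm (D ?u) + nrm ?u) <= G * (E + C')"
    using nu C10 by (intro mult_left_mono add_mono G) (auto simp: C'_def)
   then have "gnrm ?u <= C" using G(2)[OF uL] by (simp add: C_def)
   moreover have "nrm ?u <= C" using nu by (simp add: C_def C'_def)
   ultimately show ?thesis by blast
  qed
  then show ?thesis unfolding reg_def by (intro exI[of _ N] allI impI ballI)
 qed
 then show ?thesis by (intro exI[of _ C] exI[of _ h0] conjI h0 allI impI) (elim conjE)
qed

lemma regularity: "ccs S th ==> EX C h0. h0 > 0 & (ALL h. 0 < h & h < h0 --> reg k th C h)"
proof (induction k arbitrary: th)
 case 0
 obtain C where "ALL n. nrm (w th n) <= C & gnrm (w th n) <= C" using gnrm_w_bounded[OF 0] by blast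
 then have "reg 0 th C h" for h unfolding reg_def by (simp add: words_def)
 then show ?case by (intro exI[of _ C] exI[of _ 1]) simp
next
 case (Suc k)
 show ?case by (rule reg_step[OF Suc.IH Suc.prems])
qed

end

section \<open>Smoothness of limits of approximate solutions\<close>

lemma smooth_pd: "smooth_on UNIV u ==> smooth_on UNIV (pd be u)"
 by (induction be) (simp_all add: smooth_on_deriv)

lemma pd_deriv: "smooth_on UNIV u ==> pd be (%x. DD u x b) = (%x. DD (pd be u) x b)"
proof (induction be)
 case (Cons c be)
 show ?case unfolding pd.simps Cons.IH[OF Cons.prems]
  by (rule ext) (rule dir_deriv_commute[OF open_UNIV smooth_pd[OF Cons.prems] UNIV_I])
qed simp

lemma dq_deriv_close:
 fixes v :: "'a::euclidean_space => 'b::real_normed_vector"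
 assumes v: "smooth_on UNIV v" and h: "h > 0" and E: "!!x. norm (DD (%x. DD v x b) x b) <= E"
 shows "norm (DD v x b - dq h b v x) <= h * E"
proof -
 have E0: "E >= 0" using order_trans[OF norm_ge_zero E] .
 have "norm ((v (x + h *R b) - h *R DD v x b) - (v (x + 0 *R b) - 0 *R DD v x b)) <= (h * E) * norm (h - 0)"
 proof (rule differentiable_bound[where S="{0..h}" and f'="%t d. d *R (DD v (x + t *R b) b - DD v x b)"])
  fix t :: real assume t: "t : {0..h}"
  have g: "((%t. x + t *R b) has_derivative (%d. d *R b)) (at t)" by (auto intro!: derivative_eq_intros)
  have k: "(v has_derivative DD v (x + t *R b)) (at (x + t *R b))"
   by (rule smooth_has_deriv[OF v UNIV_I])
  have "((%t. v (x + t *R b)) has_derivative (%d. d *R DD v (x + t *R b) b)) (at t)"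
   using has_derivative_compose[OF g k] by (simp add: linear_scale[OF has_derivative_linear[OF k]])
  from has_derivative_diff[OF this bounded_linear_imp_has_derivative[OF bounded_linear_scaleR_left, of "DD v x b" "at t"]]
  show "((%t. v (x + t *R b) - t *R DD v x b) has_derivative (%d. d *R (DD v (x + t *R b) b - DD v x b))) (at t within {0..h})"
   unfolding scaleR_diff_right by (rule has_derivative_at_withinI)
  have "norm (DD v (x + t *R b) b - DD v x b) <= h * E"
  proof (cases "t = 0")
   case False
   then have t0: "t > 0" using t by simp
   have "norm (dq t b (%x. DD v x b) x) <= E"
    by (rule norm_dq_le[OF smooth_on_deriv[OF v] t0 E])
   moreover have "norm (dq t b (%x. DD v x b) x) = norm (DD v (x + t *R b) b - DD v x b) / t"
    using t0 by (simp add: dq_def divide_inverse mult.commute)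
   ultimately have "norm (DD v (x + t *R b) b - DD v x b) <= E * t"
    using t0 by (simp add: pos_divide_le_eq)
   also have "... <= E * h" using t E0 by (intro mult_left_mono) auto
   finally show ?thesis by (simp add: mult.commute)
  qed (use h E0 in simp)
  then show "onorm (%d. d *R (DD v (x + t *R b) b - DD v x b)) <= h * E"
   by (intro onorm_le) (simp add: mult.commute[of "h * E"] mult_left_mono del: mult.assoc)
 qed (use h in auto)
 then have "norm (v (x + h *R b) - v x - h *R DD v x b) <= h * E * h"
  using h by (simp add: algebra_simps)
 moreover have "DD v x b - dq h b v x = - (inverse h *R (v (x + h *R b) - v x - h *R DD v x b))"
  using h by (simp add: dq_def scaleR_diff_right)
 then have "norm (DD v x b - dq h b v x) = norm (v (x + h *R b) - v x - h *R DD v x b) / h"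
  using h by (simp only: norm_minus_cancel norm_scaleR) (simp add: divide_inverse mult.commute)
 ultimately show ?thesis using h by (simp add: pos_divide_le_eq)
qed

text \<open>Replacing one derivative by a quotient costs \<open>h\<close> times one further
  derivative; hence the bound on words that are longer by one.\<close>

lemma pd_dql_close:
 fixes u :: "'a::euclidean_space => 'b::real_normed_vector"
 assumes h: "h > 0"
 shows "smooth_on UNIV u ==> (!!ga x. ga : words (Suc (length be)) ==> norm (pd ga u x) <= E) ==> set be <= Basis ==>
  norm (pd be u x - dql h be u x) <= h * real (length be) * E"
proof (induction be arbitrary: u x)
 case (Cons b ga)
 note u = Cons.prems(1)
 have b: "b : Basis" "set ga <= Basis" using Cons.prems(3) by auto
 define v where "v = (%x. pd ga u x - dql h ga u x)"
 have sv: "smooth_on UNIV v" unfolding v_def by (intro smooth_on_diff smooth_pd smooth_dql u open_UNIV)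
 have 1: "norm (DD (pd ga u) x b - dq h b (pd ga u) x) <= h * E"
 proof (rule dq_deriv_close[OF smooth_pd[OF u] h])
  fix x show "norm (DD (%x. DD (pd ga u) x b) x b) <= E"
   using Cons.prems(2)[of "b # b # ga" x] b by (simp add: words_def)
 qed
 have 2: "norm (dq h b v x) <= h * real (length ga) * E"
 proof (rule norm_dq_le[OF sv h])
  fix x
  have "DD v x b = pd ga (%x. DD u x b) x - dql h ga (%x. DD u x b) x"
   unfolding v_def using dir_deriv_diff[OF smooth_pd[OF u] smooth_dql[OF u] UNIV_I, of ga h ga x b]
   by (simp add: pd_deriv[OF u] dir_deriv_dql[OF u])
  also have "norm ... <= h * real (length ga) * E"
  proof (rule Cons.IH[OF smooth_on_deriv[OF u] _ b(2)])
   fix de :: "'a list" and x assume "de : words (Suc (length ga))"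
   then show "norm (pd de (%x. DD u x b) x) <= E"
    using Cons.prems(2)[of "b # de" x] b by (simp add: words_Cons pd_deriv[OF u])
  qed
  finally show "norm (DD v x b) <= h * real (length ga) * E" .
 qed
 have e: "pd (b # ga) u x - dql h (b # ga) u x = (DD (pd ga u) x b - dq h b (pd ga u) x) + dq h b v x"
  by (simp add: v_def dq_diff)
 have "norm (pd (b # ga) u x - dql h (b # ga) u x) <= h * E + h * real (length ga) * E"
  unfolding e using norm_triangle_ineq[of "DD (pd ga u) x b - dq h b (pd ga u) x" "dq h b v x"] 1 2 by linarith
 then show ?case by (simp add: algebra_simps)
qed simp

lemma mollify_translate: "mollify k s (%x. u (x + c)) x = mollify k s u (x + c)"
 unfolding mollify_def by (simp add: algebra_simps)

lemma mollify_dq: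
 assumes "cc0 k" "continuous_on UNIV u" shows "mollify k s (dq h b u) = dq h b (mollify k s u)"
proof -
 have "continuous_on UNIV (%x. u (x + h *R b))"
  by (rule continuous_on_compose2[OF assms(2)]) (auto intro!: continuous_intros)
 then show ?thesis unfolding dq_def[abs_def]
  by (intro ext) (simp only: mollify_scale mollify_diff[OF assms(1) _ assms(2)] mollify_translate)
qed

lemma continuous_dql: "continuous_on UNIV u ==> continuous_on UNIV (dql h be u)"
 by (induction be) (simp_all add: continuous_dq)

lemma mollify_dql:
 "cc0 k ==> continuous_on UNIV u ==> mollify k s (dql h be u) = dql h be (mollify k s u)"
 by (induction be) (simp_all add: mollify_dq continuous_dql)

lemma pd_mollify:
 assumes k: "ccs T k" and u: "ccs T' u" and r: "r > 0"
 shows "pd ga (mollify k r u) = (%x. (inverse r) ^ length ga *R mollify (pd ga k) r u x)"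
proof (induction ga)
 case (Cons b ga)
 have k': "ccs T (pd ga k)" by (rule pd_ccs[OF k])
 have e1: "DD (%x. (inverse r) ^ length ga *R mollify (pd ga k) r u x) x b
   = (inverse r) ^ length ga *R mollify (pd ga k) r (%y. DD u y b) x" for x
  using dir_deriv_linear[OF bounded_linear_scaleR_right ccs_smooth[OF mollify_ccs[OF ccs_cc0[OF k'] u]] UNIV_I]
   mollify_deriv[OF ccs_cc0[OF k'] u] by simp
 have e2: "mollify (pd ga k) r (%y. DD u y b) x = inverse r *R mollify (%z. DD (pd ga k) z b) r u x" for x
  using mollify_by_parts[OF k' u, of r b x, symmetric] r by simp
 show ?case by (simp add: Cons e1 e2 mult.commute)
qed simp

lemma cc0_radius: "cc0 u ==> EX R>=0. ALL x. norm x > R --> u x = 0"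
proof -
 assume "cc0 u"
 then obtain R where "ALL x. norm x > R --> u x = 0" unfolding cc0_def by blast
 then show ?thesis by (intro exI[of _ "max R 0"]) simp
qed

context approximate_solutions
begin

text \<open>At a positive scale \<open>r\<close> all derivatives of the mollified functions are
  bounded, though badly in \<open>r\<close>. Hence derivatives and difference quotients differ by
  little if \<open>h\<close> is small depending on \<open>r\<close>, and the quotients have bounds
  independent of \<open>h\<close> and \<open>r\<close> for large \<open>n\<close>. The final bound
  is therefore uniform in \<open>r\<close>, and only the index depends on it.\<close>

lemma mollified_bound:
 assumes k: "ccs (cball 0 1) k" and th: "ccs S th" and be: "set be <= Basis"
 shows "EX C. ALL r. 0 < r & r <= 1 --> (EX N. ALL n>=N. nrm (pd be (mollify k r (w th n))) <= C)"
proof -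
 define m where "m = length be"
 have bem: "be : words m" using be by (simp add: words_def m_def)
 obtain C h0 where h0: "h0 > 0" "!!h. 0 < h ==> h < h0 ==> reg m th C h"
  using regularity[OF th, of m] by blast
 obtain Cw where Cw: "Cw >= 0" "!!n. nrm (w th n) <= Cw" using gnrm_w_bounded[OF th] by blast
 have wc: "ccs UNIV (w th n)" for n by (rule ccs_mono[OF w_ccs[OF th order_refl]]) simp
 obtain R0 where R0: "R0 >= 0" "!!x. norm x > R0 ==> th x = 0" using cc0_radius[OF ccs_cc0[OF th]] by blast
 have w0: "norm x > R0 ==> w th n x = 0" for x n using R0(2) by (simp add: w_def)
 have k0: "norm z > 1 ==> k z = 0" for z using k unfolding ccs_compact_iff[OF compact_cball] by simp
 define A where "A = (LINT z|lborel. \<bar>k z\<bar>)"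
 have A: "A >= 0" by (simp add: A_def)
 \<comment> \<open>Mollification at scale at most 1 enlarges the support by at most 1, and
   \<open>m\<close> quotients with step at most 1 by at most \<open>m\<close>.\<close>
 define R1 where "R1 = R0 + 1 + real m"
 define Vol where "Vol = sqrt (measure lborel (cball (0::real^3) R1))"
 have Vol: "Vol >= 0" by (simp add: Vol_def)
 have "EX N. ALL n>=N. nrm (pd be (mollify k r (w th n))) <= A * C + 1" if r: "0 < r" "r <= 1" for r
 proof -
  define E where "E = (SUM ga:words (Suc m). (inverse r) ^ length ga * (nrm (pd ga k) * Cw / sqrt (r ^ 3)))"
  have E: "norm (pd ga (mollify k r (w th n)) x) <= E" if "ga : words (Suc m)" for ga n x
  proof -
   have "norm (mollify (pd ga k) r (w th n) x) <= nrm (pd ga k) * nrm (w th n) / sqrt (r ^ DIM(real^3))"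
    by (rule mollify_sup_le[OF ccs_cc0[OF pd_ccs[OF k]] wc r(1)])
   also have "... <= nrm (pd ga k) * Cw / sqrt (r ^ 3)"
    using r Cw by (auto intro!: divide_right_mono mult_left_mono nrm_ge_0)
   finally have 1: "norm (mollify (pd ga k) r (w th n) x) <= nrm (pd ga k) * Cw / sqrt (r ^ 3)" .
   have "norm (pd ga (mollify k r (w th n)) x) = (inverse r) ^ length ga * norm (mollify (pd ga k) r (w th n) x)"
    unfolding pd_mollify[OF k wc r(1)] using r by simp
   also have "... <= (inverse r) ^ length ga * (nrm (pd ga k) * Cw / sqrt (r ^ 3))"
    using 1 r by (intro mult_left_mono) auto
   also have "... <= E" unfolding E_def
   proof (rule member_le_sum[OF that _ finite_words])
    fix ga' :: "(real^3) list"
    show "0 <= (inverse r) ^ length ga' * (nrm (pd ga' k) * Cw / sqrt (r ^ 3))"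
     using r Cw nrm_ge_0 by (intro mult_nonneg_nonneg divide_nonneg_nonneg) auto
   qed
   finally show ?thesis .
  qed
  have E0: "E >= 0" using order_trans[OF norm_ge_zero E[OF words_Nil]] .
  \<comment> \<open>The last term of the minimum makes the error between derivatives and quotients
    at most 1 in norm.\<close>
  define h where "h = min (min (h0 / 2) 1) (1 / (real m * E * Vol + 1))"
  have h: "h > 0" "h < h0" "h <= 1" using h0 E0 Vol by (auto simp: h_def add_nonneg_pos)
  have "h * (real m * E * Vol + 1) <= 1 / (real m * E * Vol + 1) * (real m * E * Vol + 1)"
   unfolding h_def using E0 Vol by (intro mult_right_mono) auto
  also have "... = 1" using E0 Vol by (simp add: add_nonneg_eq_0_iff)
  finally have hE: "h * real m * E * Vol <= 1" using h(1) by (simp add: algebra_simps)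
  obtain N where N: "!!n ga. n >= N ==> ga : words m ==> nrm (dql h ga (w th n)) <= C"
   using h0(2)[OF h(1,2)] unfolding reg_def by blast
  have "nrm (pd be (mollify k r (w th n))) <= A * C + 1" if n: "n >= N" for n
  proof -
   let ?g = "mollify k r (w th n)"
   have cg: "ccs UNIV ?g" by (rule mollify_ccs[OF ccs_cc0[OF k] wc])
   have g0: "?g x = 0" if "norm x > R0 + 1" for x
    by (rule mollify_support[where P=1 and R=R0]) (use k0 w0 that r in auto)
   have "nrm (dql h be ?g) = nrm (mollify k r (dql h be (w th n)))"
    using mollify_dql[OF ccs_cc0[OF k] cc0_continuous[OF ccs_cc0[OF wc]]] by simp
   also have "... <= A * nrm (dql h be (w th n))" unfolding A_def
    by (rule mollify_nrm_le[OF ccs_cc0[OF k] ccs_dql[OF wc]])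
   also have "... <= A * C" by (intro mult_left_mono N n bem A)
   finally have 1: "nrm (dql h be ?g) <= A * C" .
   have c: "cc0 (%x. pd be ?g x - dql h be ?g x)"
    by (intro cc0_diff ccs_cc0[OF pd_ccs[OF cg]] ccs_cc0[OF ccs_dql[OF cg]])
   have "nrm (%x. pd be ?g x - dql h be ?g x) <= (h * real (length be) * E) * Vol" unfolding Vol_def
   proof (rule nrm_le_sup[OF c])
    show "norm (pd be ?g x - dql h be ?g x) <= h * real (length be) * E" for x
     by (rule pd_dql_close[OF h(1) ccs_smooth[OF cg] E be]) (simp add: m_def)
    fix x :: "real^3" assume x: "norm x > R1"
    then have "norm x > R0 + 1" by (simp add: R1_def)
    then have p: "pd be ?g x = 0"
    proof -
     have "ccs (cball 0 (R0 + 1)) ?g"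
      unfolding ccs_compact_iff[OF compact_cball] using ccs_smooth[OF cg] g0 by simp
     from pd_ccs[OF this, of be] show ?thesis
      unfolding ccs_compact_iff[OF compact_cball] using \<open>norm x > R0 + 1\<close> by simp
    qed
    have "dql h be ?g x = 0"
    proof (rule dql_support[where K="cball 0 (R0 + 1)", OF _ be h(1)])
     show "?g y = 0" if "infdist y (cball 0 (R0 + 1)) > 0" for y
      using that g0[of y] by (cases "y : cball 0 (R0 + 1)") auto
     obtain y where y: "y : cball (0::real^3) (R0 + 1)" "infdist x (cball 0 (R0 + 1)) = dist x y"
      using infdist_attains_inf[of "cball (0::real^3) (R0 + 1)" x] R0 by auto
     have "norm x - norm y <= dist x y" by (simp add: dist_norm norm_triangle_ineq2)
     then have "real m < dist x y" using y x by (simp add: R1_def)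
     moreover have "h * real (length be) <= real m" using h(3) by (simp add: m_def mult_left_le_one_le h(1) less_imp_le)
     ultimately show "h * real (length be) < infdist x (cball 0 (R0 + 1))" using y by simp
    qed
    then show "pd be ?g x - dql h be ?g x = 0" using p by simp
   qed
   also have "... <= 1" using hE by (simp add: m_def)
   finally have 2: "nrm (%x. pd be ?g x - dql h be ?g x) <= 1" .
   have "nrm (pd be ?g) = nrm (%x. dql h be ?g x + (pd be ?g x - dql h be ?g x))" by simp
   also have "... <= nrm (dql h be ?g) + nrm (%x. pd be ?g x - dql h be ?g x)"
    by (intro nrm_add c ccs_cc0[OF ccs_dql[OF cg]])
   finally show ?thesis using 1 2 by linarith
  qed
  then show ?thesis by (intro exI[of _ N] allI impI)
 qed
 then show ?thesis by (intro exI[of _ "A * C + 1"] allI impI) (elim conjE)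
qed

text \<open>A diagonal choice: as the scale tends to 0, indices are chosen so late that the
  mollified functions have bounded derivatives of every order. They converge in L^2 to the same
  limit as the sequence itself, because the gradient bound makes the mollification error
  proportional to the scale.\<close>

lemma local_limit:
 assumes th: "ccs S th"
  and cau: "!!e. e > 0 ==> EX N. ALL m>=N. ALL n>=N. nrm (%x. w th m x - w th n x) < e"
 shows "EX G. ccs UNIV G & (%n. nrm (%x. w th n x - G x)) \<longlonglongrightarrow> 0"
proof -
 obtain k :: "real^3 => real" where k: "ccs (cball 0 1) k" and one: "(LINT z|lborel. k z) = 1"
  using ex_kernel by blast
 have k0: "norm z > 1 ==> k z = 0" for z using k unfolding ccs_compact_iff[OF compact_cball] by simp
 obtain Cw where Cw: "Cw >= 0" "!!n. gnrm (w th n) <= Cw" using gnrm_w_bounded[OF th] by blast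
 have wc: "ccs UNIV (w th n)" for n by (rule ccs_mono[OF w_ccs[OF th order_refl]]) simp
 obtain R0 where R0: "R0 >= 0" "!!x. norm x > R0 ==> th x = 0" using cc0_radius[OF ccs_cc0[OF th]] by blast
 have w0: "norm x > R0 ==> w th n x = 0" for x n using R0(2) by (simp add: w_def)
 define A where "A = (LINT z|lborel. \<bar>k z\<bar>)"
 have A: "A >= 0" by (simp add: A_def)
 have "ALL be. EX C. set be <= Basis --> (ALL r. 0 < r & r <= 1 --> (EX N. ALL n>=N. nrm (pd be (mollify k r (w th n))) <= C))"
 proof
  fix be :: "(real^3) list"
  show "EX C. set be <= Basis --> (ALL r. 0 < r & r <= 1 --> (EX N. ALL n>=N. nrm (pd be (mollify k r (w th n))) <= C))"
  proof (cases "set be <= Basis")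
   case True
   from mollified_bound[OF k th True] obtain C where "ALL r. 0 < r & r <= 1 --> (EX N. ALL n>=N. nrm (pd be (mollify k r (w th n))) <= C)" ..
   then show ?thesis by (intro exI[of _ C] impI)
  qed simp
 qed
 from choice[OF this] obtain C where C:
  "ALL be. set be <= Basis --> (ALL r. 0 < r & r <= 1 --> (EX N. ALL n>=N. nrm (pd be (mollify k r (w th n))) <= C be))" ..
 define r where "r m = inverse (real (Suc m))" for m
 have r: "r m > 0" "r m <= 1" for m by (auto simp: r_def inverse_le_1_iff)
 \<comment> \<open>There are finitely many words of length at most \<open>m\<close>, so one index
   serves them all.\<close>
 have "ALL m. EX n>=m. ALL be:words m. nrm (pd be (mollify k (r m) (w th n))) <= C be"
 proof
  fix m
  have "ALL be. EX N. set be <= Basis --> (ALL n>=N. nrm (pd be (mollify k (r m) (w th n))) <= C be)"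
  proof
   fix be :: "(real^3) list"
   show "EX N. set be <= Basis --> (ALL n>=N. nrm (pd be (mollify k (r m) (w th n))) <= C be)"
    using C[rule_format, of be "r m"] r[of m] by (cases "set be <= Basis") simp_all
  qed
  from choice[OF this] obtain N where N: "ALL be. set be <= Basis --> (ALL n>=N be. nrm (pd be (mollify k (r m) (w th n))) <= C be)" ..
  define M where "M = Max (insert m (N ` words m))"
  have "M >= m" "be : words m ==> M >= N be" for be
   unfolding M_def by (rule Max_ge; simp add: finite_words)+
  then show "EX n>=m. ALL be:words m. nrm (pd be (mollify k (r m) (w th n))) <= C be"
   using N unfolding words_def by (intro exI[of _ M]) simp
 qed
 from choice[OF this] obtain ns where ns: "ALL m. ns m >= m & (ALL be:words m. nrm (pd be (mollify k (r m) (w th (ns m)))) <= C be)" ..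
 define g where "g m = mollify k (r m) (w th (ns m))" for m
 have cg: "ccs (cball 0 (R0 + 1)) (g m)" for m
 proof -
  have "g m x = 0" if "norm x > R0 + 1" for x unfolding g_def
  proof (rule mollify_support[where P=1 and R=R0])
   show "R0 + \<bar>r m\<bar> * 1 < norm x" using that r[of m] by simp
  qed (use k0 w0 in auto)
  then show ?thesis unfolding ccs_compact_iff[OF compact_cball]
   using ccs_smooth[OF mollify_ccs[OF ccs_cc0[OF k] wc]] by (simp add: g_def)
 qed
 have close: "nrm (%x. g m x - w th (ns m) x) <= A * Cw * r m" for m
 proof -
  have "nrm (%x. g m x - w th (ns m) x) <= A * (\<bar>r m\<bar> * 1 * gnrm (w th (ns m)))"
   unfolding g_def A_def by (rule mollify_close[OF ccs_cc0[OF k] wc one k0]) auto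
  also have "... <= A * (r m * Cw)" using r[of m] A Cw by (intro mult_left_mono mult_mono) (auto simp: gnrm_ge_0)
  finally show ?thesis by (simp add: mult_ac)
 qed
 have lim0: "(%m. A * Cw * r m) \<longlonglongrightarrow> 0"
  unfolding r_def using tendsto_mult[OF tendsto_const LIMSEQ_inverse_real_of_nat, of "A * Cw"] by simp
 note cc = ccs_cc0[OF cg] ccs_cc0[OF wc]
 have "EX G. ccs (cball 0 (R0 + 1)) G & (%m. nrm (%x. g m x - G x)) \<longlonglongrightarrow> 0"
 proof (rule smooth_limit[OF _ cg])
  fix e :: real assume e: "e > 0"
  obtain N1 where N1: "!!m n. m >= N1 ==> n >= N1 ==> nrm (%x. w th m x - w th n x) < e / 3"
   using cau[of "e / 3"] e by auto
  have "e / 3 > 0" using e by simp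
  from LIMSEQ_D[OF lim0 this] obtain N2 where "ALL m>=N2. norm (A * Cw * r m - 0) < e / 3" ..
  then have N2: "A * Cw * r m < e / 3" if "m >= N2" for m using that by force
  have "nrm (%x. g m x - g n x) < e" if mn: "m >= max N1 N2" "n >= max N1 N2" for m n
  proof -
   have "nrm (%x. g m x - g n x) = nrm (%x. (g m x - w th (ns m) x) + ((w th (ns m) x - w th (ns n) x) - (g n x - w th (ns n) x)))"
    by (simp add: algebra_simps)
   also have "... <= nrm (%x. g m x - w th (ns m) x) + (nrm (%x. w th (ns m) x - w th (ns n) x) + nrm (%x. g n x - w th (ns n) x))"
    by (intro order_trans[OF nrm_add] add_mono nrm_diff cc0_diff cc order_refl)
   also have "... < e / 3 + (e / 3 + e / 3)"
   proof (intro add_strict_mono)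
    show "nrm (%x. g m x - w th (ns m) x) < e / 3" using close[of m] N2[of m] mn by simp
    show "nrm (%x. g n x - w th (ns n) x) < e / 3" using close[of n] N2[of n] mn by simp
    have "ns m >= N1" "ns n >= N1" using ns mn by (meson max.boundedE order_trans)+
    then show "nrm (%x. w th (ns m) x - w th (ns n) x) < e / 3" by (rule N1)
   qed
   finally show ?thesis by simp
  qed
  then show "EX M. ALL m>=M. ALL n>=M. nrm (%x. g m x - g n x) < e" by (intro exI[of _ "max N1 N2"] allI impI)
 next
  fix be :: "(real^3) list" assume "set be <= Basis"
  then have "nrm (pd be (g m)) <= C be" if "m >= length be" for m
   using ns that unfolding g_def words_def by blast
  then show "EX C N. ALL m>=N. nrm (pd be (g m)) <= C" by (intro exI[of _ "C be"] exI[of _ "length be"] allI impI)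
 qed simp
 then obtain G where G: "ccs (cball 0 (R0 + 1)) G" "(%m. nrm (%x. g m x - G x)) \<longlonglongrightarrow> 0" by blast
 have "(%n. nrm (%x. w th n x - G x)) \<longlonglongrightarrow> 0"
 proof (rule LIMSEQ_I)
  fix e :: real assume e: "e > 0"
  then have e3: "e / 3 > 0" by simp
  obtain N1 where N1: "!!m n. m >= N1 ==> n >= N1 ==> nrm (%x. w th m x - w th n x) < e / 3"
   using cau[of "e / 3"] e by auto
  from LIMSEQ_D[OF lim0 e3] obtain N2 where "ALL m>=N2. norm (A * Cw * r m - 0) < e / 3" ..
  then have N2: "A * Cw * r m < e / 3" if "m >= N2" for m using that by force
  from LIMSEQ_D[OF G(2) e3] obtain N3 where N3': "ALL m>=N3. norm (nrm (%x. g m x - G x) - 0) < e / 3" ..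
  have N3: "nrm (%x. g m x - G x) < e / 3" if "m >= N3" for m using N3'[rule_format, OF that] by simp
  define m where "m = max N1 (max N2 N3)"
  have m: "m >= N1" "m >= N2" "m >= N3" by (auto simp: m_def)
  have "norm (nrm (%x. w th n x - G x) - 0) < e" if n: "n >= N1" for n
  proof -
   have "nrm (%x. w th n x - G x) = nrm (%x. (w th n x - w th (ns m) x) + ((g m x - G x) - (g m x - w th (ns m) x)))"
    by (simp add: algebra_simps)
   also have "... <= nrm (%x. w th n x - w th (ns m) x) + (nrm (%x. g m x - G x) + nrm (%x. g m x - w th (ns m) x))"
    by (intro order_trans[OF nrm_add] add_mono nrm_diff cc0_diff cc ccs_cc0[OF G(1)] order_refl)
   also have "... < e / 3 + (e / 3 + e / 3)"
   proof (intro add_strict_mono)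
    show "nrm (%x. g m x - w th (ns m) x) < e / 3" using close[of m] N2[of m] m by simp
    have "ns m >= N1" using ns m order_trans by blast
    then show "nrm (%x. w th n x - w th (ns m) x) < e / 3" using N1 n by blast
   qed (rule N3[OF m(3)])
   finally show ?thesis by (simp add: nrm_ge_0)
  qed
  then show "EX N. ALL n>=N. norm (nrm (%x. w th n x - G x) - 0) < e" by (intro exI[of _ N1] allI impI)
 qed
 then show ?thesis using ccs_mono[OF G(1) subset_UNIV] by blast
qed

end

section \<open>Rellich compactness\<close>

text \<open>Total boundedness of a sequence with respect to the pseudo-distances \<open>d m n\<close> of its members.\<close>

definition totally_bounded_seq :: "(nat => nat => real) => bool" where
 "totally_bounded_seq d \<longleftrightarrow>
   (ALL e>0. ALL s::nat => nat. strict_mono s --> (EX r::nat => nat. strict_mono r & (ALL m n. d (s (r m)) (s (r n)) < e)))"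

lemma totally_bounded_seqD:
 assumes "totally_bounded_seq d" "e > 0" "strict_mono (s::nat => nat)"
 obtains r :: "nat => nat" where "strict_mono r" "!!m n. d (s (r m)) (s (r n)) < e"
 using assms unfolding totally_bounded_seq_def by blast

lemma totally_bounded_seq_bounded:
 fixes a :: "nat => 'b::euclidean_space"
 assumes "!!n. norm (a n) <= C"
 shows "totally_bounded_seq (%m n. norm (a m - a n))"
 unfolding totally_bounded_seq_def
proof (intro allI impI)
 fix e :: real and s :: "nat => nat" assume e: "e > 0" and s: "strict_mono s"
 have "bounded (range (a o s))" using assms unfolding bounded_iff by auto
 then obtain l r where r: "strict_mono r" "((a o s) o r) \<longlonglongrightarrow> l"
  using bounded_imp_convergent_subsequence by blast
 then have "Cauchy ((a o s) o r)" by (intro convergent_Cauchy convergentI)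
 from CauchyD[OF this e] obtain N where "ALL m>=N. ALL n>=N. norm (((a o s) o r) m - ((a o s) o r) n) < e" ..
 moreover have "strict_mono (%n. r (n + N))" using r(1) by (auto simp: strict_mono_def)
 ultimately show "EX r::nat => nat. strict_mono r & (ALL m n. norm (a (s (r m)) - a (s (r n))) < e)"
  by (intro exI[of _ "%n. r (n + N)"]) simp
qed

lemma totally_bounded_seq_add:
 assumes "totally_bounded_seq d" "totally_bounded_seq d'"
 shows "totally_bounded_seq (%m n. d m n + d' m n)"
 unfolding totally_bounded_seq_def
proof (intro allI impI)
 fix e :: real and s :: "nat => nat" assume e: "e > 0" and s: "strict_mono s"
 have e2: "e / 2 > 0" using e by simp
 obtain r :: "nat => nat" where r: "strict_mono r" "!!m n. d (s (r m)) (s (r n)) < e / 2"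
  using totally_bounded_seqD[OF assms(1) e2 s] by blast
 obtain r' :: "nat => nat" where r': "strict_mono r'" "!!m n. d' ((s o r) (r' m)) ((s o r) (r' n)) < e / 2"
  using totally_bounded_seqD[OF assms(2) e2 strict_mono_o[OF s r(1)]] by blast
 have "d (s ((r o r') m)) (s ((r o r') n)) + d' (s ((r o r') m)) (s ((r o r') n)) < e" for m n
  using r(2)[of "r' m" "r' n"] r'(2)[of m n] by simp
 then show "EX r::nat => nat. strict_mono r & (ALL m n. d (s (r m)) (s (r n)) + d' (s (r m)) (s (r n)) < e)"
  using strict_mono_o[OF r(1) r'(1)] by (intro exI[of _ "r o r'"]) simp
qed

lemma totally_bounded_seq_zero: "totally_bounded_seq (%m n. 0)"
 unfolding totally_bounded_seq_def using strict_mono_id by (intro allI impI exI[of _ id]) (simp add: strict_mono_def)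

lemma totally_bounded_seq_sum:
 "(!!i. i : I ==> totally_bounded_seq (d i)) ==> totally_bounded_seq (%m n. SUM i:I. d i m n)"
 by (induction I rule: infinite_finite_induct) (simp_all add: totally_bounded_seq_zero totally_bounded_seq_add)

lemma totally_bounded_seq_approx:
 assumes "!!e. e > 0 ==> EX d' c. c >= 0 & totally_bounded_seq d' & (ALL m n. d m n <= e + c * d' m n)"
 shows "totally_bounded_seq d"
 unfolding totally_bounded_seq_def
proof (intro allI impI)
 fix e :: real and s :: "nat => nat" assume e: "e > 0" and s: "strict_mono s"
 obtain d' c where d': "c >= 0" "totally_bounded_seq d'" "!!m n. d m n <= e / 2 + c * d' m n"
  using assms[of "e / 2"] e by auto
 have "e / (2 * (c + 1)) > 0" using e d' by simp
 from totally_bounded_seqD[OF d'(2) this s] obtain r :: "nat => nat" where r: "strict_mono r"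
  "!!m n. d' (s (r m)) (s (r n)) < e / (2 * (c + 1))" by blast
 have "d (s (r m)) (s (r n)) < e" for m n
 proof -
  have "c * d' (s (r m)) (s (r n)) <= c * (e / (2 * (c + 1)))"
   using r(2)[of m n] d'(1) by (intro mult_left_mono) auto
  also have "... < e / 2" using e d'(1) by (simp add: field_simps)
  finally show ?thesis using d'(3)[of "s (r m)" "s (r n)"] by linarith
 qed
 then show "EX r::nat => nat. strict_mono r & (ALL m n. d (s (r m)) (s (r n)) < e)" using r(1) by blast
qed

text \<open>A diagonal subsequence over the accuracies \<open>1 / (k + 1)\<close>.\<close>

lemma totally_bounded_seq_Cauchy:
 assumes "totally_bounded_seq d"
 shows "EX s::nat => nat. strict_mono s & (ALL e>0. EX N. ALL m>=N. ALL n>=N. d (s m) (s n) < e)"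
proof -
 define P where "P k s \<longleftrightarrow> (ALL m n. d (s m) (s n) < inverse (real (Suc k)))" for k and s :: "nat => nat"
 have PD: "P k s ==> d (s m) (s n) < inverse (real (Suc k))" for k s m n by (simp add: P_def)
 interpret subseqs P
 proof
  fix k and s :: "nat => nat" assume "strict_mono s"
  then obtain r :: "nat => nat" where "strict_mono r" "!!m n. d (s (r m)) (s (r n)) < inverse (real (Suc k))"
   using totally_bounded_seqD[OF assms, of "inverse (real (Suc k))" s] by auto
  then show "EX r'::nat => nat. strict_mono r' & P k (s o r')" unfolding P_def by auto
 qed
 have P: "P k (diagseq o ((+) (Suc k)))" for k
  by (rule diagseq_holds) (auto simp: P_def)
 have "EX N. ALL m>=N. ALL n>=N. d (diagseq m) (diagseq n) < e" if e: "e > 0" for e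
 proof -
  obtain k where k: "inverse (real (Suc k)) < e" using reals_Archimedean[OF e] by blast
  have "d (diagseq m) (diagseq n) < e" if "m >= Suc k" "n >= Suc k" for m n
   using PD[OF P[of k], of "m - Suc k" "n - Suc k"] k that by simp
  then show ?thesis by (intro exI[of _ "Suc k"] allI impI)
 qed
 then show ?thesis by (intro exI[of _ diagseq] conjI subseq_diagseq allI impI)
qed

text \<open>Mollified at a small fixed scale, the functions are uniformly Lipschitz, so their
  distances are controlled by the values at finitely many points, and these are bounded. The
  gradient bound makes the error of mollification uniformly small.\<close>

lemma rellich:
 fixes w :: "nat => 'a::euclidean_space => 'b::euclidean_space"
 assumes w: "!!n. ccs (cball 0 R) (w n)" and C: "!!n. nrm (w n) <= C" "!!n. gnrm (w n) <= C"
 shows "totally_bounded_seq (%m n. nrm (%x. w m x - w n x))"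
proof (rule totally_bounded_seq_approx)
 fix e :: real assume e: "e > 0"
 obtain k :: "'a => real" where k: "ccs (cball 0 1) k" and one: "(LINT z|lborel. k z) = 1"
  using ex_kernel by blast
 have k0: "norm z > 1 ==> k z = 0" for z using k unfolding ccs_compact_iff[OF compact_cball] by simp
 have w0: "norm x > R ==> w n x = 0" for n x using w[of n] unfolding ccs_compact_iff[OF compact_cball] by simp
 have C0: "C >= 0" using order_trans[OF nrm_ge_0 C(1)] .
 define A where "A = (LINT z|lborel. \<bar>k z\<bar>)"
 have A: "A >= 0" by (simp add: A_def)
 \<comment> \<open>The scale \<open>s\<close> makes the mollification error of each function at most
   \<open>e / 4\<close>; the summand 1 only keeps \<open>q\<close> positive.\<close>
 define q where "q = A * C + 1"
 define s where "s = min 1 (e / (4 * q))"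
 have AC: "q > 0" using A C0 by (simp add: q_def add_nonneg_pos)
 have s: "s > 0" "s <= 1" using e AC by (auto simp: s_def)
 have "A * C * s <= q * (e / (4 * q))"
  using A C0 s AC by (intro mult_mono) (auto simp: s_def q_def)
 also have "... = e / 4" using AC by simp
 finally have sA: "A * C * s <= e / 4" .
 define g where "g n = mollify k s (w n)" for n
 have cg: "ccs UNIV (g n)" for n unfolding g_def by (rule mollify_ccs[OF ccs_cc0[OF k] w])
 have g0: "g n x = 0" if "norm x > R + 1" for n x unfolding g_def
  by (rule mollify_support[where P=1 and R=R]) (use k0 w0 that s in auto)
 have close: "nrm (%x. g n x - w n x) <= e / 4" for n
 proof -
  have "nrm (%x. g n x - w n x) <= A * (\<bar>s\<bar> * 1 * gnrm (w n))"
   unfolding g_def A_def by (rule mollify_close[OF ccs_cc0[OF k] w one k0]) auto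
  also have "... <= A * (s * C)" using A s C by (intro mult_left_mono mult_mono) (auto simp: gnrm_ge_0)
  finally show ?thesis using sA by (simp add: mult_ac)
 qed
 define \<Lambda> where "\<Lambda> = real DIM('a) * (SUM b:Basis. inverse s * (nrm (%z. DD k z b) * C / sqrt (s ^ DIM('a))))"
 have \<Lambda>: "\<Lambda> >= 0" unfolding \<Lambda>_def using s C0 by (intro mult_nonneg_nonneg sum_nonneg divide_nonneg_nonneg nrm_ge_0) auto
 have lip: "norm (g n y - g n x) <= \<Lambda> * norm (y - x)" for n x y
  unfolding \<Lambda>_def
 proof (rule deriv_bound_lipschitz[OF ccs_smooth[OF cg]])
  fix x b :: 'a assume b: "b : Basis"
  have "DD (g n) x b = inverse s *R mollify (%z. DD k z b) s (w n) x"
   unfolding g_def mollify_deriv[OF ccs_cc0[OF k] w] mollify_by_parts[OF k w, symmetric] using s by simp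
  also have "norm ... <= inverse s * (nrm (%z. DD k z b) * nrm (w n) / sqrt (s ^ DIM('a)))"
   unfolding norm_scaleR using s
   by (intro mult_mono mollify_sup_le[OF ccs_cc0[OF ccs_deriv[OF k]] w s(1)]) auto
  also have "... <= inverse s * (nrm (%z. DD k z b) * C / sqrt (s ^ DIM('a)))"
   using s C nrm_ge_0 by (intro mult_left_mono divide_right_mono) auto
  also have "... <= (SUM b:Basis. inverse s * (nrm (%z. DD k z b) * C / sqrt (s ^ DIM('a))))"
   using s C0 nrm_ge_0 by (intro member_le_sum[OF b] mult_nonneg_nonneg divide_nonneg_nonneg) auto
  finally show "norm (DD (g n) x b) <= (SUM b:Basis. inverse s * (nrm (%z. DD k z b) * C / sqrt (s ^ DIM('a))))" .
 qed
 define Vol where "Vol = sqrt (measure lborel (cball (0::'a) (R + 1)))"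
 have Vol: "Vol >= 0" by (simp add: Vol_def)
 \<comment> \<open>The spacing of the net is chosen so that the variation of two functions between
   net points contributes at most \<open>e / 2\<close> to the norm.\<close>
 define de where "de = e / (4 * (\<Lambda> + 1) * (Vol + 1))"
 have de: "de > 0" using e \<Lambda> Vol by (simp add: de_def)
 have deV: "2 * \<Lambda> * de * Vol <= e / 2"
 proof -
  have "2 * \<Lambda> * de * Vol <= 2 * (\<Lambda> + 1) * de * (Vol + 1)"
   using \<Lambda> Vol de by (intro mult_mono) auto
  also have "2 * a * (e / (4 * a * b)) * b = e / 2" if "a > 0" "b > 0" for a b :: real
   using that by simp
  from this[of "\<Lambda> + 1" "Vol + 1"] have "2 * (\<Lambda> + 1) * de * (Vol + 1) = e / 2"
   unfolding de_def using \<Lambda> Vol by linarith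
  finally show ?thesis .
 qed
 obtain F where F: "finite F" "cball (0::'a) (R + 1) <= (UN p:F. ball p de)"
 proof -
  have 1: "cball (0::'a) (R + 1) <= (UN p:UNIV. ball p de)"
   using de by (intro subsetI UN_I[OF UNIV_I]) (rule centre_in_ball[THEN iffD2])
  show thesis by (rule compactE_image[OF compact_cball _ 1]) (use that in auto)
 qed
 define d' where "d' m n = (SUM p:F. norm (g m p - g n p))" for m n
 have tb: "totally_bounded_seq d'" unfolding d'_def
 proof (rule totally_bounded_seq_sum, rule totally_bounded_seq_bounded)
  fix p n
  show "norm (g n p) <= nrm k * C / sqrt (s ^ DIM('a))" unfolding g_def
   by (rule order_trans[OF mollify_sup_le[OF ccs_cc0[OF k] w s(1)]])
     (use s C in "auto intro!: divide_right_mono mult_left_mono nrm_ge_0")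
 qed
 have "nrm (%x. w m x - w n x) <= e + Vol * d' m n" for m n
 proof -
  note cc = ccs_cc0[OF cg] ccs_cc0[OF w]
  have sup: "norm (g m x - g n x) <= 2 * \<Lambda> * de + d' m n" for x
  proof (cases "x : cball 0 (R + 1)")
   case True
   then obtain p where p: "p : F" "x : ball p de" using F(2) by blast
   have px: "norm (x - p) <= de" using p(2) by (simp add: dist_norm norm_minus_commute)
   have "norm (g i x - g i p) <= \<Lambda> * de" for i
    using order_trans[OF lip mult_left_mono[OF px \<Lambda>]] .
   from this[of m] this[of n] have "norm ((g m x - g m p) - (g n x - g n p)) <= 2 * \<Lambda> * de"
    using norm_triangle_ineq4[of "g m x - g m p" "g n x - g n p"] by linarith
   moreover have "norm (g m p - g n p) <= d' m n" unfolding d'_def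
    by (rule member_le_sum[OF p(1)]) (use F in auto)
   moreover have "g m x - g n x = ((g m x - g m p) - (g n x - g n p)) + (g m p - g n p)" by simp
   ultimately show ?thesis
    using norm_triangle_ineq[of "(g m x - g m p) - (g n x - g n p)" "g m p - g n p"] by simp
  next
   case False
   then show ?thesis using g0 \<Lambda> de by (simp add: d'_def sum_nonneg)
  qed
  have "nrm (%x. g m x - g n x) <= (2 * \<Lambda> * de + d' m n) * Vol" unfolding Vol_def
   by (rule nrm_le_sup[OF cc0_diff[OF cc(1) cc(1)] sup]) (simp add: g0)
  also have "... <= e / 2 + Vol * d' m n" using deV by (simp add: algebra_simps)
  finally have 1: "nrm (%x. g m x - g n x) <= e / 2 + Vol * d' m n" .
  have "nrm (%x. w m x - w n x) = nrm (%x. (g m x - g n x) - ((g m x - w m x) - (g n x - w n x)))" by simp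
  also have "... <= nrm (%x. g m x - g n x) + (nrm (%x. g m x - w m x) + nrm (%x. g n x - w n x))"
   by (intro order_trans[OF nrm_diff] add_mono nrm_diff cc0_diff cc order_refl)
  finally show ?thesis using 1 close[of m] close[of n] by linarith
 qed
 then show "EX d' c. c >= 0 & totally_bounded_seq d' & (ALL m n. nrm (%x. w m x - w n x) <= e + c * d' m n)"
  using tb Vol by (intro exI[of _ d'] exI[of _ Vol]) simp
qed

section \<open>Functions on manifolds\<close>

locale smfd =
 fixes M :: "('a, 'e::euclidean_space) manifold"
 assumes smooth_M: "smooth_manifold M"
begin

lemma Hausdorff: "Hausdorff_space (mtop M)" using smooth_M by (simp add: smooth_manifold_def)

lemma charts_cover: "p : points M ==> EX c:charts M. p : fst c"
 using smooth_M unfolding smooth_manifold_def by blast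

context
 fixes c assumes c: "c : charts M"
begin

lemma openin_chart: "openin (mtop M) (fst c)" and open_cimage: "open (cimage c)"
 and homeo_chart: "homeomorphic_map (subtopology (mtop M) (fst c)) (top_of_set (cimage c)) (snd c)"
 using smooth_M c unfolding smooth_manifold_def by blast+

lemma chart_subset: "fst c <= points M" using openin_chart openin_subset by blast

lemma inj_chart: "inj_on (snd c) (fst c)"
 using homeomorphic_imp_injective_map[OF homeo_chart] chart_subset by (simp add: Int_absorb1)

lemma cinv_chart: "p : fst c ==> cinv c (snd c p) = p"
 by (rule inv_into_f_f[OF inj_chart])

lemma chart_cinv: "x : cimage c ==> snd c (cinv c x) = x" by (rule f_inv_into_f)
lemma cinv_in: "x : cimage c ==> cinv c x : fst c" by (rule inv_into_into)

lemma open_image: assumes "openin (mtop M) U" "U <= fst c" shows "open (snd c ` U)"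
proof -
 have "openin (subtopology (mtop M) (fst c)) U"
  unfolding openin_subtopology using assms by (intro exI[of _ U]) auto
 then have "openin (top_of_set (cimage c)) (snd c ` U)"
  using homeomorphic_imp_open_map[OF homeo_chart] unfolding open_map_def by blast
 then show ?thesis by (simp add: openin_open_eq[OF open_cimage])
qed

lemma homeo_inverse: "homeomorphic_map (top_of_set (cimage c)) (subtopology (mtop M) (fst c)) (cinv c)"
proof -
 obtain g where g: "homeomorphic_maps (subtopology (mtop M) (fst c)) (top_of_set (cimage c)) (snd c) g"
  using homeo_chart homeomorphic_map_maps by blast
 have "g x = cinv c x" if "x : cimage c" for x
 proof -
  have "snd c (g x) = x" "g x : fst c"
   using g that unfolding homeomorphic_maps_def continuous_map_def by auto
  then show ?thesis using cinv_chart by metis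
 qed
 then have "homeomorphic_maps (subtopology (mtop M) (fst c)) (top_of_set (cimage c)) (snd c) (cinv c)"
  using homeomorphic_maps_eq[OF g] by simp
 then show ?thesis using homeomorphic_maps_map by blast
qed

lemma openin_cinv_image: assumes "open W" "W <= cimage c" shows "openin (mtop M) (cinv c ` W)"
proof -
 have "openin (top_of_set (cimage c)) W" using assms by (simp add: open_subset)
 then have "openin (subtopology (mtop M) (fst c)) (cinv c ` W)"
  using homeomorphic_imp_open_map[OF homeo_inverse] unfolding open_map_def by blast
 then show ?thesis using openin_trans_full[OF _ openin_chart] by blast
qed

lemma compactin_cinv_image: assumes "compact K" "K <= cimage c" shows "compactin (mtop M) (cinv c ` K)"
proof -
 have "compactin (top_of_set (cimage c)) K" using assms by (simp add: compactin_subtopology)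
 then have "compactin (subtopology (mtop M) (fst c)) (cinv c ` K)"
  using image_compactin homeomorphic_imp_continuous_map[OF homeo_inverse] by blast
 then show ?thesis by (simp add: compactin_subtopology)
qed

lemma closedin_cinv_image: assumes "compact K" "K <= cimage c" shows "closedin (mtop M) (cinv c ` K)"
 using compactin_imp_closedin[OF Hausdorff compactin_cinv_image[OF assms]] .

lemma compact_image: assumes "compactin (mtop M) L" "L <= fst c" shows "compact (snd c ` L)"
proof -
 have "compactin (subtopology (mtop M) (fst c)) L" using assms by (simp add: compactin_subtopology)
 then have "compactin (top_of_set (cimage c)) (snd c ` L)"
  using image_compactin homeomorphic_imp_continuous_map[OF homeo_chart] by blast
 then show ?thesis by (simp add: compactin_subtopology)
qed

end

lemma transition_smooth:
 "c : charts M ==> d : charts M ==> smooth_on (snd c ` (fst c Int fst d)) (%x. snd d (cinv c x))"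
 using smooth_M unfolding smooth_manifold_def o_def by blast

lemma open_overlap: "c : charts M ==> d : charts M ==> open (snd c ` (fst c Int fst d))"
 by (intro open_image openin_Int openin_chart) auto

text \<open>Smoothness of functions with values in a vector space, tested in charts of the source
  alone. Values off the manifold do not matter.\<close>

definition smf :: "('a => 'b::real_normed_vector) => bool" where
 "smf h \<longleftrightarrow> (ALL c:charts M. smooth_on (cimage c) (%x. h (cinv c x)))"

definition ext :: "('a, 'e) chart => ('e => 'b::real_normed_vector) => 'a => 'b" where
 "ext c w p = (if p : fst c then w (snd c p) else 0)"

lemma smfD: "smf h ==> c : charts M ==> smooth_on (cimage c) (%x. h (cinv c x))"
 by (simp add: smf_def)

lemma smf_const: "smf (%p. k)" unfolding smf_def by (simp add: smooth_on_const)
lemma smf_add: "smf f ==> smf g ==> smf (%p. f p + g p)"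
 unfolding smf_def using smooth_on_add[OF open_cimage] by blast
lemma smf_bounded_linear: "bounded_linear L ==> smf f ==> smf (%p. L (f p))"
 unfolding smf_def using smooth_on_bounded_linear[of L, OF _ open_cimage] by blast
lemma smf_bilinear: "bounded_bilinear B ==> smf f ==> smf g ==> smf (%p. B (f p) (g p))"
 unfolding smf_def using smooth_on_bilinear[of B, OF _ open_cimage] by blast
lemmas smf_mult = smf_bilinear[OF bounded_bilinear_mult]
lemmas smf_inner = smf_bilinear[OF bounded_bilinear_inner]
lemmas smf_scale = smf_bounded_linear[OF bounded_linear_scaleR_right]
lemma smf_diff: assumes "smf f" "smf g" shows "smf (%p. f p - g p)"
 using smf_add[OF assms(1) smf_scale[OF assms(2), of "-1"]] by simp
lemma smf_sum: "(!!i. i : I ==> smf (f i)) ==> smf (%p. SUM i:I. f i p)"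
 by (induction I rule: infinite_finite_induct) (simp_all add: smf_const smf_add)
lemma smf_norm_sq: "smf f ==> smf (%p. (norm (f p :: 'b::real_inner))^2)"
 using smf_inner[of f f] by (simp add: power2_norm_eq_inner)

lemma smf_cong: assumes "smf f" "!!p. p : points M ==> f p = g p" shows "smf g"
 unfolding smf_def
proof
 fix c assume c: "c : charts M"
 show "smooth_on (cimage c) (%x. g (cinv c x))"
  by (rule smooth_on_cong[OF open_cimage[OF c] smfD[OF assms(1) c]])
    (use assms(2) cinv_in[OF c] chart_subset[OF c] in blast)
qed

text \<open>In another chart the extension is either a composite with the transition map or, off the
  image of \<open>K\<close>, zero. That image is closed since a compact set in a Hausdorff space is
  closed, so the two regions are open.\<close>

lemma smf_ext:
 assumes c: "c : charts M" and w: "ccs (cimage c) w" shows "smf (ext c w)"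
 unfolding smf_def
proof (intro ballI smooth_on_local)
 fix d x assume d: "d : charts M" and x: "x : cimage d"
 obtain K where K: "compact K" "K <= cimage c" "ALL x. x ~: K --> w x = 0" using w unfolding ccs_def by blast
 define U1 where "U1 = snd d ` (fst d Int fst c)"
 define U2 where "U2 = snd d ` (fst d - cinv c ` K)"
 have o1: "open U1" unfolding U1_def by (rule open_overlap[OF d c])
 have o2: "open U2" unfolding U2_def
  by (intro open_image[OF d] openin_diff openin_chart[OF d] closedin_cinv_image[OF c K(1,2)]) auto
 have s1: "smooth_on U1 (%x. ext c w (cinv d x))"
 proof (rule smooth_on_cong[OF o1])
  show "smooth_on U1 (%x. w (snd c (cinv d x)))" unfolding U1_def
   by (rule smooth_on_compose[OF open_overlap[OF d c] open_UNIV subset_UNIV ccs_smooth[OF w] transition_smooth[OF d c]])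
  show "w (snd c (cinv d y)) = ext c w (cinv d y)" if "y : U1" for y
   using that cinv_chart[OF d] by (auto simp: U1_def ext_def)
 qed
 have s2: "smooth_on U2 (%x. ext c w (cinv d x))"
 proof (rule smooth_on_cong[OF o2 smooth_on_const[of _ 0]])
  fix y assume "y : U2"
  then obtain p where p: "p : fst d" "p ~: cinv c ` K" "y = snd d p" by (auto simp: U2_def)
  have "w (snd c p) = 0" if "p : fst c"
  proof -
   have "snd c p ~: K" using p(2) cinv_chart[OF c that] by force
   then show ?thesis using K by blast
  qed
  then show "0 = ext c w (cinv d y)" using p cinv_chart[OF d] by (auto simp: ext_def)
 qed
 have "x : U1 | x : U2"
 proof (cases "cinv d x : fst c")
  case True then show ?thesis unfolding U1_def using cinv_in[OF d x] chart_cinv[OF d x] by force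
 next
  case False
  have "cinv c ` K <= fst c" by (intro image_subsetI cinv_in[OF c] subsetD[OF K(2)])
  then have "cinv d x ~: cinv c ` K" using False by (rule contra_subsetD)
  then have "cinv d x : fst d - cinv c ` K" using cinv_in[OF d x] by simp
  then have "x : U2" unfolding U2_def by (intro image_eqI[of _ _ "cinv d x"]) (simp_all only: chart_cinv[OF d x])
  then show ?thesis ..
 qed
 then show "EX T. open T & x : T & smooth_on T (%x. ext c w (cinv d x))"
 proof
  assume "x : U1" then show ?thesis by (intro exI[of _ U1] conjI o1 s1)
 next
  assume "x : U2" then show ?thesis by (intro exI[of _ U2] conjI o2 s2)
 qed
qed

lemma ext_cinv: "c : charts M ==> x : cimage c ==> ext c w (cinv c x) = w x"
 by (simp add: ext_def cinv_in chart_cinv)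

definition loc :: "('a, 'e) chart => ('a => 'b::real_normed_vector) => 'e => 'b" where
 "loc c h x = (if x : cimage c then h (cinv c x) else 0)"

lemma loc_ccs:
 assumes c: "c : charts M" and h: "smf h" and L: "compactin (mtop M) L" "L <= fst c" "!!p. p : fst c - L ==> h p = 0"
 shows "ccs (snd c ` L) (loc c h)"
proof (rule ccsI[OF compact_image[OF c L(1,2)] order_refl _ open_cimage[OF c]])
 show "loc c h x = 0" if "x ~: snd c ` L" for x
 proof (cases "x : cimage c")
  case True
  then have "cinv c x : fst c - L" using that chart_cinv[OF c True] cinv_in[OF c True] by (metis DiffI imageI)
  then show ?thesis using L(3) by (simp add: loc_def)
 qed (simp add: loc_def)
 show "smooth_on (cimage c) (loc c h)"
  by (rule smooth_on_cong[OF open_cimage[OF c] smfD[OF h c]]) (simp add: loc_def)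
qed (use L in auto)

end

locale closed_mfd = smfd +
 assumes compact_M: "compact_space (mtop M)"
begin

text \<open>\<open>volume_integral\<close> takes a partition of unity by \<open>SOME\<close>, and
  existence gives the chosen one its properties. Bumps from a finite subcover are divided by their
  sum, which is at least 1.\<close>

lemma ex_partition_of_unity: "EX K rh. partition_of_unity M K rh"
proof -
 have "EX c ph U. c : charts M & ccs (cimage c) ph & (ALL x. 0 <= ph x) & openin (mtop M) U & p : U & (ALL q:U. ext c ph q = (1::real))"
  if p: "p : points M" for p
 proof -
  obtain c where c: "c : charts M" "p : fst c" using charts_cover[OF p] by blast
  obtain ph W where W: "ccs (cimage c) ph" "ALL x. 0 <= ph x & ph x <= (1::real)" "open W" "{snd c p} <= W" "ALL x:W. ph x = 1"
   using ex_cutoff[OF compact_sing open_cimage[OF c(1)], of "snd c p"] c(2) by blast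
  define U where "U = cinv c ` (W Int cimage c)"
  have "openin (mtop M) U" unfolding U_def by (intro openin_cinv_image[OF c(1)] open_Int W open_cimage[OF c(1)]) simp
  moreover have "p : U" unfolding U_def using W(4) c cinv_chart[OF c(1,2)] by force
  moreover have "ext c ph q = 1" if q: "q : U" for q
  proof -
   obtain y where y: "y : W" "y : cimage c" "q = cinv c y" using q unfolding U_def by blast
   show ?thesis unfolding y(3) ext_cinv[OF c(1) y(2)] using W(5) y(1) by blast
  qed
  ultimately show ?thesis using c(1) W(1,2) by blast
 qed
 then have "ALL p:points M. EX t. fst t : charts M & ccs (cimage (fst t)) (fst (snd t)) & (ALL x. 0 <= fst (snd t) x)
   & openin (mtop M) (snd (snd t)) & p : snd (snd t) & (ALL q:snd (snd t). ext (fst t) (fst (snd t)) q = (1::real))"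
  by (metis fst_conv snd_conv)
 from bchoice[OF this] obtain t where t: "ALL p:points M. fst (t p) : charts M & ccs (cimage (fst (t p))) (fst (snd (t p)))
   & (ALL x. 0 <= fst (snd (t p)) x) & openin (mtop M) (snd (snd (t p))) & p : snd (snd (t p))
   & (ALL q:snd (snd (t p)). ext (fst (t p)) (fst (snd (t p))) q = (1::real))" ..
 define c where "c p = fst (t p)" for p
 define ph where "ph p = fst (snd (t p))" for p
 define U where "U p = snd (snd (t p))" for p
 have F: "c p : charts M & ccs (cimage (c p)) (ph p) & (ALL x. 0 <= ph p x)
   & openin (mtop M) (U p) & p : U p & (ALL q:U p. ext (c p) (ph p) q = (1::real))" if "p : points M" for p
  unfolding c_def ph_def U_def by (rule t[rule_format, OF that])
 obtain \<F> where \<F>: "finite \<F>" "\<F> <= U ` points M" "points M <= \<Union>\<F>"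
 proof -
  have 1: "compactin (mtop M) (points M)" using compact_M by (simp add: compact_space_def)
  have 2: "openin (mtop M) W" if "W : U ` points M" for W using that F by blast
  have 3: "points M <= \<Union>(U ` points M)" using F by blast
  obtain \<F> where "finite \<F> & \<F> <= U ` points M & points M <= \<Union>\<F>"
   using compactinD[OF 1 _ 3] 2 by auto
  then show thesis by (elim conjE) (rule that)
 qed
 obtain P where P: "P <= points M" "finite P" "\<F> = U ` P" using finite_subset_image[OF \<F>(1,2)] by blast
 have P: "finite P" "P <= points M" "points M <= (UN p:P. U p)" using P \<F>(3) by auto
 define e where "e p = ext (c p) (ph p)" for p
 have e: "smf (e p)" "!!q. e p q >= 0" if "p : P" for p
  using smf_ext[of "c p" "ph p"] F that P by (auto simp: e_def ext_def)
 define Ph where "Ph q = (SUM p:P. e p q)" for q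
 have Ph1: "Ph q >= 1" if q: "q : points M" for q
 proof -
  obtain p where p: "p : P" "q : U p" using P q by blast
  then have "e p q = 1" using F P by (auto simp: e_def)
  moreover have "e p q <= Ph q" unfolding Ph_def using p P e by (intro member_le_sum) auto
  ultimately show ?thesis by simp
 qed
 have smPh: "smf Ph" unfolding Ph_def by (intro smf_sum e)
 have smi: "smf (%q. inverse (Ph q))" unfolding smf_def
 proof
  fix d assume d: "d : charts M"
  show "smooth_on (cimage d) (%x. inverse (Ph (cinv d x)))"
  proof (rule smooth_on_inverse[OF open_cimage[OF d] smfD[OF smPh d]])
   fix x assume "x : cimage d"
   then have "Ph (cinv d x) >= 1" using Ph1 cinv_in[OF d] chart_subset[OF d] by blast
   then show "Ph (cinv d x) ~= 0" by simp
  qed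
 qed
 define K where "K = c ` P"
 \<comment> \<open>The partition is indexed by charts rather than by points, so bumps that live in
   the same chart are added.\<close>
 define rh where "rh k q = (SUM p:{p:P. c p = k}. e p q) * inverse (Ph q)" for k q
 have "partition_of_unity M K rh" unfolding partition_of_unity_def
 proof (intro conjI ballI)
  show "finite K" using P by (simp add: K_def)
  show "K <= charts M" using P F by (auto simp: K_def)
  fix k
  have "smf (rh k)" unfolding rh_def by (intro smf_mult smf_sum smi e) simp
  then show "smooth_on (cimage d) (rh k o cinv d)" if "d : charts M" for d
   using smfD that by (simp add: o_def)
  show "0 <= rh k q" if "q : points M" for q unfolding rh_def
   using Ph1[OF that] e by (intro mult_nonneg_nonneg sum_nonneg) auto
  assume kK: "k : K"
  have kc: "k : charts M" using kK P F by (auto simp: K_def)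
  have "ALL p:P. EX L. compact L & L <= cimage (c p) & (ALL x. x ~: L --> ph p x = 0)"
   using F P unfolding ccs_def by blast
  then obtain L where L: "!!p. p : P ==> compact (L p) & L p <= cimage (c p) & (ALL x. x ~: L p --> ph p x = 0)" by metis
  define C where "C = (UN p:{p:P. c p = k}. cinv k ` L p)"
  have "closedin (mtop M) C" unfolding C_def
  proof (rule closedin_Union)
   show "finite ((%p. cinv k ` L p) ` {p : P. c p = k})" using P by simp
   fix T assume "T : (%p. cinv k ` L p) ` {p : P. c p = k}"
   then obtain p where p: "p : P" "c p = k" "T = cinv k ` L p" by blast
   show "closedin (mtop M) T"
    unfolding p(3) using L[OF p(1)] p(2) by (intro closedin_cinv_image[OF kc]) simp_all
  qed
  moreover have "{q : points M. rh k q ~= 0} <= C"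
  proof
   fix q assume "q : {q : points M. rh k q ~= 0}"
   then have "(SUM p:{p:P. c p = k}. e p q) ~= 0" by (auto simp: rh_def)
   then obtain p where "p : {p : P. c p = k}" "e p q ~= 0" by (rule sum.not_neutral_contains_not_neutral)
   then have p: "p : P" "c p = k" "e p q ~= 0" by simp_all
   then have q: "q : fst k" "ph p (snd k q) ~= 0" by (auto simp: e_def ext_def split: if_splits)
   then have "snd k q : L p" using L p by blast
   then have "q : cinv k ` L p" by (intro image_eqI[of _ _ "snd k q"]) (simp_all only: cinv_chart[OF kc q(1)])
   then show "q : C" using p unfolding C_def by (intro UN_I[of p]) simp_all
  qed
  ultimately have "mtop M closure_of {q : points M. rh k q ~= 0} <= C" by (rule closure_of_minimal[rotated])
  also have "C <= fst k" unfolding C_def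
   by (intro UN_least image_subsetI cinv_in[OF kc]) (use L in auto)
  finally show "mtop M closure_of {q : points M. rh k q ~= 0} <= fst k" .
 next
  fix q assume q: "q : points M"
  have "(SUM k:K. rh k q) = (SUM k:K. SUM p:{p:P. c p = k}. e p q) * inverse (Ph q)"
   by (simp add: rh_def sum_distrib_right)
  also have "(SUM k:K. SUM p:{p:P. c p = k}. e p q) = Ph q" unfolding Ph_def K_def
   using P by (intro sum.group) auto
  finally show "(SUM k:K. rh k q) = 1" using Ph1[OF q] by simp
 qed
 then show ?thesis by (intro exI)
qed

end

section \<open>Integration on three-manifolds\<close>

lemma cc0I:
 assumes "open U" "continuous_on U g" "compact K" "K <= U" "!!x. x ~: K ==> g x = 0"
 shows "cc0 g"
proof -
 have "continuous_on (- K) g"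
  by (rule continuous_on_eq[of _ "%_. 0"]) (use assms(5) in auto)
 then have "continuous_on (U Un - K) g"
  by (intro continuous_on_open_Un assms) (simp_all add: assms compact_imp_closed open_Compl)
 moreover have "U Un - K = UNIV" using assms by blast
 moreover obtain R where "ALL x:K. norm x <= R" using compact_imp_bounded[OF assms(3)] bounded_iff by blast
 then have "ALL x. norm x > R --> g x = 0" using assms(5) by force
 ultimately show ?thesis unfolding cc0_def by auto
qed

lemma integral_cc0_eq: "cc0 (f :: 'a::euclidean_space => real) ==> (LINT x|lborel. f x) = integral UNIV f"
 by (rule integral_lborel[symmetric]) (rule cc0_integrable)

locale vol_mfd = closed_mfd M for M :: "('a, real^3) manifold" +
 fixes dvol :: "('a, real^3) form3"
 assumes volume_form: "volume_form M dvol"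
begin

lemma ext_eq_0:
 assumes "c : charts M" "!!x. x ~: T ==> u x = 0" "p ~: cinv c ` T" shows "ext c u p = 0"
proof (cases "p : fst c")
 case True
 have "snd c p ~: T"
 proof
  assume "snd c p : T"
  then have "cinv c (snd c p) : cinv c ` T" by (rule imageI)
  then show False using assms(3) cinv_chart[OF assms(1) True] by simp
 qed
 then show ?thesis using assms(2) by (simp add: ext_def)
qed (simp add: ext_def)

lemma cinv_image_subset: "c : charts M ==> T <= cimage c ==> cinv c ` T <= fst c"
 by (intro image_subsetI cinv_in) (auto dest: subsetD)

text \<open>Change of variables, with the Jacobian bounded on the compact set. Norms in different
  charts are compared only up to constants, so an inequality is enough.\<close>

lemma transition_comparison:
 assumes c: "c : charts M" and d: "d : charts M" and L: "compactin (mtop M) L" "L <= fst c Int fst d"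
 shows "EX C>=0. ALL k :: 'a => real. smf k & (ALL p. 0 <= k p) & (ALL p:points M - L. k p = 0) -->
  (LINT x|lborel. loc d k x) <= C * (LINT x|lborel. loc c k x)"
proof -
 define U where "U = snd c ` (fst c Int fst d)"
 define ph where "ph x = snd d (cinv c x)" for x
 define J where "J x = \<bar>det (matrix (DD ph x))\<bar>" for x
 have oU: "open U" unfolding U_def by (rule open_overlap[OF c d])
 have sm: "smooth_on U ph" unfolding ph_def U_def by (rule transition_smooth[OF c d])
 have der: "(ph has_derivative DD ph x) (at x)" if "x : U" for x by (rule smooth_has_deriv[OF sm that])
 have inj: "inj_on ph U"
 proof (rule inj_onI)
  fix x y assume "x : U" "y : U" and e: "ph x = ph y"
  then obtain p q where p: "p : fst c" "p : fst d" "x = snd c p" and q: "q : fst c" "q : fst d" "y = snd c q"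
   unfolding U_def by blast
  have "snd d p = snd d q" using e unfolding ph_def p(3) q(3) cinv_chart[OF c p(1)] cinv_chart[OF c q(1)] .
  then have "p = q" using inj_onD[OF inj_chart[OF d]] p q by blast
  then show "x = y" using p q by simp
 qed
 have cJ: "continuous_on U J"
 proof -
  show ?thesis unfolding J_def det_def matrix_def by (simp, intro continuous_intros smooth_on_continuous smooth_on_deriv sm)
 qed
 define K where "K = snd c ` L"
 have K: "compact K" "K <= U" unfolding K_def U_def using compact_image[OF c L(1)] L(2) by auto
 have "compact (J ` K)" by (intro compact_continuous_image continuous_on_subset[OF cJ] K)
 then obtain B0 where B0: "ALL x:K. J x <= B0" using compact_imp_bounded[of "J ` K"] unfolding bounded_iff by (auto simp: abs_le_iff)
 define B where "B = max B0 0"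
 have B: "B >= 0" "!!x. x : K ==> J x <= B" using B0 by (auto simp: B_def max.coboundedI1)
 have "(LINT x|lborel. loc d k x) <= B * (LINT x|lborel. loc c k x)"
  if k: "smf k" "ALL p. 0 <= k p" "ALL p:points M - L. k p = 0" for k :: "'a => real"
 proof -
  have cc: "ccs K (loc c k)" unfolding K_def
   by (rule loc_ccs[OF c k(1) L(1)]) (use L(2) k(3) chart_subset[OF c] in auto)
  have cd: "ccs (snd d ` L) (loc d k)"
   by (rule loc_ccs[OF d k(1) L(1)]) (use L(2) k(3) chart_subset[OF d] in auto)
  have c0: "loc c k x = 0" if "x ~: K" for x using cc ccs_compact_iff[OF K(1)] that by blast
  have eq: "loc d k (ph x) = loc c k x" if xU: "x : U" for x
  proof -
   obtain p where p: "p : fst c" "p : fst d" "x = snd c p" using xU unfolding U_def by blast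
   have 1: "ph x = snd d p" unfolding ph_def p(3) cinv_chart[OF c p(1)] ..
   have 2: "snd d p : cimage d" "snd c p : cimage c" using p by auto
   show ?thesis unfolding p(3) 1[unfolded p(3)] loc_def if_P[OF 2(1)] if_P[OF 2(2)] cinv_chart[OF c p(1)] cinv_chart[OF d p(2)] ..
  qed
  have img: "ph ` U = snd d ` (fst c Int fst d)"
   unfolding U_def ph_def image_image using cinv_chart[OF c] by (intro image_cong) auto
  have d0: "loc d k y = 0" if "y ~: ph ` U" for y
  proof -
   have "y ~: snd d ` L" using that L(2) unfolding img by blast
   then show ?thesis using cd ccs_compact_iff[OF compact_image[OF d L(1)]] L(2) by blast
  qed
  define G where "G x = (if x : U then J x * loc c k x else 0)" for x
  have G: "cc0 G"
  proof (rule cc0I[OF oU _ K])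
   have "continuous_on U (%x. J x * loc c k x)"
    by (intro continuous_on_mult cJ smooth_on_continuous ccs_smooth_on[OF cc])
   then show "continuous_on U G" by (rule continuous_on_eq) (simp add: G_def)
  qed (simp add: G_def c0)
  have ig: "integrable lborel (loc d k)" by (rule cc0_integrable[OF ccs_cc0[OF cd]])
  have abs: "loc d k absolutely_integrable_on ph ` U"
  proof -
   have "loc d k absolutely_integrable_on UNIV"
    using ig by (simp add: set_integrable_def integrable_completion)
   then show ?thesis
    by (rule set_integrable_subset) (use open_overlap[OF d c] in "auto simp: img Int_commute")
  qed
  \<comment> \<open>\<open>integral_change_of_variables\<close> speaks about values in
    \<open>real^'n\<close>; \<open>vec\<close> passes to \<open>real^1\<close>.\<close>
  let ?f = "%y. vec (loc d k y) :: real^1"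
  have fabs: "?f absolutely_integrable_on ph ` U" using abs unfolding absolutely_integrable_on_1_iff by simp
  have "integral (ph ` U) ?f = integral U (%x. \<bar>det (matrix (DD ph x))\<bar> *R ?f (ph x))"
   by (rule integral_change_of_variables[OF _ has_derivative_at_withinI[OF der] inj disjI1[OF fabs]]) (use oU in auto)
  then have cv: "integral (ph ` U) (loc d k) = integral U (%x. J x * loc d k (ph x))"
   unfolding integral_on_1_eq J_def by (simp add: vec_eq_iff)
  have "(LINT x|lborel. loc d k x) = integral UNIV (loc d k)" by (rule integral_cc0_eq[OF ccs_cc0[OF cd]])
  also have "... = integral UNIV (%x. if x : ph ` U then loc d k x else 0)"
   by (intro arg_cong[of _ _ "integral UNIV"] ext) (simp add: d0)
  also have "... = integral (ph ` U) (loc d k)" by (rule integral_restrict_UNIV)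
  also have "... = integral U (%x. J x * loc c k x)" unfolding cv by (rule integral_cong) (simp add: eq)
  also have "... = integral UNIV G" unfolding G_def by (rule integral_restrict_UNIV[symmetric])
  also have "... = (LINT x|lborel. G x)" by (rule integral_cc0_eq[OF G, symmetric])
  also have "... <= (LINT x|lborel. B * loc c k x)"
  proof (rule integral_mono)
   show "integrable lborel G" by (rule cc0_integrable[OF G])
   show "integrable lborel (%x. B * loc c k x)" by (intro integrable_mult_right cc0_integrable ccs_cc0[OF cc])
   fix x
   have nn: "0 <= loc c k x" using k(2) by (simp add: loc_def)
   show "G x <= B * loc c k x"
    using B nn by (cases "x : K") (auto simp: G_def c0 intro!: mult_right_mono)
  qed
  finally show ?thesis by simp
 qed
 then show ?thesis using B(1) by (intro exI[of _ B]) simp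
qed

section \<open>The integral as a finite sum over charts\<close>

text \<open>Literally the choice made inside \<open>volume_integral\<close>, so that
  \<open>K\<close> and \<open>rh\<close> are the charts and weights that the integral uses.\<close>

definition pou where "pou = (SOME (K, rh). partition_of_unity M K rh)"
definition "K = fst pou"
definition "rh = snd pou"

lemma pou: "partition_of_unity M K rh"
proof -
 have "EX p. case p of (A, r) => partition_of_unity M A r" using ex_partition_of_unity by auto
 from someI_ex[OF this] show ?thesis unfolding K_def rh_def pou_def case_prod_unfold .
qed

lemma finite_K: "finite K" and K_charts: "c : K ==> c : charts M"
 and rho_sum: "p : points M ==> (SUM c:K. rh c p) = 1"
 and rho_nonneg: "c : K ==> p : points M ==> 0 <= rh c p"
 using pou unfolding partition_of_unity_def by blast+

lemma smf_rho: "c : K ==> smf (rh c)"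
 using pou unfolding partition_of_unity_def smf_def o_def by blast

definition rsupp where "rsupp c = mtop M closure_of {p : points M. rh c p ~= 0}"

lemma rsupp: assumes "c : K" shows "compactin (mtop M) (rsupp c)" "rsupp c <= fst c"
proof -
 show "compactin (mtop M) (rsupp c)"
  unfolding rsupp_def by (rule closedin_compact_space[OF compact_M closedin_closure_of])
 have "ALL k:K. mtop M closure_of {p : points M. rh k p ~= 0} <= fst k"
  using pou unfolding partition_of_unity_def by (elim conjE)
 then show "rsupp c <= fst c" using assms unfolding rsupp_def by blast
qed

lemma rho_0: "p : points M ==> p ~: rsupp c ==> rh c p = 0"
 unfolding rsupp_def using closure_of_subset[of "{p : points M. rh c p ~= 0}" "mtop M"] by blast

lemma rho_le_1: assumes "c : K" "p : points M" shows "rh c p <= 1"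
proof -
 have "rh c p <= (SUM c:K. rh c p)" using assms rho_nonneg finite_K by (intro member_le_sum) auto
 then show ?thesis using rho_sum[OF assms(2)] by simp
qed

definition dens :: "('a, real^3) chart => real^3 => real" where
 "dens c x = dvol c (cinv c x) (axis 1 1) (axis 2 1) (axis 3 1)"

lemma dens: assumes c: "c : charts M" shows "smooth_on (cimage c) (dens c)" "x : cimage c ==> 0 < dens c x"
 using volume_form c cinv_in[OF c] unfolding volume_form_def smooth_3form_def dens_def[abs_def] by blast+

lemma dens_bounds:
 assumes c: "c : charts M" and L: "compact L" "L <= cimage c"
 shows "EX a b. 0 < a & 0 < b & (ALL x:L. a <= dens c x & dens c x <= b)"
proof (cases "L = {}")
 case False
 have cont: "continuous_on L (dens c)" by (rule continuous_on_subset[OF smooth_on_continuous[OF dens(1)[OF c]] L(2)])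
 obtain x where x: "x : L" "ALL y:L. dens c x <= dens c y" using continuous_attains_inf[OF L(1) False cont] by blast
 obtain y where y: "y : L" "ALL x:L. dens c x <= dens c y" using continuous_attains_sup[OF L(1) False cont] by blast
 have "0 < dens c x" "0 < dens c y" using dens(2)[OF c] x(1) y(1) L(2) by blast+
 then show ?thesis using x(2) y(2) by (intro exI[of _ "dens c x"] exI[of _ "dens c y"]) simp
qed (auto intro: exI[of _ 1])

definition I :: "('a => real) => real" where "I h = volume_integral M dvol h"

lemma I_eq: "I h = (SUM c:K. LINT x|lborel. loc c (%p. rh c p * h p) x * dens c x)"
proof -
 have "I h = (SUM c:K. set_lebesgue_integral lborel (cimage c) (%x. rh c (cinv c x) * h (cinv c x) * dens c x))"
  unfolding I_def volume_integral_def pou_def[symmetric] K_def rh_def dens_def by (simp add: case_prod_beta Let_def)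
 also have "... = (SUM c:K. LINT x|lborel. loc c (%p. rh c p * h p) x * dens c x)"
  unfolding set_lebesgue_integral_def
  by (intro sum.cong refl Bochner_Integration.integral_cong) (simp add: loc_def indicator_def)
 finally show ?thesis .
qed

lemma rho_smf: "c : K ==> smf h ==> smf (%p. rh c p * h p)"
 by (intro smf_mult smf_rho)

lemma loc_rho_ccs: assumes "c : K" "smf h" shows "ccs (snd c ` rsupp c) (loc c (%p. rh c p * h p))"
proof (rule loc_ccs[OF K_charts[OF assms(1)] rho_smf[OF assms] rsupp[OF assms(1)]])
 fix p assume "p : fst c - rsupp c"
 then have "p : points M" "p ~: rsupp c" using chart_subset[OF K_charts[OF assms(1)]] by blast+
 then show "rh c p * h p = 0" by (simp add: rho_0)
qed

lemma I_integrable: assumes "c : K" "smf h" shows "integrable lborel (%x. loc c (%p. rh c p * h p) x * dens c x)"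
proof (rule cc0_integrable[OF ccs_cc0])
 show "ccs (snd c ` rsupp c) (%x. loc c (%p. rh c p * h p) x * dens c x)"
  by (rule ccs_mult_smooth[OF loc_rho_ccs[OF assms] open_cimage[OF K_charts[OF assms(1)]] _ dens(1)[OF K_charts[OF assms(1)]]])
    (use rsupp[OF assms(1)] in auto)
qed

lemma I_add: assumes "smf h" "smf k" shows "I (%p. h p + k p) = I h + I k"
proof -
 have "loc c (%p. rh c p * (h p + k p)) x * dens c x
  = loc c (%p. rh c p * h p) x * dens c x + loc c (%p. rh c p * k p) x * dens c x" for c x
  by (simp add: loc_def algebra_simps)
 then show ?thesis unfolding I_eq
  by (simp add: Bochner_Integration.integral_add[OF I_integrable[OF _ assms(1)] I_integrable[OF _ assms(2)]] sum.distrib)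
qed

lemma I_mult: "I (%p. r * h p) = r * I h"
proof -
 have "loc c (%p. rh c p * (r * h p)) x = r * loc c (%p. rh c p * h p) x" for c x
  by (simp add: loc_def)
 then show ?thesis unfolding I_eq by (simp add: sum_distrib_left mult.assoc)
qed

lemma I_0: "I (%p. 0) = 0" using I_mult[of 0 "%p. 0"] by simp

lemma I_sum: "(!!i. i : A ==> smf (h i)) ==> I (%p. SUM i:A. h i p) = (SUM i:A. I (h i))"
 by (induction A rule: infinite_finite_induct) (simp_all add: I_0 I_add smf_sum)

lemma I_mono:
 assumes "smf h" "smf k" "!!p. p : points M ==> h p <= k p" shows "I h <= I k"
 unfolding I_eq
proof (intro sum_mono integral_mono I_integrable assms)
 fix c x assume c: "c : K"
 show "loc c (%p. rh c p * h p) x * dens c x <= loc c (%p. rh c p * k p) x * dens c x"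
 proof (cases "x : cimage c")
  case True
  then have "cinv c x : points M" using cinv_in[OF K_charts[OF c]] chart_subset[OF K_charts[OF c]] by blast
  then show ?thesis
   using rho_nonneg[OF c] assms(3) dens(2)[OF K_charts[OF c] True] by (auto simp: loc_def True intro!: mult_right_mono mult_left_mono)
 qed (simp add: loc_def)
qed

lemma I_nonneg: "smf h ==> (!!p. p : points M ==> 0 <= h p) ==> 0 <= I h"
 using I_mono[OF smf_const[of 0], of h] by (simp add: I_0)

lemma I_cong: "(!!p. p : points M ==> h p = k p) ==> I h = I k"
 unfolding I_eq
proof (intro sum.cong refl Bochner_Integration.integral_cong)
 fix c x assume eq: "!!p. p : points M ==> h p = k p" and c: "c : K"
 show "loc c (%p. rh c p * h p) x * dens c x = loc c (%p. rh c p * k p) x * dens c x"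
 proof (cases "x : cimage c")
  case True
  then have "cinv c x : points M" using cinv_in[OF K_charts[OF c]] chart_subset[OF K_charts[OF c]] by blast
  then show ?thesis using eq by (simp add: loc_def)
 qed (simp add: loc_def)
qed

lemma I_term_le:
 assumes "c : K" "smf h" "!!p. p : points M ==> 0 <= h p"
 shows "(LINT x|lborel. loc c (%p. rh c p * h p) x * dens c x) <= I h"
 unfolding I_eq
proof (rule member_le_sum[OF assms(1) _ finite_K])
 fix d assume "d : K - {c}"
 then have d: "d : K" by simp
 show "0 <= (LINT x|lborel. loc d (%p. rh d p * h p) x * dens d x)"
 proof (rule Bochner_Integration.integral_nonneg)
  fix x show "0 <= loc d (%p. rh d p * h p) x * dens d x"
  proof (cases "x : cimage d")
   case True
   then have "cinv d x : points M" using cinv_in[OF K_charts[OF d]] chart_subset[OF K_charts[OF d]] by blast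
   then show ?thesis
    using rho_nonneg[OF d] assms(3) dens(2)[OF K_charts[OF d] True] by (simp add: loc_def True)
  qed (simp add: loc_def)
 qed
qed

section \<open>Comparison of norms in a chart with norms on the manifold\<close>

text \<open>The weights sum to 1, which splits the local integral into pieces supported in the
  overlap of \<open>c\<close> with one chart \<open>e\<close> of the partition. Each piece is
  carried to \<open>e\<close>, where the density is bounded below on the support of the weight, and
  is then at most a multiple of a summand of \<open>I h\<close>.\<close>

lemma chart_norm_le_I:
 assumes c: "c : charts M" and th: "ccs (cimage c) th"
 shows "EX C>=0. ALL h. smf h & (ALL p. 0 <= h p) --> (LINT x|lborel. (th x)^2 * loc c h x) <= C * I h"
proof -
 obtain T where T: "compact T" "T <= cimage c" "ALL x. x ~: T --> th x = 0" using th unfolding ccs_def by blast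
 obtain B where B: "B >= 0" "!!x. norm (th x) <= B" using ccs_bounded[OF th] by blast
 define k where "k e h p = rh e p * ((ext c th p)^2 * h p)" for e and h :: "'a => real" and p
 have k_smf: "smf (k e h)" if "e : K" "smf h" for e h
  unfolding k_def power2_eq_square by (intro smf_mult smf_rho smf_ext c th that)
 have "EX C>=0. ALL h. smf h & (ALL p. 0 <= h p) --> (LINT x|lborel. loc c (k e h) x) <= C * I h" if e: "e : K" for e
 proof -
  note ec = K_charts[OF e]
  define L where "L = rsupp e Int cinv c ` T"
  have L: "compactin (mtop M) L" "L <= fst e Int fst c"
   unfolding L_def using rsupp[OF e] closedin_cinv_image[OF c T(1,2)] cinv_image_subset[OF c T(2)]
   by (simp add: compact_Int_closedin, blast)
  obtain C where C: "C >= 0" "!!k :: 'a => real. smf k ==> (ALL p. 0 <= k p) ==> (ALL p:points M - L. k p = 0) ==>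
   (LINT x|lborel. loc c k x) <= C * (LINT x|lborel. loc e k x)"
   using transition_comparison[OF ec c L] by (elim exE conjE) blast
  have rs: "compact (snd e ` rsupp e)" "snd e ` rsupp e <= cimage e" using compact_image[OF ec rsupp[OF e]] rsupp[OF e] by auto
  obtain a where a: "0 < a" "!!x. x : snd e ` rsupp e ==> a <= dens e x" using dens_bounds[OF ec rs] by blast
  have "(LINT x|lborel. loc c (k e h) x) <= (C * (B^2 / a)) * I h" if h: "smf h" "ALL p. 0 <= h p" for h
  proof -
   \<comment> \<open>Off the manifold the weights may take any values. Setting the function to 0
     there makes it nonnegative everywhere, as the comparison of charts requires.\<close>
   define k' where "k' p = (if p : points M then k e h p else 0)" for p
   have k': "smf k'" by (rule smf_cong[OF k_smf[OF e h(1)]]) (simp add: k'_def)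
   have lc: "loc f k' = loc f (k e h)" if "f : charts M" for f
    unfolding loc_def fun_eq_iff k'_def using cinv_in[OF that] chart_subset[OF that] by auto
   have nn: "ALL p. 0 <= k' p" using rho_nonneg[OF e] h by (auto simp: k'_def k_def)
   have "ALL p:points M - L. k' p = 0"
   proof
    fix p assume p: "p : points M - L"
    show "k' p = 0"
    proof (cases "p : rsupp e")
     case True
     then have "p ~: cinv c ` T" using p by (simp add: L_def)
     then have "ext c th p = 0" using T(3) by (intro ext_eq_0[OF c]) auto
     then show ?thesis by (simp add: k'_def k_def)
    qed (use p rho_0 in "simp add: k'_def k_def")
   qed
   from C(2)[OF k' nn this] have "(LINT x|lborel. loc c (k e h) x) <= C * (LINT x|lborel. loc e (k e h) x)"
    unfolding lc[OF c] lc[OF ec] .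
   also have "(LINT x|lborel. loc e (k e h) x) <= (LINT x|lborel. (B^2 / a) * (loc e (%p. rh e p * h p) x * dens e x))"
   proof (rule integral_mono)
    have "smf (%p. (ext c th p)^2 * h p)" unfolding power2_eq_square by (intro smf_mult smf_ext c th h)
    then show "integrable lborel (loc e (k e h))" unfolding k_def
     by (intro cc0_integrable ccs_cc0[OF loc_rho_ccs[OF e]])
    show "integrable lborel (%x. (B^2 / a) * (loc e (%p. rh e p * h p) x * dens e x))"
     by (intro integrable_mult_right I_integrable e h)
    fix x
    show "loc e (k e h) x <= (B^2 / a) * (loc e (%p. rh e p * h p) x * dens e x)"
    proof (cases "x : snd e ` rsupp e")
     case True
     then have x: "x : cimage e" using rs by blast
     let ?p = "cinv e x"
     have p: "?p : points M" using cinv_in[OF ec x] chart_subset[OF ec] by blast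
     have rh: "0 <= rh e ?p * h ?p" using rho_nonneg[OF e p] h by simp
     have "\<bar>ext c th ?p\<bar> <= \<bar>B\<bar>" using B by (auto simp: ext_def)
     then have "(ext c th ?p)^2 <= B^2" by (simp only: abs_le_square_iff)
     then have "loc e (k e h) x <= B^2 * (rh e ?p * h ?p)"
      using mult_right_mono[OF _ rh, of "(ext c th ?p)^2" "B^2"] x by (simp add: loc_def k_def mult_ac)
     also have "... <= (B^2 / a) * ((rh e ?p * h ?p) * dens e x)"
      using mult_left_mono[OF a(2)[OF True], of "B^2 / a * (rh e ?p * h ?p)"] a(1) rh by (simp add: mult_ac)
     finally show ?thesis using x by (simp add: loc_def)
    next
     case False
     have "loc e (%p. rh e p * g p) x = 0" if "smf g" for g
      using loc_rho_ccs[OF e that] False unfolding ccs_compact_iff[OF rs(1)] by blast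
     moreover have "smf (%p. (ext c th p)^2 * h p)" unfolding power2_eq_square by (intro smf_mult smf_ext c th h)
     ultimately show ?thesis using h(1) unfolding k_def by simp
    qed
   qed
   also have "... <= (B^2 / a) * I h"
    using a(1) h by (simp only: integral_mult_right_zero) (intro mult_left_mono I_term_le e, auto)
   finally show ?thesis using C(1) by (simp add: mult.assoc mult_left_mono)
  qed
  then show ?thesis using C(1) a(1) by (intro exI[of _ "C * (B^2 / a)"]) simp
 qed
 then have "ALL e:K. EX C>=0. ALL h. smf h & (ALL p. 0 <= h p) --> (LINT x|lborel. loc c (k e h) x) <= C * I h" ..
 from bchoice[OF this] obtain C where C: "ALL e:K. C e >= 0 & (ALL h. smf h & (ALL p. 0 <= h p) --> (LINT x|lborel. loc c (k e h) x) <= C e * I h)" ..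
 have "(LINT x|lborel. (th x)^2 * loc c h x) <= (SUM e:K. C e) * I h" if h: "smf h" "ALL p. 0 <= h p" for h
 proof -
  have "(th x)^2 * loc c h x = (SUM e:K. loc c (k e h) x)" for x
  proof (cases "x : cimage c")
   case True
   then have p: "cinv c x : points M" using cinv_in[OF c] chart_subset[OF c] by blast
   have "(SUM e:K. loc c (k e h) x) = (SUM e:K. rh e (cinv c x)) * ((th x)^2 * h (cinv c x))"
    by (simp add: loc_def True k_def ext_cinv[OF c True] sum_distrib_right)
   then show ?thesis using rho_sum[OF p] by (simp add: loc_def True)
  qed (simp add: loc_def)
  then have "(LINT x|lborel. (th x)^2 * loc c h x) = (LINT x|lborel. (SUM e:K. loc c (k e h) x))" by simp
  also have "... = (SUM e:K. LINT x|lborel. loc c (k e h) x)"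
  proof (rule Bochner_Integration.integral_sum)
   fix e assume e: "e : K"
   have "ccs (snd c ` cinv c ` T) (loc c (k e h))"
   proof (rule loc_ccs[OF c k_smf[OF e h(1)] compactin_cinv_image[OF c T(1,2)]])
    show "cinv c ` T <= fst c" by (rule cinv_image_subset[OF c T(2)])
    fix p assume "p : fst c - cinv c ` T"
    then have "ext c th p = 0" using T(3) by (intro ext_eq_0[OF c, of T]) auto
    then show "k e h p = 0" by (simp add: k_def)
   qed
   then show "integrable lborel (loc c (k e h))" by (intro cc0_integrable ccs_cc0)
  qed
  also have "... <= (SUM e:K. C e * I h)" using C h by (intro sum_mono) blast
  finally show ?thesis by (simp add: sum_distrib_right)
 qed
 then show ?thesis using C by (intro exI[of _ "SUM e:K. C e"]) (simp add: sum_nonneg)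
qed

text \<open>The converse direction of the comparison. The fixed compact set \<open>L'\<close> makes
  the Jacobians and densities involved uniformly bounded.\<close>

lemma I_ext_le:
 assumes c: "c : charts M" and L': "compact L'" "L' <= cimage c"
 shows "EX C>=0. ALL u :: real^3 => 'q::euclidean_space. ccs L' u --> I (%p. (norm (ext c u p))^2) <= C * (nrm u)^2"
proof -
 have "EX C>=0. ALL u :: real^3 => 'q. ccs L' u --> (LINT x|lborel. loc d (%p. rh d p * (norm (ext c u p))^2) x * dens d x) <= C * (nrm u)^2"
  if d: "d : K" for d
 proof -
  note dc = K_charts[OF d]
  define L where "L = rsupp d Int cinv c ` L'"
  have L: "compactin (mtop M) L" "L <= fst c Int fst d"
   unfolding L_def using rsupp[OF d] closedin_cinv_image[OF c L'] cinv_image_subset[OF c L'(2)]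
   by (simp add: compact_Int_closedin, blast)
  obtain C where C: "C >= 0" "!!k :: 'a => real. smf k ==> (ALL p. 0 <= k p) ==> (ALL p:points M - L. k p = 0) ==>
   (LINT x|lborel. loc d k x) <= C * (LINT x|lborel. loc c k x)"
   using transition_comparison[OF c dc L] by (elim exE conjE) blast
  have rs: "compact (snd d ` rsupp d)" "snd d ` rsupp d <= cimage d" using compact_image[OF dc rsupp[OF d]] rsupp[OF d] by auto
  obtain b where b: "0 < b" "!!x. x : snd d ` rsupp d ==> dens d x <= b" using dens_bounds[OF dc rs] by blast
  have "(LINT x|lborel. loc d (%p. rh d p * (norm (ext c u p))^2) x * dens d x) <= (b * C) * (nrm u)^2" if u: "ccs L' u" for u :: "real^3 => 'q"
  proof -
   have ue: "smf (ext c u)" by (rule smf_ext[OF c ccs_mono[OF u L'(2)]])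
   have u0: "ext c u p = 0" if "p ~: cinv c ` L'" for p
    using u that unfolding ccs_compact_iff[OF L'(1)] by (intro ext_eq_0[OF c, of L']) auto
   define k where "k p = (if p : points M then rh d p * (norm (ext c u p))^2 else 0)" for p
   have k: "smf k" by (rule smf_cong[OF rho_smf[OF d smf_norm_sq[OF ue]]]) (simp add: k_def)
   have lc: "loc f k = loc f (%p. rh d p * (norm (ext c u p))^2)" if "f : charts M" for f
    unfolding loc_def fun_eq_iff k_def using cinv_in[OF that] chart_subset[OF that] by auto
   have nn: "ALL p. 0 <= k p" using rho_nonneg[OF d] by (simp add: k_def)
   have k0: "ALL p:points M - L. k p = 0"
   proof
    fix p assume p: "p : points M - L"
    show "k p = 0"
     by (cases "p : rsupp d") (use p in "simp_all add: k_def L_def u0 rho_0")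
   qed
   have cd: "ccs (snd d ` rsupp d) (loc d k)" unfolding lc[OF dc] by (rule loc_rho_ccs[OF d smf_norm_sq[OF ue]])
   have "(LINT x|lborel. loc d k x * dens d x) <= (LINT x|lborel. b * loc d k x)"
   proof (rule integral_mono)
    show "integrable lborel (%x. loc d k x * dens d x)" unfolding lc[OF dc] by (rule I_integrable[OF d smf_norm_sq[OF ue]])
    show "integrable lborel (%x. b * loc d k x)" by (intro integrable_mult_right cc0_integrable ccs_cc0[OF cd])
    fix x
    have "0 <= loc d k x" using nn by (simp add: loc_def)
    moreover have "loc d k x = 0" if "x ~: snd d ` rsupp d" using cd that unfolding ccs_compact_iff[OF rs(1)] by blast
    ultimately show "loc d k x * dens d x <= b * loc d k x"
     using b(2)[of x] by (cases "x : snd d ` rsupp d") (auto simp: mult.commute[of b] intro: mult_left_mono)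
   qed
   also have "... <= b * (C * (LINT x|lborel. loc c k x))"
    using C(2)[OF k nn k0] b(1) by simp
   also have "(LINT x|lborel. loc c k x) <= (LINT x|lborel. (norm (u x))^2)"
   proof (rule integral_mono)
    have "ccs (snd c ` cinv c ` L') (loc c k)"
    proof (rule loc_ccs[OF c k compactin_cinv_image[OF c L']])
     show "cinv c ` L' <= fst c" by (rule cinv_image_subset[OF c L'(2)])
    qed (use u0 in "simp add: k_def")
    then show "integrable lborel (loc c k)" by (intro cc0_integrable ccs_cc0)
    show "integrable lborel (%x. (norm (u x))^2)"
     unfolding power2_norm_eq_inner by (intro ip_integrable ccs_cc0[OF u])
    fix x
    show "loc c k x <= (norm (u x))^2"
    proof (cases "x : cimage c")
     case True
     then have p: "cinv c x : points M" using cinv_in[OF c] chart_subset[OF c] by blast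
     have "rh d (cinv c x) * (norm (u x))^2 <= 1 * (norm (u x))^2"
      using rho_le_1[OF d p] by (intro mult_right_mono) auto
     then show ?thesis using p by (simp add: loc_def True k_def ext_cinv[OF c True])
    qed (simp add: loc_def)
   qed
   also have "(LINT x|lborel. (norm (u x))^2) = (nrm u)^2" by (simp add: nrm_sq ip_def power2_norm_eq_inner)
   finally show ?thesis using b(1) C(1) by (simp add: lc[OF dc] mult.assoc mult_left_mono)
  qed
  then show ?thesis using b(1) C(1) by (intro exI[of _ "b * C"]) simp
 qed
 then have "ALL d:K. EX C>=0. ALL u :: real^3 => 'q. ccs L' u --> (LINT x|lborel. loc d (%p. rh d p * (norm (ext c u p))^2) x * dens d x) <= C * (nrm u)^2" ..
 from bchoice[OF this] obtain C where C: "ALL d:K. C d >= 0 & (ALL u :: real^3 => 'q. ccs L' u --> (LINT x|lborel. loc d (%p. rh d p * (norm (ext c u p))^2) x * dens d x) <= C d * (nrm u)^2)" ..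
 have "I (%p. (norm (ext c u p))^2) <= (SUM d:K. C d) * (nrm u)^2" if u: "ccs L' u" for u :: "real^3 => 'q"
  unfolding I_eq sum_distrib_right using C u by (intro sum_mono) blast
 then show ?thesis using C by (intro exI[of _ "SUM d:K. C d"]) (simp add: sum_nonneg)
qed

end

section \<open>The Dirac operator on functions\<close>

context local_frame
begin

lemma nrm_dv_le:
 assumes L: "compact L" "L <= S"
 shows "EX A>=0. ALL u :: real^3 => 'q. ccs L u --> nrm (dv i u) <= A * gnrm u"
proof -
 obtain a where a: "!!i b. ccs S (a i b)" "!!i u x. ccs L (u :: real^3 => 'q) ==> dv i u x = (SUM b:Basis. a i b x *R DD u x b)"
  by (rule ex_coefficients[OF L, where 'b='q]) (rule that)
 have "ALL b. EX C>=0. ALL x. norm (a i b x) <= C" using ccs_bounded[OF a(1)] by blast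
 from choice[OF this] obtain C where C: "!!b. C b >= 0" "!!b x. norm (a i b x) <= C b" by blast
 have "nrm (dv i u) <= (SUM b:Basis. C b) * gnrm u" if u: "ccs L u" for u :: "real^3 => 'q"
 proof -
  have cd: "ccs L (%x. DD u x b)" for b by (rule ccs_deriv[OF u])
  have ca: "cc0 (%x. a i b x *R DD u x b)" for b
   by (rule ccs_cc0[OF ccs_scaleR_smooth[OF a(1) open_UNIV subset_UNIV ccs_smooth[OF cd]]])
  have e: "dv i u = (%x. SUM b:Basis. a i b x *R DD u x b)" using a(2)[OF u] by (rule ext)
  have "nrm (dv i u) <= (SUM b:Basis. nrm (%x. a i b x *R DD u x b))"
   unfolding e by (rule nrm_sum[OF ca])
  also have "... <= (SUM b:Basis. C b * gnrm u)"
  proof (rule sum_mono)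
   fix b :: "real^3" assume b: "b : Basis"
   have "nrm (%x. a i b x *R DD u x b) <= C b * nrm (%x. DD u x b)"
    by (rule nrm_mono[OF ca ccs_cc0[OF cd] _ C(1)]) (use C(2) in "auto intro!: mult_right_mono")
   also have "nrm (%x. DD u x b) <= gnrm u"
    unfolding gnrm_def by (rule member_le_sum[OF b]) (simp_all add: nrm_ge_0)
   finally show "nrm (%x. a i b x *R DD u x b) <= C b * gnrm u" using C(1) by (simp add: mult_left_mono)
  qed
  finally show ?thesis by (simp add: sum_distrib_right)
 qed
 then show ?thesis using C(1) by (intro exI[of _ "SUM b:Basis. C b"]) (simp add: sum_nonneg)
qed

text \<open>Against a smooth test function all derivatives can be moved away from \<open>u\<close>.
  This is what lets \<open>D\<close> pass to a limit that is only known in L^2.\<close>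

lemma ip_D_le:
 assumes L: "compact L" "L <= S" and ps: "ccs S ps"
 shows "EX C>=0. ALL u. ccs L u --> \<bar>ip (D u) ps\<bar> <= C * nrm u"
proof -
 obtain a where a: "!!i b. ccs S (a i b)" "!!i u x. ccs L (u :: real^3 => 'q) ==> dv i u x = (SUM b:Basis. a i b x *R DD u x b)"
  by (rule ex_coefficients[OF L, where 'b='q]) (rule that)
 define \<chi>' where "\<chi>' i b x = a i b x *R J i (ps x)" for i b x
 have c\<chi>: "ccs S (\<chi>' i b)" for i b unfolding \<chi>'_def[abs_def]
  by (rule ccs_scaleR_smooth[OF a(1) open_UNIV subset_UNIV ccs_smooth[OF ccs_J[OF ps]]])
 define C where "C = (SUM i:UNIV. SUM b:Basis. nrm (%x. DD (\<chi>' i b) x b))"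
 have "\<bar>ip (D u) ps\<bar> <= C * nrm u" if u: "ccs L u" for u
 proof -
  have cd: "ccs L (%x. DD u x b)" for b by (rule ccs_deriv[OF u])
  have "D u x \<bullet> ps x = (SUM i:UNIV. SUM b:Basis. - (DD u x b \<bullet> \<chi>' i b x))" for x
   unfolding D_def a(2)[OF u] by (simp add: inner_sum_left J_skew \<chi>'_def sum_negf)
  then have "ip (D u) ps = (SUM i:UNIV. SUM b:Basis. - ip (%x. DD u x b) (\<chi>' i b))"
   unfolding ip_def
   by (simp add: Bochner_Integration.integral_sum ip_integrable[OF ccs_cc0[OF cd] ccs_cc0[OF c\<chi>]] sum_negf)
  also have "... = (SUM i:UNIV. SUM b:Basis. ip u (%x. DD (\<chi>' i b) x b))"
   unfolding ip_by_parts[OF u c\<chi>] by simp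
  finally have "\<bar>ip (D u) ps\<bar> <= (SUM i:UNIV. \<bar>SUM b:Basis. ip u (%x. DD (\<chi>' i b) x b)\<bar>)"
   by (simp only: sum_abs)
  also have "... <= (SUM i:UNIV. SUM b:Basis. nrm u * nrm (%x. DD (\<chi>' i b) x b))"
   by (intro sum_mono order_trans[OF sum_abs] ip_Cauchy_Schwarz ccs_cc0[OF u] ccs_cc0[OF ccs_deriv[OF c\<chi>]])
  also have "... = C * nrm u" unfolding C_def by (simp add: sum_distrib_left[symmetric] mult.commute)
  finally show ?thesis .
 qed
 moreover have "C >= 0" unfolding C_def by (intro sum_nonneg nrm_ge_0)
 ultimately show ?thesis by blast
qed

end

locale frame_mfd = vol_mfd M dvol + quaternionic J
 for M :: "('a, real^3) manifold" and dvol :: "('a, real^3) form3" and J :: "3 => 'q::euclidean_space => 'q" +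
 fixes v :: "3 => ('a, real^3) vector_field"
 assumes positive_frame: "positive_divergence_free_frame M dvol v"
begin

lemma smooth_v: "c : charts M ==> smooth_on (cimage c) (%x. v i c (cinv c x))"
 and v_trans: "c : charts M ==> d : charts M ==> p : fst c ==> p : fst d ==> v i d p = dtrans c d p (v i c p)"
 and dvol_v: "c : charts M ==> p : fst c ==> 0 < dvol c p (v 1 c p) (v 2 c p) (v 3 c p)"
 using positive_frame unfolding positive_divergence_free_frame_def smooth_vector_field_def by blast+

text \<open>A linear relation between the frame fields, inserted into one slot of
  \<open>dvol\<close>, leaves by alternation a single coefficient times a positive number.\<close>

lemma local_frame_chart: assumes c: "c : charts M" shows "local_frame J (cimage c) (%i x. v i c (cinv c x))"
proof
 show "open (cimage c)" by (rule open_cimage[OF c])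
 show "smooth_on (cimage c) (%x. v i c (cinv c x))" for i by (rule smooth_v[OF c])
 fix x assume x: "x : cimage c"
 define p where "p = cinv c x"
 have p: "p : fst c" unfolding p_def by (rule cinv_in[OF c x])
 define A :: "real^3^3" where "A = (\<chi> i j. v j c p $ i)"
 have "det A ~= 0"
 proof
  assume "det A = 0"
  then obtain w where w: "w ~= 0" "A *v w = 0" 
   using invertible_det_nz[of A] unfolding invertible_left_inverse matrix_left_invertible_ker by blast
  have s: "w $ 1 *R v 1 c p + w $ 2 *R v 2 c p + w $ 3 *R v 3 c p = 0"
   using w(2) by (simp add: vec_eq_iff A_def matrix_vector_mult_def sum_3 mult.commute)
  have form: "smooth_3form M dvol" using volume_form unfolding volume_form_def by blast
  have lin: "linear (%z. dvol c p z a b)" "linear (%z. dvol c p a z b)" "linear (%z. dvol c p a b z)"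
   and alt: "dvol c p a a b = 0" "dvol c p a b a = 0" "dvol c p b a a = 0" for a b
   using form c p unfolding smooth_3form_def by blast+
  note ls = linear_add[OF lin(1)] linear_add[OF lin(2)] linear_add[OF lin(3)] linear_cmul[OF lin(1)] linear_cmul[OF lin(2)] linear_cmul[OF lin(3)]
  have "dvol c p (w $ 1 *R v 1 c p + w $ 2 *R v 2 c p + w $ 3 *R v 3 c p) (v 2 c p) (v 3 c p) = 0"
   unfolding s using linear_0[OF lin(1)] by simp
  then have 1: "w $ 1 = 0" using dvol_v[OF c p] by (simp add: ls alt)
  have "dvol c p (v 1 c p) (w $ 1 *R v 1 c p + w $ 2 *R v 2 c p + w $ 3 *R v 3 c p) (v 3 c p) = 0"
   unfolding s using linear_0[OF lin(2)] by simp
  then have 2: "w $ 2 = 0" using dvol_v[OF c p] by (simp add: ls alt)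
  have "dvol c p (v 1 c p) (v 2 c p) (w $ 1 *R v 1 c p + w $ 2 *R v 2 c p + w $ 3 *R v 3 c p) = 0"
   unfolding s using linear_0[OF lin(3)] by simp
  then have 3: "w $ 3 = 0" using dvol_v[OF c p] by (simp add: ls alt)
  show False using w(1) 1 2 3 by (simp add: vec_eq_iff forall_3)
 qed
 then show "det (\<chi> i j. v j c (cinv c x) $ i) ~= 0" unfolding A_def p_def .
qed

definition dd :: "3 => ('a => 'b::real_normed_vector) => 'a => 'b" where
 "dd i f p = (let c = chart_at M p in DD (%x. f (cinv c x)) (snd c p) (v i c p))"

definition Dir :: "('a => 'q) => 'a => 'q" where "Dir f p = (SUM i:UNIV. J i (dd i f p))"

lemma chart_atM: "p : points M ==> chart_at M p : charts M & p : fst (chart_at M p)"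
proof -
 assume "p : points M"
 then have "EX c. c : charts M & p : fst c" using charts_cover by blast
 from someI_ex[OF this] show ?thesis by (simp only: chart_at_def)
qed

lemma dd_chart:
 assumes c: "c : charts M" and p: "p : fst c" and f: "smf (f :: 'a => 'b::euclidean_space)"
 shows "dd i f p = DD (%x. f (cinv c x)) (snd c p) (v i c p)"
proof -
 define d where "d = chart_at M p"
 have "p : points M" using p chart_subset[OF c] by blast
 then have d: "d : charts M" "p : fst d" using chart_atM by (auto simp: d_def)
 define S where "S = snd c ` (fst c Int fst d)"
 have x: "snd c p : S" using p d by (auto simp: S_def)
 have e: "snd d (cinv c (snd c p)) = snd d p" by (simp add: cinv_chart[OF c p])
 have "DD (%x. f (cinv c x)) (snd c p) (v i c p) = DD (%x. f (cinv d (snd d (cinv c x)))) (snd c p) (v i c p)"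
 proof (intro fun_cong[OF deriv_cong_open[of S]] x)
  show "open S" unfolding S_def by (rule open_overlap[OF c d(1)])
  fix y assume "y : S"
  then obtain q where q: "q : fst c" "q : fst d" "y = snd c q" unfolding S_def by blast
  show "f (cinv c y) = f (cinv d (snd d (cinv c y)))" unfolding q(3) cinv_chart[OF c q(1)] cinv_chart[OF d(1) q(2)] ..
 qed
 also have "... = DD (%x. f (cinv d x)) (snd d (cinv c (snd c p))) (DD (%x. snd d (cinv c x)) (snd c p) (v i c p))"
  by (rule dir_deriv_compose[OF smfD[OF f d(1)] transition_smooth[OF c d(1)]]) (use x d(2) in "auto simp: S_def e")
 also have "DD (%x. snd d (cinv c x)) (snd c p) (v i c p) = v i d p"
  using v_trans[OF c d(1) p d(2)] by (simp add: dtrans_def o_def)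
 finally show ?thesis unfolding e by (simp add: dd_def d_def Let_def)
qed

lemma dv_loc:
 assumes c: "c : charts M" and x: "x : cimage c" and f: "smf (f :: 'a => 'b::euclidean_space)"
 shows "DD (loc c f) x (v i c (cinv c x)) = dd i f (cinv c x)"
proof -
 have "DD (loc c f) x = DD (%x. f (cinv c x)) x"
  by (rule deriv_cong_open[OF open_cimage[OF c] x]) (simp only: loc_def if_P)
 then show ?thesis unfolding dd_chart[OF c cinv_in[OF c x] f] chart_cinv[OF c x] by simp
qed

lemma D_loc:
 assumes c: "c : charts M" and x: "x : cimage c" and f: "smf f"
 shows "local_frame.D J (%i x. v i c (cinv c x)) (loc c f) x = Dir f (cinv c x)"
proof -
 interpret F: local_frame J "cimage c" "%i x. v i c (cinv c x)" by (rule local_frame_chart[OF c])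
 show ?thesis unfolding F.D_def F.dv_def Dir_def dv_loc[OF c x f] ..
qed

lemma smooth_loc: "c : charts M ==> smf f ==> smooth_on (cimage c) (loc c f)"
 by (rule smooth_on_cong[OF open_cimage smfD]) (simp_all only: loc_def if_P)

lemma smf_dd: assumes f: "smf (f :: 'a => 'b::euclidean_space)" shows "smf (dd i f)"
 unfolding smf_def
proof
 fix c assume c: "c : charts M"
 show "smooth_on (cimage c) (%x. dd i f (cinv c x))"
 proof (rule smooth_on_cong[OF open_cimage[OF c]])
  show "smooth_on (cimage c) (%x. SUM b:Basis. (v i c (cinv c x) \<bullet> b) *R DD (loc c f) x b)"
   by (intro smooth_on_sum smooth_on_scaleR smooth_on_inner smooth_on_const smooth_on_deriv open_cimage c smooth_v smooth_loc f)
  fix x assume x: "x : cimage c"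
  show "(SUM b:Basis. (v i c (cinv c x) \<bullet> b) *R DD (loc c f) x b) = dd i f (cinv c x)"
   unfolding dv_loc[OF c x f, symmetric]
   by (rule basis_expand[OF linear_DD[OF smooth_loc[OF c f] x], symmetric])
 qed
qed

lemma smf_Dir: "smf f ==> smf (Dir f)"
 unfolding Dir_def[abs_def] by (intro smf_sum smf_bounded_linear[OF bounded_linear_J] smf_dd)

lemma dd_diff_scale:
 assumes f: "smf (f :: 'a => 'b::euclidean_space)" and g: "smf g" and p: "p : points M"
 shows "dd i (%p. f p - g p) p = dd i f p - dd i g p" "dd i (%p. r *R f p) p = r *R dd i f p" "dd i (%p. q :: 'b) p = 0"
proof -
 obtain c where c: "c : charts M" "p : fst c" using charts_cover[OF p] by blast
 have x: "snd c p : cimage c" using c(2) by (rule imageI)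
 show "dd i (%p. f p - g p) p = dd i f p - dd i g p"
  unfolding dd_chart[OF c smf_diff[OF f g]] dd_chart[OF c f] dd_chart[OF c g]
  by (rule dir_deriv_diff[OF smfD[OF f c(1)] smfD[OF g c(1)] x])
 show "dd i (%p. r *R f p) p = r *R dd i f p"
  unfolding dd_chart[OF c smf_scale[OF f]] dd_chart[OF c f]
  by (rule dir_deriv_linear[OF bounded_linear_scaleR_right smfD[OF f c(1)] x])
 show "dd i (%p. q) p = 0"
  unfolding dd_chart[OF c smf_const] by simp
qed

lemma Dir_diff_scale:
 assumes f: "smf f" and g: "smf g" and p: "p : points M"
 shows "Dir (%p. f p - g p) p = Dir f p - Dir g p" "Dir (%p. r *R f p) p = r *R Dir f p" "Dir (%p. q) p = 0"
 unfolding Dir_def dd_diff_scale[OF f g p]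
 by (simp_all add: linear_diff[OF linear_J] linear_cmul[OF linear_J] linear_0[OF linear_J] sum_subtractf scaleR_sum_right)

definition l2 :: "('a => 'b::euclidean_space) => real" where "l2 h = sqrt (I (%p. (norm (h p))^2))"

lemma l2_sq: "smf h ==> (l2 h)^2 = I (%p. (norm (h p))^2)" and l2_ge_0: "smf h ==> 0 <= l2 h"
 unfolding l2_def by (simp_all add: I_nonneg smf_norm_sq)

lemma chart_nrm_le:
 assumes c: "c : charts M" and th: "ccs (cimage c) th"
 shows "EX C>=0. ALL h :: 'a => 'b::euclidean_space. smf h --> nrm (%x. th x *R loc c h x) <= C * l2 h"
proof -
 obtain C where C: "C >= 0" "!!h. smf h ==> (ALL p. 0 <= h p) ==> (LINT x|lborel. (th x)^2 * loc c h x) <= C * I h"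
  using chart_norm_le_I[OF c th] by (elim exE conjE) blast
 have "nrm (%x. th x *R loc c h x) <= sqrt C * l2 h" if h: "smf h" for h :: "'a => 'b"
 proof -
  have "(th x *R loc c h x) \<bullet> (th x *R loc c h x) = (th x)^2 * loc c (%p. (norm (h p))^2) x" for x
   by (simp add: loc_def dot_square_norm power2_eq_square)
  then have "nrm (%x. th x *R loc c h x) = sqrt (LINT x|lborel. (th x)^2 * loc c (%p. (norm (h p))^2) x)"
   unfolding nrm_def ip_def by simp
  also have "... <= sqrt (C * I (%p. (norm (h p))^2))"
   by (intro real_sqrt_le_mono C(2) smf_norm_sq h) simp
  finally show ?thesis by (simp add: l2_def real_sqrt_mult)
 qed
 then show ?thesis using C(1) by (intro exI[of _ "sqrt C"]) simp
qed

lemma l2_ext_le: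
 assumes c: "c : charts M" and L': "compact L'" "L' <= cimage c"
 shows "EX C>=0. ALL u :: real^3 => 'b::euclidean_space. ccs L' u --> l2 (ext c u) <= C * nrm u"
proof -
 obtain C where C: "C >= 0" "!!u :: real^3 => 'b. ccs L' u ==> I (%p. (norm (ext c u p))^2) <= C * (nrm u)^2"
  using I_ext_le[OF c L', where 'q='b] by (elim exE conjE) blast
 have "l2 (ext c u) <= sqrt C * nrm u" if u: "ccs L' u" for u :: "real^3 => 'b"
 proof -
  have "l2 (ext c u) <= sqrt (C * (nrm u)^2)" unfolding l2_def by (intro real_sqrt_le_mono C(2) u)
  then show ?thesis by (simp add: real_sqrt_mult nrm_ge_0)
 qed
 then show ?thesis using C(1) by (intro exI[of _ "sqrt C"]) simp
qed

lemma scaleR_D_loc: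
 assumes c: "c : charts M" and th: "ccs (cimage c) th" and f: "smf f"
 shows "th x *R local_frame.D J (%i x. v i c (cinv c x)) (loc c f) x = th x *R loc c (Dir f) x"
proof (cases "x : cimage c")
 case True
 show ?thesis unfolding D_loc[OF c True f] loc_def if_P[OF True] ..
next
 case False
 then have "th x = 0" using th unfolding ccs_def by blast
 then show ?thesis by simp
qed

text \<open>The cut-off is 1 near the support of the weight, so there the cut-off function has the
  derivatives of \<open>f\<close>. Elsewhere its commutator with the operator is of order zero and
  contributes \<open>l2 f\<close>.\<close>

lemma garding_chart:
 assumes c: "c : K"
 shows "EX C>=0. ALL f. smf f -->
  (LINT x|lborel. loc c (%p. rh c p * (norm (dd i f p))^2) x * dens c x) <= C * (l2 (Dir f) + l2 f)^2"
proof -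
 note cM = K_charts[OF c]
 interpret F: local_frame J "cimage c" "%i x. v i c (cinv c x)" by (rule local_frame_chart[OF cM])
 have rs: "compact (snd c ` rsupp c)" "snd c ` rsupp c <= cimage c"
  using compact_image[OF cM rsupp[OF c]] rsupp[OF c] by auto
 obtain th U where th: "ccs (cimage c) th" "open U" "snd c ` rsupp c <= U" "ALL x:U. th x = (1::real)"
  using ex_cutoff[OF rs(1) open_cimage[OF cM] rs(2)] by (elim exE conjE) (rule that)
 obtain b where b: "0 < b" "!!x. x : snd c ` rsupp c ==> dens c x <= b" using dens_bounds[OF cM rs] by blast
 obtain L where L: "compact L" "L <= cimage c" "ALL x. x ~: L --> th x = 0" using th(1) unfolding ccs_def by blast
 have thL: "ccs L th" using th(1) L unfolding ccs_def by blast
 obtain A where A: "A >= 0" "!!u :: real^3 => 'q. ccs L u ==> nrm (F.dv i u) <= A * gnrm u"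
  using F.nrm_dv_le[OF L(1,2), of i] by (elim exE conjE) blast
 obtain G where G: "G >= 0" "!!u. ccs L u ==> gnrm u <= G * (nrm (F.D u) + nrm u)"
  using F.garding[OF L(1,2)] by (elim exE conjE) blast
 have thv: "ccs (cimage c) (F.dv j th)" for j by (rule F.dv_ccs[OF th(1) order_refl])
 obtain B where B: "B >= 0" "!!h :: 'a => 'q. smf h ==> nrm (%x. th x *R loc c h x) <= B * l2 h"
  using chart_nrm_le[OF cM th(1), where 'b='q] by (elim exE conjE) blast
 have "ALL j. EX C>=0. ALL h :: 'a => 'q. smf h --> nrm (%x. F.dv j th x *R loc c h x) <= C * l2 h"
  by (rule allI, rule chart_nrm_le[OF cM thv])
 from choice[OF this] obtain B'
  where B'_: "ALL j. 0 <= B' j & (ALL h :: 'a => 'q. smf h --> nrm (%x. F.dv j th x *R loc c h x) <= B' j * l2 h)" ..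
 have B': "B' j >= 0" "smf h ==> nrm (%x. F.dv j th x *R loc c h x) <= B' j * l2 h" for j and h :: "'a => 'q"
  using B'_ by simp_all
 define E where "E = B + (SUM j:UNIV. B' j)"
 have E0: "0 <= (SUM j:UNIV. B' j)" by (intro sum_nonneg B'(1))
 have E: "B <= E" "E >= 0" using E0 B(1) by (auto simp: E_def)
 have "(LINT x|lborel. loc c (%p. rh c p * (norm (dd i f p))^2) x * dens c x) <= (b * (A * (G * E))^2) * (l2 (Dir f) + l2 f)^2"
  if f: "smf f" for f
 proof -
  define u where "u x = th x *R loc c f x" for x
  have u: "ccs L u" unfolding u_def[abs_def] by (rule ccs_scaleR_smooth[OF thL open_cimage[OF cM] L(2) smooth_loc[OF cM f]])
  have cw: "ccs (cimage c) (%x. F.dv j th x *R loc c f x)" for j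
   by (rule ccs_scaleR_smooth[OF thv open_cimage[OF cM] order_refl smooth_loc[OF cM f]])
  have cD: "ccs (cimage c) (%x. th x *R loc c (Dir f) x)"
   by (rule ccs_scaleR_smooth[OF th(1) open_cimage[OF cM] order_refl smooth_loc[OF cM smf_Dir[OF f]]])
  have Du: "F.D u = (%x. th x *R loc c (Dir f) x + (SUM j:UNIV. J j (F.dv j th x *R loc c f x)))"
  proof
   fix x
   show "F.D u x = th x *R loc c (Dir f) x + (SUM j:UNIV. J j (F.dv j th x *R loc c f x))"
   proof (cases "x : cimage c")
    case True
    show ?thesis unfolding u_def[abs_def] F.D_cutoff[OF True th(1) smooth_loc[OF cM f]] scaleR_D_loc[OF cM th(1) f] ..
   next
    case False
    have z: "g x = 0" if "ccs (cimage c) g" for g :: "real^3 => 'c::real_normed_vector" using that False unfolding ccs_def by blast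
    show ?thesis using z[OF F.D_ccs[OF ccs_mono[OF u L(2)] order_refl]] z[OF th(1)] z[OF thv]
     by (simp add: linear_0[OF linear_J])
   qed
  qed
  have "nrm (F.D u) <= nrm (%x. th x *R loc c (Dir f) x) + nrm (%x. SUM j:UNIV. J j (F.dv j th x *R loc c f x))"
   unfolding Du by (intro nrm_add ccs_cc0[OF cD] cc0_sum ccs_cc0[OF ccs_J[OF cw]])
  also have "nrm (%x. SUM j:UNIV. J j (F.dv j th x *R loc c f x)) <= (SUM j:UNIV. nrm (%x. J j (F.dv j th x *R loc c f x)))"
   by (intro nrm_sum ccs_cc0[OF ccs_J[OF cw]])
  also have "... <= (SUM j:UNIV. B' j * l2 f)" unfolding nrm_J by (intro sum_mono B'(2) f)
  finally have "nrm (F.D u) <= B * l2 (Dir f) + (SUM j:UNIV. B' j) * l2 f"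
   using B(2)[OF smf_Dir[OF f]] by (simp add: sum_distrib_right)
  moreover have "nrm u <= B * l2 f" unfolding u_def[abs_def] by (rule B(2)[OF f])
  moreover have "B * l2 (Dir f) <= E * l2 (Dir f)" by (intro mult_right_mono E l2_ge_0 smf_Dir f)
  moreover have "(SUM j:UNIV. B' j) * l2 f + B * l2 f = E * l2 f" by (simp add: E_def algebra_simps)
  ultimately have Dn: "nrm (F.D u) + nrm u <= E * (l2 (Dir f) + l2 f)" unfolding distrib_left by linarith
  have "nrm (F.dv i u) <= A * (G * (nrm (F.D u) + nrm u))"
   by (rule order_trans[OF A(2)[OF u] mult_left_mono[OF G(2)[OF u] A(1)]])
  also have "... <= A * (G * (E * (l2 (Dir f) + l2 f)))" by (intro mult_left_mono Dn A(1) G(1))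
  finally have dn: "nrm (F.dv i u) <= (A * (G * E)) * (l2 (Dir f) + l2 f)" by (simp add: mult.assoc)
  have cdv: "cc0 (F.dv i u)" by (rule ccs_cc0[OF F.dv_ccs[OF u L(2)]])
  have "(LINT x|lborel. loc c (%p. rh c p * (norm (dd i f p))^2) x * dens c x) <= (LINT x|lborel. b * (F.dv i u x \<bullet> F.dv i u x))"
  proof (rule integral_mono)
   show "integrable lborel (%x. loc c (%p. rh c p * (norm (dd i f p))^2) x * dens c x)"
    by (intro I_integrable c smf_norm_sq smf_dd f)
   show "integrable lborel (%x. b * (F.dv i u x \<bullet> F.dv i u x))" by (intro integrable_mult_right ip_integrable cdv)
   fix x
   show "loc c (%p. rh c p * (norm (dd i f p))^2) x * dens c x <= b * (F.dv i u x \<bullet> F.dv i u x)"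
   proof (cases "x : snd c ` rsupp c")
    case True
    then have x: "x : cimage c" "x : U" using rs th by blast+
    have "DD u x = DD (loc c f) x"
     by (rule deriv_cong_open[OF th(2) x(2)]) (use th(4) in "simp add: u_def")
    then have e: "F.dv i u x = dd i f (cinv c x)" unfolding F.dv_def by (simp only: dv_loc[OF cM x(1) f])
    have p: "cinv c x : points M" using cinv_in[OF cM x(1)] chart_subset[OF cM] by blast
    have "loc c (%p. rh c p * (norm (dd i f p))^2) x * dens c x = (rh c (cinv c x) * dens c x) * (norm (F.dv i u x))^2"
     unfolding loc_def if_P[OF x(1)] e by simp
    also have "... <= (1 * b) * (norm (F.dv i u x))^2"
     using rho_le_1[OF c p] rho_nonneg[OF c p] b(2)[OF True] dens(2)[OF cM x(1)] b(1)
     by (intro mult_right_mono mult_mono) auto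
    finally show ?thesis by (simp add: power2_norm_eq_inner)
   next
    case False
    have "loc c (%p. rh c p * (norm (dd i f p))^2) x = 0"
     using loc_rho_ccs[OF c smf_norm_sq[OF smf_dd[OF f]]] False unfolding ccs_compact_iff[OF rs(1)] by blast
    then show ?thesis using b(1) by simp
   qed
  qed
  also have "... = b * (nrm (F.dv i u))^2" by (simp add: nrm_sq ip_def)
  also have "... <= b * ((A * (G * E)) * (l2 (Dir f) + l2 f))^2"
   using b(1) by (intro mult_left_mono power_mono dn nrm_ge_0) auto
  finally show ?thesis by (simp add: power_mult_distrib mult.assoc)
 qed
 then show ?thesis using b(1) by (intro exI[of _ "b * (A * (G * E))^2"]) simp
qed

lemma garding_M: "EX C>=0. ALL f. smf f --> (SUM i:UNIV. I (%p. (norm (dd i f p))^2)) <= C * (l2 (Dir f) + l2 f)^2"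
proof -
 have "ALL q:UNIV \<times> K. EX C>=0. ALL f. smf f -->
   (LINT x|lborel. loc (snd q) (%p. rh (snd q) p * (norm (dd (fst q) f p))^2) x * dens (snd q) x) <= C * (l2 (Dir f) + l2 f)^2"
  using garding_chart by force
 from bchoice[OF this] obtain C where C: "ALL q:UNIV \<times> K. C q >= 0 & (ALL f. smf f -->
   (LINT x|lborel. loc (snd q) (%p. rh (snd q) p * (norm (dd (fst q) f p))^2) x * dens (snd q) x) <= C q * (l2 (Dir f) + l2 f)^2)" ..
 have C0: "C (i, c) >= 0" if "c : K" for i c using C that by simp
 have "(SUM i:UNIV. I (%p. (norm (dd i f p))^2)) <= (SUM i:UNIV. SUM c:K. C (i, c)) * (l2 (Dir f) + l2 f)^2" if f: "smf f" for f
  unfolding I_eq sum_distrib_right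
 proof (intro sum_mono)
  fix i c assume c: "c : K"
  show "(LINT x|lborel. loc c (%p. rh c p * (norm (dd i f p))^2) x * dens c x) <= C (i, c) * (l2 (Dir f) + l2 f)^2"
   using bspec[OF C, of "(i, c)"] c f by simp
 qed
 moreover have "0 <= (SUM i:UNIV. SUM c:K. C (i, c))" by (intro sum_nonneg C0)
 ultimately show ?thesis by blast
qed

end

section \<open>The Poincare inequality for regular frames\<close>

context frame_mfd
begin

lemma approximate_solutions_chart:
 assumes f: "!!n::nat. smf (f n)" "!!n. l2 (f n) <= B" and D: "(%n. l2 (Dir (f n))) \<longlonglongrightarrow> 0" and c: "c : charts M"
 shows "approximate_solutions J (cimage c) (%i x. v i c (cinv c x)) (%n. loc c (f n))"
proof (rule approximate_solutions.intro[OF local_frame_chart[OF c]], rule approximate_solutions_axioms.intro)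
 show "smooth_on (cimage c) (loc c (f n))" for n by (rule smooth_loc[OF c f(1)])
 fix th :: "real^3 => real" assume th: "ccs (cimage c) th"
 obtain C where C: "C >= 0" "!!h :: 'a => 'q. smf h ==> nrm (%x. th x *R loc c h x) <= C * l2 h"
  using chart_nrm_le[OF c th, where 'b='q] by (elim exE conjE) blast
 show "EX C. ALL n. nrm (%x. th x *R loc c (f n) x) <= C"
  by (intro exI[of _ "C * B"] allI order_trans[OF C(2)[OF f(1)]] mult_left_mono f(2) C(1))
 show "(%n. nrm (%x. th x *R local_frame.D J (%i x. v i c (cinv c x)) (loc c (f n)) x)) \<longlonglongrightarrow> 0"
  unfolding scaleR_D_loc[OF c th f(1)]
 proof (rule tendsto_sandwich[OF always_eventually always_eventually tendsto_const])
  show "ALL n. 0 <= nrm (%x. th x *R loc c (Dir (f n)) x)" by (simp add: nrm_ge_0)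
  show "ALL n. nrm (%x. th x *R loc c (Dir (f n)) x) <= C * l2 (Dir (f n))" using C(2)[OF smf_Dir[OF f(1)]] by blast
  show "(%n. C * l2 (Dir (f n))) \<longlonglongrightarrow> 0" using tendsto_mult_left[OF D, of C] by simp
 qed
qed

lemma l2_cong: "(!!p. p : points M ==> h p = k p) ==> l2 h = l2 k"
 unfolding l2_def by (intro arg_cong[of _ _ sqrt] I_cong) simp

lemma l2_scale: "l2 (%p. r *R h p) = \<bar>r\<bar> * l2 h"
 unfolding l2_def by (simp add: power_mult_distrib I_mult real_sqrt_mult)

lemma l2_sum_le:
 assumes "!!c. c : A ==> smf (g c :: 'a => 'b::euclidean_space)"
 shows "(l2 (%p. SUM c:A. g c p))^2 <= real (card A) * (SUM c:A. (l2 (g c))^2)"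
proof -
 have "(l2 (%p. SUM c:A. g c p))^2 = I (%p. (norm (SUM c:A. g c p))^2)"
  by (rule l2_sq) (intro smf_sum assms)
 also have "... <= I (%p. real (card A) * (SUM c:A. (norm (g c p))^2))"
 proof (rule I_mono)
  show "smf (%p. (norm (SUM c:A. g c p))^2)" by (intro smf_norm_sq smf_sum assms)
  show "smf (%p. real (card A) * (SUM c:A. (norm (g c p))^2))" by (intro smf_mult smf_const smf_norm_sq smf_sum assms)
  fix p
  have "(norm (SUM c:A. g c p))^2 <= (SUM c:A. norm (g c p))^2" by (intro power_mono norm_sum norm_ge_zero)
  also have "... <= (SUM c:A. (norm (g c p))^2) * real (card A)" by (rule sum_squared_le_sum_of_squares)
  finally show "(norm (SUM c:A. g c p))^2 <= real (card A) * (SUM c:A. (norm (g c p))^2)" by (simp add: mult.commute)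
 qed
 also have "... = real (card A) * (SUM c:A. (l2 (g c))^2)"
  using assms by (simp add: I_mult I_sum smf_norm_sq l2_sq)
 finally show ?thesis .
qed

text \<open>The test function is the cut-off of \<open>Dir F\<close> itself. Tested against it,
  \<open>Dir (f n - F)\<close> tends to 0 by \<open>ip_D_le\<close> and \<open>Dir (f n)\<close> by
  hypothesis, which leaves the norm of the cut-off \<open>Dir F\<close>. The factor
  \<open>ph\<close> occurs twice in \<open>ps\<close>, so that one copy goes to each side of the
  inner product.\<close>

lemma Dir_limit:
 assumes f: "!!n::nat. smf (f n)" and F: "smf F" and D: "(%n. l2 (Dir (f n))) \<longlonglongrightarrow> 0"
  and lim: "(%n. l2 (%p. f n p - F p)) \<longlonglongrightarrow> 0" and p: "p : points M"
 shows "Dir F p = 0"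
proof -
 obtain c where c: "c : charts M" "p : fst c" using charts_cover[OF p] by blast
 note cM = c(1)
 interpret F: local_frame J "cimage c" "%i x. v i c (cinv c x)" by (rule local_frame_chart[OF cM])
 have x0: "snd c p : cimage c" using c(2) by (rule imageI)
 have x0': "{snd c p} <= cimage c" using x0 by (simp only: insert_subset empty_subsetI)
 obtain ph U0 where ph: "ccs (cimage c) ph" "{snd c p} <= U0" "ALL x:U0. ph x = (1::real)"
  using ex_cutoff[OF compact_sing open_cimage[OF cM] x0'] by (elim exE conjE) (rule that)
 obtain L where L: "compact L" "L <= cimage c" "ALL x. x ~: L --> ph x = 0" using ph(1) unfolding ccs_def by blast
 obtain th U where th: "ccs (cimage c) th" "open U" "L <= U" "ALL x:U. th x = (1::real)"
  using ex_cutoff[OF L(1) open_cimage[OF cM] L(2)] by (elim exE conjE) (rule that)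
 obtain L2 where L2: "compact L2" "L2 <= cimage c" "ALL x. x ~: L2 --> th x = 0" using th(1) unfolding ccs_def by blast
 have thL: "ccs L2 th" using th(1) L2 unfolding ccs_def by blast
 define A where "A h x = ph x *R loc c (Dir h) x" for h x
 have cA: "ccs (cimage c) (A h)" if "smf h" for h
  unfolding A_def[abs_def] by (rule ccs_scaleR_smooth[OF ph(1) open_cimage[OF cM] order_refl smooth_loc[OF cM smf_Dir[OF that]]])
 define ps where "ps x = ph x *R A F x" for x
 have cps: "ccs (cimage c) ps"
  unfolding ps_def[abs_def] by (rule ccs_scaleR_smooth[OF ph(1) open_UNIV subset_UNIV ccs_smooth[OF cA[OF F]]])
 obtain C1 where C1: "C1 >= 0" "!!u. ccs L2 u ==> \<bar>ip (F.D u) ps\<bar> <= C1 * nrm u"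
  using F.ip_D_le[OF L2(1,2) cps] by (elim exE conjE) blast
 obtain C2 where C2: "C2 >= 0" "!!h :: 'a => 'q. smf h ==> nrm (%x. th x *R loc c h x) <= C2 * l2 h"
  using chart_nrm_le[OF cM th(1), where 'b='q] by (elim exE conjE) blast
 obtain C3 where C3: "C3 >= 0" "!!h :: 'a => 'q. smf h ==> nrm (%x. ph x *R loc c h x) <= C3 * l2 h"
  using chart_nrm_le[OF cM ph(1), where 'b='q] by (elim exE conjE) blast
 have bound: "(nrm (A F))^2 <= C3 * l2 (Dir (f n)) * nrm (A F) + C1 * (C2 * l2 (%p. f n p - F p))" for n
 proof -
  define h where "h p = f n p - F p" for p
  have h: "smf h" unfolding h_def[abs_def] by (rule smf_diff[OF f F])
  define u where "u x = th x *R loc c h x" for x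
  have u: "ccs L2 u" unfolding u_def[abs_def] by (rule ccs_scaleR_smooth[OF thL open_cimage[OF cM] L2(2) smooth_loc[OF cM h]])
  have "F.D u x \<bullet> ps x = A (f n) x \<bullet> A F x - A F x \<bullet> A F x" for x
  proof (cases "x : L")
   case True
   then have x: "x : cimage c" "x : U" using L th by blast+
   have "DD u x = DD (loc c h) x"
    by (rule deriv_cong_open[OF th(2) x(2)]) (use th(4) in "simp add: u_def")
   then have "F.D u x = F.D (loc c h) x" by (simp only: F.D_def F.dv_def)
   also have "... = Dir h (cinv c x)" by (rule D_loc[OF cM x(1) h])
   also have "... = Dir (f n) (cinv c x) - Dir F (cinv c x)"
    unfolding h_def[abs_def] using chart_subset[OF cM] cinv_in[OF cM x(1)] by (intro Dir_diff_scale(1) f F) blast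
   finally have e: "ph x *R F.D u x = A (f n) x - A F x" unfolding A_def loc_def if_P[OF x(1)] by (simp add: scaleR_diff_right)
   have "F.D u x \<bullet> ps x = (ph x *R F.D u x) \<bullet> A F x" by (simp add: ps_def)
   then show ?thesis unfolding e by (simp only: inner_diff_left)
  next
   case False
   then show ?thesis using L(3) by (simp add: ps_def A_def)
  qed
  then have "ip (F.D u) ps = ip (A (f n)) (A F) - ip (A F) (A F)"
   unfolding ip_def by (simp add: Bochner_Integration.integral_diff ip_integrable ccs_cc0[OF cA[OF f]] ccs_cc0[OF cA[OF F]])
  then have "(nrm (A F))^2 <= \<bar>ip (A (f n)) (A F)\<bar> + \<bar>ip (F.D u) ps\<bar>" unfolding nrm_sq by linarith
  also have "\<bar>ip (A (f n)) (A F)\<bar> <= nrm (A (f n)) * nrm (A F)"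
   by (intro ip_Cauchy_Schwarz ccs_cc0[OF cA] f F)
  also have "... <= C3 * l2 (Dir (f n)) * nrm (A F)"
   using C3(2)[OF smf_Dir[OF f]] unfolding A_def[abs_def] by (intro mult_right_mono nrm_ge_0)
  also have "\<bar>ip (F.D u) ps\<bar> <= C1 * (C2 * l2 h)"
   unfolding u_def[abs_def] by (rule order_trans[OF C1(2)[OF u[unfolded u_def[abs_def]]] mult_left_mono[OF C2(2)[OF h] C1(1)]])
  finally show ?thesis by (simp add: h_def[abs_def])
 qed
 have "(%n. C3 * l2 (Dir (f n)) * nrm (A F) + C1 * (C2 * l2 (%p. f n p - F p))) \<longlonglongrightarrow> C3 * 0 * nrm (A F) + C1 * (C2 * 0)"
  by (intro tendsto_intros D lim)
 then have "(nrm (A F))^2 <= C3 * 0 * nrm (A F) + C1 * (C2 * 0)" by (rule LIMSEQ_le_const) (use bound in blast)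
 then have "nrm (A F) = 0" by simp
 then have "A F (snd c p) = 0" by (rule nrm_eq_0[OF ccs_cc0[OF cA[OF F]]])
 then show ?thesis unfolding A_def loc_def if_P[OF x0] cinv_chart[OF c] using ph(2,3) by simp
qed

text \<open>Rellich's theorem in each chart gives an L^2 Cauchy subsequence of the cut-off
  functions, and interior regularity makes its limit smooth. The limits are glued with the weights
  of the partition, which the cut-offs do not disturb because they are 1 on the supports of the
  weights.\<close>

lemma compactness:
 assumes f: "!!n::nat. smf (f n)" "!!n. l2 (f n) <= B" and D: "(%n. l2 (Dir (f n))) \<longlonglongrightarrow> 0"
 shows "EX (r::nat => nat) F. strict_mono r & smf F & (%n. l2 (%p. f (r n) p - F p)) \<longlonglongrightarrow> 0 & (ALL p:points M. Dir F p = 0)"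
proof -
 have rs: "compact (snd c ` rsupp c)" "snd c ` rsupp c <= cimage c" if "c : K" for c
  using compact_image[OF K_charts[OF that] rsupp[OF that]] rsupp[OF that] by auto
 have "ALL c:K. EX th :: real^3 => real. ccs (cimage c) th & (ALL x:snd c ` rsupp c. th x = 1)"
 proof
  fix c assume c: "c : K"
  obtain th U where "ccs (cimage c) th" "open U" "snd c ` rsupp c <= U" "ALL x:U. th x = (1::real)"
   using ex_cutoff[OF rs(1)[OF c] open_cimage[OF K_charts[OF c]] rs(2)[OF c]] by (elim exE conjE) (rule that)
  then show "EX th :: real^3 => real. ccs (cimage c) th & (ALL x:snd c ` rsupp c. th x = 1)"
   by (intro exI[of _ th]) (simp add: subset_iff)
 qed
 from bchoice[OF this] obtain th :: "('a, real^3) chart => real^3 => real"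
  where th': "ALL c:K. ccs (cimage c) (th c) & (ALL x:snd c ` rsupp c. th c x = 1)" ..
 have th: "ccs (cimage c) (th c)" "!!p. p : rsupp c ==> th c (snd c p) = 1" if "c : K" for c using th' that by blast+
 define W where "W c n x = th c x *R loc c (f n) x" for c n x
 have cW: "ccs (cimage c) (W c n)" if "c : K" for c n
  unfolding W_def[abs_def] by (rule ccs_scaleR_smooth[OF th(1)[OF that] open_cimage[OF K_charts[OF that]] order_refl smooth_loc[OF K_charts[OF that] f(1)]])
 \<comment> \<open>Adding the distances over the charts yields one subsequence for all of
   them.\<close>
 have "totally_bounded_seq (%m n. SUM c:K. nrm (%x. W c m x - W c n x))"
 proof (rule totally_bounded_seq_sum)
  fix c assume c: "c : K"
  interpret A: approximate_solutions J "cimage c" "%i x. v i c (cinv c x)" "%n. loc c (f n)"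
   by (rule approximate_solutions_chart[OF f D K_charts[OF c]])
  obtain C where C: "!!n. nrm (A.w (th c) n) <= C" "!!n. gnrm (A.w (th c) n) <= C"
   using A.gnrm_w_bounded[OF th(1)[OF c]] by (elim exE conjE) blast
  obtain L where L: "compact L" "L <= cimage c" "ALL x. x ~: L --> th c x = 0" using th(1)[OF c] unfolding ccs_def by blast
  have thL: "ccs L (th c)" using th(1)[OF c] L unfolding ccs_def by blast
  obtain R where "ALL x:L. norm x <= R" using compact_imp_bounded[OF L(1)] unfolding bounded_iff by blast
  then have "L <= cball 0 R" by (simp add: subset_iff)
  then have "ccs (cball 0 R) (A.w (th c) n)" for n by (rule ccs_mono[OF A.w_ccs[OF thL L(2)]])
  from rellich[OF this C] show "totally_bounded_seq (%m n. nrm (%x. W c m x - W c n x))"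
   unfolding A.w_def W_def .
 qed
 from totally_bounded_seq_Cauchy[OF this] obtain s :: "nat => nat" where s: "strict_mono s"
  and cau: "ALL e>0. EX N. ALL m>=N. ALL n>=N. (SUM c:K. nrm (%x. W c (s m) x - W c (s n) x)) < e" by (elim exE conjE)
 have Ds: "(%n. l2 (Dir (f (s n)))) \<longlonglongrightarrow> 0" using LIMSEQ_subseq_LIMSEQ[OF D s] by (simp add: o_def)
 have "ALL c:K. EX G. ccs UNIV G & (%n. nrm (%x. W c (s n) x - G x)) \<longlonglongrightarrow> 0"
 proof
  fix c assume c: "c : K"
  interpret A: approximate_solutions J "cimage c" "%i x. v i c (cinv c x)" "%n. loc c (f (s n))"
   by (rule approximate_solutions_chart[OF f(1) f(2) Ds K_charts[OF c]])
  show "EX G. ccs UNIV G & (%n. nrm (%x. W c (s n) x - G x)) \<longlonglongrightarrow> 0"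
   unfolding W_def
  proof (rule A.local_limit[OF th(1)[OF c], unfolded A.w_def])
   fix e :: real assume "e > 0"
   then obtain N where N: "!!m n. m >= N ==> n >= N ==> (SUM c:K. nrm (%x. W c (s m) x - W c (s n) x)) < e" using cau by blast
   have "nrm (%x. W c (s m) x - W c (s n) x) < e" if "m >= N" "n >= N" for m n
    by (rule le_less_trans[OF member_le_sum[OF c _ finite_K] N[OF that]]) (rule nrm_ge_0)
   then show "EX N. ALL m>=N. ALL n>=N. nrm (%x. th c x *R loc c (f (s m)) x - th c x *R loc c (f (s n)) x) < e"
    unfolding W_def by (intro exI[of _ N] allI impI)
  qed
 qed
 from bchoice[OF this] obtain G where G': "ALL c:K. ccs UNIV (G c) & (%n. nrm (%x. W c (s n) x - G c x)) \<longlonglongrightarrow> 0" ..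
 have G: "ccs UNIV (G c)" "(%n. nrm (%x. W c (s n) x - G c x)) \<longlonglongrightarrow> 0" if "c : K" for c using G' that by blast+
 define r where "r c = loc c (rh c)" for c
 have r: "ccs (snd c ` rsupp c) (r c)" if "c : K" for c
  using loc_rho_ccs[OF that smf_const[of 1]] by (simp add: r_def)
 have r1: "\<bar>r c x\<bar> <= 1" if c: "c : K" for c x
 proof (cases "x : cimage c")
  case True
  have "cinv c x : points M" using cinv_in[OF K_charts[OF c] True] chart_subset[OF K_charts[OF c]] by blast
  then show ?thesis unfolding r_def loc_def if_P[OF True] using rho_le_1[OF c] rho_nonneg[OF c] by simp
 qed (simp add: r_def loc_def)
 \<comment> \<open>The local limits need not be compared on overlaps: \<open>f\<close> itself is the
   sum of its weighted localisations, so the sum of the weighted limits is the limit of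
   \<open>f (s n)\<close>.\<close>
 define F where "F p = (SUM c:K. ext c (%x. r c x *R G c x) p)" for p
 have rG: "ccs (snd c ` rsupp c) (%x. r c x *R g x)" if "c : K" "ccs UNIV g" for c and g :: "real^3 => 'q"
  by (rule ccs_scaleR_smooth[OF r[OF that(1)] open_UNIV subset_UNIV ccs_smooth[OF that(2)]])
 have smF: "smf F" unfolding F_def[abs_def]
 proof (rule smf_sum)
  fix c assume c: "c : K"
  show "smf (ext c (%x. r c x *R G c x))" by (rule smf_ext[OF K_charts[OF c] ccs_mono[OF rG[OF c G(1)[OF c]] rs(2)[OF c]]])
 qed
 define u where "u c n x = r c x *R (W c (s n) x - G c x)" for c n x
 have cu: "ccs (snd c ` rsupp c) (u c n)" if "c : K" for c n
  unfolding u_def[abs_def] by (intro rG that ccs_diff G(1) ccs_mono[OF cW] subset_UNIV)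
 have split: "f (s n) p - F p = (SUM c:K. ext c (u c n) p)" if p: "p : points M" for n p
 proof -
  have "ext c (u c n) p = rh c p *R f (s n) p - ext c (%x. r c x *R G c x) p" if c: "c : K" for c
  proof (cases "p : fst c")
   case True
   have x: "snd c p : cimage c" using True by (rule imageI)
   have "rh c p * th c (snd c p) = rh c p" by (cases "p : rsupp c") (simp_all add: th(2)[OF c] rho_0[OF p])
   then show ?thesis unfolding ext_def if_P[OF True] u_def W_def r_def loc_def if_P[OF x] cinv_chart[OF K_charts[OF c] True]
    by (simp add: scaleR_diff_right)
  next
   case False
   then have "p ~: rsupp c" using rsupp(2)[OF c] by blast
   then show ?thesis using False by (simp add: ext_def rho_0[OF p])
  qed
  then have "(SUM c:K. ext c (u c n) p) = (SUM c:K. rh c p) *R f (s n) p - F p"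
   by (simp add: F_def sum_subtractf scaleR_sum_left)
  then show ?thesis using rho_sum[OF p] by simp
 qed
 have "ALL c:K. EX C>=0. ALL u :: real^3 => 'q. ccs (snd c ` rsupp c) u --> l2 (ext c u) <= C * nrm u"
  using l2_ext_le[OF K_charts rs] by blast
 from bchoice[OF this] obtain C where C: "ALL c:K. C c >= 0 & (ALL u :: real^3 => 'q. ccs (snd c ` rsupp c) u --> l2 (ext c u) <= C c * nrm u)" ..
 define b where "b n = sqrt (real (card K) * (SUM c:K. (C c * nrm (%x. W c (s n) x - G c x))^2))" for n
 have le: "ALL n. l2 (%p. f (s n) p - F p) <= b n"
 proof
  fix n
  have eu: "smf (ext c (u c n))" if "c : K" for c by (rule smf_ext[OF K_charts[OF that] ccs_mono[OF cu[OF that] rs(2)[OF that]]])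
  have "(l2 (%p. f (s n) p - F p))^2 = (l2 (%p. SUM c:K. ext c (u c n) p))^2"
   by (intro arg_cong[of _ _ "%t. t^2"] l2_cong split)
  also have "... <= real (card K) * (SUM c:K. (l2 (ext c (u c n)))^2)" by (rule l2_sum_le[OF eu])
  also have "... <= real (card K) * (SUM c:K. (C c * nrm (%x. W c (s n) x - G c x))^2)"
  proof (intro mult_left_mono sum_mono power_mono)
   fix c assume c: "c : K"
   show "0 <= l2 (ext c (u c n))" by (rule l2_ge_0[OF eu[OF c]])
   have cc: "cc0 (%x. W c (s n) x - G c x)" by (intro cc0_diff ccs_cc0[OF cW[OF c]] ccs_cc0[OF G(1)[OF c]])
   have "nrm (u c n) <= nrm (%x. W c (s n) x - G c x)"
    by (rule nrm_mono1[OF ccs_cc0[OF cu[OF c]] cc]) (simp add: u_def mult_left_le_one_le r1[OF c])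
   moreover have "C c >= 0" "l2 (ext c (u c n)) <= C c * nrm (u c n)" using C c cu[OF c] by blast+
   ultimately show "l2 (ext c (u c n)) <= C c * nrm (%x. W c (s n) x - G c x)"
    using mult_left_mono[of "nrm (u c n)" "nrm (%x. W c (s n) x - G c x)" "C c"] by linarith
  qed simp
  finally show "l2 (%p. f (s n) p - F p) <= b n" unfolding b_def by (rule real_le_rsqrt)
 qed
 have "b \<longlonglongrightarrow> sqrt (real (card K) * (SUM c:K. (C c * 0)^2))"
  unfolding b_def[abs_def] by (intro tendsto_intros G(2))
 then have b0: "b \<longlonglongrightarrow> 0" by simp
 have ge0: "ALL n. 0 <= l2 (%p. f (s n) p - F p)" using l2_ge_0[OF smf_diff[OF f(1) smF]] ..
 have lim: "(%n. l2 (%p. f (s n) p - F p)) \<longlonglongrightarrow> 0"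
  by (rule tendsto_sandwich[OF always_eventually[OF ge0] always_eventually[OF le] tendsto_const b0])
 have "ALL p:points M. Dir F p = 0" using Dir_limit[OF f(1) smF Ds lim] by blast
 then show ?thesis using s smF lim by (intro exI[of _ s] exI[of _ F] conjI)
qed

lemma poincare:
 assumes reg: "!!f. smf f ==> (!!p. p : points M ==> Dir f p = 0) ==> EX q. ALL p:points M. f p = q"
 shows "EX C>=0. ALL f. smf f & (ALL b:Basis. I (%p. f p \<bullet> b) = 0) --> l2 f <= C * l2 (Dir f)"
proof (rule ccontr)
 assume neg: "~ ?thesis"
 have "ALL n. EX f. smf f & (ALL b:Basis. I (%p. f p \<bullet> b) = 0) & real (Suc n) * l2 (Dir f) < l2 f"
 proof
  fix n
  show "EX f. smf f & (ALL b:Basis. I (%p. f p \<bullet> b) = 0) & real (Suc n) * l2 (Dir f) < l2 f"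
  proof (rule ccontr)
   assume no: "~ ?thesis"
   have "ALL f. smf f & (ALL b:Basis. I (%p. f p \<bullet> b) = 0) --> l2 f <= real (Suc n) * l2 (Dir f)"
   proof (intro allI impI, rule ccontr)
    fix f assume f: "smf f & (ALL b:Basis. I (%p. f p \<bullet> b) = 0)" "~ l2 f <= real (Suc n) * l2 (Dir f)"
    have "real (Suc n) * l2 (Dir f) < l2 f" using f(2) by (simp only: not_le)
    with f(1) have "smf f & (ALL b:Basis. I (%p. f p \<bullet> b) = 0) & real (Suc n) * l2 (Dir f) < l2 f"
     by (elim conjE) (intro conjI)
    then have "EX f. smf f & (ALL b:Basis. I (%p. f p \<bullet> b) = 0) & real (Suc n) * l2 (Dir f) < l2 f" by (rule exI[of _ f])
    then show False by (rule notE[OF no])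
   qed
   then have "0 <= real (Suc n) & (ALL f. smf f & (ALL b:Basis. I (%p. f p \<bullet> b) = 0) --> l2 f <= real (Suc n) * l2 (Dir f))"
    by (rule conjI[OF of_nat_0_le_iff])
   then have "EX C>=0. ALL f. smf f & (ALL b:Basis. I (%p. f p \<bullet> b) = 0) --> l2 f <= C * l2 (Dir f)" by (rule exI[of _ "real (Suc n)"])
   then show False by (rule notE[OF neg])
  qed
 qed
 from choice[OF this] obtain f where f': "ALL n. smf (f n) & (ALL b:Basis. I (%p. f n p \<bullet> b) = 0) & real (Suc n) * l2 (Dir (f n)) < l2 (f n)" ..
 have f: "smf (f n)" "b : Basis ==> I (%p. f n p \<bullet> b) = 0" "real (Suc n) * l2 (Dir (f n)) < l2 (f n)" for n b
  using f' by blast+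
 have pos: "0 < l2 (f n)" for n
  by (rule le_less_trans[OF _ f(3)]) (intro mult_nonneg_nonneg l2_ge_0 smf_Dir f, simp)
 define g where "g n p = inverse (l2 (f n)) *R f n p" for n p
 have g: "smf (g n)" for n unfolding g_def[abs_def] by (rule smf_scale[OF f(1)])
 have g1: "l2 (g n) = 1" for n unfolding g_def[abs_def] l2_scale using pos[of n] by simp
 have g0: "I (%p. g n p \<bullet> b) = 0" if "b : Basis" for n b
  unfolding g_def inner_scaleR_left I_mult f(2)[OF that] by simp
 have "l2 (Dir (g n)) = inverse (l2 (f n)) * l2 (Dir (f n))" for n
 proof -
  have "l2 (Dir (g n)) = l2 (%p. inverse (l2 (f n)) *R Dir (f n) p)"
   unfolding g_def[abs_def] by (intro l2_cong Dir_diff_scale(2)[OF f(1) f(1)])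
  then show ?thesis unfolding l2_scale using pos[of n] by simp
 qed
 then have le: "l2 (Dir (g n)) <= inverse (real (Suc n))" for n
  using f(3)[of n] pos[of n] by (simp add: field_simps)
 have "(%n. l2 (Dir (g n))) \<longlonglongrightarrow> 0"
  by (rule tendsto_sandwich[OF always_eventually[OF allI[OF l2_ge_0[OF smf_Dir[OF g]]]] always_eventually[OF allI[OF le]]
     tendsto_const LIMSEQ_inverse_real_of_nat])
 from compactness[OF g _ this, of 1] g1 obtain r F where F: "smf F" "(%n. l2 (%p. g (r n) p - F p)) \<longlonglongrightarrow> 0" "ALL p:points M. Dir F p = 0"
  by (simp, elim exE conjE) (rule that)
 obtain q where q: "ALL p:points M. F p = q" using reg[OF F(1)] F(3) by blast
 \<comment> \<open>Mean zero makes \<open>g n\<close> orthogonal to the constant \<open>q\<close>,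
   so the square of the distance is 1 plus the square of the norm of the constant. This contradicts
   convergence to \<open>q\<close>.\<close>
 have "1 <= l2 (%p. g n p - F p)" for n
 proof -
  have "I (%p. g n p \<bullet> q) = I (%p. SUM b:Basis. (q \<bullet> b) * (g n p \<bullet> b))"
   by (intro I_cong) (simp add: euclidean_inner[of _ q] mult.commute)
  also have "... = (SUM b:Basis. (q \<bullet> b) * I (%p. g n p \<bullet> b))"
   by (subst I_sum) (intro smf_mult smf_inner smf_const g, simp add: I_mult)
  also have "... = 0" by (simp add: g0)
  finally have gq: "I (%p. g n p \<bullet> q) = 0" .
  have sg: "smf (%p. g n p \<bullet> q)" by (intro smf_inner g smf_const)
  have "(l2 (%p. g n p - F p))^2 = I (%p. (norm (g n p - F p))^2)" by (rule l2_sq[OF smf_diff[OF g F(1)]])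
  also have "... = I (%p. (norm (g n p))^2 + ((norm q)^2 + (- 2) * (g n p \<bullet> q)))"
   by (intro I_cong) (simp add: q power2_norm_eq_inner inner_diff_left inner_diff_right inner_commute)
  also have "... = I (%p. (norm (g n p))^2) + (I (%p. (norm q)^2) + (- 2) * I (%p. g n p \<bullet> q))"
   unfolding I_mult[symmetric] by (subst I_add, intro smf_norm_sq g, intro smf_add smf_const smf_mult sg, subst I_add, intro smf_const, intro smf_mult smf_const sg, rule refl)
  also have "... >= 1" using gq g1[of n] l2_sq[OF g, of n] I_nonneg[OF smf_const[of "(norm q)^2"]] by simp
  finally have "1^2 <= (l2 (%p. g n p - F p))^2" by simp
  then show ?thesis by (rule power2_le_imp_le) (rule l2_ge_0[OF smf_diff[OF g F(1)]])
 qed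
 then have "1 <= (0::real)" by (intro LIMSEQ_le_const[OF F(2)]) blast
 then show False by simp
qed

text \<open>The divisor in the mean value of a function. One summand \<open>h\<close> of the
  integrand is nonzero somewhere, and \<open>h^2 <= B * h\<close> reduces positivity of its integral
  to definiteness of the norm.\<close>

lemma I_1_pos: assumes "points M ~= {}" shows "0 < I (%p. 1)"
proof -
 obtain p where p: "p : points M" using assms by blast
 have "EX c:K. rh c p ~= 0"
 proof (rule ccontr)
  assume "~ ?thesis"
  then have "(SUM c:K. rh c p) = 0" by (intro sum.neutral) blast
  then show False using rho_sum[OF p] by simp
 qed
 then obtain c where c: "c : K" and rhc: "rh c p ~= 0" by blast
 note cM = K_charts[OF c]
 have pc: "p : fst c" using rho_0[OF p] rhc rsupp(2)[OF c] by blast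
 have x: "snd c p : cimage c" using pc by (rule imageI)
 define h where "h x = loc c (%p. rh c p * 1) x * dens c x" for x
 have h: "ccs (snd c ` rsupp c) h" unfolding h_def[abs_def]
  by (rule ccs_mult_smooth[OF loc_rho_ccs[OF c smf_const] open_cimage[OF cM] _ dens(1)[OF cM]]) (use rsupp[OF c] in auto)
 have h0: "0 <= h x" for x
 proof (cases "x : cimage c")
  case True
  have "cinv c x : points M" using cinv_in[OF cM True] chart_subset[OF cM] by blast
  then show ?thesis unfolding h_def loc_def if_P[OF True] using rho_nonneg[OF c] dens(2)[OF cM True] by simp
 qed (simp add: h_def loc_def)
 obtain B where B: "B >= 0" "!!x. norm (h x) <= B" using ccs_bounded[OF h] by blast
 have hI: "(LINT x|lborel. h x) <= I (%p. 1)" unfolding h_def[abs_def] by (rule I_term_le[OF c smf_const]) simp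
 have "ip h h <= (LINT x|lborel. B * h x)" unfolding ip_def
 proof (rule integral_mono)
  show "integrable lborel (%x. h x \<bullet> h x)" by (intro ip_integrable ccs_cc0[OF h])
  show "integrable lborel (%x. B * h x)" by (intro integrable_mult_right cc0_integrable ccs_cc0[OF h])
  show "h x \<bullet> h x <= B * h x" for x using B(2)[of x] h0[of x] by (simp add: mult_right_mono)
 qed
 then have le: "ip h h <= B * (LINT x|lborel. h x)" by simp
 have "I (%p. 1) ~= 0"
 proof
  assume "I (%p. 1) = 0"
  then have "B * (LINT x|lborel. h x) <= 0" using hI B(1) by (simp add: mult_nonneg_nonpos)
  then have "nrm h = 0" using le ip_ge_0[of h] by (simp add: nrm_def)
  then have "h (snd c p) = 0" by (rule nrm_eq_0[OF ccs_cc0[OF h]])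
  then show False unfolding h_def loc_def if_P[OF x] cinv_chart[OF cM pc] using rhc dens(2)[OF cM x] by simp
 qed
 moreover have "0 <= I (%p. 1)" by (rule I_nonneg[OF smf_const]) simp
 ultimately show ?thesis by simp
qed

text \<open>Subtracting the mean changes neither the derivatives nor \<open>Dir f\<close>. For
  functions of mean zero the Poincare inequality absorbs the lower-order term of Garding's
  inequality.\<close>

theorem energy_estimate:
 assumes reg: "!!f. smf f ==> (!!p. p : points M ==> Dir f p = 0) ==> EX q. ALL p:points M. f p = q"
 shows "EX C>=0. ALL f. smf f --> (SUM i:UNIV. I (%p. (norm (dd i f p))^2)) <= C * I (%p. (norm (Dir f p))^2)"
proof (cases "points M = {}")
 case True
 then have "I h = 0" for h using I_cong[of h "%p. 0"] by (simp add: I_0)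
 then show ?thesis by (intro exI[of _ 0]) simp
next
 case False
 note pos = I_1_pos[OF False]
 obtain C1 where C1: "C1 >= 0" "!!f. smf f ==> (SUM i:UNIV. I (%p. (norm (dd i f p))^2)) <= C1 * (l2 (Dir f) + l2 f)^2"
  using garding_M by (elim exE conjE) blast
 have P: "EX C>=0. ALL f. smf f & (ALL b:Basis. I (%p. f p \<bullet> b) = 0) --> l2 f <= C * l2 (Dir f)"
  by (rule poincare) (rule reg)
 obtain C2 where C2: "C2 >= 0" "!!f. smf f ==> (ALL b:Basis. I (%p. f p \<bullet> b) = 0) ==> l2 f <= C2 * l2 (Dir f)"
  using P by (elim exE conjE) blast
 have "(SUM i:UNIV. I (%p. (norm (dd i f p))^2)) <= (C1 * (1 + C2)^2) * I (%p. (norm (Dir f p))^2)" if f: "smf f" for f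
 proof -
  define m where "m = (SUM b:Basis. (I (%p. f p \<bullet> b) / I (%p. 1)) *R b)"
  define h where "h p = f p - m" for p
  have h: "smf h" unfolding h_def[abs_def] by (intro smf_diff f smf_const)
  have "I (%p. h p \<bullet> b) = 0" if b: "b : Basis" for b
  proof -
   have mb: "m \<bullet> b = I (%p. f p \<bullet> b) / I (%p. 1)" unfolding m_def using b by simp
   have "I (%p. h p \<bullet> b) = I (%p. f p \<bullet> b + (- (m \<bullet> b)) * 1)" by (intro I_cong) (simp add: h_def inner_diff_left)
   also have "... = I (%p. f p \<bullet> b) + (- (m \<bullet> b)) * I (%p. 1)"
    unfolding I_mult[symmetric] by (intro I_add smf_inner f smf_const)
   finally show ?thesis using pos by (simp add: mb)
  qed
  then have le: "l2 h <= C2 * l2 (Dir h)" by (intro C2(2) h) blast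
  have Dh: "l2 (Dir h) = l2 (Dir f)" unfolding h_def[abs_def]
   by (rule l2_cong) (simp add: Dir_diff_scale(1)[OF f smf_const] Dir_diff_scale(3)[OF f f])
  have "(SUM i:UNIV. I (%p. (norm (dd i f p))^2)) = (SUM i:UNIV. I (%p. (norm (dd i h p))^2))" unfolding h_def[abs_def]
   by (intro sum.cong refl I_cong) (simp add: dd_diff_scale(1)[OF f smf_const] dd_diff_scale(3)[OF f f])
  also have "... <= C1 * (l2 (Dir h) + l2 h)^2" by (rule C1(2)[OF h])
  also have "... <= C1 * ((1 + C2) * l2 (Dir f))^2"
   using le l2_ge_0[OF h] l2_ge_0[OF smf_Dir[OF h]] by (intro mult_left_mono power_mono C1(1)) (simp_all add: Dh distrib_right)
  also have "... = (C1 * (1 + C2)^2) * I (%p. (norm (Dir f p))^2)"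
   by (simp add: power_mult_distrib l2_sq[OF smf_Dir[OF f]])
  finally show ?thesis .
 qed
 then show ?thesis using C1(1) by (intro exI[of _ "C1 * (1 + C2)^2"]) simp
qed

end

section \<open>The Frobenius theorem for linear systems\<close>

text \<open>The product rule for a family of linear maps applied to a moving vector, for families
  that are known to be smooth only on each fixed vector.\<close>

lemma smooth_on_apply:
 fixes B :: "'a::euclidean_space => 'b::euclidean_space => 'c::real_normed_vector"
 assumes S: "open S" and B: "!!y. smooth_on S (%x. B x y)" "!!x. x : S ==> linear (B x)" and Y: "smooth_on S Y"
 shows "smooth_on S (%x. B x (Y x))"
  and "x : S ==> DD (%x. B x (Y x)) x a = DD (%z. B z (Y x)) x a + B x (DD Y x a)"
proof -
 have s: "smooth_on S (%x. (Y x \<bullet> e) *R B x e)" for e by (intro smooth_on_scaleR smooth_on_inner smooth_on_const S Y B)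
 have e: "(SUM e:Basis. (y \<bullet> e) *R B x e) = B x y" if "x : S" for x y
  by (rule basis_expand[OF B(2)[OF that], symmetric])
 show "smooth_on S (%x. B x (Y x))"
  by (rule smooth_on_cong[OF S smooth_on_sum[OF S s] e])
 assume x: "x : S"
 have L: "linear (B x)" by (rule B(2)[OF x])
 have 1: "DD (%z. B z (Y x)) x a = (SUM e:Basis. (Y x \<bullet> e) *R DD (%z. B z e) x a)"
 proof -
  have "DD (%z. B z (Y x)) x a = DD (%z. SUM e:Basis. (Y x \<bullet> e) *R B z e) x a"
   by (rule fun_cong[OF deriv_cong_open[OF S x e[symmetric]]])
  also have "... = (SUM e:Basis. DD (%z. (Y x \<bullet> e) *R B z e) x a)"
   by (rule dir_deriv_sum[OF smooth_on_scaleR[OF S smooth_on_const B(1)] x])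
  finally show ?thesis unfolding dir_deriv_linear[OF bounded_linear_scaleR_right B(1) x] .
 qed
 have "DD (%x. B x (Y x)) x a = DD (%x. SUM e:Basis. (Y x \<bullet> e) *R B x e) x a"
  by (rule fun_cong[OF deriv_cong_open[OF S x e[symmetric]]])
 also have "... = (SUM e:Basis. DD (%x. (Y x \<bullet> e) *R B x e) x a)" by (rule dir_deriv_sum[OF s x])
 also have "... = (SUM e:Basis. (Y x \<bullet> e) *R DD (%z. B z e) x a + (DD Y x a \<bullet> e) *R B x e)"
  unfolding dir_deriv_bilinear[OF bounded_bilinear_scaleR smooth_on_inner[OF S Y smooth_on_const] B(1) x]
   dir_deriv_linear[OF bounded_linear_inner_left Y x] ..
 finally show "DD (%x. B x (Y x)) x a = DD (%z. B z (Y x)) x a + B x (DD Y x a)"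
  by (simp add: 1 sum.distrib e[OF x])
qed

section \<open>Averages along the rays from a point\<close>

text \<open>A weighted average of \<open>g\<close> over the segment from \<open>x0\<close> to
  \<open>x\<close>. The exponent is a parameter because each differentiation in \<open>x\<close>
  produces one more factor \<open>t\<close>.\<close>

definition rad :: "'a::euclidean_space => nat => ('a => 'b::euclidean_space) => 'a => 'b" where
 "rad x0 k g x = integral {0..1} (%t. t ^ k *R g (x0 + t *R (x - x0)))"

lemma rad_integrand:
 assumes "continuous_on UNIV (g :: 'a::euclidean_space => 'b::euclidean_space)"
 shows "continuous_on {0..1::real} (%t. t ^ k *R g (x0 + t *R (x - x0)))"
 by (intro continuous_intros continuous_on_compose2[OF assms]) simp

lemma rad_integrable:
 assumes "continuous_on UNIV (g :: 'a::euclidean_space => 'b::euclidean_space)"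
 shows "(%t. t ^ k *R g (x0 + t *R (x - x0))) integrable_on {0..1::real}"
 by (rule integrable_continuous_real[OF rad_integrand[OF assms]])

lemma rad_has_derivative:
 assumes "ccs S (g :: 'a::euclidean_space => 'b::euclidean_space)"
 shows "(rad x0 k g has_derivative (%v. rad x0 (Suc k) (%z. DD g z v) x)) (at x)"
proof -
 obtain C where C: "C >= 0" "!!x v. norm (g (x + v) - g x - DD g x v) <= C * (norm v)^2" using ccs_taylor[OF assms] by blast
 have cg: "continuous_on UNIV g" by (rule smooth_on_continuous[OF ccs_smooth[OF assms]])
 have cd: "continuous_on UNIV (%z. DD g z v)" for v by (rule smooth_on_continuous[OF ccs_smooth[OF ccs_deriv[OF assms]]])
 have L: "linear (DD g z)" for z by (rule linear_DD[OF ccs_smooth[OF assms] UNIV_I])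
 have lin: "linear (%v. rad x0 (Suc k) (%z. DD g z v) x)"
 proof (rule linearI)
  fix u v and r :: real
  show "rad x0 (Suc k) (%z. DD g z (u + v)) x = rad x0 (Suc k) (%z. DD g z u) x + rad x0 (Suc k) (%z. DD g z v) x"
   unfolding rad_def linear_add[OF L] scaleR_add_right by (rule Henstock_Kurzweil_Integration.integral_add) (rule rad_integrable[OF cd])+
  show "rad x0 (Suc k) (%z. DD g z (r *R v)) x = r *R rad x0 (Suc k) (%z. DD g z v) x"
   unfolding rad_def linear_cmul[OF L] scaleR_left_commute[of _ r] by (rule integral_cmul)
 qed
 have "norm (rad x0 k g (x + v) - rad x0 k g x - rad x0 (Suc k) (%z. DD g z v) x) <= C * (norm v)^2" for v
 proof -
  let ?z = "%t. x0 + t *R (x - x0)"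
  let ?h = "%t. t ^ k *R g (x0 + t *R (x + v - x0)) - t ^ k *R g (?z t) - t ^ Suc k *R DD g (?z t) v"
  have "rad x0 k g (x + v) - rad x0 k g x - rad x0 (Suc k) (%z. DD g z v) x = integral {0..1} ?h"
   unfolding rad_def
   by (subst Henstock_Kurzweil_Integration.integral_diff[OF integrable_diff[OF rad_integrable[OF cg] rad_integrable[OF cg]] rad_integrable[OF cd]])
     (subst Henstock_Kurzweil_Integration.integral_diff[OF rad_integrable[OF cg] rad_integrable[OF cg]], rule refl)
  also have "norm ... <= (C * (norm v)^2) * (1 - 0)"
  proof (rule integral_bound)
   show "continuous_on {0..1} ?h" by (intro continuous_on_diff rad_integrand cg cd)
   fix t :: real assume t: "t : {0..1}"
   have z: "x0 + t *R (x + v - x0) = ?z t + t *R v" by (simp add: algebra_simps)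
   have "?h t = t ^ k *R (g (?z t + t *R v) - g (?z t) - DD g (?z t) (t *R v))"
    unfolding z linear_cmul[OF L] by (simp add: scaleR_diff_right mult.commute)
   then have "norm (?h t) <= 1 * (C * (norm (t *R v))^2)"
    using t C(2)[of "?z t" "t *R v"] by (simp only: norm_scaleR) (intro mult_mono, auto simp: power_le_one)
   also have "... <= C * (norm v)^2" using t C(1) by (simp add: mult_left_mono power_mult_distrib mult_left_le_one_le power_le_one)
   finally show "norm (?h t) <= C * (norm v)^2" .
  qed simp
  finally show ?thesis by simp
 qed
 then show ?thesis using has_derivative_quadratic lin by blast
qed

lemma rad_smooth: assumes "ccs S (g :: 'a::euclidean_space => 'b::euclidean_space)" shows "smooth_on UNIV (rad x0 k g)"
proof -
 have "C_on m UNIV (rad x0 k g)" if "ccs S g" for m k and g :: "'a => 'b"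
  using that
 proof (induction m arbitrary: k g)
  case 0
  have "continuous_on UNIV (rad x0 k g)"
   by (rule has_derivative_continuous_on) (rule rad_has_derivative[OF 0])
  then show ?case by simp
 next
  case (Suc m)
  show ?case by (rule C_on_SucI[OF open_UNIV rad_has_derivative[OF Suc.prems]]) (rule Suc.IH[OF ccs_deriv[OF Suc.prems]])
 qed
 then show ?thesis using assms by (simp add: smooth_on_def)
qed

text \<open>The fundamental theorem of calculus for the function
  \<open>t *R g (x0 + t *R (x - x0))\<close> on the unit interval.\<close>

lemma rad_fundamental:
 assumes g: "smooth_on UNIV (g :: 'a::euclidean_space => 'b::euclidean_space)"
 shows "g x = rad x0 0 g x + rad x0 1 (%z. DD g z (x - x0)) x"
proof -
 let ?z = "%t. x0 + t *R (x - x0)"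
 have cg: "continuous_on UNIV g" and cd: "continuous_on UNIV (%z. DD g z v)" for v
  by (rule smooth_on_continuous[OF g] smooth_on_continuous[OF smooth_on_deriv[OF g]])+
 have "((%t. t ^ 0 *R g (?z t) + t ^ 1 *R DD g (?z t) (x - x0)) has_integral (1 *R g (?z 1) - 0 *R g (?z 0))) {0..1::real}"
 proof (rule fundamental_theorem_of_calculus)
  fix t :: real
  have "(g has_derivative DD g (?z t)) (at (?z t))" by (rule smooth_has_deriv[OF g UNIV_I])
  moreover have "(?z has_derivative (%s. s *R (x - x0))) (at t within {0..1})" by (auto intro!: derivative_eq_intros)
  ultimately have "((%t. g (?z t)) has_derivative (%s. DD g (?z t) (s *R (x - x0)))) (at t within {0..1})"
   by (rule has_derivative_compose[rotated])
  from has_derivative_scaleR[OF has_derivative_ident this]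
  show "((%t. t *R g (?z t)) has_vector_derivative (t ^ 0 *R g (?z t) + t ^ 1 *R DD g (?z t) (x - x0))) (at t within {0..1})"
   unfolding has_vector_derivative_def
   by (rule has_derivative_eq_rhs) (simp add: fun_eq_iff linear_cmul[OF linear_DD[OF g UNIV_I]] scaleR_add_right mult.commute)
 qed simp
 from integral_unique[OF this] show ?thesis unfolding rad_def
  by (simp only: Henstock_Kurzweil_Integration.integral_add[OF rad_integrable[OF cg] rad_integrable[OF cd]]) simp
qed

lemma rad_bound:
 assumes g: "continuous_on UNIV (g :: 'a::euclidean_space => 'b::euclidean_space)" and b: "!!z. z : ball x0 r ==> norm (g z) <= b" and x: "x : ball x0 r"
 shows "norm (rad x0 k g x) <= b"
proof -
 have "norm (rad x0 k g x) <= b * (1 - 0)" unfolding rad_def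
 proof (rule integral_bound[OF _ rad_integrand[OF g]])
  fix t :: real assume t: "t : {0..1}"
  have "dist x0 (x0 + t *R (x - x0)) = \<bar>t\<bar> * norm (x - x0)" by (simp add: dist_norm)
  also have "... <= 1 * norm (x - x0)" using t by (intro mult_right_mono) auto
  finally have "norm (g (x0 + t *R (x - x0))) <= b" using x by (intro b) (simp add: dist_norm norm_minus_commute)
  then have "\<bar>t\<bar> ^ k * norm (g (x0 + t *R (x - x0))) <= 1 * b" using t by (intro mult_mono) (auto simp: power_le_one)
  then show "norm (t ^ k *R g (x0 + t *R (x - x0))) <= b" by (simp add: power_abs)
 qed simp
 then show ?thesis by simp
qed

lemma rad_diff:
 assumes "continuous_on UNIV (g :: 'a::euclidean_space => 'b::euclidean_space)" "continuous_on UNIV h"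
 shows "rad x0 k g x - rad x0 k h x = rad x0 k (%z. g z - h z) x"
 unfolding rad_def scaleR_diff_right[of "(t::real) ^ k" for t]
 by (rule Henstock_Kurzweil_Integration.integral_diff[OF rad_integrable[OF assms(1)] rad_integrable[OF assms(2)], symmetric])

lemma rad_sum:
 assumes "!!b. b : I ==> continuous_on UNIV (g b :: 'a::euclidean_space => 'b::euclidean_space)" "finite I"
 shows "rad x0 k (%z. SUM b:I. c b *R g b z) x = (SUM b:I. c b *R rad x0 k (g b) x)"
proof -
 have "rad x0 k (%z. SUM b:I. c b *R g b z) x = integral {0..1} (%t. SUM b:I. c b *R (t ^ k *R g b (x0 + t *R (x - x0))))"
  unfolding rad_def by (simp add: scaleR_sum_right mult.commute)
 also have "... = (SUM b:I. integral {0..1} (%t. c b *R (t ^ k *R g b (x0 + t *R (x - x0)))))"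
  by (rule integral_sum[OF assms(2)]) (intro integrable_cmul rad_integrable assms(1))
 finally show ?thesis unfolding rad_def integral_cmul .
qed

text \<open>Picard iteration along the rays from \<open>x0\<close>, which by itself yields a
  solution in the radial direction only. The condition \<open>flat\<close>, the vanishing of the
  curvature of the connection, shows that the defect in all directions contracts from one iterate to
  the next, so the limit solves the full system.\<close>

theorem frobenius:
 fixes A :: "'a::euclidean_space => 'a => 'b::euclidean_space => 'b"
 assumes S: "open S" "x0 : S"
  and lin1: "!!x y. x : S ==> linear (%a. A x a y)" and lin2: "!!x a. x : S ==> linear (A x a)"
  and sm: "!!a y. smooth_on S (%x. A x a y)"
  and flat: "!!x a b y. x : S ==>
   DD (%z. A z b y) x a - DD (%z. A z a y) x b = A x a (A x b y) - A x b (A x a y)"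
 shows "EX r>0. ball x0 r <= S & (ALL y0. EX Y. smooth_on (ball x0 r) Y & Y x0 = y0 &
  (ALL x:ball x0 r. (Y has_derivative (%a. A x a (Y x))) (at x)))"
proof -
 have "{x0} <= S" using S by simp
 from ex_cutoff[OF compact_sing S(1) this] obtain th U where th: "ccs S th" "open U" "{x0} <= U" "ALL x:U. th x = (1::real)"
  by (elim exE conjE) (rule that)
 obtain r1 where r1: "r1 > 0" "ball x0 r1 <= U" using th(2,3) open_contains_ball by blast
 have th0: "th x = 0" if "x ~: S" for x using th(1) that unfolding ccs_def by blast
 have US: "U <= S" using th(4) th0 by force
 \<comment> \<open>The cut-off gives coefficients that are defined and bounded on the whole space;
   near \<open>x0\<close> they are unchanged.\<close>
 define B where "B x a y = th x *R A x a y" for x a y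
 have Bl: "linear (%a. B x a y)" "linear (B x a)" for x a y
 proof -
  show "linear (%a. B x a y)"
   by (cases "x : S") (auto simp: B_def th0 linear_compose_scale_right lin1 module_hom_zero intro: linear_compose_scale_right)
  show "linear (B x a)" unfolding B_def[abs_def]
   by (cases "x : S") (auto simp: th0 linear_compose_scale_right lin2 module_hom_zero intro: linear_compose_scale_right)
 qed
 have cB: "ccs S (%x. B x a y)" for a y unfolding B_def by (rule ccs_scaleR_smooth[OF th(1) S(1) order_refl sm])
 have sB: "smooth_on UNIV (%x. B x a y)" for a y by (rule ccs_smooth[OF cB])
 have "ALL q. EX C>=0. ALL x. norm (B x (fst q) (snd q)) <= C" using ccs_bounded[OF cB] by blast
 from choice[OF this] obtain C where C_: "ALL q. 0 <= C q & (ALL x. norm (B x (fst q) (snd q)) <= C q)" ..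
 have C: "C (a, y) >= 0" "norm (B x a y) <= C (a, y)" for a x y using C_[THEN spec, of "(a, y)"] by simp_all
 define C' where "C' = (SUM b:Basis. SUM e:Basis. C (b, e))"
 define K where "K = real DIM('a) * (real DIM('b) * C')"
 have C'0: "C' >= 0" unfolding C'_def by (intro sum_nonneg C(1))
 have K0: "K >= 0" using C'0 by (simp add: K_def)
 have K: "norm (B x a y) <= K * norm a * norm y" for x a y
 proof -
  have "norm (B x b e) <= C'" if "b : Basis" "e : Basis" for b e
  proof -
   have "C (b, e) <= (SUM e:Basis. C (b, e))" using that C(1) by (intro member_le_sum) auto
   also have "... <= C'" unfolding C'_def using that C(1) by (intro member_le_sum sum_nonneg) auto
   finally show ?thesis using C(2)[where a=b and x=x and y=e] by linarith
  qed
  then have "norm (B x b y) <= real DIM('b) * C' * norm y" if "b : Basis" for b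
   using norm_deriv_basis_bound[OF Bl(2)] that by blast
  from norm_deriv_basis_bound[OF Bl(1) this] show ?thesis by (simp add: K_def mult_ac)
 qed
 \<comment> \<open>\<open>K * r <= 1 / 8\<close> makes the iterates contract by \<open>1 / 4\<close>
   and each of the two parts of the new defect at most a quarter of the bound on the old one, so the
   defect bound is halved.\<close>
 define r where "r = min r1 (1 / (8 * (K + 1)))"
 have r: "r > 0" "r <= r1" using r1 K0 by (auto simp: r_def)
 have "K * r <= K * (1 / (8 * (K + 1)))" using K0 by (intro mult_left_mono) (auto simp: r_def)
 also have "... <= 1 / 8" using K0 by (simp add: field_simps)
 finally have Kr: "K * r <= 1 / 8" .
 have bU: "ball x0 r <= U" using r(2) r1(2) by auto
 have BA: "B x a y = A x a y" if "x : ball x0 r" for x a y using th(4) bU that by (auto simp: B_def)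
 have dBA: "DD (%z. B z b y) x = DD (%z. A z b y) x" if "x : ball x0 r" for x b y
  by (rule deriv_cong_open[OF open_ball that BA])
 have Bflat: "DD (%z. B z b y) x a - DD (%z. B z a y) x b = B x a (B x b y) - B x b (B x a y)" if "x : ball x0 r" for x a b y
  unfolding dBA[OF that] BA[OF that] using that bU US by (intro flat) blast
 have w: "norm (x - x0) <= r" if "x : ball x0 r" for x using that by (simp add: dist_norm norm_minus_commute)
 have "EX Y. smooth_on (ball x0 r) Y & Y x0 = y0 & (ALL x:ball x0 r. (Y has_derivative (%a. A x a (Y x))) (at x))" for y0
 proof -
  define Y where "Y = rec_nat (%x. y0) (%n Yn x. y0 + (SUM b:Basis. ((x - x0) \<bullet> b) *R rad x0 0 (%z. B z b (Yn z)) x))"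
  have Y0: "Y 0 = (%x. y0)" and Y1: "Y (Suc n) = (%x. y0 + (SUM b:Basis. ((x - x0) \<bullet> b) *R rad x0 0 (%z. B z b (Y n z)) x))" for n
   by (simp_all add: Y_def)
  have cBY: "ccs S (%z. B z a (F z))" if "smooth_on UNIV F" for F a
   unfolding B_def
   by (rule ccs_scaleR_smooth[OF th(1) S(1) order_refl smooth_on_apply(1)[OF S(1) sm lin2 smooth_on_subset[OF that subset_UNIV]]])
  have sY: "smooth_on UNIV (Y n)" for n
  proof (induction n)
   case 0
   show ?case unfolding Y0 by (rule smooth_on_const)
  next
   case (Suc n)
   show ?case unfolding Y1
    by (intro smooth_on_add smooth_on_const smooth_on_sum smooth_on_scaleR smooth_on_inner smooth_on_diff smooth_on_ident open_UNIV
      rad_smooth[OF cBY[OF Suc]])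
  qed
  define g where "g n a z = B z a (Y n z)" for n a z
  have gz: "(%z. B z a (Y n z)) = g n a" for n a by (simp add: g_def[abs_def])
  have cg: "ccs S (g n a)" for n a unfolding g_def[abs_def] by (rule cBY[OF sY])
  have sg: "smooth_on UNIV (g n a)" for n a by (rule ccs_smooth[OF cg])
  have kg: "continuous_on UNIV (g n a)" for n a by (rule smooth_on_continuous[OF sg])
  have kd: "continuous_on UNIV (%z. DD (g n a) z b)" for n a b by (rule smooth_on_continuous[OF smooth_on_deriv[OF sg]])
  have gexp: "g n v = (%z. SUM b:Basis. (v \<bullet> b) *R g n b z)" for n v
   unfolding g_def[abs_def] by (rule ext) (rule basis_expand[OF Bl(1)])
  have dgexp: "DD (g n v) z a = (SUM b:Basis. (v \<bullet> b) *R DD (g n b) z a)" for n v z a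
   unfolding gexp[of n v] dir_deriv_sum[OF smooth_on_scaleR[OF open_UNIV smooth_on_const sg] UNIV_I]
    dir_deriv_linear[OF bounded_linear_scaleR_right sg UNIV_I] ..
  have step: "Y (Suc n) x = y0 + rad x0 0 (g n (x - x0)) x" for n x
   unfolding Y1 gexp[of n "x - x0"] rad_sum[OF kg finite_Basis] by (simp add: g_def[abs_def])
  have dY: "DD (Y (Suc n)) x a = rad x0 0 (g n a) x + rad x0 1 (%z. DD (g n (x - x0)) z a) x" for n x a
  proof -
   have "(Y (Suc n) has_derivative (%a. 0 + (SUM b:Basis. ((x - x0) \<bullet> b) *R rad x0 (Suc 0) (%z. DD (g n b) z a) x + ((a - 0) \<bullet> b) *R rad x0 0 (g n b) x))) (at x)"
    unfolding Y1 gz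
    by (intro has_derivative_add has_derivative_sum has_derivative_scaleR has_derivative_inner_left has_derivative_diff
      has_derivative_ident has_derivative_const rad_has_derivative[OF cg])
   from dir_deriv_eq[OF this] show ?thesis
    unfolding dgexp[of n "x - x0"] rad_sum[OF kd finite_Basis] gexp[of n a] rad_sum[OF kg finite_Basis]
    by (simp add: sum.distrib)
  qed
  have d1: "norm (Y (Suc n) x - Y n x) <= norm y0 * (1 / 4) ^ n" if "x : ball x0 r" for n x
   using that
  proof (induction n arbitrary: x)
   case 0
   have "norm (rad x0 0 (g 0 (x - x0)) x) <= K * r * norm y0"
   proof (rule rad_bound[OF kg _ 0])
    fix z
    have "norm (g 0 (x - x0) z) <= K * norm (x - x0) * norm y0" unfolding g_def Y0 by (rule K)
    also have "... <= K * r * norm y0" by (intro mult_right_mono mult_left_mono w 0 K0) auto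
    finally show "norm (g 0 (x - x0) z) <= K * r * norm y0" .
   qed
   also have "... <= (1 / 8) * norm y0" by (intro mult_right_mono Kr) simp
   finally have *: "norm (rad x0 0 (g 0 (x - x0)) x) <= (1 / 8) * norm y0" .
   have "norm (rad x0 0 (g 0 (x - x0)) x) <= norm y0" using * norm_ge_zero[of y0] by linarith
   then show ?case unfolding step Y0 by simp
  next
   case (Suc n)
   have "Y (Suc (Suc n)) x - Y (Suc n) x = rad x0 0 (%z. g (Suc n) (x - x0) z - g n (x - x0) z) x"
    unfolding step[of "Suc n"] rad_diff[OF kg kg, symmetric] by (simp add: step)
   also have "norm ... <= K * r * (norm y0 * (1 / 4) ^ n)"
   proof (rule rad_bound[OF continuous_on_diff[OF kg kg] _ Suc.prems])
    fix z assume z: "z : ball x0 r"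
    have "norm (g (Suc n) (x - x0) z - g n (x - x0) z) = norm (B z (x - x0) (Y (Suc n) z - Y n z))"
     unfolding g_def by (simp add: linear_diff[OF Bl(2)])
    also have "... <= K * norm (x - x0) * norm (Y (Suc n) z - Y n z)" by (rule K)
    also have "... <= K * r * (norm y0 * (1 / 4) ^ n)"
     using r K0 by (intro mult_mono mult_left_mono w Suc mult_nonneg_nonneg z) auto
    finally show "norm (g (Suc n) (x - x0) z - g n (x - x0) z) <= K * r * (norm y0 * (1 / 4) ^ n)" .
   qed
   also have "... <= (1 / 4) * (norm y0 * (1 / 4) ^ n)" using Kr by (intro mult_right_mono) auto
   finally show ?case by simp
  qed
  \<comment> \<open>the defect of the iterates, which flatness makes contract\<close>
  define R where "R n x a = DD (Y n) x a - B x a (Y n x)" for n x a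
  define D where "D = 4 * K * norm y0"
  have D0: "D >= 0" using K0 by (simp add: D_def)
  have d2: "norm (R n x a) <= D * (1 / 2) ^ n * norm a" if "x : ball x0 r" for n x a
   using that
  proof (induction n arbitrary: x a)
   case 0
   have "norm (R 0 x a) <= K * norm a * norm y0" using K[of x a y0] by (simp add: R_def Y0)
   also have "... = (1/4) * (D * norm a)" by (simp add: D_def)
   also have "... <= D * norm a" using D0 by simp
   finally show ?case by simp
  next
   case (Suc n)
   \<comment> \<open>By \<open>rad_fundamental\<close> the expression \<open>B x a (Y n x)\<close>
     has the same leading average as the derivative of the new iterate. What remains is an
     antisymmetrised derivative, which flatness expresses through the old defect alone.\<close>
   have "R (Suc n) x a = rad x0 1 (%z. DD (g n (x - x0)) z a - DD (g n a) z (x - x0)) x + B x a (Y n x - Y (Suc n) x)"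
   proof -
    have "B x a (Y n x) = rad x0 0 (g n a) x + rad x0 1 (%z. DD (g n a) z (x - x0)) x"
     using rad_fundamental[OF sg, of n a x x0] by (simp only: g_def)
    then show ?thesis unfolding R_def dY rad_diff[OF kd kd, symmetric] linear_diff[OF Bl(2)] by simp
   qed
   also have "norm ... <= D * (1 / 2) ^ n * norm a / 4 + D * (1 / 2) ^ n * norm a / 4"
   proof (rule order_trans[OF norm_triangle_ineq add_mono])
    have bnd: "norm (B z u (R n z v)) <= K * norm u * (D * (1 / 2) ^ n * norm v)" if "z : ball x0 r" for z u v
     by (rule order_trans[OF K mult_left_mono[OF Suc.IH[OF that]]]) (use K0 in auto)
    have "norm (rad x0 1 (%z. DD (g n (x - x0)) z a - DD (g n a) z (x - x0)) x) <= 2 * (K * norm (x - x0) * (D * (1 / 2) ^ n * norm a))"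
    proof (rule rad_bound[OF continuous_on_diff[OF kd kd] _ Suc.prems])
     fix z assume z: "z : ball x0 r"
     have "DD (g n u) z v = DD (%z'. B z' u (Y n z)) z v + B z u (DD (Y n) z v)" for u v
      unfolding g_def[abs_def] by (rule smooth_on_apply(2)[OF open_UNIV sB Bl(2) sY UNIV_I])
     then have "DD (g n (x - x0)) z a - DD (g n a) z (x - x0) = B z (x - x0) (R n z a) - B z a (R n z (x - x0))"
      using Bflat[OF z, of "x - x0" "Y n z" a] by (simp add: R_def linear_diff[OF Bl(2)] algebra_simps)
     then show "norm (DD (g n (x - x0)) z a - DD (g n a) z (x - x0)) <= 2 * (K * norm (x - x0) * (D * (1 / 2) ^ n * norm a))"
      using norm_triangle_ineq4[of "B z (x - x0) (R n z a)" "B z a (R n z (x - x0))"] bnd[OF z, of "x - x0" a] bnd[OF z, of a "x - x0"]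
      by (simp add: mult_ac)
    qed
    also have "... <= 2 * (K * r * (D * (1 / 2) ^ n * norm a))" using K0 D0 by (intro mult_left_mono mult_right_mono w Suc.prems) auto
    also have "... <= 2 * ((1 / 8) * (D * (1 / 2) ^ n * norm a))" using D0 by (intro mult_left_mono mult_right_mono Kr) auto
    finally show "norm (rad x0 1 (%z. DD (g n (x - x0)) z a - DD (g n a) z (x - x0)) x) <= D * (1 / 2) ^ n * norm a / 4" by (simp add: mult_ac)
    have "norm (B x a (Y n x - Y (Suc n) x)) <= K * norm a * (norm y0 * (1 / 4) ^ n)"
     using d1[OF Suc.prems, of n] by (intro order_trans[OF K mult_left_mono]) (auto simp: norm_minus_commute K0)
    also have "... = D * (1 / 4) ^ n * norm a / 4" by (simp add: D_def)
    also have "... <= D * (1 / 2) ^ n * norm a / 4"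
     using D0 by (intro divide_right_mono mult_right_mono mult_left_mono power_mono) auto
    finally show "norm (B x a (Y n x - Y (Suc n) x)) <= D * (1 / 2) ^ n * norm a / 4" .
   qed
   finally show ?case by (simp add: mult_ac)
  qed
  have d3: "norm (Y (n + k) x - Y n x) <= 2 * norm y0 * ((1 / 4) ^ n - (1 / 4) ^ (n + k))" if x: "x : ball x0 r" for n k x
  proof (induction k)
   case (Suc k)
   have "norm (Y (n + Suc k) x - Y n x) <= norm (Y (Suc (n + k)) x - Y (n + k) x) + norm (Y (n + k) x - Y n x)"
    using norm_triangle_ineq[of "Y (Suc (n + k)) x - Y (n + k) x" "Y (n + k) x - Y n x"] by simp
   moreover have "2 * norm y0 * ((1 / 4) ^ n - (1 / 4) ^ (n + k)) = 2 * (norm y0 * (1 / 4) ^ n) - 2 * (norm y0 * (1 / 4) ^ (n + k))"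
    "2 * norm y0 * ((1 / 4) ^ n - (1 / 4) ^ (n + Suc k)) = 2 * (norm y0 * (1 / 4) ^ n) - norm y0 * (1 / 4) ^ (n + k) / 2"
    by (simp_all add: algebra_simps)
   moreover have "0 <= norm y0 * (1 / 4) ^ (n + k)" by simp
   ultimately show ?case using Suc d1[OF x, of "n + k"] by linarith
  qed simp
  have d4: "norm (Y m x - Y n x) <= 2 * norm y0 * (1 / 4) ^ n" if x: "x : ball x0 r" and mn: "m >= n" for n m x
  proof -
   obtain k where m: "m = n + k" using le_Suc_ex[OF mn] ..
   have "2 * norm y0 * ((1 / 4) ^ n - (1 / 4) ^ (n + k)) <= 2 * norm y0 * (1 / 4) ^ n" by (intro mult_left_mono) auto
   then show ?thesis using d3[OF x, of n k] unfolding m by linarith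
  qed
  define l where "l x = lim (%n. Y n x)" for x
  have lim4: "(%n. c * (1 / 4) ^ n) \<longlonglongrightarrow> 0" for c :: real
   using tendsto_mult_right_zero[OF LIMSEQ_power_zero[of "1 / 4 :: real"], of c] by simp
  have lim2: "(%n. c * (1 / 2) ^ n) \<longlonglongrightarrow> 0" for c :: real
   using tendsto_mult_right_zero[OF LIMSEQ_power_zero[of "1 / 2 :: real"], of c] by simp
  have l: "(%n. Y n x) \<longlonglongrightarrow> l x" if x: "x : ball x0 r" for x
  proof -
   have "Cauchy (%n. Y n x)"
   proof (rule metric_CauchyI)
    fix e :: real assume "e > 0"
    then obtain N where N: "!!n. n >= N ==> 2 * norm y0 * (1 / 4) ^ n < e / 2"
     using order_tendstoD(2)[OF lim4[of "2 * norm y0"], of "e / 2"] unfolding eventually_sequentially by (simp, blast)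
    have "dist (Y m x) (Y n x) < e" if "m >= N" "n >= N" for m n
     using d4[OF x that(1)] d4[OF x that(2)] N[of N] dist_triangle2[of "Y m x" "Y n x" "Y N x"] by (simp add: dist_norm)
    then show "EX N. ALL m>=N. ALL n>=N. dist (Y m x) (Y n x) < e" by (intro exI[of _ N] allI impI)
   qed
   then show ?thesis unfolding l_def by (simp add: Cauchy_convergent_iff convergent_LIMSEQ_iff)
  qed
  have d5: "norm (Y n x - l x) <= 2 * norm y0 * (1 / 4) ^ n" if x: "x : ball x0 r" for n x
  proof (rule LIMSEQ_le_const2[OF tendsto_norm[OF tendsto_diff[OF tendsto_const l[OF x]]]])
   show "EX N. ALL m>=N. norm (Y n x - Y m x) <= 2 * norm y0 * (1 / 4) ^ n"
    unfolding norm_minus_commute[of "Y n x"] using d4[OF x] by (intro exI[of _ n] allI impI)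
  qed
  have x0: "x0 : ball x0 r" using r by simp
  have Yx0: "Y n x0 = y0" for n by (cases n) (simp_all add: Y0 Y1)
  \<comment> \<open>The defect tends to 0 uniformly on the ball, so the derivatives of the iterates
    converge uniformly to the right-hand side of the system.\<close>
  have "EX G. ALL x:ball x0 r. (%n. Y n x) \<longlonglongrightarrow> G x & (G has_derivative (%h. B x h (l x))) (at x within ball x0 r)"
  proof (rule has_derivative_sequence[OF convex_ball _ _ x0])
   show "(Y n has_derivative DD (Y n) x) (at x within ball x0 r)" for n x
    by (rule has_derivative_at_withinI[OF smooth_has_deriv[OF sY UNIV_I]])
   show "(%n. Y n x0) \<longlonglongrightarrow> y0" unfolding Yx0 by (rule tendsto_const)
   fix e :: real assume e: "e > 0"
   have "(%n. D * (1 / 2) ^ n + K * (2 * norm y0) * (1 / 4) ^ n) \<longlonglongrightarrow> 0 + 0" by (intro tendsto_add lim2 lim4)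
   then have "\<forall>\<^sub>F n in sequentially. D * (1 / 2) ^ n + K * (2 * norm y0) * (1 / 4) ^ n < e" using order_tendstoD(2) e by fastforce
   then show "\<forall>\<^sub>F n in sequentially. ALL x:ball x0 r. ALL h. norm (DD (Y n) x h - B x h (l x)) <= e * norm h"
   proof (rule eventually_mono, intro ballI allI)
    fix n x h assume e: "D * (1 / 2) ^ n + K * (2 * norm y0) * (1 / 4) ^ n < e" and x: "x : ball x0 r"
    have "DD (Y n) x h - B x h (l x) = R n x h + B x h (Y n x - l x)" by (simp add: R_def linear_diff[OF Bl(2)])
    also have "norm ... <= D * (1 / 2) ^ n * norm h + K * norm h * (2 * norm y0 * (1 / 4) ^ n)"
     by (intro order_trans[OF norm_triangle_ineq] add_mono d2 x order_trans[OF K] mult_left_mono d5 mult_nonneg_nonneg K0 norm_ge_zero)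
    also have "... = (D * (1 / 2) ^ n + K * (2 * norm y0) * (1 / 4) ^ n) * norm h" by (simp add: algebra_simps)
    also have "... <= e * norm h" using e by (intro mult_right_mono) auto
    finally show "norm (DD (Y n) x h - B x h (l x)) <= e * norm h" .
   qed
  qed
  then obtain G where G: "!!x. x : ball x0 r ==> (%n. Y n x) \<longlonglongrightarrow> G x"
    "!!x. x : ball x0 r ==> (G has_derivative (%h. B x h (l x))) (at x within ball x0 r)" by blast
  have der: "(G has_derivative (%h. A x h (G x))) (at x)" if x: "x : ball x0 r" for x
   using G(2)[OF x] unfolding LIMSEQ_unique[OF l[OF x] G(1)[OF x]] BA[OF x] at_within_open[OF x open_ball] .
  have "C_on k (ball x0 r) G" for k
  proof (induction k)
   case 0
   have "continuous_on (ball x0 r) G" by (rule has_derivative_continuous_on[OF G(2)])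
   then show ?case by simp
  next
   case (Suc k)
   show ?case
   proof (rule C_on_SucI[OF open_ball der])
    fix u
    have C: "C_on k (ball x0 r) (%x. SUM e:Basis. (G x \<bullet> e) *R B x u e)"
     by (rule C_on_sum[OF open_ball C_on_bilinear[OF bounded_bilinear_scaleR open_ball C_on_bounded_linear[OF bounded_linear_inner_left open_ball Suc]]])
       (use smooth_on_subset[OF sB subset_UNIV] in "simp add: smooth_on_def")
    show "C_on k (ball x0 r) (%x. A x u (G x))"
     by (rule C_on_cong[OF open_ball C]) (simp only: BA[symmetric] basis_expand[OF Bl(2), symmetric])
   qed
  qed
  moreover have "G x0 = y0" using LIMSEQ_unique[OF G(1)[OF x0]] unfolding Yx0 by simp
  ultimately show ?thesis using der by (intro exI[of _ G]) (simp add: smooth_on_def)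
 qed
 then show ?thesis using r(1) bU US by (intro exI[of _ r]) blast
qed

section \<open>Flat hyperkaehler metrics in a chart\<close>

locale metric_chart =
 fixes S :: "'e::euclidean_space set" and G :: "'e => 'e => 'e => real"
 assumes open_S: "open S"
  and G1: "x : S ==> linear (%u. G x u w)" and G2: "x : S ==> linear (G x u)"
  and smooth_G: "smooth_on S (%x. G x u w)"
  and G_sym: "x : S ==> G x u w = G x w u" and G_pos: "x : S ==> u ~= 0 ==> 0 < G x u u"
begin

lemma smooth_G_fields:
 assumes "open W" "W <= S" "smooth_on W u" "smooth_on W w" shows "smooth_on W (%x. G x (u x) (w x))"
 by (rule smooth_on_apply(1)[OF assms(1) smooth_on_apply(1)[OF assms(1) smooth_on_subset[OF smooth_G assms(2)] G1 assms(3)] G2 assms(4)])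
   (use assms(2) in auto)

lemma G_eqI: "x : S ==> (!!w. G x u w = G x u' w) ==> u = u'"
 using G_pos[of x "u - u'"] linear_diff[OF G1, of x u u' "u - u'"] by fastforce

text \<open>Gram-Schmidt orthogonalisation of the standard basis.\<close>

lemma ex_orthogonal_frame:
 "EX e :: 'e => 'e => 'e. (ALL b:Basis. smooth_on S (e b)) & (ALL x:S. (ALL b:Basis. e b x ~= 0) &
   (ALL b:Basis. ALL c:Basis. b ~= c --> G x (e b x) (e c x) = 0) & span ((%b. e b x) ` Basis) = UNIV)"
proof -
 have "EX e :: 'e => 'e => 'e. (ALL b:B. smooth_on S (e b)) & (ALL x:S. (ALL b:B. e b x ~= 0 & b : span ((%b. e b x) ` B)
   & (ALL c:Basis - B. e b x \<bullet> c = 0) & (ALL c:B. b ~= c --> G x (e b x) (e c x) = 0)))"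
  if "finite B" "B <= Basis" for B
  using that
 proof (induction B rule: finite_induct)
  case empty
  then show ?case by simp
 next
  case (insert b B)
  have "B <= Basis" using insert.prems by simp
  from insert.IH[OF this] obtain e :: "'e => 'e => 'e" where e1: "ALL c:B. smooth_on S (e c)"
   and e2: "ALL x:S. ALL c:B. e c x ~= 0 & c : span ((%b. e b x) ` B)
    & (ALL d:Basis - B. e c x \<bullet> d = 0) & (ALL d:B. c ~= d --> G x (e c x) (e d x) = 0)" by (elim exE conjE) (rule that)
  have se: "!!c. c : B ==> smooth_on S (e c)" using e1 by blast
  have e: "!!x c. x : S ==> c : B ==> e c x ~= 0 & c : span ((%b. e b x) ` B)
    & (ALL d:Basis - B. e c x \<bullet> d = 0) & (ALL d:B. c ~= d --> G x (e c x) (e d x) = 0)" using e2 by blast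
  have b: "b : Basis" using insert by simp
  define k where "k c x = G x b (e c x) * inverse (G x (e c x) (e c x))" for c x
  define n where "n x = b - (SUM c:B. k c x *R e c x)" for x
  have sn: "smooth_on S n"
   unfolding n_def[abs_def] k_def
   by (intro smooth_on_diff smooth_on_const smooth_on_sum smooth_on_scaleR smooth_on_mult smooth_on_inverse open_S smooth_G_fields order_refl se)
     (use e G_pos in "auto simp: less_imp_neq[symmetric]")
  define e' where "e' = e(b := n)"
  have e': "c : B ==> e' c = e c" "e' b = n" for c using insert by (auto simp: e'_def)
  have im: "(%c. e' c x) ` insert b B = insert (n x) ((%c. e c x) ` B)" for x using e' by auto
  have nd: "n x \<bullet> d = b \<bullet> d" if "x : S" "d : Basis - B" for x d
   using e[OF that(1)] that(2) by (simp add: n_def inner_diff_left inner_sum_left)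
  have n0: "n x ~= 0" if "x : S" for x using nd[OF that, of b] b insert by auto
  have ort: "G x (n x) (e d x) = 0" if x: "x : S" and d: "d : B" for x d
  proof -
   have "G x (SUM c:B. k c x *R e c x) (e d x) = (SUM c:B. k c x * G x (e c x) (e d x))"
    by (simp add: linear_sum[OF G1[OF x]] linear_cmul[OF G1[OF x]])
   also have "... = (SUM c:B. if c = d then k d x * G x (e d x) (e d x) else 0)"
    using e[OF x] d by (intro sum.cong) auto
   also have "... = G x b (e d x)"
    using insert d e[OF x d] G_pos[OF x, of "e d x"] by (simp add: k_def)
   finally show ?thesis unfolding n_def linear_diff[OF G1[OF x]] by simp
  qed
  have bs: "b : span ((%c. e' c x) ` insert b B)" for x
  proof -
   have "b = n x + (SUM c:B. k c x *R e c x)" by (simp add: n_def)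
   also have "... : span ((%c. e' c x) ` insert b B)" unfolding im
    by (intro span_add span_sum span_scale span_base) auto
   finally show ?thesis .
  qed
  have sp: "c : span ((%c. e' c x) ` insert b B)" if "x : S" "c : B" for c x
   using e[OF that] span_mono[of "(%c. e c x) ` B" "(%c. e' c x) ` insert b B"] im by auto
  have bas: "ALL d:Basis - insert b B. b \<bullet> d = 0" using b by (auto simp: inner_Basis)
  show ?case
  proof (intro exI[of _ e'] conjI ballI)
   fix c assume "c : insert b B"
   then show "smooth_on S (e' c)" using sn se e' by auto
  next
   fix x c assume x: "x : S" and c: "c : insert b B"
   show "e' c x ~= 0" using c n0[OF x] e[OF x] e' by auto
   show "c : span ((%b. e' b x) ` insert b B)" using c bs sp[OF x] by auto
   fix d
   show "e' c x \<bullet> d = 0" if "d : Basis - insert b B" using c that e[OF x] nd[OF x] bas e' by auto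
   show "c ~= d --> G x (e' c x) (e' d x) = 0" if "d : insert b B"
    using c that e[OF x] ort[OF x] G_sym[OF x] e' by auto
  qed
 qed
 from this[OF finite_Basis order_refl] obtain e :: "'e => 'e => 'e" where e: "ALL b:Basis. smooth_on S (e b)"
  "ALL x:S. ALL b:Basis. e b x ~= 0 & b : span ((%b. e b x) ` Basis)
   & (ALL c:Basis - Basis. e b x \<bullet> c = 0) & (ALL c:Basis. b ~= c --> G x (e b x) (e c x) = 0)" by (elim exE conjE) (rule that)
 have "span ((%b. e b x) ` Basis) = UNIV" if "x : S" for x
 proof -
  have "Basis <= span ((%b. e b x) ` Basis)" using e(2) that by blast
  then show ?thesis using span_mono[of Basis "span ((%b. e b x) ` Basis)"] unfolding span_span by auto
 qed
 then show ?thesis using e by (intro exI[of _ e]) blast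
qed

text \<open>The orthogonal frame gives the representing vector by an explicit formula, which makes
  its smooth dependence on \<open>x\<close> visible. It is used to turn the Koszul formula into a
  smooth vector field.\<close>

lemma riesz:
 assumes h: "!!x. x : S ==> linear (h x)" "!!w. smooth_on S (%x. h x w :: real)"
 shows "EX z. smooth_on S z & (ALL x:S. ALL w. G x (z x) w = h x w)"
proof -
 obtain e :: "'e => 'e => 'e" where e: "!!b. b : Basis ==> smooth_on S (e b)" "!!x b. x : S ==> b : Basis ==> e b x ~= 0"
  "!!x b c. x : S ==> b : Basis ==> c : Basis ==> b ~= c ==> G x (e b x) (e c x) = 0" "!!x. x : S ==> span ((%b. e b x) ` Basis) = UNIV"
  using ex_orthogonal_frame by (elim exE conjE) blast
 define z where "z x = (SUM b:Basis. (h x (e b x) * inverse (G x (e b x) (e b x))) *R e b x)" for x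
 have "smooth_on S z" unfolding z_def[abs_def]
  by (intro smooth_on_sum smooth_on_scaleR smooth_on_mult smooth_on_inverse smooth_G_fields order_refl smooth_on_apply(1)[OF open_S h(2) h(1)] open_S e(1))
    (use e(2) G_pos in "auto simp: less_imp_neq[symmetric]")
 moreover have "G x (z x) w = h x w" if x: "x : S" for x w
 proof -
  have ec: "G x (z x) (e c x) = h x (e c x)" if c: "c : Basis" for c
  proof -
   have "G x (z x) (e c x) = (SUM b:Basis. (h x (e b x) * inverse (G x (e b x) (e b x))) * G x (e b x) (e c x))"
    unfolding z_def by (simp add: linear_sum[OF G1[OF x]] linear_cmul[OF G1[OF x]])
   also have "... = (SUM b:Basis. if b = c then h x (e c x) else 0)"
    using e(3)[OF x] c e(2)[OF x c] G_pos[OF x, of "e c x"] by (intro sum.cong) auto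
   finally show ?thesis using c by simp
  qed
  have "w : span ((%b. e b x) ` Basis)" unfolding e(4)[OF x] by simp
  from linear_eq_on[OF G2[OF x] h(1)[OF x] this] show ?thesis using ec by auto
 qed
 ultimately show ?thesis by blast
qed

definition DG :: "'e => 'e => 'e => 'e => real" where "DG x a u w = DD (%y. G y u w) x a"

lemma DG_linear: assumes x: "x : S"
 shows "linear (%a. DG x a u w)" "linear (%u. DG x a u w)" "linear (%w. DG x a u w)"
proof -
 have c: "DD (%y. G y u w) x a = DD f x a" if "!!y. y : S ==> G y u w = f y" for u w f a
  by (rule fun_cong[OF deriv_cong_open[OF open_S x that]])
 show "linear (%a. DG x a u w)" unfolding DG_def by (rule linear_DD[OF smooth_G x])
 show "linear (%u. DG x a u w)" unfolding DG_def
 proof (rule linearI)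
  fix u u' and r :: real
  show "DD (%y. G y (u + u') w) x a = DD (%y. G y u w) x a + DD (%y. G y u' w) x a"
   unfolding dir_deriv_add[OF smooth_G smooth_G x, symmetric] by (rule c[OF linear_add[OF G1]])
  show "DD (%y. G y (r *R u) w) x a = r *R DD (%y. G y u w) x a"
   unfolding dir_deriv_linear[OF bounded_linear_scaleR_right smooth_G x, symmetric] by (rule c[OF linear_cmul[OF G1]])
 qed
 show "linear (%w. DG x a u w)" unfolding DG_def
 proof (rule linearI)
  fix w w' and r :: real
  show "DD (%y. G y u (w + w')) x a = DD (%y. G y u w) x a + DD (%y. G y u w') x a"
   unfolding dir_deriv_add[OF smooth_G smooth_G x, symmetric] by (rule c[OF linear_add[OF G2]])
  show "DD (%y. G y u (r *R w)) x a = r *R DD (%y. G y u w) x a"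
   unfolding dir_deriv_linear[OF bounded_linear_scaleR_right smooth_G x, symmetric] by (rule c[OF linear_cmul[OF G2]])
 qed
qed

lemma DG_sym: "x : S ==> DG x a u w = DG x a w u"
 unfolding DG_def by (rule fun_cong[OF deriv_cong_open[OF open_S _ G_sym]])

section \<open>The Levi-Civita connection\<close>

text \<open>The same expression as \<open>christoffel\<close>, so that flatness in the sense of
  \<open>curvature\<close> carries over by unfolding.\<close>

definition Gam :: "'e => 'e => 'e => 'e" where
 "Gam x a b = (THE z. ALL w. 2 * G x z w = DG x a b w + DG x b a w - DG x w a b)"

lemma shows Gam: "x : S ==> 2 * G x (Gam x a b) w = DG x a b w + DG x b a w - DG x w a b"
 and smooth_Gam: "smooth_on S (%x. Gam x a b)"
proof -
 have lin: "linear (%w. (1/2) * (DG x a b w + DG x b a w - DG x w a b))" if "x : S" for x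
  using DG_linear[OF that] by (simp add: linear_iff algebra_simps add_divide_distrib diff_divide_distrib)
 have "smooth_on S (%x. (1/2) * (DG x a b w + DG x b a w - DG x w a b))" for w
  unfolding DG_def by (intro smooth_on_mult smooth_on_const smooth_on_add smooth_on_diff smooth_on_deriv smooth_G open_S)
 then have "EX z. smooth_on S z & (ALL x:S. ALL w. G x (z x) w = (1/2) * (DG x a b w + DG x b a w - DG x w a b))"
  by (intro riesz lin)
 then obtain z where z: "smooth_on S z" "ALL x:S. ALL w. G x (z x) w = (1/2) * (DG x a b w + DG x b a w - DG x w a b)"
  by (elim exE conjE)
 have eq: "Gam x a b = z x" if "x : S" for x unfolding Gam_def
 proof (rule the_equality)
  have z2: "2 * G x (z x) w = DG x a b w + DG x b a w - DG x w a b" for w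
   unfolding bspec[OF z(2) that, THEN spec, of w] by simp
  then show "ALL w. 2 * G x (z x) w = DG x a b w + DG x b a w - DG x w a b" ..
  fix y assume "ALL w. 2 * G x y w = DG x a b w + DG x b a w - DG x w a b"
  then have "2 * G x y w = 2 * G x (z x) w" for w unfolding z2 ..
  then show "y = z x" by (intro G_eqI[OF that]) simp
 qed
 show "2 * G x (Gam x a b) w = DG x a b w + DG x b a w - DG x w a b" if "x : S"
  unfolding eq[OF that] bspec[OF z(2) that, THEN spec, of w] by simp
 show "smooth_on S (%x. Gam x a b)" by (rule smooth_on_cong[OF open_S z(1) eq[symmetric]])
qed

lemma Gam_linear: assumes x: "x : S" shows "linear (%a. Gam x a b)" "linear (Gam x a)"
proof -
 note l = linear_add[OF DG_linear(1)[OF x]] linear_add[OF DG_linear(2)[OF x]] linear_add[OF DG_linear(3)[OF x]]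
  linear_cmul[OF DG_linear(1)[OF x]] linear_cmul[OF DG_linear(2)[OF x]] linear_cmul[OF DG_linear(3)[OF x]] linear_add[OF G1[OF x]] linear_cmul[OF G1[OF x]]
 have eqI: "u = u'" if "!!w. 2 * G x u w = 2 * G x u' w" for u u' by (rule G_eqI[OF x]) (use that in simp)
 show "linear (%a. Gam x a b)"
  by (rule linearI; rule eqI; simp add: Gam[OF x] l distrib_left mult.left_commute[of 2]) (simp_all add: algebra_simps)
 show "linear (Gam x a)"
  by (rule linearI; rule eqI; simp add: Gam[OF x] l distrib_left mult.left_commute[of 2]) (simp_all add: algebra_simps)
qed

lemma Gam_sym: assumes x: "x : S" shows "Gam x a b = Gam x b a"
 by (rule G_eqI[OF x]) (use Gam[OF x, of a b] Gam[OF x, of b a] DG_sym[OF x] in "smt (verit)")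

text \<open>Compatibility with the metric: in the sum of two instances of the Koszul formula, with
  \<open>b\<close> and \<open>w\<close> exchanged, all terms but one cancel.\<close>

lemma DG_Gam: assumes x: "x : S" shows "DG x a b w = G x (Gam x a b) w + G x b (Gam x a w)"
 using Gam[OF x, of a b w] Gam[OF x, of a w b] G_sym[OF x, of b "Gam x a w"] DG_sym[OF x, of a b w] DG_sym[OF x, of b a w] DG_sym[OF x, of w a b]
 by linarith

lemma G_fields_derivative:
 assumes W: "open W" "W <= S" and u: "smooth_on W u" and w: "smooth_on W w" and x: "x : W"
 shows "DD (%x. G x (u x) (w x)) x a = DG x a (u x) (w x) + G x (DD u x a) (w x) + G x (u x) (DD w x a)"
proof -
 have l: "linear (%u. G z u w)" "linear (G z u)" if "z : W" for z u w using that W(2) G1 G2 by blast+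
 note sG = smooth_on_subset[OF smooth_G W(2)]
 have "DD (%x. G x (u x) (w x)) x a = DD (%z. G z (u z) (w x)) x a + G x (u x) (DD w x a)"
  by (rule smooth_on_apply(2)[where B="%x. G x (u x)", OF W(1) smooth_on_apply(1)[OF W(1) sG l(1) u] l(2) w x])
 moreover have "DD (%z. G z (u z) (w x)) x a = DG x a (u x) (w x) + G x (DD u x a) (w x)"
  unfolding DG_def by (rule smooth_on_apply(2)[where B="%z y. G z y (w x)", OF W(1) sG l(1) u x])
 ultimately show ?thesis by simp
qed

end

lemma smooth_constant:
 assumes "convex W" "open W" "smooth_on W f" "!!x a. x : W ==> DD f x a = 0" "x : W" "y : W"
 shows "f x = (f y :: 'b::real_normed_vector)"
proof -
 have "(f has_derivative (%h. 0)) (at x within W)" if "x : W" for x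
  using has_derivative_at_withinI[OF smooth_has_deriv[OF assms(3) that]] assms(4)[OF that] by simp
 from has_derivative_zero_constant[OF assms(1) this] show ?thesis using assms(5,6) by metis
qed

text \<open>The symplectic forms are eliminated: the form \<open>\<omega> i\<close> evaluated at
  \<open>b\<close> and \<open>d\<close> is \<open>- G x b (J i x d)\<close>, so closedness becomes a
  condition on \<open>G\<close> and \<open>J\<close>.\<close>

locale hk_chart = metric_chart S G for S :: "'e::euclidean_space set" and G +
 fixes J :: "3 => 'e => 'e => 'e"
 assumes linear_J: "x : S ==> linear (J i x)" and smooth_J: "smooth_on S (%x. J i x u)"
  and J_J: "x : S ==> J i x (J i x u) = - u" and G_J: "x : S ==> G x (J i x u) (J i x w) = G x u w"
  and closed: "x : S ==> DD (%y. G y b (J i y d)) x a - DD (%y. G y a (J i y d)) x b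
   + DD (%y. G y a (J i y b)) x d = 0"
  and integrable_J: "x : S ==> EX T ps (J0 :: 'e => 'e). open T & x : T & T <= S & smooth_on T (ps :: 'e => 'e) & inj (DD ps x) &
   (ALL y:T. ALL u. DD ps y (J i y u) = J0 (DD ps y u))"
  and flat: "x : S ==> DD (%y. Gam y b w) x a - DD (%y. Gam y a w) x b
   + Gam x a (Gam x b w) - Gam x b (Gam x a w) = 0"
begin

lemma J_skew: "x : S ==> G x (J i x u) w = - G x u (J i x w)"
 using G_J[of x i "J i x u" w] linear_neg[OF G1, of x u] by (simp add: J_J)

lemma J_skew': "x : S ==> G x u (J i x w) = - G x w (J i x u)"
 using J_skew[of x i w u] G_sym[of x u "J i x w"] by simp

text \<open>Closedness of the Kaehler form and integrability of the complex structure make it parallel.\<close>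

lemma parallel_J:
 assumes x: "x : S"
 shows "DD (%y. J i y w) x a = J i x (Gam x a w) - Gam x a (J i x w)"
proof -
 define j where "j = J i x"
 define DJ where "DJ a w = DD (%y. J i y w) x a" for a w
 \<comment> \<open>\<open>N a w\<close> is the covariant derivative of the complex structure in the
   direction \<open>a\<close>, applied to \<open>w\<close>. The goal is that it vanishes;
   \<open>P\<close> below is \<open>N\<close> paired with a vector.\<close>
 define N where "N a w = DJ a w + Gam x a (j w) - j (Gam x a w)" for a w
 define P where "P a b w = G x b (N a w)" for a b w
 note lj = linear_J[OF x, of i, folded j_def]
 note jj = J_J[OF x, of i, folded j_def] and sk = J_skew[OF x, of i, folded j_def] and sk' = J_skew'[OF x, of _ i, folded j_def]
 note l = linear_add[OF lj] linear_diff[OF lj] linear_neg[OF lj] linear_add[OF G2[OF x]] linear_diff[OF G2[OF x]] linear_neg[OF G2[OF x]]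
  linear_neg[OF Gam_linear(2)[OF x]]
 have E: "DD (%y. G y b (J i y w)) x a = G x (Gam x a b) (j w) + G x b (j (Gam x a w)) + P a b w" for a b w
  unfolding G_fields_derivative[OF open_S order_refl smooth_on_const smooth_J x] DG_Gam[OF x] P_def N_def
  by (simp add: DJ_def j_def[symmetric] l linear_0[OF G1[OF x]])
 have anti: "P a b w = - P a w b" for a b w
 proof -
  have "DD (%y. G y b (J i y w)) x a = DD (%y. - G y w (J i y b)) x a"
   by (rule fun_cong[OF deriv_cong_open[OF open_S x J_skew']])
  also have "... = - DD (%y. G y w (J i y b)) x a"
   by (rule dir_deriv_linear[OF bounded_linear_minus[OF bounded_linear_ident] smooth_G_fields[OF open_S order_refl smooth_on_const smooth_J] x])
  finally show ?thesis unfolding E using sk'[of b "Gam x a w"] sk'[of "Gam x a b" w] by linarith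
 qed
 \<comment> \<open>Closedness of the form. The connection terms cancel because \<open>Gam\<close> is
   symmetric.\<close>
 have cyc: "P a b d + P b d a + P d a b = 0" for a b d
 proof -
  have "P a b d - P b a d + P d a b = 0"
   using closed[OF x, of b i d a] unfolding E Gam_sym[OF x, of b a] Gam_sym[OF x, of d a] Gam_sym[OF x, of d b] using sk'[of b "Gam x a d"] by linarith
  then show ?thesis using anti[of b a d] by linarith
 qed
 have sw: "P a b (j w) = P a (j b) w" for a b w
 proof -
  have "DD (%y. J i y (J i y w)) x a = DD (%y. - w) x a"
   by (rule fun_cong[OF deriv_cong_open[OF open_S x J_J]])
  moreover have "DD (%y. J i y (J i y w)) x a = DJ a (j w) + j (DJ a w)"
   unfolding DJ_def j_def by (rule smooth_on_apply(2)[OF open_S smooth_J linear_J smooth_J x])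
  ultimately have "DJ a (j w) + j (DJ a w) = 0" by simp
  then have "N a (j w) = - j (N a w)" unfolding N_def by (simp add: l jj linear_neg[OF Gam_linear(2)[OF x]] add_eq_0_iff)
  then show ?thesis unfolding P_def by (simp add: l sk)
 qed
 obtain T ps and J0 :: "'e => 'e" where T: "open T" "x : T" "T <= S" "smooth_on T (ps :: 'e => 'e)" "inj (DD ps x)"
  "ALL y:T. ALL u. DD ps y (J i y u) = J0 (DD ps y u)" using integrable_J[OF x, of i] by (elim exE conjE) (rule that)
 define d where "d = DD ps x"
 define D2 where "D2 a b = DD (%y. DD ps y b) x a" for a b
 have ld: "linear d" unfolding d_def by (rule linear_DD[OF T(4,2)])
 have J0: "J0 (d u) = d (j u)" for u using T(2,6) by (simp add: d_def j_def)
 have "surj d" using linear_injective_imp_surjective[OF ld] T(5) by (simp add: d_def)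
 then have d_surj: "EX u. v = d u" for v by (auto simp: surj_def)
 have lJ0: "linear J0"
 proof (rule linearI)
  fix v v' and r :: real
  obtain u u' where "v = d u" "v' = d u'" using d_surj by blast
  then show "J0 (v + v') = J0 v + J0 v'" "J0 (r *R v) = r *R J0 v"
   by (simp_all add: linear_add[OF ld, symmetric] linear_cmul[OF ld, symmetric] J0 linear_add[OF lj] linear_cmul[OF lj])
 qed
 \<comment> \<open>Minus the covariant Hessian of the coordinates \<open>ps\<close>, symmetric
   because second derivatives commute and the connection has no torsion.\<close>
 define si where "si a b = d (Gam x a b) - D2 a b" for a b
 have si: "si a b = si b a" for a b
  unfolding si_def D2_def using dir_deriv_commute[OF T(1,4,2), of b a] Gam_sym[OF x, of a b] by simp
 have dN: "d (N a w) = si a (j w) - J0 (si a w)" for a w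
 proof -
  have "DD (%y. DD ps y (J i y w)) x a = DD (%y. J0 (DD ps y w)) x a"
   by (rule fun_cong[OF deriv_cong_open[OF T(1,2)]]) (use T(6) in blast)
  also have "... = J0 (D2 a w)" unfolding D2_def
   by (rule dir_deriv_linear[OF lJ0[unfolded linear_conv_bounded_linear] smooth_on_deriv[OF T(4)] T(2)])
  also have "DD (%y. DD ps y (J i y w)) x a = D2 a (j w) + d (DJ a w)" unfolding D2_def DJ_def d_def j_def
   by (rule smooth_on_apply(2)[OF T(1) smooth_on_deriv[OF T(4)] linear_DD[OF T(4)] smooth_on_subset[OF smooth_J T(3)] T(2)])
  finally have "D2 a (j w) + d (DJ a w) = J0 (D2 a w)" .
  then show ?thesis by (simp add: N_def si_def linear_add[OF ld] linear_diff[OF ld] linear_diff[OF lJ0] J0 algebra_simps)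
 qed
 \<comment> \<open>The vanishing of the Nijenhuis tensor, written with covariant derivatives. It
   follows from the symmetry of \<open>si\<close>.\<close>
 have "N (j a) w - N (j w) a = j (N a w - N w a)" for a w
 proof -
  have "d (N (j a) w - N (j w) a) = J0 (si (j w) a - si (j a) w)"
   unfolding linear_diff[OF ld] dN linear_diff[OF lJ0] si[of "j w" "j a"] by simp
  also have "... = J0 (d (N a w - N w a))"
   unfolding linear_diff[OF ld] dN si[of w a] si[of "j w" a] si[of "j a" w] by simp
  also have "... = d (j (N a w - N w a))" by (rule J0)
  finally show ?thesis using T(5) by (simp add: d_def inj_eq)
 qed
 then have "G x b (N (j a) w) - G x b (N (j w) a) = G x b (j (N a w)) - G x b (j (N w a))" for a b w
  unfolding linear_diff[OF G2[OF x], symmetric] linear_diff[OF lj, symmetric] by simp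
 then have nij: "P (j a) b w - P (j w) b a = - P a (j b) w + P w (j b) a" for a b w
  unfolding P_def using sk[of b] by simp
 \<comment> \<open>Linear algebra from here on: skewness in the last two arguments, the cyclic
   identity, the exchange rule \<open>sw\<close> and the Nijenhuis identity together leave only
   zero.\<close>
 have "P b w (j a) = 0" for a b w
  using nij[of a b w] cyc[of "j a" b w] cyc[of a b "j w"] anti[of "j w" b a] anti[of w "j b" a] sw[of a b w] sw[of w a b] sw[of b w a]
   anti[of w "j a" b] anti[of w a "j b"] anti[of b "j w" a] by linarith
 then have "P b w a = 0" for a b w using jj[of "- a"] by (metis minus_minus)
 then have "N a w = 0" using G_pos[OF x, of "N a w"] unfolding P_def by fastforce
 then show ?thesis by (simp add: N_def DJ_def j_def algebra_simps)
qed

section \<open>Parallel vector fields and flat coordinates\<close>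

definition parallel :: "'e set => ('e => 'e) => bool" where
 "parallel W u \<longleftrightarrow> smooth_on W u & (ALL x:W. ALL a. DD u x a = - Gam x a (u x))"

lemma parallel_J_field: assumes "parallel W u" "open W" "W <= S" shows "parallel W (%x. J i x (u x))"
proof -
 have u: "smooth_on W u" "!!x a. x : W ==> DD u x a = - Gam x a (u x)" using assms by (auto simp: parallel_def)
 have x: "x : S" if "x : W" for x using that assms by blast
 note sJ = smooth_on_subset[OF smooth_J assms(3)]
 have "DD (%x. J i x (u x)) x a = - Gam x a (J i x (u x))" if "x : W" for x a
 proof -
  have "DD (%x. J i x (u x)) x a = DD (%z. J i z (u x)) x a + J i x (DD u x a)"
   by (rule smooth_on_apply(2)[OF assms(2) sJ linear_J[OF x] u(1) that])
  then show ?thesis unfolding parallel_J[OF x[OF that]] u(2)[OF that] linear_neg[OF linear_J[OF x[OF that]]] by simp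
 qed
 then show ?thesis using smooth_on_apply(1)[OF assms(2) sJ linear_J[OF x] u(1)] by (simp add: parallel_def)
qed

lemma parallel_G:
 assumes "parallel W u" "parallel W w" "open W" "convex W" "W <= S" "x : W" "y : W"
 shows "G x (u x) (w x) = G y (u y) (w y)"
proof (rule smooth_constant[OF assms(4,3) _ _ assms(6,7)])
 have u: "smooth_on W u" "smooth_on W w" using assms by (auto simp: parallel_def)
 show "smooth_on W (%x. G x (u x) (w x))" by (rule smooth_G_fields[OF assms(3,5) u])
 fix x a assume x: "x : W"
 then have xS: "x : S" using assms by blast
 show "DD (%x. G x (u x) (w x)) x a = 0"
  using G_fields_derivative[OF assms(3,5) u x, of a] assms x DG_Gam[OF xS, of a "u x" "w x"]
  by (simp add: parallel_def linear_neg[OF G1[OF xS]] linear_neg[OF G2[OF xS]])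
qed

end

context metric_chart
begin

lemma ex_riesz: assumes x: "x0 : S" shows "EX z. ALL a. G x0 a z = a \<bullet> b"
proof -
 have "EX z. smooth_on S z & (ALL x:S. ALL w. G x (z x) w = w \<bullet> b)"
  by (rule riesz) (auto intro: smooth_on_const linearI simp: inner_add_left)
 then obtain z where "ALL x:S. ALL w. G x (z x) w = w \<bullet> b" by blast
 then show ?thesis using x G_sym[OF x] by (intro exI[of _ "z x0"]) metis
qed

end

context hk_chart
begin

text \<open>A parallel field and a potential of its dual one-form are obtained together, as a
  solution of one linear system with values in \<open>'e \<times> real\<close>. Integrability of the
  first component is flatness; that of the second is metric compatibility with the symmetry of
  \<open>Gam\<close>.\<close>

lemma parallel_potential:
 assumes x0: "x0 : S"
 shows "EX r>0. ball x0 r <= S & (ALL v. EX u ps. parallel (ball x0 r) u & u x0 = v & smooth_on (ball x0 r) ps &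
  (ALL x:ball x0 r. ALL a. DD ps x a = G x a (u x)))"
proof -
 define A where "A x a y = (- Gam x a (fst y), G x a (fst y))" for x a and y :: "'e \<times> real"
 have der: "((%z. A z b y) has_derivative (%a. (- DD (%z. Gam z b (fst y)) x a, DG x a b (fst y)))) (at x)" if "x : S" for b x y
  unfolding A_def DG_def
  by (intro has_derivative_Pair has_derivative_minus smooth_has_deriv[OF smooth_Gam that] smooth_has_deriv[OF smooth_G that])
 note l = linear_add[OF Gam_linear(1)] linear_cmul[OF Gam_linear(1)] linear_add[OF Gam_linear(2)] linear_cmul[OF Gam_linear(2)]
  linear_add[OF G1] linear_cmul[OF G1] linear_add[OF G2] linear_cmul[OF G2] linear_neg[OF Gam_linear(2)] linear_neg[OF G2]
 have "EX r>0. ball x0 r <= S & (ALL y0. EX Y. smooth_on (ball x0 r) Y & Y x0 = y0 &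
  (ALL x:ball x0 r. (Y has_derivative (%a. A x a (Y x))) (at x)))"
 proof (rule frobenius[OF open_S x0])
  fix x a b and y :: "'e \<times> real"
  show "smooth_on S (%x. A x a y)"
  proof (rule smooth_on_if_deriv[OF open_S der])
   show "smooth_on S (%x. (- DD (%z. Gam z a (fst y)) x u, DG x u a (fst y)))" for u
   proof (rule smooth_on_componentwise[OF open_S])
    fix e :: "'e \<times> real" assume "e : Basis"
    have "smooth_on S (%x. (- DD (%z. Gam z a (fst y)) x u) \<bullet> fst e + DG x u a (fst y) * snd e)"
     unfolding DG_def by (intro smooth_on_add smooth_on_inner smooth_on_mult smooth_on_const smooth_on_minus smooth_on_deriv smooth_Gam smooth_G open_S)
    then show "smooth_on S (%x. (- DD (%z. Gam z a (fst y)) x u, DG x u a (fst y)) \<bullet> e)" by (simp add: inner_prod_def)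
   qed
  qed
  assume x: "x : S"
  show "linear (%a. A x a y)" "linear (A x a)" by (rule linearI; simp add: A_def l[OF x])+
  have "DD (%z. Gam z b w) x a - DD (%z. Gam z a w) x b = Gam x b (Gam x a w) - Gam x a (Gam x b w)" for w
   using flat[OF x, of b w a] by (simp add: algebra_simps)
  from this[of "fst y"]
  show "DD (%z. A z b y) x a - DD (%z. A z a y) x b = A x a (A x b y) - A x b (A x a y)"
   unfolding dir_deriv_eq[OF der[OF x]] unfolding A_def by (simp add: l[OF x] DG_Gam[OF x] Gam_sym[OF x, of b a] algebra_simps)
 qed
 then obtain r where r: "r > 0" "ball x0 r <= S" and Y: "!!y0. EX Y. smooth_on (ball x0 r) Y & Y x0 = y0 &
  (ALL x:ball x0 r. (Y has_derivative (%a. A x a (Y x))) (at x))" by blast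
 have "EX u ps. parallel (ball x0 r) u & u x0 = v & smooth_on (ball x0 r) ps & (ALL x:ball x0 r. ALL a. DD ps x a = G x a (u x))" for v
 proof -
  obtain Y where Y: "smooth_on (ball x0 r) Y" "Y x0 = (v, 0)" "!!x. x : ball x0 r ==> (Y has_derivative (%a. A x a (Y x))) (at x)"
   using Y[of "(v, 0)"] by blast
  have "DD (%x. fst (Y x)) x a = - Gam x a (fst (Y x))" "DD (%x. snd (Y x)) x a = G x a (fst (Y x))" if "x : ball x0 r" for x a
   using dir_deriv_eq[OF has_derivative_fst[OF Y(3)[OF that]]] dir_deriv_eq[OF has_derivative_snd[OF Y(3)[OF that]]] by (simp_all add: A_def)
  then show ?thesis using Y(2) smooth_on_bounded_linear[OF bounded_linear_fst open_ball Y(1)] smooth_on_bounded_linear[OF bounded_linear_snd open_ball Y(1)]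
   by (intro exI[of _ "%x. fst (Y x)"] exI[of _ "%x. snd (Y x)"]) (simp add: parallel_def)
 qed
 then show ?thesis using r by (intro exI[of _ r]) blast
qed

definition isom :: "('e => 'e => real) => (3 => 'e => 'e) => 'e set => ('e => 'e) => bool" where
 "isom g0 J0 W ph \<longleftrightarrow> smooth_on W ph & (ALL x:W. (ALL a c. g0 (DD ph x a) (DD ph x c) = G x a c) &
   (ALL i a. DD ph x (J i x a) = J0 i (DD ph x a)))"

text \<open>The coordinates are potentials of parallel fields that are dual to the standard basis at
  \<open>x0\<close>. Inner products of parallel fields are constant, so the derivative of
  \<open>ph\<close> sends a parallel field to its value at \<open>x0\<close>. As the complex
  structures preserve parallel fields, they become constant along with the metric.\<close>

theorem flat_coordinates:
 assumes x0: "x0 : S"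
 shows "EX r>0. ball x0 r <= S & (EX ph. isom (G x0) (%i. J i x0) (ball x0 r) ph &
  (ALL v. EX u. parallel (ball x0 r) u & (ALL x:ball x0 r. DD ph x (u x) = v)))"
proof -
 obtain r where r: "r > 0" "ball x0 r <= S" and up: "!!v. EX u ps. parallel (ball x0 r) u & u x0 = v & smooth_on (ball x0 r) ps &
  (ALL x:ball x0 r. ALL a. DD ps x a = G x a (u x))" using parallel_potential[OF x0] by blast
 define W where "W = ball x0 r"
 have W: "open W" "convex W" "W <= S" "x0 : W" using r by (auto simp: W_def)
 have "ALL b. EX u ps. (ALL a. G x0 a (u x0) = a \<bullet> b) & parallel W u & smooth_on W ps & (ALL x:W. ALL a. DD ps x a = G x a (u x))"
  using ex_riesz[OF x0] up unfolding W_def by metis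
 then obtain U Ps where U: "!!b a. G x0 a (U b x0) = a \<bullet> b" "!!b. parallel W (U b)" "!!b. smooth_on W (Ps b :: 'e => real)"
  "!!b x a. x : W ==> DD (Ps b) x a = G x a (U b x)" by metis
 define ph where "ph x = (SUM b:Basis. Ps b x *R b)" for x
 have s: "smooth_on W (%x. Ps b x *R b)" for b by (intro smooth_on_scaleR smooth_on_const U W)
 have sph: "smooth_on W ph" unfolding ph_def[abs_def] by (rule smooth_on_sum[OF W(1) s])
 have D: "DD ph x a = (SUM b:Basis. G x a (U b x) *R b)" if "x : W" for x a
  unfolding ph_def[abs_def] dir_deriv_sum[OF s that] dir_deriv_linear[OF bounded_linear_scaleR_left U(3) that] U(4)[OF that] ..
 have lD: "linear (DD ph x)" if "x : W" for x by (rule linear_DD[OF sph that])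
 have Du: "DD ph x (u x) = u x0" if "parallel W u" "x : W" for x u
 proof -
  have "DD ph x (u x) = (SUM b:Basis. (u x0 \<bullet> b) *R b)"
   unfolding D[OF that(2)] parallel_G[OF that(1) U(2) W(1,2,3) that(2) W(4)] U(1) ..
  then show ?thesis by (simp add: euclidean_representation)
 qed
 have "ALL v. EX u. parallel W u & u x0 = v" using up unfolding W_def by blast
 from choice[OF this] obtain u where u: "!!v. parallel W (u v)" "!!v. u v x0 = v" by blast
 have inv: "u (DD ph x a) x = a" if x: "x : W" for x a
 proof -
  have "surj (DD ph x)" 
   by (rule surjI[where f="%v. u v x"]) (simp add: Du[OF u(1) x] u(2))
  then have "inj (DD ph x)" by (rule linear_surjective_imp_injective[OF lD[OF x]]) (rule refl)
  then show ?thesis using Du[OF u(1) x, of "DD ph x a"] u(2) by (simp add: inj_eq)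
 qed
 have "isom (G x0) (%i. J i x0) W ph" unfolding isom_def
 proof (intro conjI ballI allI sph)
  fix x a c i assume x: "x : W"
  show "G x0 (DD ph x a) (DD ph x c) = G x a c"
   using parallel_G[OF u(1) u(1) W(1,2,3) W(4) x, of "DD ph x a" "DD ph x c"] unfolding u(2) inv[OF x] .
  show "DD ph x (J i x a) = J i x0 (DD ph x a)"
   using Du[OF parallel_J_field[OF u(1) W(1,3)] x, of i "DD ph x a"] unfolding u(2) inv[OF x] .
 qed
 moreover have "ALL v. EX w. parallel W w & (ALL x:W. DD ph x (w x) = v)" using u Du by metis
 ultimately show ?thesis using r unfolding W_def by blast
qed

lemma isom_bij:
 assumes "isom g0 J0 W ph" "W <= S" "x : W"
 shows "linear (DD ph x)" "inj (DD ph x)" "surj (DD ph x)"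
proof -
 show l: "linear (DD ph x)" using assms linear_DD unfolding isom_def by blast
 have "a = 0" if "DD ph x a = 0" for a
 proof -
  have "G x a a = g0 (DD ph x a) (DD ph x a)" "G x 0 0 = g0 (DD ph x 0) (DD ph x 0)"
   using assms by (auto simp: isom_def)
  then have "G x a a = 0" using that linear_0[OF l] linear_0[OF G1] assms by auto
  then show ?thesis using G_pos[of x a] assms by force
 qed
 then show i: "inj (DD ph x)" by (simp add: linear_injective_0[OF l])
 show "surj (DD ph x)" by (rule linear_injective_imp_surjective[OF l i]) (rule refl)
qed

text \<open>The algebra behind the uniqueness of the Levi-Civita connection: \<open>T\<close> is
  symmetric in its first two arguments and its symmetrisation in the last two is the derivative of
  the metric, so the Koszul formula determines it.\<close>

lemma isom_hess:
 assumes ph: "isom g0 J0 W ph" and W: "open W" "W <= S" "x : W" and g0: "bounded_bilinear g0" "!!a b. g0 a b = g0 b a"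
 shows "DD (%y. DD ph y b) x a = DD ph x (Gam x a b)"
proof -
 have x: "x : S" using W by blast
 have sph: "smooth_on W ph" and g: "!!y a c. y : W ==> g0 (DD ph y a) (DD ph y c) = G y a c"
  using ph by (auto simp: isom_def)
 define D2 where "D2 a b = DD (%y. DD ph y b) x a" for a b
 define T where "T a b c = g0 (D2 a b) (DD ph x c)" for a b c
 have Ts: "T a b c = T b a c" for a b c unfolding T_def D2_def dir_deriv_commute[OF W(1) sph W(3), of b a] ..
 have DT: "DG x a b c = T a b c + T a c b" for a b c
 proof -
  have "DG x a b c = DD (%y. g0 (DD ph y b) (DD ph y c)) x a"
   unfolding DG_def by (rule fun_cong[OF deriv_cong_open[OF W(1,3) g[symmetric]]])
  also have "... = g0 (DD ph x b) (D2 a c) + g0 (D2 a b) (DD ph x c)" unfolding D2_def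
   by (rule dir_deriv_bilinear[OF g0(1) smooth_on_deriv[OF sph] smooth_on_deriv[OF sph] W(3)])
  finally show ?thesis using g0(2) by (simp add: T_def)
 qed
 have "G x (Gam x a b) c = T a b c" for c
  using Gam[OF x, of a b c] DT[of a b c] DT[of b a c] DT[of c a b] Ts[of c a b] Ts[of a b c] Ts[of b c a] by linarith
 then have z: "g0 (DD ph x (Gam x a b) - D2 a b) (DD ph x c) = 0" for c
  unfolding bounded_bilinear.diff_left[OF g0(1)] by (simp add: T_def g[OF W(3)])
 obtain c where c: "DD ph x (Gam x a b) - D2 a b = DD ph x c"
  using surjD[OF isom_bij(3)[OF ph W(2,3)]] by blast
 have "c = 0" using z[of c] G_pos[OF x, of c] unfolding c g[OF W(3)] by fastforce
 then have "DD ph x (Gam x a b) - D2 a b = 0" unfolding c using linear_0[OF isom_bij(1)[OF ph W(2,3)]] by simp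
 then show ?thesis by (simp add: D2_def)
qed

text \<open>By \<open>isom_hess\<close> the derivative of \<open>ph\<close> maps each parallel field
  to a constant, and so does that of \<open>ph0\<close>. The linear map \<open>L\<close> relates
  these constants; \<open>ph\<close> and \<open>L\<close> after \<open>ph0\<close> then have the
  same derivative and differ by a constant on the convex set \<open>V\<close>.\<close>

lemma isom_affine:
 assumes ph0: "isom g1 J1 W ph0" "W <= S" "!!v. EX u. parallel W u & (ALL x:W. DD ph0 x (u x) = v)"
  and ph: "isom g0 J0 V ph" and V: "open V" "convex V" "V <= W" "V ~= {}"
  and g0: "bounded_bilinear g0" "!!a b. g0 a b = g0 b a"
 shows "EX L b. linear L & (ALL x:V. ph x = L (ph0 x) + b & (ALL a. DD ph x a = L (DD ph0 x a))) &
  (ALL v w. g0 (L v) (L w) = g1 v w) & (ALL i v. L (J1 i v) = J0 i (L v))"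
proof -
 have VS: "V <= S" using V ph0(2) by blast
 have sph: "smooth_on V ph" "smooth_on V ph0" using ph ph0(1) V(3) smooth_on_subset by (auto simp: isom_def)
 obtain y where y: "y : V" using V(4) by blast
 have "ALL v. EX u. parallel W u & (ALL x:W. DD ph0 x (u x) = v)" using ph0(3) by blast
 from choice[OF this] obtain u where u: "!!v. parallel W (u v)" "!!v x. x : W ==> DD ph0 x (u v x) = v" by blast
 have su: "smooth_on V (u v)" "!!x a. x : V ==> DD (u v) x a = - Gam x a (u v x)" for v
  using u(1)[of v] V(3) smooth_on_subset by (auto simp: parallel_def)
 define L where "L v = DD ph y (u v y)" for v
 note lin = isom_bij(1)[OF ph VS]
 have L: "DD ph x (u v x) = L v" if x: "x : V" for x v unfolding L_def
 proof (rule smooth_constant[OF V(2,1) _ _ x y])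
  show "smooth_on V (%x. DD ph x (u v x))"
   by (rule smooth_on_apply(1)[OF V(1) smooth_on_deriv[OF sph(1)] lin su(1)])
  fix x a assume x: "x : V"
  have "DD (%x. DD ph x (u v x)) x a = DD (%z. DD ph z (u v x)) x a + DD ph x (DD (u v) x a)"
   by (rule smooth_on_apply(2)[OF V(1) smooth_on_deriv[OF sph(1)] lin su(1) x])
  then show "DD (%x. DD ph x (u v x)) x a = 0"
   unfolding isom_hess[OF ph V(1) VS x g0] su(2)[OF x] linear_neg[OF lin[OF x]] by simp
 qed
 have DL: "DD ph x a = L (DD ph0 x a)" if x: "x : V" for x a
 proof -
  have xW: "x : W" using x V by blast
  have "u (DD ph0 x a) x = a" using isom_bij(2)[OF ph0(1,2) xW] u(2)[OF xW, of "DD ph0 x a"] by (simp add: inj_eq)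
  then show ?thesis using L[OF x, of "DD ph0 x a"] by simp
 qed
 have yW: "y : W" using y V by blast
 note l0 = isom_bij(1)[OF ph0(1,2) yW]
 have sj: "EX a. v = DD ph0 y a" for v using surjD[OF isom_bij(3)[OF ph0(1,2) yW]] .
 have lL: "linear L"
 proof (rule linearI)
  fix v w and r :: real
  obtain a b where ab: "v = DD ph0 y a" "w = DD ph0 y b" using sj by metis
  show "L (v + w) = L v + L w" "L (r *R v) = r *R L v"
   unfolding ab linear_add[OF l0, symmetric] linear_cmul[OF l0, symmetric] DL[OF y, symmetric]
   by (simp_all add: linear_add[OF lin[OF y]] linear_cmul[OF lin[OF y]])
 qed
 have bL: "bounded_linear L" using lL by (simp add: linear_conv_bounded_linear)
 define b where "b = ph y - L (ph0 y)"
 have "ph x - L (ph0 x) = ph y - L (ph0 y)" if x: "x : V" for x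
 proof (rule smooth_constant[OF V(2,1) _ _ x y])
  have sL: "smooth_on V (%x. L (ph0 x))" by (rule smooth_on_bounded_linear[OF bL V(1) sph(2)])
  show "smooth_on V (%x. ph x - L (ph0 x))" by (rule smooth_on_diff[OF V(1) sph(1) sL])
  fix x a assume x: "x : V"
  show "DD (%x. ph x - L (ph0 x)) x a = 0"
   unfolding dir_deriv_diff[OF sph(1) sL x] dir_deriv_linear[OF bL sph(2) x] DL[OF x] by simp
 qed
 then have "ALL x:V. ph x = L (ph0 x) + b" unfolding b_def by (metis add.commute diff_add_cancel)
 moreover have "g0 (L v) (L w) = g1 v w & L (J1 i v) = J0 i (L v)" for v w i
 proof -
  obtain a c where ac: "v = DD ph0 y a" "w = DD ph0 y c" using sj by metis
  have "L (J1 i v) = L (DD ph0 y (J i y a))" using ph0(1) yW by (simp add: isom_def ac)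
  also have "... = J0 i (L v)" using ph y by (simp add: isom_def ac DL[OF y, symmetric])
  finally show ?thesis using ph0(1) ph y yW by (simp add: ac isom_def DL[OF y, symmetric])
 qed
 ultimately show ?thesis using lL DL by (intro exI[of _ L] exI[of _ b]) blast
qed

end

section \<open>The developing map along a contraction\<close>

context hk_chart
begin

lemma isom_mono: "isom g0 J0 W ph ==> V <= W ==> isom g0 J0 V ph"
 unfolding isom_def using smooth_on_subset by blast

lemma isom_compose_affine:
 assumes "isom g1 J1 W ph0" "open W" "linear L" "!!v w. g0 (L v) (L w) = g1 v w" "!!i v. L (J1 i v) = J0 i (L v)"
 shows "isom g0 J0 W (%x. L (ph0 x) + b)"
proof -
 have s: "smooth_on W ph0" using assms by (simp add: isom_def)
 have bL: "bounded_linear L" using assms(3) by (simp add: linear_conv_bounded_linear)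
 have sL: "smooth_on W (%x. L (ph0 x))" by (rule smooth_on_bounded_linear[OF bL assms(2) s])
 have "DD (%x. L (ph0 x) + b) x a = L (DD ph0 x a)" if "x : W" for x a
  unfolding dir_deriv_add[OF sL smooth_on_const that] dir_deriv_linear[OF bL s that] by simp
 then show ?thesis using assms(1,4,5) smooth_on_add[OF assms(2) sL smooth_on_const] by (simp add: isom_def)
qed

end

locale hk_mfd = smfd X for X :: "('b, 'e::euclidean_space) manifold" +
 fixes \<omega> :: "3 => ('b, 'e) form2" and J :: "3 => ('b, 'e) endo_field" and g :: "('b, 'e) form2"
 assumes hk: "hyperkaehler X \<omega> J g" and flat: "flat_metric X g"
begin

abbreviation "gc c \<equiv> (%x. g c (cinv c x))"
abbreviation "Jc c \<equiv> (%i x. J i c (cinv c x))"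

lemma metric: "riemannian_metric X g" and cplx: "complex_structure X (J i)" and sympl: "symplectic_form X (\<omega> i)"
 using hk unfolding hyperkaehler_def by blast+

lemma J12: "c : charts X ==> p : fst c ==> J 1 c p (J 2 c p u) = J 3 c p u"
 and J21: "c : charts X ==> p : fst c ==> J 2 c p (J 1 c p u) = - J 3 c p u"
 using hk unfolding hyperkaehler_def by blast+

lemma g_trans: "c : charts X ==> d : charts X ==> p : fst c ==> p : fst d ==> g d p (dtrans c d p u) (dtrans c d p w) = g c p u w"
 using metric unfolding riemannian_metric_def smooth_bilinear_field_def by blast

lemma J_trans: "c : charts X ==> d : charts X ==> p : fst c ==> p : fst d ==> J i d p (dtrans c d p u) = dtrans c d p (J i c p u)"
 using cplx[of i] unfolding complex_structure_def smooth_endo_field_def by blast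

lemma hk_chart: assumes c: "c : charts X" shows "hk_chart (cimage c) (gc c) (Jc c)"
proof -
 note rm = metric and cs = cplx and sy = sympl
 have g\<omega>: "!!i p u z. p : fst c ==> g c p u z = \<omega> i c p u (J i c p z)"
  using hk c unfolding hyperkaehler_def compat_metric_def by blast
 note ci = cinv_in[OF c]
 have m: "bilinear (g c p)" "smooth_on (cimage c) (%x. g c (cinv c x) u w)" "g c p u w = g c p w u" "u ~= 0 ==> 0 < g c p u u" if "p : fst c" for p u w
  using rm c that unfolding riemannian_metric_def smooth_bilinear_field_def by blast+
 have sg: "smooth_on (cimage c) (%x. g c (cinv c x) u w)" for u w
  using rm c unfolding riemannian_metric_def smooth_bilinear_field_def by blast
 have \<omega>: "bilinear (\<omega> i c p)" "\<omega> i c p u u = 0" if "p : fst c" for i p u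
  using sy[of i] c that unfolding symplectic_form_def smooth_bilinear_field_def by blast+
 have s\<omega>: "smooth_on (cimage c) (%x. \<omega> i c (cinv c x) u w)" and cl: "x : cimage c ==> DD (%y. \<omega> i c (cinv c y) b d) x a
    - DD (%y. \<omega> i c (cinv c y) a d) x b + DD (%y. \<omega> i c (cinv c y) a b) x d = 0" for i u w x a b d
  using sy[of i] c unfolding symplectic_form_def smooth_bilinear_field_def closed_2form_def by blast+
 have jj: "J i c p (J i c p u) = - u" and jl: "linear (J i c p)" if "p : fst c" for i p u
  using cs[of i] c that unfolding complex_structure_def smooth_endo_field_def by blast+
 have js: "smooth_on (cimage c) (%x. J i c (cinv c x) u)" for i u
  using cs[of i] c unfolding complex_structure_def smooth_endo_field_def by blast
 have ji: "EX S ps (J0 :: 'e => 'e). open S & snd c p : S & S <= cimage c & smooth_on S ps & inj_on ps S & open (ps ` S)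
   & smooth_on (ps ` S) (inv_into S ps) & (ALL x:S. ALL u. DD ps x (J i c (cinv c x) u) = J0 (DD ps x u))" if "p : fst c" for i p
  using cs[of i] c that unfolding complex_structure_def by blast
 interpret m: metric_chart "cimage c" "gc c"
  using open_cimage[OF c] m ci sg unfolding bilinear_def by unfold_locales (auto simp: bilinear_def linear_iff)
 have gJ: "g c (cinv c x) b (J i c (cinv c x) d) = - \<omega> i c (cinv c x) b d" if "x : cimage c" for x i b d
  unfolding g\<omega>[OF ci[OF that], of b _ i] jj[OF ci[OF that]] using linear_neg[of "\<omega> i c (cinv c x) b"] \<omega>(1)[OF ci[OF that]] by (simp add: bilinear_def)
 show ?thesis
 proof (rule hk_chart.intro[OF m.metric_chart_axioms], rule hk_chart_axioms.intro)
  fix x i u w a b d assume x: "x : cimage c"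
  note p = ci[OF x]
  show "linear (J i c (cinv c x))" "J i c (cinv c x) (J i c (cinv c x) u) = - u" by (rule jl[OF p] jj[OF p])+
  have "- \<omega> i c (cinv c x) v z = \<omega> i c (cinv c x) z v" for v z
   using \<omega>(2)[OF p, of i "v + z"] \<omega>(2)[OF p, of i v] \<omega>(2)[OF p, of i z] by (simp add: bilinear_ladd[OF \<omega>(1)[OF p]] bilinear_radd[OF \<omega>(1)[OF p]])
  then show "g c (cinv c x) (J i c (cinv c x) u) (J i c (cinv c x) w) = g c (cinv c x) u w"
   unfolding gJ[OF x] m(3)[OF p, of u w] g\<omega>[OF p, of w u i] .
  have "DD (%y. g c (cinv c y) b (J i c (cinv c y) d)) x a = - DD (%y. \<omega> i c (cinv c y) b d) x a" for a b d
  proof -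
   have "DD (%y. g c (cinv c y) b (J i c (cinv c y) d)) x a = DD (%y. - \<omega> i c (cinv c y) b d) x a"
    by (rule fun_cong[OF deriv_cong_open[OF open_cimage[OF c] x gJ]])
   then show ?thesis unfolding dir_deriv_linear[OF bounded_linear_minus[OF bounded_linear_ident] s\<omega> x] .
  qed
  then show "DD (%y. g c (cinv c y) b (J i c (cinv c y) d)) x a - DD (%y. g c (cinv c y) a (J i c (cinv c y) d)) x b
    + DD (%y. g c (cinv c y) a (J i c (cinv c y) b)) x d = 0" using cl[OF x, of i b d a] by simp
  have ch: "m.Gam y b w = christoffel g c y b w" for y b w unfolding m.Gam_def christoffel_def m.DG_def ..
  show "DD (%y. m.Gam y b w) x a - DD (%y. m.Gam y a w) x b + m.Gam x a (m.Gam x b w) - m.Gam x b (m.Gam x a w) = 0"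
   using flat c x unfolding flat_metric_def curvature_def ch by blast
  obtain S ps and J0 :: "'e => 'e" where S: "open S" "snd c (cinv c x) : S" "S <= cimage c" "smooth_on S ps" "inj_on ps S" "open (ps ` S)"
   "smooth_on (ps ` S) (inv_into S ps)" "ALL x:S. ALL u. DD ps x (J i c (cinv c x) u) = J0 (DD ps x u)"
   using ji[OF p, of i] by (elim exE conjE) (rule that)
  have xS: "x : S" using S(2) unfolding chart_cinv[OF c x] .
  have "DD (inv_into S ps) (ps x) (DD ps x u) = u" for u
  proof -
   have "DD (inv_into S ps) (ps x) (DD ps x u) = DD (%y. inv_into S ps (ps y)) x u"
    by (rule dir_deriv_compose[OF S(7,4) xS imageI[OF xS], symmetric])
   also have "... = DD (%y. y) x u"
    by (rule fun_cong[OF deriv_cong_open[OF S(1) xS inv_into_f_f[OF S(5)]]])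
   finally show ?thesis by simp
  qed
  then have "inj (DD ps x)" by (rule inj_on_inverseI)
  then show "EX T ps (J0 :: 'e => 'e). open T & x : T & T <= cimage c & smooth_on T (ps :: 'e => 'e) & inj (DD ps x) &
    (ALL y:T. ALL u. DD ps y (J i c (cinv c y) u) = J0 (DD ps y u))"
   using S(1,3,4,8) xS by (intro exI[of _ S] exI[of _ ps] exI[of _ J0]) simp
 qed (rule js)
qed

end

locale flat_model = hk_mfd X \<omega> J g
 for X :: "('b, 'e::euclidean_space) manifold" and \<omega> :: "3 => ('b, 'e) form2" and J :: "3 => ('b, 'e) endo_field" and g :: "('b, 'e) form2" +
 fixes g0 :: "'e => 'e => real" and J0 :: "3 => 'e => 'e"
 assumes g0: "bounded_bilinear g0" and g0_sym: "g0 a b = g0 b a"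
begin

text \<open>The flat coordinate maps on \<open>U\<close> with values in the constant structure \<open>g0\<close>, \<open>J0\<close>.\<close>

definition FF :: "'b set => ('b => 'e) => bool" where
 "FF U ph \<longleftrightarrow> openin (mtop X) U &
   (ALL d:charts X. hk_chart.isom (gc d) (Jc d) g0 J0 (snd d ` (U Int fst d)) (%x. ph (cinv d x)))"

lemma FF_open: "FF U ph ==> openin (mtop X) U" and FF_isom: "FF U ph ==> d : charts X ==>
  hk_chart.isom (gc d) (Jc d) g0 J0 (snd d ` (U Int fst d)) (%x. ph (cinv d x))"
 unfolding FF_def by blast+

lemma FF_mono: assumes "FF U ph" "openin (mtop X) V" "V <= U" shows "FF V ph"
 unfolding FF_def
proof (intro conjI ballI assms(2))
 fix d assume d: "d : charts X"
 show "hk_chart.isom (gc d) (Jc d) g0 J0 (snd d ` (V Int fst d)) (%x. ph (cinv d x))"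
  by (rule hk_chart.isom_mono[OF hk_chart[OF d] FF_isom[OF assms(1) d]]) (use assms(3) in blast)
qed

text \<open>One chart suffices: the transition maps carry the metric and the complex structures of
  one chart to those of another.\<close>

lemma FF_chart:
 assumes c: "c : charts X" and U: "openin (mtop X) U" "U <= fst c" and f: "hk_chart.isom (gc c) (Jc c) g0 J0 (snd c ` U) f"
 shows "FF U (%p. f (snd c p))"
 unfolding FF_def
proof (intro conjI ballI U(1))
 fix d assume d: "d : charts X"
 define V where "V = snd d ` (U Int fst d)"
 define ta where "ta x = snd c (cinv d x)" for x
 note f' = f[unfolded hk_chart.isom_def[OF hk_chart[OF c]]]
 have oV: "open V" unfolding V_def by (intro open_image d openin_Int U openin_chart) auto
 have oU: "open (snd c ` U)" by (rule open_image[OF c U])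
 have sta: "smooth_on V ta" unfolding ta_def[abs_def] V_def by (rule smooth_on_subset[OF transition_smooth[OF d c]]) (use U in auto)
 have pt: "EX p. p : U & p : fst d & x = snd d p & cinv d x = p & ta x = snd c p" if x: "x : V" for x
 proof -
  obtain p where p: "p : U" "p : fst d" "x = snd d p" using x unfolding V_def by blast
  then show ?thesis using cinv_chart[OF d p(2)] by (intro exI[of _ p]) (simp add: ta_def)
 qed
 have img: "ta ` V <= snd c ` U" using pt by force
 have s: "smooth_on V (%x. f (ta x))" using smooth_on_compose[OF oV oU img _ sta] f' by blast
 show "hk_chart.isom (gc d) (Jc d) g0 J0 (snd d ` (U Int fst d)) (%x. f (snd c (cinv d x)))"
  unfolding hk_chart.isom_def[OF hk_chart[OF d]] V_def[symmetric] ta_def[symmetric]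
 proof (intro conjI ballI allI s)
  fix x a a' i assume x: "x : V"
  obtain p where p: "p : U" "p : fst d" "x = snd d p" "cinv d x = p" "ta x = snd c p" using pt[OF x] by blast
  have pc: "p : fst c" using p(1) U(2) by blast
  have x': "ta x : snd c ` U" using p by simp
  have D: "DD (%x. f (ta x)) x a = DD f (snd c p) (dtrans d c p a)" for a
   using dir_deriv_compose[of "snd c ` U" f V ta, OF _ sta x x', of a] f' by (simp add: p(5) dtrans_def o_def ta_def[abs_def] p(3) cinv_chart[OF d p(2)])
  have f1: "g0 (DD f (snd c p) u) (DD f (snd c p) w) = g c p u w" "DD f (snd c p) (J i c p u) = J0 i (DD f (snd c p) u)" for u w
   using bspec[OF conjunct2[OF f'] x'] unfolding p(5) cinv_chart[OF c pc] by blast+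
  show "g0 (DD (%x. f (ta x)) x a) (DD (%x. f (ta x)) x a') = g d (cinv d x) a a'"
   unfolding D f1 p(4) by (rule g_trans[OF d c p(2) pc])
  show "DD (%x. f (ta x)) x (J i d (cinv d x) a) = J0 i (DD (%x. f (ta x)) x a)"
   unfolding D f1(2)[symmetric] p(4) J_trans[OF d c p(2) pc] ..
 qed
qed

text \<open>Sets on which continuation is trivial: every germ of a flat map at a point of
  \<open>W\<close> is the germ of a flat map on all of \<open>W\<close>, and flat maps on
  \<open>W\<close> that agree on a nonempty open subset agree everywhere.\<close>

definition good :: "'b set => bool" where
 "good W \<longleftrightarrow> (ALL U ph y. FF U ph & y : U Int W --> (EX ph' V. FF W ph' & openin (mtop X) V & y : V & V <= U Int W & (ALL z:V. ph z = ph' z))) &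
  (ALL ph ph' V. FF W ph & FF W ph' & openin (mtop X) V & V ~= {} & V <= W & (ALL z:V. ph z = ph' z) --> (ALL z:W. ph z = ph' z))"

text \<open>Small coordinate balls work. Such a ball carries one flat map \<open>ph0\<close>, and by
  \<open>isom_affine\<close> any flat map on a convex open part of it is an affine image of
  \<open>ph0\<close>. The affine map extends a germ to the whole ball, and it is determined by the
  value and the derivative at one point.\<close>

lemma ex_good: assumes O: "openin (mtop X) O'" "P : O'" shows "EX W. openin (mtop X) W & P : W & W <= O' & good W"
proof -
 have "P : points X" using O openin_subset by blast
 then obtain c where c: "c : charts X" "P : fst c" using charts_cover by blast
 note cM = c(1)
 interpret c: hk_chart "cimage c" "gc c" "Jc c" by (rule hk_chart[OF cM])
 define x0 where "x0 = snd c P"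
 have x0: "x0 : cimage c" unfolding x0_def using c(2) by (rule imageI)
 obtain r ph0 where r: "r > 0" "ball x0 r <= cimage c" and ph0: "c.isom (gc c x0) (%i. Jc c i x0) (ball x0 r) ph0"
  "!!v. EX u. c.parallel (ball x0 r) u & (ALL x:ball x0 r. DD ph0 x (u x) = v)" using c.flat_coordinates[OF x0] by blast
 have oO: "open (snd c ` (O' Int fst c))" by (intro open_image cM openin_Int O openin_chart) auto
 have "x0 : snd c ` (O' Int fst c)" using O(2) c(2) by (simp add: x0_def)
 then obtain r1 where r1: "r1 > 0" "ball x0 r1 <= snd c ` (O' Int fst c)" using oO open_contains_ball by blast
 define B where "B = ball x0 (min r r1)"
 define W where "W = cinv c ` B"
 have B: "open B" "convex B" "B <= ball x0 r" "B <= snd c ` (O' Int fst c)" "x0 : B" "B <= cimage c" using r r1 by (auto simp: B_def)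
 have oW: "openin (mtop X) W" unfolding W_def by (rule openin_cinv_image[OF cM B(1,6)])
 have Wc: "W <= fst c" unfolding W_def using B(6) cinv_in[OF cM] by blast
 have cW: "snd c ` W = B" unfolding W_def image_image using B(6) chart_cinv[OF cM] by (auto simp: image_iff subset_iff)
 have "cinv c x0 : W" unfolding W_def using B(5) by (rule imageI)
 then have PW: "P : W" unfolding x0_def cinv_chart[OF cM c(2)] .
 have WO: "W <= O'"
 proof
  fix q assume "q : W"
  then obtain p where "p : O'" "p : fst c" "q = cinv c (snd c p)" using B(4) unfolding W_def by blast
  then show "q : O'" using cinv_chart[OF cM] by simp
 qed
 have rep: "EX L b. linear L & (ALL x:V. ph (cinv c x) = L (ph0 x) + b & (ALL a. DD (%x. ph (cinv c x)) x a = L (DD ph0 x a))) &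
   (ALL v w. g0 (L v) (L w) = gc c x0 v w) & (ALL i v. L (Jc c i x0 v) = J0 i (L v))"
  if "FF U ph" "open V" "convex V" "V <= B" "V ~= {}" "V <= snd c ` (U Int fst c)" for U ph V
  by (rule c.isom_affine[OF ph0(1) r(2) ph0(2) c.isom_mono[OF FF_isom[OF that(1) cM] that(6)] that(2,3) order_trans[OF that(4) B(3)] that(5) g0 g0_sym])
 have "good W" unfolding good_def
 proof (intro conjI allI impI)
  fix U ph y assume "FF U ph & y : U Int W"
  then have U: "FF U ph" "y : U" "y : W" by auto
  have yc: "y : fst c" using U(3) Wc by blast
  have "open (B Int snd c ` (U Int fst c))" by (intro open_Int B open_image cM openin_Int FF_open[OF U(1)] openin_chart) auto
  moreover have "snd c y : B Int snd c ` (U Int fst c)" using U yc cW by blast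
  ultimately obtain e where e: "e > 0" "ball (snd c y) e <= B Int snd c ` (U Int fst c)" using open_contains_ball by blast
  have eB: "ball (snd c y) e <= B" "ball (snd c y) e <= snd c ` (U Int fst c)" "ball (snd c y) e ~= {}" using e by auto
  obtain L b where L: "linear L" "ALL x:ball (snd c y) e. ph (cinv c x) = L (ph0 x) + b & (ALL a. DD (%x. ph (cinv c x)) x a = L (DD ph0 x a))"
   "!!v w. g0 (L v) (L w) = gc c x0 v w" "!!i v. L (Jc c i x0 v) = J0 i (L v)"
   using rep[OF U(1) open_ball convex_ball eB(1,3,2)] by blast
  have "c.isom g0 J0 B (%x. L (ph0 x) + b)"
   by (rule c.isom_compose_affine[where L=L and ?ph0.0=ph0 and ?g0.0=g0 and ?J0.0=J0, OF c.isom_mono[OF ph0(1) B(3)] B(1) L(1)])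
     (rule L(3) L(4))+
  then have F: "FF W (%p. L (ph0 (snd c p)) + b)" using FF_chart[OF cM oW Wc, of "%x. L (ph0 x) + b"] cW by simp
  have "openin (mtop X) (cinv c ` ball (snd c y) e)" by (rule openin_cinv_image[OF cM open_ball order_trans[OF eB(1) B(6)]])
  moreover have "cinv c (snd c y) : cinv c ` ball (snd c y) e" using e(1) by (intro imageI) simp
  then have "y : cinv c ` ball (snd c y) e" unfolding cinv_chart[OF cM yc] .
  moreover have "cinv c ` ball (snd c y) e <= U Int W"
  proof
   fix q assume "q : cinv c ` ball (snd c y) e"
   then obtain x where x: "x : ball (snd c y) e" "q = cinv c x" by blast
   obtain p where p: "p : U" "p : fst c" "x = snd c p" using x(1) eB(2) by blast
   have "q : W" unfolding x(2) W_def using x(1) eB(1) by blast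
   then show "q : U Int W" using p(1) unfolding x(2) p(3) cinv_chart[OF cM p(2)] by simp
  qed
  moreover have "ALL z:cinv c ` ball (snd c y) e. ph z = L (ph0 (snd c z)) + b"
  proof
   fix z assume "z : cinv c ` ball (snd c y) e"
   then obtain x where x: "x : ball (snd c y) e" "z = cinv c x" by blast
   have "snd c z = x" using chart_cinv[OF cM, of x] x eB(1) B(6) by blast
   then show "ph z = L (ph0 (snd c z)) + b" using L(2) x by simp
  qed
  ultimately show "EX ph' V. FF W ph' & openin (mtop X) V & y : V & V <= U Int W & (ALL z:V. ph z = ph' z)"
   using F by (intro exI[of _ "%p. L (ph0 (snd c p)) + b"] exI[of _ "cinv c ` ball (snd c y) e"] conjI)
 next
  fix ph ph' V assume a: "FF W ph & FF W ph' & openin (mtop X) V & V ~= {} & V <= W & (ALL z:V. ph z = ph' z)"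
  have BW: "B <= snd c ` (W Int fst c)" "B ~= {}" using cW Wc B(5) by auto
  obtain L b where L: "ALL x:B. ph (cinv c x) = L (ph0 x) + b & (ALL a. DD (%x. ph (cinv c x)) x a = L (DD ph0 x a))"
   using rep[of W ph B] a B(1,2) BW by blast
  obtain L' b' where L': "ALL x:B. ph' (cinv c x) = L' (ph0 x) + b' & (ALL a. DD (%x. ph' (cinv c x)) x a = L' (DD ph0 x a))"
   using rep[of W ph' B] a B(1,2) BW by blast
  obtain y where y: "y : V" using a by blast
  have V: "openin (mtop X) V" "V <= fst c" "!!z. z : V ==> ph z = ph' z" using a Wc by auto
  have yV: "snd c y : snd c ` V" and yB: "snd c y : B" using y a cW by blast+
  have eq: "ph (cinv c x) = ph' (cinv c x)" if x: "x : snd c ` V" for x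
  proof -
   obtain p where p: "p : V" "x = snd c p" using x by blast
   have "p : fst c" using p V by blast
   then show ?thesis using V(3)[OF p(1)] cinv_chart[OF cM] unfolding p(2) by simp
  qed
  have D: "DD (%x. ph (cinv c x)) (snd c y) = DD (%x. ph' (cinv c x)) (snd c y)"
   by (rule deriv_cong_open[OF open_image[OF cM V(1,2)] yV eq])
  have yr: "snd c y : ball x0 r" using yB B(3) by blast
  have LL: "L v = L' v" for v
  proof -
   obtain w where "v = DD ph0 (snd c y) w" using surjD[OF c.isom_bij(3)[OF ph0(1) r(2) yr]] by blast
   then show ?thesis using bspec[OF L yB] bspec[OF L' yB] D by simp
  qed
  have bb: "b = b'" using bspec[OF L yB] bspec[OF L' yB] eq[OF yV] LL by simp
  show "ALL z:W. ph z = ph' z" using L L' LL bb unfolding W_def by simp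
 qed
 then show ?thesis using oW PW WO by blast
qed

section \<open>Germs of flat maps and their continuation along paths\<close>

text \<open>Equality of germs at \<open>y\<close>. A germ is represented by a pair of a domain and a
  map, and the map matters only near \<open>y\<close>.\<close>

definition eqg :: "'b => 'b set \<times> ('b => 'e) => 'b set \<times> ('b => 'e) => bool" where
 "eqg y A B \<longleftrightarrow> (EX V. openin (mtop X) V & y : V & V <= fst A Int fst B & (ALL z:V. snd A z = snd B z))"

lemma eqg_sym: "eqg y A B ==> eqg y B A" unfolding eqg_def by (metis Int_commute)

lemma eqg_trans: assumes "eqg y A B" "eqg y B C" shows "eqg y A C"
proof -
 obtain V V' where V: "openin (mtop X) V" "y : V" "V <= fst A Int fst B" "ALL z:V. snd A z = snd B z"
  "openin (mtop X) V'" "y : V'" "V' <= fst B Int fst C" "ALL z:V'. snd B z = snd C z" using assms unfolding eqg_def by blast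
 have "openin (mtop X) (V Int V')" "y : V Int V'" "V Int V' <= fst A Int fst C" "ALL z:V Int V'. snd A z = snd C z" using V by auto
 then show ?thesis unfolding eqg_def by (intro exI[of _ "V Int V'"] conjI)
qed

text \<open>Continuation of germs of flat coordinates along the path \<open>h\<close>, from time \<open>1\<close> down to \<open>t\<close>.\<close>

definition cont :: "(real => 'b) => real => (real => 'b set \<times> ('b => 'e)) => bool" where
 "cont h t Ga \<longleftrightarrow> (ALL s:{t..1}. FF (fst (Ga s)) (snd (Ga s)) & h s : fst (Ga s) &
   (EX e>0. ALL s':{t..1}. \<bar>s' - s\<bar> < e --> eqg (h s') (Ga s') (Ga s)))"

definition path :: "(real => 'b) => bool" where
 "path h \<longleftrightarrow> (ALL s:{0..1}. ALL W. openin (mtop X) W & h s : W --> (EX e>0. ALL s':{0..1}. \<bar>s' - s\<bar> < e --> h s' : W))"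

text \<open>\<open>Bolzano\<close> reduces the claim to short time intervals around some
  \<open>x\<close>. There both continuations come from two maps on one good set, so agreement at the
  later time spreads to the earlier one.\<close>

lemma cont_unique:
 assumes h: "path h" and Ga: "cont h 0 Ga" "cont h 0 Ga'" and 1: "eqg (h 1) (Ga 1) (Ga' 1)"
 shows "eqg (h 0) (Ga 0) (Ga' 0)"
proof -
 define Q where "Q s \<longleftrightarrow> eqg (h s) (Ga s) (Ga' s)" for s
 have "0 <= (0::real) --> (1::real) <= 1 --> Q 1 --> Q 0"
 proof (rule Bolzano[where P="%a b. 0 <= a --> b <= 1 --> Q b --> Q a", OF zero_le_one])
  fix x :: real assume "0 <= x" "x <= 1"
  then have x: "x : {0..1}" by simp
  obtain e1 where G: "FF (fst (Ga x)) (snd (Ga x))" "h x : fst (Ga x)" "e1 > 0" "!!s. s : {0..1} ==> \<bar>s - x\<bar> < e1 ==> eqg (h s) (Ga s) (Ga x)"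
   using Ga(1) x unfolding cont_def by blast
  obtain e2 where G': "FF (fst (Ga' x)) (snd (Ga' x))" "h x : fst (Ga' x)" "e2 > 0" "!!s. s : {0..1} ==> \<bar>s - x\<bar> < e2 ==> eqg (h s) (Ga' s) (Ga' x)"
   using Ga(2) x unfolding cont_def by blast
  have "openin (mtop X) (fst (Ga x) Int fst (Ga' x))" "h x : fst (Ga x) Int fst (Ga' x)" using FF_open G(1,2) G'(1,2) by blast+
  from ex_good[OF this] obtain W where W: "openin (mtop X) W" "h x : W" "W <= fst (Ga x) Int fst (Ga' x)" "good W" by blast
  obtain e3 where e3: "e3 > 0" "!!s. s : {0..1} ==> \<bar>s - x\<bar> < e3 ==> h s : W" 
   using h[unfolded path_def, THEN bspec, OF x, THEN spec, THEN mp, OF conjI[OF W(1,2)]] by blast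
  show "EX d>0. ALL a b. a <= x & x <= b & b - a < d --> 0 <= a --> b <= 1 --> Q b --> Q a"
  proof (intro exI[of _ "min e1 (min e2 e3)"] conjI allI impI)
   show "0 < min e1 (min e2 e3)" using G G' e3 by simp
   fix a b assume ab: "a <= x & x <= b & b - a < min e1 (min e2 e3)" "0 <= a" "b <= 1" and Qb: "Q b"
   have I: "a : {0..1}" "b : {0..1}" using ab by auto
   have d: "\<bar>a - x\<bar> < e1" "\<bar>a - x\<bar> < e2" "\<bar>a - x\<bar> < e3" "\<bar>b - x\<bar> < e1" "\<bar>b - x\<bar> < e2" "\<bar>b - x\<bar> < e3" using ab by auto
   have "eqg (h b) (Ga x) (Ga' x)"
    by (rule eqg_trans[OF eqg_sym[OF G(4)[OF I(2) d(4)]] eqg_trans[OF Qb[unfolded Q_def] G'(4)[OF I(2) d(5)]]])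
   then obtain V where V: "openin (mtop X) V" "h b : V" "ALL z:V. snd (Ga x) z = snd (Ga' x) z" unfolding eqg_def by blast
   have F: "FF W (snd (Ga x))" "FF W (snd (Ga' x))" using FF_mono[OF G(1) W(1)] FF_mono[OF G'(1) W(1)] W(3) by blast+
   have VW: "openin (mtop X) (V Int W)" "V Int W ~= {}" "V Int W <= W" using V W e3(2)[OF I(2) d(6)] by auto
   have "ALL z:W. snd (Ga x) z = snd (Ga' x) z" using conjunct2[OF W(4)[unfolded good_def]] F VW V(3) by blast
   then have "eqg (h a) (Ga x) (Ga' x)" unfolding eqg_def using W e3(2)[OF I(1) d(3)] by blast
   then show "Q a" unfolding Q_def
    by (rule eqg_trans[OF G(4)[OF I(1) d(1)] eqg_trans[OF _ eqg_sym[OF G'(4)[OF I(1) d(2)]]]])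
  qed
 qed auto
 then show ?thesis using 1 by (simp add: Q_def)
qed

end

context flat_model
begin

lemma eqg_refl: "FF (fst A) (snd A) ==> y : fst A ==> eqg y A A"
 unfolding eqg_def using FF_open by blast

lemma tube:
 assumes H: "continuous_map (prod_topology (top_of_set {0..1::real}) T) (mtop X) H"
  and x: "x : {0..1}" and p: "p : topspace T" and W: "openin (mtop X) W" "H (x, p) : W"
 obtains e N where "e > 0" "openin T N" "p : N" "!!s q. s : {0..1} ==> \<bar>s - x\<bar> < e ==> q : N ==> H (s, q) : W"
proof -
 define Z where "Z = {z : topspace (prod_topology (top_of_set {0..1::real}) T). H z : W}"
 have "openin (prod_topology (top_of_set {0..1}) T) Z" unfolding Z_def using H W(1) by (rule openin_continuous_map_preimage)
 from iffD1[OF openin_prod_topology_alt this, THEN spec, of x, THEN spec, of p]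
 obtain U N where U: "openin (top_of_set {0..1}) U" "openin T N" "x : U" "p : N" "U \<times> N <= Z"
  using x p W(2) by (auto simp: Z_def)
 have "ALL x:U. EX e>0. ALL s:{0..1}. dist s x < e --> s : U"
  by (rule conjunct2[OF iffD1[OF openin_euclidean_subtopology_iff U(1)]])
 from bspec[OF this U(3)] obtain e where e: "e > 0" "ALL s:{0..1}. dist s x < e --> s : U" by (elim exE conjE)
 have "H (s, q) : W" if "s : {0..1}" "\<bar>s - x\<bar> < e" "q : N" for s q
 proof -
  have "(s, q) : Z" using e(2) that U(5) by (auto simp: dist_real_def)
  then show ?thesis by (simp add: Z_def)
 qed
 then show thesis using e(1) U(2,4) by (intro that)
qed

text \<open>The family \<open>Ga\<close> depends on the time only: one continuation serves the paths
  of all points in a neighbourhood of \<open>p0\<close>. This uniformity makes the developing map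
  locally a composite with a single flat map.\<close>

lemma cont_exists:
 assumes H: "continuous_map (prod_topology (top_of_set {0..1::real}) T) (mtop X) H"
  and base: "FF U0 ph0" "!!p. p : topspace T ==> H (1, p) : U0" and p0: "p0 : topspace T"
 shows "EX N Ga. openin T N & p0 : N & Ga 1 = (U0, ph0) & (ALL p:N. cont (%s. H (s, p)) 0 Ga)"
proof -
 define Q where "Q t \<longleftrightarrow> (EX N Ga. openin T N & p0 : N & Ga 1 = (U0, ph0) & (ALL p:N. cont (%s. H (s, p)) t Ga))" for t
 have "Q 1" unfolding Q_def
 proof (intro exI[of _ "topspace T"] exI[of _ "%_. (U0, ph0)"] conjI ballI)
  fix p assume p: "p : topspace T"
  have "eqg (H (1, p)) (U0, ph0) (U0, ph0)" using eqg_refl[of "(U0, ph0)"] base p by simp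
  then show "cont (%s. H (s, p)) 1 (%_. (U0, ph0))" unfolding cont_def using base p by (auto intro: exI[of _ 1])
 qed (use p0 in auto)
 moreover have "0 <= (0::real) --> (1::real) <= 1 --> Q 1 --> Q 0"
 proof (rule Bolzano[where P="%a b. 0 <= a --> b <= 1 --> Q b --> Q a", OF zero_le_one])
  fix x :: real assume "0 <= x" "x <= 1"
  then have x: "x : {0..1}" by simp
  have "H (x, p0) : points X" using continuous_map_image_subset_topspace[OF H] x p0 by auto
  from ex_good[OF openin_topspace this] obtain W where W: "openin (mtop X) W" "H (x, p0) : W" "good W" by blast
  obtain e N1 where e: "e > 0" "openin T N1" "p0 : N1" "!!s q. s : {0..1} ==> \<bar>s - x\<bar> < e ==> q : N1 ==> H (s, q) : W"
   by (rule tube[OF H x p0 W(1,2)]) (rule that)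
  show "EX d>0. ALL a b. a <= x & x <= b & b - a < d --> 0 <= a --> b <= 1 --> Q b --> Q a"
  proof (intro exI[of _ e] conjI allI impI e(1))
   fix a b assume ab: "a <= x & x <= b & b - a < e" "0 <= a" "b <= 1" and "Q b"
   from this(4) obtain N Ga where N: "openin T N" "p0 : N" "Ga 1 = (U0, ph0)" "!!p. p : N ==> cont (%s. H (s, p)) b Ga"
    unfolding Q_def by (elim exE conjE) blast
   have HW: "H (s, q) : W" if "a <= s" "s <= b" "q : N1" for s q using that ab by (intro e(4)) auto
   have b: "b : {0..1}" using ab by auto
   have Ga: "FF (fst (Ga s)) (snd (Ga s))" "H (s, p) : fst (Ga s)"
    "EX e>0. ALL s':{b..1}. \<bar>s' - s\<bar> < e --> eqg (H (s', p)) (Ga s') (Ga s)" if "p : N" "b <= s" "s <= 1" for s p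
    using N(4)[OF that(1)] that(2,3) unfolding cont_def by auto
   have "FF (fst (Ga b)) (snd (Ga b)) & H (b, p0) : fst (Ga b) Int W" using Ga(1,2)[OF N(2) order_refl ab(3)] HW[of b p0] ab e(3) by simp
   then obtain ph' V where V: "FF W ph'" "openin (mtop X) V" "H (b, p0) : V" "V <= fst (Ga b) Int W" "ALL z:V. snd (Ga b) z = ph' z"
    using conjunct1[OF W(3)[unfolded good_def]] by (elim allE impE) (assumption, elim exE conjE, rule that)
   obtain e2 N2 where e2: "e2 > 0" "openin T N2" "p0 : N2" "!!s q. s : {0..1} ==> \<bar>s - b\<bar> < e2 ==> q : N2 ==> H (s, q) : V"
    by (rule tube[OF H b p0 V(2,3)]) (rule that)
   \<comment> \<open>At time \<open>b\<close> the old germ is kept. It agrees with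
     \<open>ph'\<close> on \<open>V\<close>, and \<open>N2\<close> keeps the paths inside
     \<open>V\<close> at times close to \<open>b\<close>.\<close>
   define Ga' where "Ga' s = (if b <= s then Ga s else (W, ph'))" for s
   have "cont (%s. H (s, p)) a Ga'" if p: "p : N Int N1 Int N2" for p
    unfolding cont_def
   proof
    fix s assume s: "s : {a..1}"
    consider "b < s" | "s = b" | "s < b" by linarith
    then show "FF (fst (Ga' s)) (snd (Ga' s)) & H (s, p) : fst (Ga' s) & (EX e>0. ALL s':{a..1}. \<bar>s' - s\<bar> < e --> eqg (H (s', p)) (Ga' s') (Ga' s))"
    proof cases
     case 1
     obtain e3 where e3: "e3 > 0" "ALL s':{b..1}. \<bar>s' - s\<bar> < e3 --> eqg (H (s', p)) (Ga s') (Ga s)" using Ga(3)[of p s] p s 1 by auto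
     have "eqg (H (s', p)) (Ga' s') (Ga' s)" if s': "s' : {a..1}" "\<bar>s' - s\<bar> < min e3 (s - b)" for s'
     proof -
      have "b <= s'" using s'(2) by linarith
      then show ?thesis using e3(2) s' 1 by (simp add: Ga'_def)
     qed
     moreover have "FF (fst (Ga' s)) (snd (Ga' s))" "H (s, p) : fst (Ga' s)" using Ga(1,2)[of p s] p s 1 by (auto simp: Ga'_def)
     ultimately show ?thesis using e3(1) 1 by (intro conjI exI[of _ "min e3 (s - b)"] ballI impI) auto
    next
     case 2
     obtain e3 where e3: "e3 > 0" "ALL s':{b..1}. \<bar>s' - b\<bar> < e3 --> eqg (H (s', p)) (Ga s') (Ga b)" using Ga(3)[of p b] p ab by auto
     have "eqg (H (s', p)) (Ga' s') (Ga' s)" if s': "s' : {a..1}" "\<bar>s' - s\<bar> < min e3 e2" for s'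
     proof (cases "b <= s'")
      case True
      then show ?thesis using e3(2) s' 2 by (simp add: Ga'_def)
     next
      case False
      have "H (s', p) : V" by (rule e2(4)) (use s' p ab 2 in auto)
      then have "eqg (H (s', p)) (W, ph') (Ga b)" unfolding eqg_def using V by (intro exI[of _ V]) auto
      then show ?thesis using False 2 by (simp add: Ga'_def)
     qed
     moreover have "FF (fst (Ga' s)) (snd (Ga' s))" "H (s, p) : fst (Ga' s)" using Ga(1,2)[of p b] p ab 2 by (auto simp: Ga'_def)
     ultimately show ?thesis using e3(1) e2(1) by (intro conjI exI[of _ "min e3 e2"] ballI impI) auto
    next
     case 3
     have "eqg (H (s', p)) (Ga' s') (Ga' s)" if s': "s' : {a..1}" "\<bar>s' - s\<bar> < b - s" for s'
     proof -
      have l: "s' < b" using s' by auto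
      have "H (s', p) : W" by (rule HW) (use s' l p in auto)
      then have "eqg (H (s', p)) (W, ph') (W, ph')" using eqg_refl[of "(W, ph')"] V(1) by simp
      then show ?thesis using l 3 by (simp add: Ga'_def)
     qed
     moreover have "H (s, p) : W" by (rule HW) (use s 3 p in auto)
     then have "FF (fst (Ga' s)) (snd (Ga' s))" "H (s, p) : fst (Ga' s)" using V(1) 3 by (auto simp: Ga'_def)
     ultimately show ?thesis using 3 by (intro conjI exI[of _ "b - s"] ballI impI) auto
    qed
   qed
   then show "Q a" unfolding Q_def using N(1-3) e(2,3) e2(2,3) ab(3)
    by (intro exI[of _ "N Int N1 Int N2"] exI[of _ Ga']) (auto simp: Ga'_def)
  qed
 qed auto
 ultimately show ?thesis by (simp add: Q_def)
qed

text \<open>\<open>F\<close> is defined pointwise, by any continuation along the path of the point.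
  Uniqueness of continuation allows it to be computed near \<open>p0\<close> with the continuation
  shared by all nearby points.\<close>

theorem developing_map:
 assumes H: "continuous_map (prod_topology (top_of_set {0..1::real}) T) (mtop X) H"
  and base: "FF U0 ph0" "!!p. p : topspace T ==> H (1, p) : U0"
 shows "EX F. ALL p0:topspace T. EX N U ph. openin T N & p0 : N & FF U ph & (ALL p:N. H (0, p) : U & F p = ph (H (0, p)))"
proof -
 have ex: "EX N Ga. openin T N & p0 : N & Ga 1 = (U0, ph0) & (ALL p:N. cont (%s. H (s, p)) 0 Ga)" if "p0 : topspace T" for p0
  by (rule cont_exists[OF H base that])
 have "ALL p0:topspace T. EX Ga. Ga 1 = (U0, ph0) & cont (%s. H (s, p0)) 0 Ga" using ex by blast
 from bchoice[OF this] obtain De where De: "ALL p0:topspace T. De p0 1 = (U0, ph0) & cont (%s. H (s, p0)) 0 (De p0)" ..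
 define F where "F p = snd (De p 0) (H (0, p))" for p
 have "EX N U ph. openin T N & p0 : N & FF U ph & (ALL p:N. H (0, p) : U & F p = ph (H (0, p)))" if p0: "p0 : topspace T" for p0
 proof -
  obtain N Ga where N: "openin T N" "p0 : N" "Ga 1 = (U0, ph0)" "ALL p:N. cont (%s. H (s, p)) 0 Ga" using ex[OF p0] by (elim exE conjE)
  have "H (0, p) : fst (Ga 0) & F p = snd (Ga 0) (H (0, p))" if p: "p : N" for p
  proof -
   have pT: "p : topspace T" using p N(1) openin_subset by blast
   have path: "path (%s. H (s, p))" unfolding path_def
   proof (intro ballI allI impI)
    fix s W assume s: "s : {0..1::real}" and W: "openin (mtop X) W & H (s, p) : W"
    obtain e N' where e: "e > 0" "p : N'" "!!s' q. s' : {0..1} ==> \<bar>s' - s\<bar> < e ==> q : N' ==> H (s', q) : W"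
     by (rule tube[OF H s pT conjunct1[OF W] conjunct2[OF W]]) (rule that)
    show "EX e>0. ALL s':{0..1}. \<bar>s' - s\<bar> < e --> H (s', p) : W"
     by (intro exI[of _ e] conjI ballI impI e(1)) (rule e(3)[OF _ _ e(2)])
   qed
   have c: "cont (%s. H (s, p)) 0 Ga" and d: "cont (%s. H (s, p)) 0 (De p)" "De p 1 = (U0, ph0)" using N(4) p De pT by blast+
   have "eqg (H (1, p)) (De p 1) (Ga 1)" unfolding d(2) N(3) using eqg_refl[of "(U0, ph0)"] base(1) base(2)[OF pT] by simp
   from cont_unique[OF path d(1) c this] have "F p = snd (Ga 0) (H (0, p))" unfolding eqg_def F_def by blast
   then show ?thesis using c unfolding cont_def by auto
  qed
  moreover have "FF (fst (Ga 0)) (snd (Ga 0))" using N(2,4) unfolding cont_def by auto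
  ultimately show ?thesis using N(1,2) by (intro exI[of _ N] exI[of _ "fst (Ga 0)"] exI[of _ "snd (Ga 0)"] conjI ballI) blast+
 qed
 then show ?thesis by blast
qed

end

context metric_chart
begin

text \<open>The basis is orthogonal but not normalised, so the squared lengths \<open>n b\<close>
  remain as denominators.\<close>

lemma parseval: assumes x: "x : S"
 shows "EX (e :: 'e => 'e) n. (ALL b:Basis. n b > 0) & (ALL y. (SUM b:Basis. (G x (e b) y)^2 / n b) = G x y y)"
proof -
 obtain e' :: "'e => 'e => 'e" where e': "!!x b. x : S ==> b : Basis ==> e' b x ~= 0"
  "!!x b c. x : S ==> b : Basis ==> c : Basis ==> b ~= c ==> G x (e' b x) (e' c x) = 0" "!!x. x : S ==> span ((%b. e' b x) ` Basis) = UNIV"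
  using ex_orthogonal_frame by (elim exE conjE) blast
 define e where "e b = e' b x" for b
 have e: "!!b. b : Basis ==> G x (e b) (e b) > 0" "!!b c. b : Basis ==> c : Basis ==> b ~= c ==> G x (e b) (e c) = 0" "span (e ` Basis) = UNIV"
  using e'[OF x] G_pos[OF x] by (auto simp: e_def[abs_def])
 have "(SUM b:Basis. (G x (e b) y)^2 / G x (e b) (e b)) = G x y y" for y
 proof -
  define z where "z = (SUM b:Basis. (G x (e b) y / G x (e b) (e b)) *R e b)"
  have zw: "G x z w = (SUM b:Basis. G x (e b) y / G x (e b) (e b) * G x (e b) w)" for w
   unfolding z_def by (simp add: linear_sum[OF G1[OF x]] linear_cmul[OF G1[OF x]])
  have "G x z w = G x y w" for w
  proof -
   have "G x z (e c) = G x y (e c)" if c: "c : Basis" for c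
   proof -
    have "G x z (e c) = (SUM b:Basis. if b = c then G x (e c) y else 0)"
     unfolding zw by (rule sum.cong[OF refl]) (use e(2)[OF _ c] e(1)[OF c] in auto)
    then show ?thesis using c G_sym[OF x, of y "e c"] by simp
   qed
   moreover have "w : span (e ` Basis)" using e(3) by simp
   ultimately show ?thesis using linear_eq_on[OF G2[OF x] G2[OF x], of w "e ` Basis" z y] by auto
  qed
  then have "G x y y = G x z y" by simp
  then show ?thesis unfolding zw by (simp add: power2_eq_square)
 qed
 then show ?thesis using e(1) by (intro exI[of _ e] exI[of _ "%b. G x (e b) (e b)"]) simp
qed

end

section \<open>The energy estimate\<close>

lemma (in smfd) smf_continuous: assumes f: "smf (f :: 'a => 'c::real_normed_vector)" shows "continuous_map (mtop M) euclidean f"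
 unfolding continuous_map_def
proof (intro conjI allI impI)
 fix W :: "'c set" assume "openin euclidean W"
 then have W: "open W" by simp
 have "EX T. openin (mtop M) T & p : T & T <= {p : points M. f p : W}" if p: "p : points M" "f p : W" for p
 proof -
  obtain c where c: "c : charts M" "p : fst c" using charts_cover[OF p(1)] by blast
  define A where "A = cimage c Int (%x. f (cinv c x)) -` W"
  have A: "open A" "A <= cimage c" unfolding A_def
   using continuous_open_preimage[OF smooth_on_continuous[OF smfD[OF f c(1)]] open_cimage[OF c(1)] W] by auto
  have "snd c p : A" using p(2) c(2) cinv_chart[OF c] by (simp add: A_def)
  then have "cinv c (snd c p) : cinv c ` A" by (rule imageI)
  then have "p : cinv c ` A" unfolding cinv_chart[OF c] .
  moreover have "cinv c ` A <= {p : points M. f p : W}" using A(2) cinv_in[OF c(1)] chart_subset[OF c(1)] by (auto simp: A_def)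
  ultimately show ?thesis using openin_cinv_image[OF c(1) A] by blast
 qed
 then show "openin (mtop M) {p : points M. f p : W}" by (subst openin_subopen) blast
qed simp

lemma vector4:
 "(vector [a, b, c, d] :: 'a::zero^4) $ 1 = a" "(vector [a, b, c, d] :: 'a^4) $ 2 = b"
 "(vector [a, b, c, d] :: 'a^4) $ 3 = c" "(vector [a, b, c, d] :: 'a^4) $ 4 = d"
 unfolding vector_def by simp_all

lemma quaternionic_qmult: "quaternionic (%i. qmult (quaternion_unit i))"
proof (rule quaternionic.intro)
 have u: "i = 1 | i = 2 | i = (3::3)" for i using exhaust_3 by blast
 note d = qmult_def quaternion_unit_def vector4 vec_eq_iff forall_4 axis_def inner_vec_def sum_4
 fix i j :: 3 and x y :: "real^4"
 show "linear (qmult (quaternion_unit i))" by (rule linearI) (use u[of i] in "auto simp: d algebra_simps")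
 show "qmult (quaternion_unit i) x \<bullet> qmult (quaternion_unit i) y = x \<bullet> y" using u[of i] by (auto simp: d)
 show "qmult (quaternion_unit i) (qmult (quaternion_unit i) x) = - x" using u[of i] by (auto simp: d)
 show "qmult (quaternion_unit i) (qmult (quaternion_unit j) x) = - qmult (quaternion_unit j) (qmult (quaternion_unit i) x)" if "i ~= j"
  using u[of i] u[of j] that by (auto simp: d)
qed

text \<open>Near \<open>p\<close> the function \<open>F\<close> is a flat map after
  \<open>f\<close>, so its smoothness and its derivative follow from the chain rule in charts of
  both manifolds.\<close>

lemma (in flat_model) FF_comp:
 assumes M: "smooth_manifold M" and f: "smooth_map M X f" and c: "c : charts M" "p : fst c" and d: "d : charts X" "f p : fst d"
  and F: "FF U ph" "openin (mtop M) N" "p : N" "!!p. p : N ==> f p : U & F p = ph (f p)"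
 shows "EX T. open T & snd c p : T & smooth_on T (%x. F (cinv c x))"
  and "DD (%x. F (cinv c x)) (snd c p) a
   = DD (%y. ph (cinv d y)) (snd d (f p)) (DD (snd d o f o cinv c) (snd c p) a)"
proof -
 interpret M: smfd M using M by unfold_locales
 define h where "h = snd d o f o cinv c"
 define N' where "N' = {p' : points M. f p' : fst d} Int (N Int fst c)"
 define V where "V = snd d ` (U Int fst d)"
 have "openin (mtop M) {p' : points M. f p' : fst d}"
  using f unfolding smooth_map_def by (blast intro: openin_continuous_map_preimage openin_chart[OF d(1)])
 then have N': "openin (mtop M) N'" "N' <= fst c" "p : N'"
  using F(2,3) c(2) d(2) M.openin_chart[OF c(1)] M.chart_subset[OF c(1)] by (auto simp: N'_def)
 have oT: "open (snd c ` N')" by (rule M.open_image[OF c(1) N'(1,2)])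
 have x: "snd c p : snd c ` N'" using N'(3) by (rule imageI)
 have oV: "open V" unfolding V_def by (intro open_image d(1) openin_Int FF_open[OF F(1)] openin_chart) auto
 have pt: "h x : V & F (cinv c x) = ph (cinv d (h x))" if xT: "x : snd c ` N'" for x
 proof -
  obtain p' where p': "p' : N'" "x = snd c p'" using xT by blast
  then have q: "p' : fst c" "p' : N" "f p' : fst d" by (auto simp: N'_def)
  have hx: "h (snd c p') = snd d (f p')" by (simp add: h_def M.cinv_chart[OF c(1) q(1)])
  show ?thesis using F(4)[OF q(2)] q(3) unfolding p'(2) hx M.cinv_chart[OF c(1) q(1)] cinv_chart[OF d(1) q(3)] by (simp add: V_def)
 qed
 have sh: "smooth_on (snd c ` N') h"
  by (rule smooth_on_subset[of "snd c ` {p : fst c. f p : fst d}"]) (use f c d in "auto simp: smooth_map_def h_def N'_def")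
 have sph: "smooth_on V (%y. ph (cinv d y))"
  using FF_isom[OF F(1) d(1)] unfolding hk_chart.isom_def[OF hk_chart[OF d(1)]] V_def by blast
 have img: "h ` snd c ` N' <= V" using pt by blast
 have "smooth_on (snd c ` N') (%x. F (cinv c x))"
  by (rule smooth_on_cong[OF oT smooth_on_compose[OF oT oV img sph sh]]) (simp only: pt)
 then show "EX T. open T & snd c p : T & smooth_on T (%x. F (cinv c x))" using oT x by blast
 have "DD (%x. F (cinv c x)) (snd c p) a = DD (%x. ph (cinv d (h x))) (snd c p) a"
  by (rule fun_cong[OF deriv_cong_open[OF oT x]]) (simp only: pt)
 also have "... = DD (%y. ph (cinv d y)) (h (snd c p)) (DD h (snd c p) a)"
  by (rule dir_deriv_compose[OF sph sh x]) (use pt[OF x] in blast)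
 finally show "DD (%x. F (cinv c x)) (snd c p) a
   = DD (%y. ph (cinv d y)) (snd d (f p)) (DD (snd d o f o cinv c) (snd c p) a)"
  by (simp add: h_def M.cinv_chart[OF c])
qed

theorem lemma4p2:
  fixes M :: "('a, real^3) manifold"
    and dvol :: "('a, real^3) form3"
    and v :: "3 \<Rightarrow> ('a, real^3) vector_field"
    and X :: "('b, 'e::euclidean_space) manifold"
    and \<omega> :: "3 \<Rightarrow> ('b, 'e) form2"
    and J :: "3 \<Rightarrow> ('b, 'e) endo_field"
    and g :: "('b, 'e) form2"
  assumes "closed_manifold M" and "connected_space (mtop M)" and "oriented M"
    and "volume_form M dvol"
    and "positive_divergence_free_frame M dvol v"
    and "closed_manifold X" and "hyperkaehler X \<omega> J g"
    and "regular_frame M v"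
    and "flat_metric X g"
  shows "\<exists>c::real. \<forall>f. smooth_map M X f \<and> contractible_map M X f \<longrightarrow>
           volume_integral M dvol (energy_density M v X g f)
             \<le> c * volume_integral M dvol (norm_sq_along X g f (dirac M v J f))"
proof -
 have sM: "smooth_manifold M" using assms(1) by (simp add: closed_manifold_def)
 interpret Q: quaternionic "%i. qmult (quaternion_unit i)" by (rule quaternionic_qmult)
 interpret M: frame_mfd M dvol "%i. qmult (quaternion_unit i)" v
  using assms(1,4,5) sM by unfold_locales (auto simp: closed_manifold_def)
 interpret X: hk_mfd X \<omega> J g
  using assms(7,9) by unfold_locales (auto simp: hyperkaehler_def)
 have reg: "EX q. ALL p:points M. f p = q" if f: "M.smf f" and D: "!!p. p : points M ==> M.Dir f p = 0" for f :: "'a => real^4"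
 proof -
  have "smooth_map M quaternion_space f"
   unfolding smooth_map_def using M.smf_continuous[OF f] M.smfD[OF f] by (simp add: quaternion_space_def o_def)
  moreover have "dirac M v quaternion_J f d p = 0" if "d : charts quaternion_space" "p : points M" for d p
  proof -
   have "partial M (v i) f d p = M.dd i f p" for i using that(1) by (simp add: partial_def M.dd_def quaternion_space_def o_def Let_def)
   then show ?thesis using D[OF that(2)] by (simp add: dirac_def M.Dir_def quaternion_J_def)
  qed
  ultimately have "constant_map M quaternion_space f" using assms(8) unfolding regular_frame_def by blast
  then show ?thesis unfolding constant_map_def by blast
 qed
 have "EX C>=0. ALL f :: 'a => real^4. M.smf f --> (SUM i:UNIV. M.I (%p. (norm (M.dd i f p))^2)) <= C * M.I (%p. (norm (M.Dir f p))^2)"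
  by (rule M.energy_estimate) (rule reg)
 then obtain C where C: "!!f :: 'a => real^4. M.smf f ==> (SUM i:UNIV. M.I (%p. (norm (M.dd i f p))^2)) <= C * M.I (%p. (norm (M.Dir f p))^2)"
  by (elim exE conjE) blast
 have "M.I (energy_density M v X g f) <= C * M.I (norm_sq_along X g f (dirac M v J f))"
  if sf: "smooth_map M X f" and cf: "contractible_map M X f" for f
 proof -
  \<comment> \<open>The homotopy is \<open>f\<close> at time 0 and constant at time 1, so
    continuation starts at time 1 with one germ common to all points.\<close>
  obtain q H where q: "q : points X" and H: "continuous_map (prod_topology (top_of_set {0..1::real}) (mtop M)) (mtop X) H"
   "!!x. H (0, x) = f x" "!!x. H (1, x) = q"
   using cf unfolding contractible_map_def homotopic_with_def by blast
  obtain c where c: "c : charts X" "q : fst c" using X.charts_cover[OF q] by blast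
  interpret c: hk_chart "cimage c" "X.gc c" "X.Jc c" by (rule X.hk_chart[OF c(1)])
  define x0 where "x0 = snd c q"
  have x0: "x0 : cimage c" unfolding x0_def using c(2) by (rule imageI)
  have cx0: "cinv c x0 = q" unfolding x0_def by (rule X.cinv_chart[OF c])
  \<comment> \<open>The model is the tangent space at the end point of the contraction, in the
    coordinates of \<open>c\<close>.\<close>
  define g0 where "g0 = g c q"
  define J0 where "J0 i = J i c q" for i
  have gx: "X.gc c x0 = g0" "(%i. X.Jc c i x0) = J0" by (auto simp: cx0 g0_def J0_def[abs_def])
  have bb: "bounded_bilinear g0"
   using c.G1[OF x0] c.G2[OF x0] unfolding gx bilinear_conv_bounded_bilinear[symmetric] bilinear_def by blast
  interpret R: flat_model X \<omega> J g g0 J0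
   by (rule flat_model.intro[OF X.hk_mfd_axioms flat_model_axioms.intro[OF bb]]) (rule c.G_sym[OF x0, unfolded gx])
  obtain r ph0 where r: "r > 0" "ball x0 r <= cimage c" "c.isom g0 J0 (ball x0 r) ph0"
   using c.flat_coordinates[OF x0] unfolding gx by blast
  define U0 where "U0 = cinv c ` ball x0 r"
  have U0: "openin (mtop X) U0" "U0 <= fst c" "snd c ` U0 = ball x0 r" "q : U0"
  proof -
   show "openin (mtop X) U0" unfolding U0_def by (rule X.openin_cinv_image[OF c(1) open_ball r(2)])
   show "U0 <= fst c" unfolding U0_def by (intro image_subsetI X.cinv_in c(1)) (use r(2) in blast)
   have "snd c (cinv c x) = x" if "x : ball x0 r" for x using that r(2) X.chart_cinv[OF c(1)] by blast
   then show "snd c ` U0 = ball x0 r" unfolding U0_def image_image by simp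
   have "cinv c x0 : U0" unfolding U0_def using r(1) by (intro imageI) simp
   then show "q : U0" unfolding cx0 .
  qed
  have "R.FF U0 (%p. ph0 (snd c p))" by (rule R.FF_chart[OF c(1) U0(1,2)]) (use r(3) U0(3) in simp)
  from R.developing_map[OF H(1) this] U0(4) H(3) obtain F where
   F: "ALL p0:points M. EX N U ph. openin (mtop M) N & p0 : N & R.FF U ph & (ALL p:N. H (0, p) : U & F p = ph (H (0, p)))" by auto
  have fX: "f p : points X" if "p : points M" for p
   using sf that unfolding smooth_map_def by (meson continuous_map_image_subset_topspace image_subset_iff)
  have smF: "M.smf F" unfolding M.smf_def
  proof (intro ballI smooth_on_local)
   fix k x assume k: "k : charts M" and x: "x : cimage k"
   define p where "p = cinv k x"
   have p: "p : fst k" "p : points M" "snd k p = x"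
    using M.cinv_in[OF k x] M.chart_subset[OF k] M.chart_cinv[OF k x] by (auto simp: p_def)
   obtain d where d: "d : charts X" "f p : fst d" using X.charts_cover[OF fX[OF p(2)]] by blast
   obtain N U ph where N: "openin (mtop M) N" "p : N" "R.FF U ph" "!!p. p : N ==> f p : U & F p = ph (f p)"
    using bspec[OF F p(2)] unfolding H(2) by (elim exE conjE) blast
   show "EX T. open T & x : T & smooth_on T (%x. F (cinv k x))"
    using R.FF_comp(1)[OF sM sf k p(1) d N(3,1,2,4)] unfolding p(3) .
  qed
  \<comment> \<open>The flat maps are isometries that respect the complex structures, so both
    densities of \<open>f\<close> can be computed from the vector-valued function \<open>F\<close>
    with constant coefficients.\<close>
  have key: "energy_density M v X g f p = (SUM i:UNIV. g0 (M.dd i F p) (M.dd i F p)) &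
    norm_sq_along X g f (dirac M v J f) p = g0 (SUM i:UNIV. J0 i (M.dd i F p)) (SUM i:UNIV. J0 i (M.dd i F p))"
   if p: "p : points M" for p
  proof -
   define d where "d = chart_at X (f p)"
   define k where "k = chart_at M p"
   have d: "d : charts X" "f p : fst d"
    using someI_ex[of "%c. c : charts X & f p : fst c"] X.charts_cover[OF fX[OF p]] unfolding d_def chart_at_def by blast+
   have k: "k : charts M" "p : fst k" using M.chart_atM[OF p] by (auto simp: k_def)
   obtain N U ph where N: "openin (mtop M) N" "p : N" "R.FF U ph" "!!p. p : N ==> f p : U & F p = ph (f p)"
    using bspec[OF F p] unfolding H(2) by (elim exE conjE) blast
   define D where "D = DD (%y. ph (cinv d y)) (snd d (f p))"
   have dd: "M.dd i F p = D (partial M (v i) f d p)" for i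
    unfolding M.dd_def partial_def k_def[symmetric] Let_def D_def by (rule R.FF_comp(2)[OF sM sf k d N(3,1,2,4)])
   have y: "snd d (f p) : snd d ` (U Int fst d)" using N(2,4) d(2) by blast
   note iso = R.FF_isom[OF N(3) d(1), unfolded hk_chart.isom_def[OF X.hk_chart[OF d(1)]]]
   have D: "g0 (D a) (D b) = g d (f p) a b" "D (J i d (f p) a) = J0 i (D a)" for a b i
    using bspec[OF conjunct2[OF iso] y] unfolding X.cinv_chart[OF d] D_def by blast+
   have lD: "linear D" unfolding D_def by (rule linear_DD[OF conjunct1[OF iso] y])
   have "D (dirac M v J f d p) = (SUM i:UNIV. J0 i (M.dd i F p))"
    unfolding dirac_def linear_sum[OF lD] D(2) dd ..
   then show ?thesis unfolding energy_density_def norm_sq_along_def d_def[symmetric] Let_def dd by (simp add: D(1)[symmetric])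
  qed
  note l0 = linear_add[OF c.G2[OF x0], unfolded gx] linear_cmul[OF c.G2[OF x0], unfolded gx]
  have skew: "g0 z (J0 i y) = - g0 (J0 i z) y" for z i y using c.J_skew[OF x0, of i z y] unfolding cx0 g0_def J0_def by simp
  have neg: "g0 (- z) y = - g0 z y" for z y using linear_neg[OF c.G1[OF x0]] unfolding gx .
  have JJ: "J0 i (J0 i z) = - z" for z i using c.J_J[OF x0] unfolding cx0 J0_def .
  have nJ: "J0 i (- z) = - J0 i z" for z i using linear_neg[OF c.linear_J[OF x0]] unfolding cx0 J0_def .
  have J12: "J0 1 (J0 2 z) = J0 3 z" and J21: "J0 2 (J0 1 z) = - J0 3 z" for z unfolding J0_def by (rule X.J12[OF c] X.J21[OF c])+
  have J13: "J0 1 (J0 3 z) = - J0 2 z" for z unfolding J12[symmetric] by (simp add: JJ)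
  have J23: "J0 2 (J0 3 z) = J0 1 z" for z using J21[of "J0 1 z"] J21[of z] JJ[of 2 "J0 1 z"] nJ[of 2] by (metis minus_minus)
  have J31: "J0 3 (J0 1 z) = J0 2 z" for z using J12[of "J0 1 z"] J21[of z] J13[of z] nJ[of 1] by (metis minus_minus)
  have J32: "J0 3 (J0 2 z) = - J0 1 z" for z using J12[of "J0 2 z"] JJ[of 2 z] nJ[of 1] by metis
  \<comment> \<open>The components are arranged so that left multiplication by a quaternion unit
    corresponds to \<open>J0 i\<close> acting on \<open>y\<close>. Hence \<open>T b\<close> after
    \<open>F\<close> has as its Dirac image \<open>T b\<close> of that of \<open>F\<close>.\<close>
  define T where "T b y = (vector [g0 b y, g0 (J0 1 b) y, g0 (J0 2 b) y, g0 (J0 3 b) y] :: real^4)" for b y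
  have lT: "linear (T b)" for b by (rule linearI) (simp_all add: T_def vec_eq_iff forall_4 vector4 l0)
  have bT: "bounded_linear (T b)" for b using lT linear_conv_bounded_linear by blast
  have qT: "qmult (quaternion_unit i) (T b y) = T b (J0 i y)" for i b y
   using exhaust_3[of i]
   by (auto simp: T_def qmult_def quaternion_unit_def vector4 vec_eq_iff forall_4 axis_def skew JJ J12 J13 J21 J23 J31 J32 neg)
  obtain e :: "'e => 'e" and n where n: "!!b. b : Basis ==> n b > 0" and pars: "!!y. (SUM b:Basis. (g0 (e b) y)^2 / n b) = g0 y y"
   using c.parseval[OF x0] unfolding gx by (elim exE conjE) blast
  \<comment> \<open>By Parseval's identity each of the four components of \<open>T\<close>, divided
    by \<open>n b\<close> and summed over \<open>b\<close>, contributes \<open>g0 y y\<close>; hence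
    the factor 4.\<close>
  define w where "w b = 1 / (4 * n b)" for b
  have T4: "(SUM b:Basis. w b * (norm (T (e b) y))^2) = g0 y y" for y
  proof -
   have gJ: "g0 (J0 i y) (J0 i y) = g0 y y" for i using skew[of "J0 i y" i y] by (simp add: JJ neg)
   have sq: "(g0 (J0 i b) y)^2 = (g0 b (J0 i y))^2" for i b unfolding skew by simp
   have "(norm (T b y))^2 = (g0 b y)^2 + (g0 b (J0 1 y))^2 + (g0 b (J0 2 y))^2 + (g0 b (J0 3 y))^2" for b
    unfolding power2_norm_eq_inner inner_vec_def sum_4 T_def vector4 sq[symmetric] by (simp add: power2_eq_square)
   then have "(SUM b:Basis. w b * (norm (T (e b) y))^2) = (1/4) * ((SUM b:Basis. (g0 (e b) y)^2 / n b)
    + (SUM b:Basis. (g0 (e b) (J0 1 y))^2 / n b) + (SUM b:Basis. (g0 (e b) (J0 2 y))^2 / n b) + (SUM b:Basis. (g0 (e b) (J0 3 y))^2 / n b))"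
    by (simp add: w_def sum_distrib_left sum.distrib[symmetric] add_divide_distrib mult.commute)
   then show ?thesis unfolding pars gJ by simp
  qed
  define h where "h b p = T (e b) (F p)" for b p
  have h: "M.smf (h b)" for b unfolding h_def[abs_def] by (rule M.smf_bounded_linear[OF bT smF])
  have ddh: "M.dd i (h b) p = T (e b) (M.dd i F p)" if p: "p : points M" for i b p
  proof -
   obtain k where k: "k : charts M" "p : fst k" using M.charts_cover[OF p] by blast
   show ?thesis unfolding M.dd_chart[OF k h] M.dd_chart[OF k smF] h_def
    by (rule dir_deriv_linear[OF bT M.smfD[OF smF k(1)] imageI[OF k(2)]])
  qed
  have Dh: "M.Dir (h b) p = T (e b) (SUM i:UNIV. J0 i (M.dd i F p))" if "p : points M" for b p
   unfolding M.Dir_def ddh[OF that] qT linear_sum[OF lT] ..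
  have sn: "M.smf (%p. (norm (M.dd i (h b) p))^2)" "M.smf (%p. (norm (M.Dir (h b) p))^2)" for i b
   by (intro M.smf_norm_sq M.smf_dd M.smf_Dir h)+
  have "M.I (energy_density M v X g f) = M.I (%p. SUM b:Basis. w b * (SUM i:UNIV. (norm (M.dd i (h b) p))^2))"
  proof (rule M.I_cong)
   fix p assume p: "p : points M"
   show "energy_density M v X g f p = (SUM b:Basis. w b * (SUM i:UNIV. (norm (M.dd i (h b) p))^2))"
    unfolding conjunct1[OF key[OF p]] T4[symmetric] ddh[OF p] sum_distrib_left by (rule sum.swap)
  qed
  also have "... = (SUM b:Basis. M.I (%p. w b * (SUM i:UNIV. (norm (M.dd i (h b) p))^2)))"
   by (rule M.I_sum) (intro M.smf_mult M.smf_const M.smf_sum sn)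
  also have "... = (SUM b:Basis. w b * (SUM i:UNIV. M.I (%p. (norm (M.dd i (h b) p))^2)))"
   unfolding M.I_mult M.I_sum[OF sn(1)] ..
  also have "... <= (SUM b:Basis. w b * (C * M.I (%p. (norm (M.Dir (h b) p))^2)))"
   by (intro sum_mono mult_left_mono C h) (use n in "auto simp: w_def less_imp_le")
  also have "... = C * (SUM b:Basis. M.I (%p. w b * (norm (M.Dir (h b) p))^2))"
   unfolding M.I_mult by (simp add: sum_distrib_left mult.left_commute)
  also have "(SUM b:Basis. M.I (%p. w b * (norm (M.Dir (h b) p))^2)) = M.I (%p. SUM b:Basis. w b * (norm (M.Dir (h b) p))^2)"
   by (rule M.I_sum[symmetric]) (intro M.smf_mult M.smf_const sn)
  also have "... = M.I (norm_sq_along X g f (dirac M v J f))"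
   by (rule M.I_cong) (simp add: key Dh T4)
  finally show ?thesis .
 qed
 then show ?thesis unfolding M.I_def by (intro exI[of _ C]) blast
qed

end
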